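(* Let $\mathfrak{X}$ be a countable set and $H$ a (possibly unbounded) self-adjoint operator on $\ell^2(\mathfrak{X})$, and let $K_H^{(-)}$ be the spectral projection of $H$ onto $\{H<0\}$. Assume that $\varphi_{H,\beta}$ is stochastically positive with respect to $\mathfrak{D}(\mathfrak{X})$ for all $\beta>0$. Then so is $\varphi_{K_H^{(-)}}$ (as an $\alpha^H$-ground state, i.e. with $\beta=\infty$). Moreover, the associated stochastic process $(X_t)_{-\infty<t<\infty}$ on $\mathcal{C}(\mathfrak{X})$ satisfies $$\mathbb{P}[(X_{t_1})_{x_1}=1,\dots,(X_{t_n})_{x_n}=1]=\det[R_H(x_i,t_i;x_j,t_j)]_{i,j=1}^n$$ for any $n\geq 1$, $x_1,\dots,x_n\in\mathfrak{X}$ and $t_1\le\cdots\le t_n$ in $\mathbb{R}$, where $$R_H(x,t;y,s):=\begin{cases}\langle e^{(s-t)H}K_H^{(-)}\delta_x,\delta_y\rangle & t\le s,\\ -\langle e^{-(t-s)H}(1-K_H^{(-)})\delta_x,\delta_y\rangle & t>s.\end{cases}$$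
   Context: Inner products are complex linear in the left argument. $\mathfrak{X}$ is a countable discrete set and $\mathcal{C}(\mathfrak{X})=\{0,1\}^{\mathfrak{X}}$ with the product topology. $\mathfrak{A}(\mathfrak{X})$ is the CAR algebra over $\ell^2(\mathfrak{X})$: the universal unital $C^*$-algebra generated by $a(h)$, $h\in\ell^2(\mathfrak{X})$, such that $h\mapsto a^*(h):=a(h)^*$ is linear, $a(h)a(k)+a(k)a(h)=0$ and $a^*(h)a(k)+a(k)a^*(h)=\langle h,k\rangle 1$. With $(\delta_x)_{x\in\mathfrak{X}}$ the canonical basis, $a_x:=a(\delta_x)$ and $\rho_x:=a_x^*a_x$; $\mathfrak{D}(\mathfrak{X})$ is the commutative unital $C^*$-subalgebra generated by $\{\rho_x\}_{x\in\mathfrak{X}}$, identified with $C(\mathcal{C}(\mathfrak{X}))$ so that $\rho_x$ is the indicator function of $\{\omega:\omega_x=1\}$; $\mathfrak{D}(\mathfrak{X})_+$ is its set of nonnegative elements. For a bounded operator $0\le K\le 1$ on $\ell^2(\mathfrak{X})$, $\varphi_K$ is the unique state with $\varphi_K(a^*(h_n)\cdots a^*(h_1)a(k_1)\cdots a(k_m))=\delta_{n,m}\det[\langle Kh_i,k_j\rangle]_{i,j=1}^n$ (quasi-free state). For $0<\beta<\infty$ put $K_{H,\beta}:=e^{-\beta H}(1+e^{-\beta H})^{-1}$ and $\varphi_{H,\beta}:=\varphi_{K_{H,\beta}}$. Let $\alpha^H$ be the flow $\alpha^H_t(a(h))=a(e^{\mathrm{i}tH}h)$. $\varphi_{H,\beta}$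 is an $\alpha^H$-KMS state at $\beta$; $\varphi_{K_H^{(-)}}$ is an $\alpha^H$-ground state, regarded as the case $\beta=\infty$, for which $[-\beta/2,\beta/2]$ means $\mathbb{R}$. Let $\varphi$ be one of these states with corresponding $\beta\in(0,\infty]$. $A$ is entire analytic for $\alpha^H$ if $t\mapsto\alpha^H_t(A)$ extends to an entire function $z\mapsto\alpha^H_z(A)$; such elements are norm dense. For $t_1\le\cdots\le t_n$ in $[-\beta/2,\beta/2]$, $(A_1,\dots,A_n)\mapsto\mathcal{S}_{A_1,\dots,A_n}(t_1,\dots,t_n)$ is the unique multilinear form bounded by $\|A_1\|\cdots\|A_n\|$ with $\mathcal{S}_{A_1,\dots,A_n}(t_1,\dots,t_n)=\varphi(\alpha^H_{\mathrm{i}t_1}(A_1)\cdots\alpha^H_{\mathrm{i}t_n}(A_n))$ for entire analytic $A_i$. $\varphi$ is stochastically positive with respect to $\mathfrak{D}(\mathfrak{X})$ if $\mathcal{S}_{A_1,\dots,A_n}(t_1,\dots,t_n)\ge0$ for all $n$, all such $(t_i)$ and all $A_i\in\mathfrak{D}(\mathfrak{X})_+$; the associated stochastic process is then the $\mathcal{C}(\mathfrak{X})$-valued process (unique up to finite-dimensional distributions) with $\mathbb{E}[f_1(X_{t_1})\cdots f_n(X_{t_n})]=\mathcal{S}_{f_1,\dots,f_n}(t_1,\dots,t_n)$ for all $f_i\in C(\mathcal{C}(\mathfrak{X}))$. $(X_t)_x$ is the $x$-coordinate of $X_t$.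
   Formalization: The determinant formula is proved for pairwise distinct space-time points (x_i, t_i); for a repeated point it is false as written (one-point space, H = −1, x_1 = x_2, t_1 = t_2: the determinant is 0 but the probability is 1). *)

theory Defs
  imports
    "HOL-Probability.Probability"
    "HOL-Algebra.Module"
    "Jordan_Normal_Form.Determinant"
begin

section \<open>Complex vector spaces and unital \<open>C\<^sup>*\<close>-algebras\<close>

class scaleC =
  fixes scaleC :: "complex \<Rightarrow> 'a \<Rightarrow> 'a" (infixr \<open>*\<^sub>C\<close> 75)

class complex_vector = real_vector + scaleC +
  assumes scaleC_add_right: "c *\<^sub>C (x + y) = c *\<^sub>C x + c *\<^sub>C y"
    and scaleC_add_left: "(c + d) *\<^sub>C x = c *\<^sub>C x + d *\<^sub>C x"
    and scaleC_scaleC: "c *\<^sub>C d *\<^sub>C x = (c * d) *\<^sub>C x"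
    and scaleC_of_real: "complex_of_real r *\<^sub>C x = r *\<^sub>R x"

text \<open>The norm of a non-zero unital \<open>C\<^sup>*\<close>-algebra satisfies \<open>norm 1 = 1\<close>, so the library class
  \<open>real_normed_algebra_1\<close> is no restriction.\<close>

class cstar_algebra = complex_vector + real_normed_algebra_1 + complete_space +
  fixes star :: "'a \<Rightarrow> 'a"
  assumes scaleC_mult_left: "(c *\<^sub>C x) * y = c *\<^sub>C (x * y)"
    and scaleC_mult_right: "x * (c *\<^sub>C y) = c *\<^sub>C (x * y)"
    and star_star: "star (star x) = x"
    and star_add: "star (x + y) = star x + star y"
    and star_scaleC: "star (c *\<^sub>C x) = cnj c *\<^sub>C star x"
    and star_mult: "star (x * y) = star y * star x"
    and norm_star_mult: "norm (star x * x) = (norm x)\<^sup>2"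

instantiation complex :: complex_vector
begin
definition scaleC_complex :: "complex \<Rightarrow> complex \<Rightarrow> complex"
  where "scaleC_complex c x = c * x"
instance
  by standard (auto simp: scaleC_complex_def algebra_simps scaleR_conv_of_real)
end

definition clinear :: "('a::complex_vector \<Rightarrow> 'b::complex_vector) \<Rightarrow> bool" where
  "clinear f \<longleftrightarrow> (\<forall>x y. f (x + y) = f x + f y) \<and> (\<forall>c x. f (c *\<^sub>C x) = c *\<^sub>C f x)"

definition star_subalgebra :: "'a::cstar_algebra set \<Rightarrow> bool" where
  "star_subalgebra S \<longleftrightarrow> 1 \<in> S \<and> (\<forall>x\<in>S. \<forall>y\<in>S. x + y \<in> S \<and> x * y \<in> S) \<and>
     (\<forall>x\<in>S. star x \<in> S \<and> (\<forall>c. c *\<^sub>C x \<in> S))"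

definition cstar_generated :: "'a::cstar_algebra set \<Rightarrow> 'a set" where
  "cstar_generated G = \<Inter> {S. star_subalgebra S \<and> closed S \<and> G \<subseteq> S}"

definition star_automorphism :: "('a::cstar_algebra \<Rightarrow> 'a) \<Rightarrow> bool" where
  "star_automorphism \<Phi> \<longleftrightarrow> bij \<Phi> \<and> clinear \<Phi> \<and>
     (\<forall>x y. \<Phi> (x * y) = \<Phi> x * \<Phi> y) \<and> (\<forall>x. \<Phi> (star x) = star (\<Phi> x))"

definition state :: "('a::cstar_algebra \<Rightarrow> complex) \<Rightarrow> bool" where
  "state \<phi> \<longleftrightarrow> clinear \<phi> \<and> \<phi> 1 = 1 \<and> (\<forall>x. \<phi> (star x * x) \<in> \<real>\<^sub>\<ge>\<^sub>0)"


section \<open>The Hilbert space \<open>\<ell>\<^sup>2\<close>\<close>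

typedef 'x ell2 = "{f :: 'x \<Rightarrow> complex. (\<lambda>x. (cmod (f x))\<^sup>2) summable_on UNIV}"
  morphisms ell2_coord Abs_ell2
  by (rule exI[of _ "\<lambda>_. 0"]) simp

setup_lifting type_definition_ell2

lemma ell2_prod_summable:
  fixes f g :: "'x \<Rightarrow> complex"
  assumes "(\<lambda>x. (cmod (f x))\<^sup>2) summable_on UNIV" "(\<lambda>x. (cmod (g x))\<^sup>2) summable_on UNIV"
  shows "(\<lambda>x. f x * cnj (g x)) summable_on UNIV"
proof (rule abs_summable_summable, rule summable_on_comparison_test)
  show "(\<lambda>x. (cmod (f x))\<^sup>2 + (cmod (g x))\<^sup>2) summable_on UNIV"
    by (intro summable_on_add assms)
  fix x
  have "0 \<le> (cmod (f x) - cmod (g x))\<^sup>2" by simp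
  moreover have "0 \<le> cmod (f x) * cmod (g x)" by simp
  ultimately show "norm (f x * cnj (g x)) \<le> (cmod (f x))\<^sup>2 + (cmod (g x))\<^sup>2"
    unfolding norm_mult complex_mod_cnj power2_diff by linarith
qed auto

lemma ell2_add_summable:
  fixes f g :: "'x \<Rightarrow> complex"
  assumes "(\<lambda>x. (cmod (f x))\<^sup>2) summable_on UNIV" "(\<lambda>x. (cmod (g x))\<^sup>2) summable_on UNIV"
  shows "(\<lambda>x. (cmod (f x + g x))\<^sup>2) summable_on UNIV"
proof (rule summable_on_comparison_test)
  show "(\<lambda>x. 2 * (cmod (f x))\<^sup>2 + 2 * (cmod (g x))\<^sup>2) summable_on UNIV"
    by (intro summable_on_add summable_on_cmult_right assms)
  fix x
  have "(cmod (f x + g x))\<^sup>2 \<le> (cmod (f x) + cmod (g x))\<^sup>2"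
    by (intro power_mono norm_triangle_ineq) simp
  also have "\<dots> \<le> 2 * (cmod (f x))\<^sup>2 + 2 * (cmod (g x))\<^sup>2"
    using sum_squares_bound[of "cmod (f x)" "cmod (g x)"] by (simp add: power2_sum)
  finally show "(cmod (f x + g x))\<^sup>2 \<le> 2 * (cmod (f x))\<^sup>2 + 2 * (cmod (g x))\<^sup>2" .
qed auto

lemma ell2_scale_summable:
  fixes f :: "'x \<Rightarrow> complex"
  assumes "(\<lambda>x. (cmod (f x))\<^sup>2) summable_on UNIV"
  shows "(\<lambda>x. (cmod (c * f x))\<^sup>2) summable_on UNIV"
  unfolding norm_mult power_mult_distrib by (intro summable_on_cmult_right assms)

lift_definition cinner :: "'x ell2 \<Rightarrow> 'x ell2 \<Rightarrow> complex"
  is "\<lambda>f g. \<Sum>\<^sub>\<infinity>x. f x * cnj (g x)" .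

lift_definition ket :: "'x \<Rightarrow> 'x ell2" is "\<lambda>x y. if y = x then 1 else 0"
proof -
  fix x :: 'x
  have "(\<lambda>y. (cmod (if y = x then 1 else 0))\<^sup>2) summable_on {x}" by simp
  then show "(\<lambda>y. (cmod (if y = x then 1 else 0))\<^sup>2) summable_on UNIV"
    by (rule summable_on_cong_neutral[THEN iffD1, rotated -1]) auto
qed

instantiation ell2 :: (type) complex_vector
begin

lift_definition zero_ell2 :: "'a ell2" is "\<lambda>_. 0" by simp
lift_definition plus_ell2 :: "'a ell2 \<Rightarrow> 'a ell2 \<Rightarrow> 'a ell2" is "\<lambda>f g x. f x + g x"
  by (rule ell2_add_summable)
lift_definition uminus_ell2 :: "'a ell2 \<Rightarrow> 'a ell2" is "\<lambda>f x. - f x" by simp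
lift_definition minus_ell2 :: "'a ell2 \<Rightarrow> 'a ell2 \<Rightarrow> 'a ell2" is "\<lambda>f g x. f x - g x"
  using ell2_add_summable[of _ "\<lambda>x. - _ x"] by simp
lift_definition scaleC_ell2 :: "complex \<Rightarrow> 'a ell2 \<Rightarrow> 'a ell2" is "\<lambda>c f x. c * f x"
  by (rule ell2_scale_summable)
definition scaleR_ell2 :: "real \<Rightarrow> 'a ell2 \<Rightarrow> 'a ell2"
  where "scaleR_ell2 r h = complex_of_real r *\<^sub>C h"
instance
proof
  fix h k l :: "'a ell2" and r s :: real
  show "h + k + l = h + (k + l)" by transfer (simp add: add.assoc)
  show "h + k = k + h" by transfer (simp add: add.commute)
  show "0 + h = h" by transfer simp
  show "- h + h = 0" by transfer simp
  show "h - k = h + - k" by transfer simp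
  show C1: "c *\<^sub>C (h + k) = c *\<^sub>C h + c *\<^sub>C k" for c and h k :: "'a ell2"
    by transfer (simp add: distrib_left)
  show C2: "(c + d) *\<^sub>C h = c *\<^sub>C h + d *\<^sub>C h" for c d and h :: "'a ell2"
    by transfer (simp add: distrib_right)
  show C3: "c *\<^sub>C d *\<^sub>C h = (c * d) *\<^sub>C h" for c d and h :: "'a ell2"
    by transfer (simp add: mult.assoc)
  show "complex_of_real r *\<^sub>C h = r *\<^sub>R h" by (simp add: scaleR_ell2_def)
  show "r *\<^sub>R (h + k) = r *\<^sub>R h + r *\<^sub>R k" by (simp add: scaleR_ell2_def C1)
  show "(r + s) *\<^sub>R h = r *\<^sub>R h + s *\<^sub>R h" by (simp add: scaleR_ell2_def C2)
  show "r *\<^sub>R s *\<^sub>R h = (r * s) *\<^sub>R h" by (simp add: scaleR_ell2_def C3)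
  show "1 *\<^sub>R h = h" unfolding scaleR_ell2_def by transfer simp
qed

end

lemma cinner_add_left_ell2: "cinner (h + h') k = cinner h k + cinner (h' :: 'a ell2) k"
  by transfer (simp add: distrib_right infsum_add ell2_prod_summable)

lemma cinner_scaleC_left_ell2: "cinner (c *\<^sub>C h) k = c * cinner h (k :: 'a ell2)"
  by transfer (simp add: mult.assoc infsum_cmult_right ell2_prod_summable)

lemma cinner_commute_ell2: "cinner h k = cnj (cinner k (h :: 'a ell2))"
  by transfer (simp add: mult.commute flip: infsum_cnj)

lemma cinner_self_ell2: "cinner h h = complex_of_real (\<Sum>\<^sub>\<infinity>x. (cmod (ell2_coord h x))\<^sup>2)"
proof transfer
  fix f :: "'a \<Rightarrow> complex"
  assume "(\<lambda>x. (cmod (f x))\<^sup>2) summable_on UNIV"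
  then have "((\<lambda>x. complex_of_real ((cmod (f x))\<^sup>2))
      has_sum complex_of_real (\<Sum>\<^sub>\<infinity>x. (cmod (f x))\<^sup>2)) UNIV"
    by (intro has_sum_of_real has_sum_infsum)
  then show "(\<Sum>\<^sub>\<infinity>x. f x * cnj (f x)) = complex_of_real (\<Sum>\<^sub>\<infinity>x. (cmod (f x))\<^sup>2)"
    by (simp add: infsumI complex_norm_square flip: of_real_power)
qed

lemma cinner_self_zero_ell2: "Re (cinner h h) = 0 \<longleftrightarrow> (h :: 'a ell2) = 0"
proof
  assume "Re (cinner h h) = 0"
  then have "(\<Sum>\<^sub>\<infinity>x. (cmod (ell2_coord h x))\<^sup>2) = 0" by (simp add: cinner_self_ell2)
  then have "ell2_coord h x = 0" for x
    using nonneg_infsum_le_0D[of "\<lambda>x. (cmod (ell2_coord h x))\<^sup>2" UNIV x] ell2_coord[of h] by simp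
  then show "h = 0" by transfer auto
next
  assume "h = 0"
  then show "Re (cinner h h) = 0" by transfer simp
qed

instantiation ell2 :: (type) real_inner
begin

definition inner_ell2 :: "'a ell2 \<Rightarrow> 'a ell2 \<Rightarrow> real"
  where "inner_ell2 h k = Re (cinner h k)"
definition norm_ell2 :: "'a ell2 \<Rightarrow> real"
  where "norm_ell2 h = sqrt (inner h h)"
definition sgn_ell2 :: "'a ell2 \<Rightarrow> 'a ell2"
  where "sgn_ell2 h = h /\<^sub>R norm h"
definition dist_ell2 :: "'a ell2 \<Rightarrow> 'a ell2 \<Rightarrow> real"
  where "dist_ell2 h k = norm (h - k)"
definition uniformity_ell2 :: "('a ell2 \<times> 'a ell2) filter"
  where "uniformity_ell2 = (INF e\<in>{0<..}. principal {(h, k). dist h k < e})"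
definition open_ell2 :: "'a ell2 set \<Rightarrow> bool"
  where "open_ell2 U = (\<forall>h\<in>U. \<forall>\<^sub>F (h', k) in uniformity. h' = h \<longrightarrow> k \<in> U)"

instance
proof
  fix h k l :: "'a ell2" and r :: real
  show "inner h k = inner k h"
    by (subst inner_ell2_def, subst cinner_commute_ell2) (simp add: inner_ell2_def)
  show "inner (h + k) l = inner h l + inner k l"
    by (simp add: inner_ell2_def cinner_add_left_ell2)
  show "inner (r *\<^sub>R h) k = r * inner h k"
    by (simp add: inner_ell2_def scaleR_ell2_def cinner_scaleC_left_ell2)
  show "0 \<le> inner h h" by (simp add: inner_ell2_def cinner_self_ell2 infsum_nonneg)
  show "inner h h = 0 \<longleftrightarrow> h = 0" by (simp add: inner_ell2_def cinner_self_zero_ell2)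
qed (rule norm_ell2_def sgn_ell2_def dist_ell2_def uniformity_ell2_def open_ell2_def)+

end


section \<open>Unbounded self-adjoint operators and their functional calculus\<close>

text \<open>An unbounded operator is a domain together with a map; the values of the map outside of the
  domain are irrelevant.\<close>

definition self_adjoint :: "'x ell2 set \<Rightarrow> ('x ell2 \<Rightarrow> 'x ell2) \<Rightarrow> bool" where
  "self_adjoint D H \<longleftrightarrow>
     closure D = UNIV \<and> 0 \<in> D \<and>
     (\<forall>h\<in>D. \<forall>k\<in>D. h + k \<in> D \<and> H (h + k) = H h + H k) \<and>
     (\<forall>h\<in>D. \<forall>c. c *\<^sub>C h \<in> D \<and> H (c *\<^sub>C h) = c *\<^sub>C H h) \<and>
     (\<forall>h\<in>D. \<forall>k\<in>D. cinner (H h) k = cinner h (H k)) \<and>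
     D = {k. \<exists>w. \<forall>h\<in>D. cinner (H h) k = cinner h w}"

definition projection_valued_measure :: "(real set \<Rightarrow> 'x ell2 \<Rightarrow> 'x ell2) \<Rightarrow> bool" where
  "projection_valued_measure E \<longleftrightarrow>
     (\<forall>B\<in>sets borel. clinear (E B) \<and> (\<forall>h. E B (E B h) = E B h) \<and>
        (\<forall>h k. cinner (E B h) k = cinner h (E B k))) \<and>
     E UNIV = id \<and>
     (\<forall>B\<in>sets borel. \<forall>C\<in>sets borel. E (B \<inter> C) = E B \<circ> E C) \<and>
     (\<forall>B :: nat \<Rightarrow> real set. range B \<subseteq> sets borel \<longrightarrow> disjoint_family B \<longrightarrow>
        (\<forall>h. (\<lambda>n. E (B n) h) sums E (\<Union>n. B n) h))"

definition spectral_dist :: "(real set \<Rightarrow> 'x ell2 \<Rightarrow> 'x ell2) \<Rightarrow> 'x ell2 \<Rightarrow> real measure" where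
  "spectral_dist E h = measure_of UNIV (sets borel) (\<lambda>B. ennreal ((norm (E B h))\<^sup>2))"

definition fc_dom :: "(real set \<Rightarrow> 'x ell2 \<Rightarrow> 'x ell2) \<Rightarrow> (real \<Rightarrow> complex) \<Rightarrow> 'x ell2 set" where
  "fc_dom E f = {h. integrable (spectral_dist E h) (\<lambda>r. (cmod (f r))\<^sup>2)}"

text \<open>Integral of \<open>f\<close> against the complex measure \<open>B \<mapsto> \<langle>E B h, k\<rangle>\<close>, written through polarization.
  It is meaningful for \<open>h\<close> and \<open>k\<close> in \<open>fc_dom E f\<close>.\<close>

definition fc_form ::
    "(real set \<Rightarrow> 'x ell2 \<Rightarrow> 'x ell2) \<Rightarrow> (real \<Rightarrow> complex) \<Rightarrow> 'x ell2 \<Rightarrow> 'x ell2 \<Rightarrow> complex" where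
  "fc_form E f h k =
     (\<Sum>j<4. \<i> ^ j * (\<integral>r. f r \<partial>spectral_dist E (h + \<i> ^ j *\<^sub>C k))) / 4"

text \<open>The vector \<open>(\<integral>f dE) h\<close> for Borel measurable \<open>f\<close> and \<open>h\<close> in \<open>fc_dom E f\<close>. The domain is dense,
  so that testing against it determines the vector.\<close>

definition fc :: "(real set \<Rightarrow> 'x ell2 \<Rightarrow> 'x ell2) \<Rightarrow> (real \<Rightarrow> complex) \<Rightarrow> 'x ell2 \<Rightarrow> 'x ell2" where
  "fc E f h = (THE v. \<forall>k\<in>fc_dom E f. cinner v k = fc_form E f h k)"

definition spectral_measure_of ::
    "'x ell2 set \<Rightarrow> ('x ell2 \<Rightarrow> 'x ell2) \<Rightarrow> (real set \<Rightarrow> 'x ell2 \<Rightarrow> 'x ell2) \<Rightarrow> bool" where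
  "spectral_measure_of D H E \<longleftrightarrow> projection_valued_measure E \<and>
     fc_dom E complex_of_real = D \<and> (\<forall>h\<in>D. fc E complex_of_real h = H h)"

definition fermi_op :: "(real set \<Rightarrow> 'x ell2 \<Rightarrow> 'x ell2) \<Rightarrow> real \<Rightarrow> 'x ell2 \<Rightarrow> 'x ell2" where
  "fermi_op E \<beta> = fc E (\<lambda>r. complex_of_real (exp (- \<beta> * r) / (1 + exp (- \<beta> * r))))"

definition neg_proj :: "(real set \<Rightarrow> 'x ell2 \<Rightarrow> 'x ell2) \<Rightarrow> 'x ell2 \<Rightarrow> 'x ell2" where
  "neg_proj E = E {..<0}"


section \<open>The CAR algebra\<close>

text \<open>The universal property quantifies over all \<open>C\<^sup>*\<close>-algebras. As HOL has no quantification over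
  types inside of formulas, the target algebras are given on carrier sets. Being generated by a
  separable set, the image of a CAR family generates an algebra with at most continuum many elements,
  and every non-zero complex algebra has at least as many; so the carriers inside of the type of the
  algebra itself suffice.\<close>

record 'b cstar_struct = "(complex, 'b) module" +
  adj :: "'b \<Rightarrow> 'b"
  nrm :: "'b \<Rightarrow> real"

locale cstar_struct = ring B for B :: "'b cstar_struct" (structure) +
  assumes smult_closed: "x \<in> carrier B \<Longrightarrow> c \<odot> x \<in> carrier B"
    and smult_l_distr: "x \<in> carrier B \<Longrightarrow> (c + d) \<odot> x = c \<odot> x \<oplus> d \<odot> x"
    and smult_r_distr: "\<lbrakk>x \<in> carrier B; y \<in> carrier B\<rbrakk> \<Longrightarrow> c \<odot> (x \<oplus> y) = c \<odot> x \<oplus> c \<odot> y"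
    and smult_smult: "x \<in> carrier B \<Longrightarrow> c \<odot> (d \<odot> x) = (c * d) \<odot> x"
    and smult_one: "x \<in> carrier B \<Longrightarrow> 1 \<odot> x = x"
    and smult_mult_left: "\<lbrakk>x \<in> carrier B; y \<in> carrier B\<rbrakk> \<Longrightarrow> (c \<odot> x) \<otimes> y = c \<odot> (x \<otimes> y)"
    and smult_mult_right: "\<lbrakk>x \<in> carrier B; y \<in> carrier B\<rbrakk> \<Longrightarrow> x \<otimes> (c \<odot> y) = c \<odot> (x \<otimes> y)"
    and adj_closed: "x \<in> carrier B \<Longrightarrow> adj B x \<in> carrier B"
    and adj_adj: "x \<in> carrier B \<Longrightarrow> adj B (adj B x) = x"
    and adj_add: "\<lbrakk>x \<in> carrier B; y \<in> carrier B\<rbrakk> \<Longrightarrow> adj B (x \<oplus> y) = adj B x \<oplus> adj B y"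
    and adj_smult: "x \<in> carrier B \<Longrightarrow> adj B (c \<odot> x) = cnj c \<odot> adj B x"
    and adj_mult: "\<lbrakk>x \<in> carrier B; y \<in> carrier B\<rbrakk> \<Longrightarrow> adj B (x \<otimes> y) = adj B y \<otimes> adj B x"
    and nrm_nonneg: "x \<in> carrier B \<Longrightarrow> 0 \<le> nrm B x"
    and nrm_eq_0: "x \<in> carrier B \<Longrightarrow> nrm B x = 0 \<longleftrightarrow> x = \<zero>"
    and nrm_add: "\<lbrakk>x \<in> carrier B; y \<in> carrier B\<rbrakk> \<Longrightarrow> nrm B (x \<oplus> y) \<le> nrm B x + nrm B y"
    and nrm_smult: "x \<in> carrier B \<Longrightarrow> nrm B (c \<odot> x) = cmod c * nrm B x"
    and nrm_mult: "\<lbrakk>x \<in> carrier B; y \<in> carrier B\<rbrakk> \<Longrightarrow> nrm B (x \<otimes> y) \<le> nrm B x * nrm B y"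
    and nrm_adj_mult: "x \<in> carrier B \<Longrightarrow> nrm B (adj B x \<otimes> x) = (nrm B x)\<^sup>2"
    and nrm_complete: "\<lbrakk>range \<sigma> \<subseteq> carrier B;
        \<forall>\<epsilon>>0. \<exists>N. \<forall>m\<ge>N. \<forall>n\<ge>N. nrm B (\<sigma> m \<ominus> \<sigma> n) < \<epsilon>\<rbrakk> \<Longrightarrow>
        \<exists>x\<in>carrier B. (\<lambda>n. nrm B (\<sigma> n \<ominus> x)) \<longlonglongrightarrow> 0"

definition star_hom_into :: "('a::cstar_algebra \<Rightarrow> 'b) \<Rightarrow> 'b cstar_struct \<Rightarrow> bool" where
  "star_hom_into \<Phi> B \<longleftrightarrow> range \<Phi> \<subseteq> carrier B \<and> \<Phi> 1 = \<one>\<^bsub>B\<^esub> \<and>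
     (\<forall>x y. \<Phi> (x + y) = \<Phi> x \<oplus>\<^bsub>B\<^esub> \<Phi> y \<and> \<Phi> (x * y) = \<Phi> x \<otimes>\<^bsub>B\<^esub> \<Phi> y) \<and>
     (\<forall>c x. \<Phi> (c *\<^sub>C x) = c \<odot>\<^bsub>B\<^esub> \<Phi> x) \<and> (\<forall>x. \<Phi> (star x) = adj B (\<Phi> x))"

definition car_relations_in :: "'b cstar_struct \<Rightarrow> ('x ell2 \<Rightarrow> 'b) \<Rightarrow> bool" where
  "car_relations_in B b \<longleftrightarrow> range b \<subseteq> carrier B \<and>
     (\<forall>h k. adj B (b (h + k)) = adj B (b h) \<oplus>\<^bsub>B\<^esub> adj B (b k)) \<and>
     (\<forall>c h. adj B (b (c *\<^sub>C h)) = c \<odot>\<^bsub>B\<^esub> adj B (b h)) \<and>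
     (\<forall>h k. b h \<otimes>\<^bsub>B\<^esub> b k \<oplus>\<^bsub>B\<^esub> b k \<otimes>\<^bsub>B\<^esub> b h = \<zero>\<^bsub>B\<^esub>) \<and>
     (\<forall>h k. adj B (b h) \<otimes>\<^bsub>B\<^esub> b k \<oplus>\<^bsub>B\<^esub> b k \<otimes>\<^bsub>B\<^esub> adj B (b h) = cinner h k \<odot>\<^bsub>B\<^esub> \<one>\<^bsub>B\<^esub>)"

definition car_relations :: "('x ell2 \<Rightarrow> 'a::cstar_algebra) \<Rightarrow> bool" where
  "car_relations a \<longleftrightarrow> clinear (\<lambda>h. star (a h)) \<and>
     (\<forall>h k. a h * a k + a k * a h = 0) \<and>
     (\<forall>h k. star (a h) * a k + a k * star (a h) = cinner h k *\<^sub>C 1)"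

definition car_algebra :: "('x ell2 \<Rightarrow> 'a::cstar_algebra) \<Rightarrow> bool" where
  "car_algebra a \<longleftrightarrow> car_relations a \<and> cstar_generated (range a) = UNIV \<and>
     (\<forall>(B :: 'a cstar_struct) b. cstar_struct B \<and> car_relations_in B b \<longrightarrow>
        (\<exists>\<Phi>. star_hom_into \<Phi> B \<and> (\<forall>h. \<Phi> (a h) = b h)))"

definition number_at :: "('x ell2 \<Rightarrow> 'a::cstar_algebra) \<Rightarrow> 'x \<Rightarrow> 'a" where
  "number_at a x = star (a (ket x)) * a (ket x)"

definition diagonal_algebra :: "('x ell2 \<Rightarrow> 'a::cstar_algebra) \<Rightarrow> 'a set" where
  "diagonal_algebra a = cstar_generated (range (number_at a))"

definition diagonal_pos :: "('x ell2 \<Rightarrow> 'a::cstar_algebra) \<Rightarrow> 'a set" where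
  "diagonal_pos a = {star d * d | d. d \<in> diagonal_algebra a}"

text \<open>The configuration space \<open>{0,1}\<^sup>X\<close> is the type \<open>'x \<Rightarrow> bool\<close> with its library (product) topology,
  \<open>True\<close> standing for 1. The map \<open>\<iota>\<close> matters on continuous functions only.\<close>

definition diagonal_identification ::
    "('x ell2 \<Rightarrow> 'a::cstar_algebra) \<Rightarrow> ((('x \<Rightarrow> bool) \<Rightarrow> complex) \<Rightarrow> 'a) \<Rightarrow> bool" where
  "diagonal_identification a \<iota> \<longleftrightarrow>
     bij_betw \<iota> {f. continuous_on UNIV f} (diagonal_algebra a) \<and>
     \<iota> (\<lambda>_. 1) = 1 \<and>
     (\<forall>f g. continuous_on UNIV f \<longrightarrow> continuous_on UNIV g \<longrightarrow>
        \<iota> (\<lambda>\<omega>. f \<omega> + g \<omega>) = \<iota> f + \<iota> g \<and> \<iota> (\<lambda>\<omega>. f \<omega> * g \<omega>) = \<iota> f * \<iota> g) \<and>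
     (\<forall>f. continuous_on UNIV f \<longrightarrow>
        (\<forall>c. \<iota> (\<lambda>\<omega>. c * f \<omega>) = c *\<^sub>C \<iota> f) \<and> \<iota> (\<lambda>\<omega>. cnj (f \<omega>)) = star (\<iota> f)) \<and>
     (\<forall>x. \<iota> (\<lambda>\<omega>. if \<omega> x then 1 else 0) = number_at a x)"

text \<open>\<open>\<phi>\<^sub>K (a\<^sup>*(h\<^sub>n) \<cdots> a\<^sup>*(h\<^sub>1) a(k\<^sub>1) \<cdots> a(k\<^sub>m))\<close>, the lists \<open>hs\<close> and \<open>ks\<close> being
  \<open>[h\<^sub>1, \<dots>, h\<^sub>n]\<close> and \<open>[k\<^sub>1, \<dots>, k\<^sub>m]\<close>.\<close>

definition quasi_free_state ::
    "('x ell2 \<Rightarrow> 'a::cstar_algebra) \<Rightarrow> ('x ell2 \<Rightarrow> 'x ell2) \<Rightarrow> ('a \<Rightarrow> complex) \<Rightarrow> bool" where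
  "quasi_free_state a K \<phi> \<longleftrightarrow> state \<phi> \<and>
     (\<forall>hs ks. \<phi> (prod_list (map (\<lambda>h. star (a h)) (rev hs)) * prod_list (map a ks)) =
        (if length hs = length ks
         then Determinant.det (Matrix.mat (length hs) (length hs)
                (\<lambda>(i, j). cinner (K (hs ! i)) (ks ! j)))
         else 0))"

definition quasi_free_flow ::
    "('x ell2 \<Rightarrow> 'a::cstar_algebra) \<Rightarrow> (real set \<Rightarrow> 'x ell2 \<Rightarrow> 'x ell2) \<Rightarrow> (real \<Rightarrow> 'a \<Rightarrow> 'a) \<Rightarrow> bool" where
  "quasi_free_flow a E \<alpha> \<longleftrightarrow>
     (\<forall>t. star_automorphism (\<alpha> t)) \<and>
     (\<forall>s t. \<alpha> (s + t) = \<alpha> s \<circ> \<alpha> t) \<and>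
     (\<forall>A. continuous_on UNIV (\<lambda>t. \<alpha> t A)) \<and>
     (\<forall>t h. \<alpha> t (a h) = a (fc E (\<lambda>r. exp (\<i> * complex_of_real (t * r))) h))"


section \<open>Stochastic positivity and the associated process\<close>

definition entire :: "(complex \<Rightarrow> 'a::cstar_algebra) \<Rightarrow> bool" where
  "entire F \<longleftrightarrow> (\<forall>z. \<exists>A. (F has_derivative (\<lambda>w. w *\<^sub>C A)) (at z))"

definition entire_extension :: "(real \<Rightarrow> 'a \<Rightarrow> 'a) \<Rightarrow> 'a \<Rightarrow> (complex \<Rightarrow> 'a::cstar_algebra) \<Rightarrow> bool" where
  "entire_extension \<alpha> A F \<longleftrightarrow> entire F \<and> (\<forall>t. F (complex_of_real t) = \<alpha> t A)"

definition time_window :: "ereal \<Rightarrow> real set" where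
  "time_window \<beta> = {t. - \<beta> / 2 \<le> ereal t \<and> ereal t \<le> \<beta> / 2}"

text \<open>\<open>S\<close> is the form \<open>(A\<^sub>1, \<dots>, A\<^sub>n) \<mapsto> \<S>(t\<^sub>1, \<dots>, t\<^sub>n)\<close>, its arguments being collected in a list of
  length \<open>n\<close>. It is determined on such lists because entire analytic elements are dense.\<close>

definition euclidean_form ::
    "('a::cstar_algebra \<Rightarrow> complex) \<Rightarrow> (real \<Rightarrow> 'a \<Rightarrow> 'a) \<Rightarrow> real list \<Rightarrow> ('a list \<Rightarrow> complex) \<Rightarrow> bool" where
  "euclidean_form \<phi> \<alpha> ts S \<longleftrightarrow>
     (\<forall>As. length As = length ts \<longrightarrow>
        (\<forall>i<length ts. clinear (\<lambda>A. S (As[i := A]))) \<and>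
        cmod (S As) \<le> prod_list (map norm As)) \<and>
     (\<forall>As Fs. length As = length ts \<and> length Fs = length ts \<and>
          (\<forall>i<length ts. entire_extension \<alpha> (As ! i) (Fs ! i)) \<longrightarrow>
        S As = \<phi> (prod_list (map (\<lambda>i. (Fs ! i) (\<i> * complex_of_real (ts ! i))) [0..<length ts])))"

definition stochastically_positive ::
    "('x ell2 \<Rightarrow> 'a::cstar_algebra) \<Rightarrow> (real \<Rightarrow> 'a \<Rightarrow> 'a) \<Rightarrow> ('a \<Rightarrow> complex) \<Rightarrow> ereal \<Rightarrow> bool" where
  "stochastically_positive a \<alpha> \<phi> \<beta> \<longleftrightarrow>
     (\<forall>ts. sorted ts \<and> set ts \<subseteq> time_window \<beta> \<longrightarrow>
        (\<exists>S. euclidean_form \<phi> \<alpha> ts S \<and>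
           (\<forall>As. length As = length ts \<and> set As \<subseteq> diagonal_pos a \<longrightarrow> S As \<in> \<real>\<^sub>\<ge>\<^sub>0)))"

definition associated_process ::
    "((('x \<Rightarrow> bool) \<Rightarrow> complex) \<Rightarrow> 'a::cstar_algebra) \<Rightarrow> (real \<Rightarrow> 'a \<Rightarrow> 'a) \<Rightarrow> ('a \<Rightarrow> complex) \<Rightarrow> ereal \<Rightarrow>
     'w measure \<Rightarrow> (real \<Rightarrow> 'w \<Rightarrow> 'x \<Rightarrow> bool) \<Rightarrow> bool" where
  "associated_process \<iota> \<alpha> \<phi> \<beta> M X \<longleftrightarrow>
     prob_space M \<and> (\<forall>t\<in>time_window \<beta>. X t \<in> borel_measurable M) \<and>
     (\<forall>ts S fs. sorted ts \<and> set ts \<subseteq> time_window \<beta> \<and> euclidean_form \<phi> \<alpha> ts S \<and>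
          length fs = length ts \<and> (\<forall>f\<in>set fs. continuous_on UNIV f) \<longrightarrow>
        (\<integral>\<omega>. (\<Prod>i<length ts. (fs ! i) (X (ts ! i) \<omega>)) \<partial>M) = S (map \<iota> fs))"

text \<open>The kernel yields correlation functions at pairwise distinct space-time points only: for a
  repeated point the determinant has two equal rows, whereas the event is merely listed twice.\<close>

definition R_kernel ::
    "(real set \<Rightarrow> 'x ell2 \<Rightarrow> 'x ell2) \<Rightarrow> 'x \<Rightarrow> real \<Rightarrow> 'x \<Rightarrow> real \<Rightarrow> complex" where
  "R_kernel E x t y s =
     (if t \<le> s
      then cinner (fc E (\<lambda>r. complex_of_real (exp ((s - t) * r))) (neg_proj E (ket x))) (ket y)
      else - cinner (fc E (\<lambda>r. complex_of_real (exp (- (t - s) * r))) (ket x - neg_proj E (ket x)))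
               (ket y))"

end

theory Submission
  imports Defs "HOL-Complex_Analysis.Conformal_Mappings"
begin

text \<open>
  By Wick's theorem, a Euclidean correlation of factors \<open>c + b \<rho>\<^sub>x\<close> at ordered times is the determinant
  of a kernel whose entries are functions of \<open>H\<close>, both for the Gibbs states and for the ground state;
  for the latter this is the asserted formula. The Euclidean forms of the ground state exist because
  \<open>A \<mapsto> \<alpha>\<^bsub>it\<^esub> A\<close>, \<open>t \<ge> 0\<close>, is contractive in the seminorm of the GNS representation.

  Positivity of the ground state determinants does not follow by letting \<open>\<beta> \<rightarrow> \<infinity>\<close> directly, since the
  Fermi operators converge to the projection onto \<open>H < 0\<close> plus one half of the projection onto the
  kernel of \<open>H\<close>. The remedy is a chemical potential: the functions \<open>\<Prod>\<^sub>y (1 - c \<rho>\<^sub>y)\<close> at time \<open>- \<beta> / 2\<close>, with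
  \<open>y\<close> in a finite set and \<open>0 \<le> c < 1\<close>, are non-negative, and inserting them and exhausting the space replaces the
  Fermi symbol \<open>k\<close> by \<open>(1 - c) k / (1 - c k)\<close>. With \<open>\<beta> = n\<^sup>2\<close> and \<open>1 - c = e\<^bsup>-n\<^esup>\<close> the resulting kernels, whose
  determinants are thus non-negative, converge to the one of the ground state as \<open>n \<rightarrow> \<infinity>\<close>. Finally,
  positivity on cylinder projections extends to the diagonal algebra by multilinearity and density.
\<close>

section \<open>Hilbert space geometry of \<open>\<ell>\<^sup>2\<close>\<close>

text \<open>Two obstacles shape the argument. The Hamiltonian is unbounded, so \<open>ket x\<close>
  need not lie in the domain of its exponentials and \<open>number_at a x\<close> need not be entire
  analytic. Every letter is therefore first cut to the spectral window
  \<open>{- real n..real n}\<close>. The cut is removed only after the exponentials have been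
  absorbed into the kernels: the symbol k tames exp ((s - t) r) at large r if t <= s, and 1 - k
  tames it at very negative r if s <= t. This is why the determinants treat entries on or above the
  diagonal and those below it differently. Moreover, for infinitely many sites the algebra has no
  total number operator, so the chemical potential is only reached through finite sections of the
  resolvent of 1 - c K. Two demands fix n^2 and e^-n: the chemical potential log (1 - c) / \<beta> =
  - 1 / n must vanish in the limit, while its product with \<beta>, of modulus n, must diverge in
  order to empty the kernel of the Hamiltonian. Besides, - n^2 / 2 precedes any given finite set of
  times once n is large.\<close>

lemma mult_cnj_cmod: "z * cnj z = (complex_of_real (cmod z))\<^sup>2"
  using complex_norm_square[of z] by simp

lemma scaleC_zero_right [simp]: "c *\<^sub>C (0 :: 'a::complex_vector) = 0"
  using scaleC_add_right[of c 0 "0::'a"] by simp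

lemma scaleC_zero_left [simp]: "0 *\<^sub>C (x :: 'a::complex_vector) = 0"
  using scaleC_of_real[of 0 x] by simp

lemma scaleC_one [simp]: "1 *\<^sub>C (x :: 'a::complex_vector) = x"
  using scaleC_of_real[of 1 x] by simp

lemma scaleC_minus_one: "(-1) *\<^sub>C (x :: 'a::complex_vector) = - x"
  using scaleC_of_real[of "-1" x] by simp

lemma scaleC_minus_right: "c *\<^sub>C (- x) = - (c *\<^sub>C (x :: 'a::complex_vector))"
  by (metis scaleC_minus_one scaleC_scaleC mult.commute)

lemma scaleC_minus_left: "(- c) *\<^sub>C x = - (c *\<^sub>C (x :: 'a::complex_vector))"
  by (metis scaleC_minus_one scaleC_scaleC mult_minus1)

lemma scaleC_diff_right: "c *\<^sub>C (x - y) = c *\<^sub>C x - c *\<^sub>C (y :: 'a::complex_vector)"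
  by (metis diff_conv_add_uminus scaleC_add_right scaleC_minus_right)

lemma clinear_add: "clinear f \<Longrightarrow> f (x + y) = f x + f y"
  and clinear_scale: "clinear f \<Longrightarrow> f (c *\<^sub>C x) = c *\<^sub>C f x"
  by (auto simp: clinear_def)

lemma clinear_zero: "clinear f \<Longrightarrow> f 0 = 0"
  by (metis clinear_scale scaleC_zero_left)

lemma clinear_minus: "clinear f \<Longrightarrow> f (- x) = - f x"
  by (metis clinear_scale scaleC_minus_one)

lemma clinear_diff: "clinear f \<Longrightarrow> f (x - y) = f x - f y"
  using clinear_add[of f x "- y"] by (simp add: clinear_minus)

lemma clinear_sum:
  assumes "clinear f" shows "f (\<Sum>i\<in>I. g i) = (\<Sum>i\<in>I. f (g i))"
  by (induction I rule: infinite_finite_induct) (simp_all add: clinear_add[OF assms] clinear_zero[OF assms])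

lemma cinner_add_right: "cinner h (k + l) = cinner h k + cinner h (l :: 'x ell2)"
  by (metis cinner_add_left_ell2 cinner_commute_ell2 complex_cnj_add)

lemma cinner_scaleC_right: "cinner h (c *\<^sub>C k) = cnj c * cinner h (k :: 'x ell2)"
  by (metis cinner_scaleC_left_ell2 cinner_commute_ell2 complex_cnj_mult)

lemma cinner_zero_left [simp]: "cinner 0 (k :: 'x ell2) = 0"
  using cinner_scaleC_left_ell2[of 0 k k] by simp

lemma cinner_zero_right [simp]: "cinner k (0 :: 'x ell2) = 0"
  using cinner_scaleC_right[of k 0 k] by simp

lemma cinner_minus_left: "cinner (- h) k = - cinner h (k :: 'x ell2)"
  using cinner_scaleC_left_ell2[of "-1" h k] by (simp add: scaleC_minus_one)

lemma cinner_minus_right: "cinner h (- k) = - cinner h (k :: 'x ell2)"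
  using cinner_scaleC_right[of h "-1" k] by (simp add: scaleC_minus_one)

lemma cinner_diff_left: "cinner (h - k) l = cinner h l - cinner k (l :: 'x ell2)"
  using cinner_add_left_ell2[of h "- k" l] by (simp add: cinner_minus_left)

lemma cinner_diff_right: "cinner l (h - k) = cinner l h - cinner l (k :: 'x ell2)"
  using cinner_add_right[of l h "- k"] by (simp add: cinner_minus_right)

lemma cinner_sum_left: "cinner (\<Sum>i\<in>I. f i) k = (\<Sum>i\<in>I. cinner (f i) (k :: 'x ell2))"
  by (induction I rule: infinite_finite_induct) (auto simp: cinner_add_left_ell2)

lemma cinner_sum_right: "cinner k (\<Sum>i\<in>I. f i) = (\<Sum>i\<in>I. cinner (k :: 'x ell2) (f i))"
  by (induction I rule: infinite_finite_induct) (auto simp: cinner_add_right)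

lemma cinner_norm: "cinner h h = complex_of_real ((norm (h :: 'x ell2))\<^sup>2)"
proof -
  have "cinner h h = complex_of_real (Re (cinner h h))" by (simp add: cinner_self_ell2)
  then show ?thesis by (simp add: power2_norm_eq_inner inner_ell2_def)
qed

lemma norm_ell2_sq: "(norm (h :: 'x ell2))\<^sup>2 = Re (cinner h h)"
  by (simp add: cinner_norm)

lemma norm_scaleC_ell2: "norm (c *\<^sub>C (h :: 'x ell2)) = cmod c * norm h"
proof -
  have "complex_of_real ((norm (c *\<^sub>C h))\<^sup>2) = cinner (c *\<^sub>C h) (c *\<^sub>C h)"
    by (simp only: cinner_norm)
  also have "\<dots> = (c * cnj c) * cinner h h"
    by (simp add: cinner_scaleC_left_ell2 cinner_scaleC_right)
  also have "\<dots> = complex_of_real ((cmod c * norm h)\<^sup>2)"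
    by (simp add: mult_cnj_cmod cinner_norm power_mult_distrib)
  finally show ?thesis by (simp only: of_real_eq_iff) (simp add: power2_eq_iff_nonneg)
qed

text \<open>Rotating \<open>h\<close> by the phase \<open>u\<close> makes the inner product with
  \<open>k\<close> real and non-negative, so the Cauchy-Schwarz inequality of the real inner product
  suffices.\<close>

lemma cinner_cauchy_schwarz: "cmod (cinner h k) \<le> norm h * norm (k :: 'x ell2)"
proof (cases "cinner h k = 0")
  case False
  define u where "u = cnj (sgn (cinner h k))"
  have "u * cinner h k = complex_of_real (cmod (cinner h k))"
  proof -
    have "cinner h k = complex_of_real (cmod (cinner h k)) * sgn (cinner h k)"
      using False by (simp add: sgn_div_norm scaleR_conv_of_real)
    moreover have "sgn (cinner h k) * u = 1"
      using False by (simp add: u_def mult_cnj_cmod norm_sgn)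
    ultimately show ?thesis by (metis mult.assoc mult.commute mult.right_neutral)
  qed
  then have "cinner (u *\<^sub>C h) k = complex_of_real (cmod (cinner h k))"
    by (simp add: cinner_scaleC_left_ell2)
  then have "cmod (cinner h k) = inner (u *\<^sub>C h) k" by (simp add: inner_ell2_def)
  also have "\<dots> \<le> norm (u *\<^sub>C h) * norm k" by (rule norm_cauchy_schwarz)
  also have "norm (u *\<^sub>C h) = norm h" using False by (simp add: norm_scaleC_ell2 u_def norm_sgn)
  finally show ?thesis .
qed simp

lemma bounded_bilinear_cinner: "bounded_bilinear (cinner :: 'x ell2 \<Rightarrow> _)"
  by standard (auto simp: cinner_add_left_ell2 cinner_add_right cinner_scaleC_left_ell2 cinner_scaleC_right
      scaleR_conv_of_real scaleR_ell2_def intro!: exI[of _ 1] cinner_cauchy_schwarz)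

lemmas tendsto_cinner = bounded_bilinear.tendsto[OF bounded_bilinear_cinner]

lemma cinner_ket: "cinner h (ket x) = ell2_coord h (x :: 'x)"
proof transfer
  fix f :: "'x \<Rightarrow> complex" and x
  have "(\<Sum>\<^sub>\<infinity>y. f y * cnj (if y = x then 1 else 0)) = (\<Sum>\<^sub>\<infinity>y\<in>{x}. f y)"
    by (rule infsum_cong_neutral) auto
  then show "(\<Sum>\<^sub>\<infinity>y. f y * cnj (if y = x then 1 else 0)) = f x" by simp
qed

lemma cinner_ket_left: "cinner (ket x) h = cnj (ell2_coord h (x :: 'x))"
  by (subst cinner_commute_ell2) (simp add: cinner_ket)

lemma ell2_coord_ket: "ell2_coord (ket x) y = (if y = x then 1 else 0)"
  by transfer simp

lemma norm_ket [simp]: "norm (ket x) = 1"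
proof -
  have "(norm (ket x))\<^sup>2 = 1" by (simp add: norm_ell2_sq cinner_ket ell2_coord_ket)
  then show ?thesis by (metis norm_ge_zero one_power2 power2_eq_iff_nonneg zero_le_one)
qed

lemma ell2_eqI: "(\<And>k. cinner v k = cinner w k) \<Longrightarrow> v = (w :: 'x ell2)"
  using cinner_self_zero_ell2[of "v - w"] by (simp add: cinner_diff_left)

section \<open>Coordinate truncations and the Riesz representation\<close>

definition ell2_trunc :: "'x set \<Rightarrow> 'x ell2 \<Rightarrow> 'x ell2" where
  "ell2_trunc F h = (\<Sum>x\<in>F. ell2_coord h x *\<^sub>C ket x)"

lemma cinner_ell2_trunc: "cinner (ell2_trunc F h) k = (\<Sum>x\<in>F. ell2_coord h x * cnj (ell2_coord k x))"
  by (simp add: ell2_trunc_def cinner_sum_left cinner_scaleC_left_ell2 cinner_ket_left)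

lemma cinner_ell2_trunc_commute: "cinner (ell2_trunc F h) k = cinner h (ell2_trunc F k)"
  by (subst (2) cinner_commute_ell2) (simp add: cinner_ell2_trunc mult.commute)

lemma ell2_coord_trunc: "finite F \<Longrightarrow> ell2_coord (ell2_trunc F h) x = (if x \<in> F then ell2_coord h x else 0)"
proof -
  assume F: "finite F"
  have "ell2_coord (ell2_trunc F h) x = (\<Sum>y\<in>F. ell2_coord h y * cnj (ell2_coord (ket x) y))"
    by (simp add: cinner_ell2_trunc flip: cinner_ket[of "ell2_trunc F h"])
  also have "\<dots> = (\<Sum>y\<in>F. if x = y then ell2_coord h y else 0)"
    by (rule sum.cong) (auto simp: ell2_coord_ket)
  finally show ?thesis using F by simp
qed

lemma norm_ell2_eq: "(norm (h :: 'x ell2))\<^sup>2 = (\<Sum>\<^sub>\<infinity>x. (cmod (ell2_coord h x))\<^sup>2)"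
  by (simp add: norm_ell2_sq cinner_self_ell2)

text \<open>For finite \<open>F\<close> the truncation is an orthogonal projection, so by Pythagoras
  the squared error is the tail of the series of squared coordinates.\<close>

lemma ell2_trunc_tendsto: "((\<lambda>F. ell2_trunc F h) \<longlongrightarrow> h) (finite_subsets_at_top UNIV)"
proof -
  have "(\<lambda>x. (cmod (ell2_coord h x))\<^sup>2) summable_on UNIV"
    using ell2_coord[of h] by simp
  then have "((\<lambda>F. \<Sum>x\<in>F. (cmod (ell2_coord h x))\<^sup>2) \<longlongrightarrow> (norm h)\<^sup>2) (finite_subsets_at_top UNIV)"
    unfolding norm_ell2_eq by (metis has_sum_infsum has_sum_def)
  moreover have "(norm (ell2_trunc F h - h))\<^sup>2 = (norm h)\<^sup>2 - (\<Sum>x\<in>F. (cmod (ell2_coord h x))\<^sup>2)"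
    if "finite F" for F
  proof -
    have 1: "cinner (ell2_trunc F h) h = complex_of_real (\<Sum>x\<in>F. (cmod (ell2_coord h x))\<^sup>2)"
      by (simp add: cinner_ell2_trunc mult_cnj_cmod)
    moreover have "cinner h (ell2_trunc F h) = cinner (ell2_trunc F h) h"
      by (simp add: cinner_ell2_trunc_commute)
    moreover have "cinner (ell2_trunc F h) (ell2_trunc F h) = cinner (ell2_trunc F h) h"
      using that by (simp add: cinner_ell2_trunc ell2_coord_trunc)
    ultimately show ?thesis
      unfolding norm_ell2_sq[of "ell2_trunc F h - h"] by (simp add: cinner_diff_left cinner_diff_right cinner_norm[of h] del: of_real_sum of_real_power)
  qed
  ultimately have "((\<lambda>F. (norm (ell2_trunc F h - h))\<^sup>2) \<longlongrightarrow> 0) (finite_subsets_at_top UNIV)"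
    by (subst tendsto_cong[where g = "\<lambda>F. (norm h)\<^sup>2 - (\<Sum>x\<in>F. (cmod (ell2_coord h x))\<^sup>2)"])
       (auto intro!: eventually_finite_subsets_at_top_weakI tendsto_eq_intros)
  then have "((\<lambda>F. norm (ell2_trunc F h - h)) \<longlongrightarrow> 0) (finite_subsets_at_top UNIV)"
    using tendsto_real_sqrt[of "\<lambda>F. (norm (ell2_trunc F h - h))\<^sup>2" 0] by simp
  then show ?thesis by (simp add: Lim_null[of _ h] tendsto_norm_zero_iff)
qed

text \<open>The functionals are antilinear because \<open>cinner\<close> is linear on the left. The
  representing vector must have the coordinates \<open>L (ket x)\<close>; that these are square
  summable is the point.\<close>

lemma ell2_riesz:
  fixes L :: "'x ell2 \<Rightarrow> complex"
  assumes add: "\<And>k l. L (k + l) = L k + L l" and scale: "\<And>c k. L (c *\<^sub>C k) = cnj c * L k"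
    and bdd: "\<And>k. cmod (L k) \<le> C * norm k"
  shows "\<exists>v. \<forall>k. cinner v k = L k"
proof -
  have zero: "L 0 = 0" using scale[of 0 0] by simp
  have Lsum: "L (\<Sum>x\<in>F. g x) = (\<Sum>x\<in>F. L (g x))" for F and g :: "'x \<Rightarrow> 'x ell2"
    by (induction F rule: infinite_finite_induct) (auto simp: add zero)
  have C0: "0 \<le> C" using order_trans[OF norm_ge_zero bdd[of "ket undefined"]] by simp
  define f where "f x = L (ket x)" for x
  have "(\<Sum>x\<in>F. (cmod (f x))\<^sup>2) \<le> C\<^sup>2" if "finite F" for F
  proof -
    \<comment> \<open>Testing \<open>L\<close> on this finite section of the candidate gives
      \<open>L u = s\<close> and \<open>norm u = sqrt s\<close>, so the bound on \<open>L\<close>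
      yields \<open>sqrt s <= C\<close>.\<close>
    define u where "u = (\<Sum>x\<in>F. f x *\<^sub>C ket x)"
    define s where "s = (\<Sum>x\<in>F. (cmod (f x))\<^sup>2)"
    have s0: "0 \<le> s" by (simp add: s_def sum_nonneg)
    have Lu: "L u = complex_of_real s"
      by (simp add: u_def Lsum scale s_def mult_cnj_cmod mult.commute[of "cnj _"] flip: f_def)
    have "ell2_coord u x = (\<Sum>y\<in>F. f y * ell2_coord (ket y) x)" for x
      by (simp add: u_def cinner_sum_left cinner_scaleC_left_ell2 flip: cinner_ket)
    moreover have "(\<Sum>y\<in>F. f y * ell2_coord (ket y) x) = (if x \<in> F then f x else 0)" for x
    proof -
      have "(\<Sum>y\<in>F. f y * ell2_coord (ket y) x) = (\<Sum>y\<in>F. if x = y then f y else 0)"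
        by (rule sum.cong) (auto simp: ell2_coord_ket)
      then show ?thesis using that by simp
    qed
    ultimately have u: "ell2_coord u x = (if x \<in> F then f x else 0)" for x by simp
    have "cinner u u = (\<Sum>x\<in>F. f x * cnj (ell2_coord u x))"
      unfolding u_def by (simp add: cinner_sum_left cinner_scaleC_left_ell2 cinner_ket_left)
    also have "\<dots> = (\<Sum>x\<in>F. f x * cnj (f x))" by (rule sum.cong) (auto simp: u)
    finally have "cinner u u = complex_of_real s" by (simp add: s_def mult_cnj_cmod)
    then have nu: "norm u = sqrt s" by (simp add: norm_ell2_def inner_ell2_def)
    have "s \<le> C * sqrt s" using bdd[of u] Lu nu s0 by simp
    have "sqrt s \<le> C"
    proof (cases "s = 0")
      case False
      then have "sqrt s * sqrt s \<le> C * sqrt s" "0 < sqrt s" using s0 \<open>s \<le> C * sqrt s\<close> by auto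
      then show ?thesis by (rule mult_right_le_imp_le)
    qed (use C0 in simp)
    then have "(sqrt s)\<^sup>2 \<le> C\<^sup>2" using s0 by (intro power_mono) auto
    then show ?thesis using s0 by (simp add: s_def)
  qed
  then have "bdd_above (sum (\<lambda>x. (cmod (f x))\<^sup>2) ` {F. F \<subseteq> UNIV \<and> finite F})"
    by (intro bdd_aboveI[of _ "C\<^sup>2"]) blast
  then have "(\<lambda>x. (cmod (f x))\<^sup>2) summable_on UNIV"
    by (intro nonneg_bdd_above_summable_on) simp_all
  then have v: "ell2_coord (Abs_ell2 f) = f" by (simp add: Abs_ell2_inverse)
  define v where "v = Abs_ell2 f"
  have "cinner v k = L k" for k
  proof -
    have "cinner v (ell2_trunc F k) = L (ell2_trunc F k)" for F
      by (simp add: ell2_trunc_def cinner_sum_right cinner_scaleC_right cinner_ket v v_def Lsum scale flip: f_def)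
    moreover have "((\<lambda>F. cinner v (ell2_trunc F k)) \<longlongrightarrow> cinner v k) (finite_subsets_at_top UNIV)"
      by (rule tendsto_cinner[OF tendsto_const ell2_trunc_tendsto])
    moreover have "((\<lambda>F. L (ell2_trunc F k)) \<longlongrightarrow> L k) (finite_subsets_at_top UNIV)"
    proof -
      have scaleR: "L (r *\<^sub>R l) = r *\<^sub>R L l" for r l
        by (simp add: scaleR_ell2_def scale scaleR_conv_of_real)
      interpret L: bounded_linear L
        using bdd by (intro bounded_linear_intro[where K = C] add scaleR) (simp add: mult.commute[of C])
      show ?thesis by (rule L.tendsto[OF ell2_trunc_tendsto])
    qed
    ultimately show ?thesis
      using tendsto_unique[OF finite_subsets_at_top_neq_bot] by simp
  qed
  then show ?thesis by blast
qed

section \<open>Bounded Borel functional calculus\<close>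

definition bounded_borel :: "(real \<Rightarrow> complex) \<Rightarrow> bool" where
  "bounded_borel f \<longleftrightarrow> f \<in> borel_measurable borel \<and> (\<exists>C. \<forall>r. cmod (f r) \<le> C)"

lemma bounded_borelI:
  "f \<in> borel_measurable borel \<Longrightarrow> (\<And>r. cmod (f r) \<le> C) \<Longrightarrow> bounded_borel f"
  by (auto simp: bounded_borel_def)

lemma bounded_borel_measurable [measurable_dest]: "bounded_borel f \<Longrightarrow> f \<in> borel_measurable borel"
  by (simp add: bounded_borel_def)

lemma bounded_borel_bound:
  assumes "bounded_borel f" obtains C where "0 \<le> C" "\<And>r. cmod (f r) \<le> C"
proof -
  from assms obtain C where C: "\<And>r. cmod (f r) \<le> C" by (auto simp: bounded_borel_def)
  then have "0 \<le> C" using norm_ge_zero order_trans by blast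
  with C that show ?thesis by blast
qed

lemma bounded_borel_const [intro, simp]: "bounded_borel (\<lambda>_. c)"
  by (rule bounded_borelI[of _ "cmod c"]) auto

lemma bounded_borel_indicator [intro]: "B \<in> sets borel \<Longrightarrow> bounded_borel (indicator B)"
  by (rule bounded_borelI[of _ 1]) (auto simp: indicator_def)

lemma bounded_borel_add [intro]:
  assumes "bounded_borel f" "bounded_borel g" shows "bounded_borel (\<lambda>r. f r + g r)"
proof -
  obtain C where C: "\<And>r. cmod (f r) \<le> C" using bounded_borel_bound[OF assms(1)] by blast
  obtain D where D: "\<And>r. cmod (g r) \<le> D" using bounded_borel_bound[OF assms(2)] by blast
  show ?thesis
    by (rule bounded_borelI[where C = "C + D"])
       (use assms in \<open>auto intro: norm_triangle_le add_mono C D borel_measurable_add bounded_borel_measurable\<close>)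
qed

lemma bounded_borel_mult [intro]:
  assumes "bounded_borel f" "bounded_borel g" shows "bounded_borel (\<lambda>r. f r * g r)"
proof -
  obtain C where C: "0 \<le> C" "\<And>r. cmod (f r) \<le> C" using bounded_borel_bound[OF assms(1)] by blast
  obtain D where D: "\<And>r. cmod (g r) \<le> D" using bounded_borel_bound[OF assms(2)] by blast
  show ?thesis
    by (rule bounded_borelI[where C = "C * D"])
       (use assms in \<open>auto simp: norm_mult intro!: mult_mono C D borel_measurable_times bounded_borel_measurable\<close>)
qed

lemma bounded_borel_cnj [intro]:
  assumes "bounded_borel f" shows "bounded_borel (\<lambda>r. cnj (f r))"
proof -
  obtain C where C: "\<And>r. cmod (f r) \<le> C" using bounded_borel_bound[OF assms] by blast
  have "cnj \<in> borel_measurable borel"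
    by (intro borel_measurable_continuous_onI continuous_intros)
  then show ?thesis
    by (intro bounded_borelI[where C = C]) (use assms C in \<open>auto intro: measurable_compose bounded_borel_measurable\<close>)
qed

lemma bounded_borel_diff [intro]:
  assumes "bounded_borel f" "bounded_borel g" shows "bounded_borel (\<lambda>r. f r - g r)"
  using bounded_borel_add[OF assms(1) bounded_borel_mult[OF bounded_borel_const[of "-1"] assms(2)]] by simp

text \<open>The non-negative case is the usual induction over simple functions and increasing
  limits. The common bound \<open>C\<close> in \<open>lim\<close> is what dominated convergence
  against the finite spectral measures will need.\<close>

lemma bounded_borel_induct [consumes 1, case_names indicator add scale lim]:
  assumes f: "bounded_borel f"
    and indicator: "\<And>B. B \<in> sets borel \<Longrightarrow> P (indicator B)"
    and add: "\<And>f g. bounded_borel f \<Longrightarrow> P f \<Longrightarrow> bounded_borel g \<Longrightarrow> P g \<Longrightarrow> P (\<lambda>r. f r + g r)"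
    and scale: "\<And>c f. bounded_borel f \<Longrightarrow> P f \<Longrightarrow> P (\<lambda>r. c * f r)"
    and lim: "\<And>F f C. (\<And>n::nat. bounded_borel (F n)) \<Longrightarrow> (\<And>n. P (F n)) \<Longrightarrow> (\<And>n r. cmod (F n r) \<le> C) \<Longrightarrow>
        (\<And>r. (\<lambda>n. F n r) \<longlonglongrightarrow> f r) \<Longrightarrow> bounded_borel f \<Longrightarrow> P f"
  shows "P f"
proof -
  have nonneg: "P (\<lambda>r. complex_of_real (u r))"
    if u: "u \<in> borel_measurable borel" "\<And>r. 0 \<le> u r" and bdd: "\<And>r. u r \<le> C" for u C
  proof -
    have "(\<forall>r. u r \<le> C) \<longrightarrow> P (\<lambda>r. complex_of_real (u r))" for C
      using u
    proof (induction u arbitrary: C rule: borel_measurable_induct_real)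
      case (set A)
      have "(\<lambda>r. complex_of_real (indicator A r)) = indicator A" by (auto simp: indicator_def)
      with set show ?case using indicator[of A] by simp
    next
      case (mult u c C)
      show ?case
      proof (cases "c = 0")
        case True
        have "(\<lambda>r. 0) = (indicator {} :: real \<Rightarrow> complex)" by auto
        with True show ?thesis using indicator[of "{}"] by simp
      next
        case False
        with mult have c: "c > 0" by simp
        show ?thesis
        proof
          assume b: "\<forall>r. c * u r \<le> C"
          then have b: "u r \<le> C / c" for r using c by (simp add: field_simps)
          then have "bounded_borel (\<lambda>r. complex_of_real (u r))"
            using mult by (intro bounded_borelI[of _ "C / c"]) auto
          then show "P (\<lambda>r. complex_of_real (c * u r))"
            using scale[of "\<lambda>r. complex_of_real (u r)" "of_real c"] mult.IH b by auto
        qed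
      qed
    next
      case (add u v C)
      show ?case
      proof
        assume b: "\<forall>r. v r + u r \<le> C"
        have b1: "u r \<le> C" "v r \<le> C" for r using add.hyps(2,4)[of r] b[rule_format, of r] by linarith+
        then have "bounded_borel (\<lambda>r. complex_of_real (u r))" "bounded_borel (\<lambda>r. complex_of_real (v r))"
          using add by (auto intro!: bounded_borelI[of _ "C"])
        then show "P (\<lambda>r. complex_of_real (v r + u r))"
          using assms(3)[of "\<lambda>r. complex_of_real (v r)" "\<lambda>r. complex_of_real (u r)"] add.IH b1 by auto
      qed
    next
      case (seq U C)
      show ?case
      proof
        assume b: "\<forall>r. u r \<le> C"
        have le: "U n r \<le> u r" for n r
          using seq.hyps(3) by (intro incseq_le[OF _ seq.hyps(4)]) (auto simp: incseq_def le_fun_def)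
        then have le: "U n r \<le> C" for n r using b order_trans by blast
        have bU: "bounded_borel (\<lambda>r. complex_of_real (U n r))" for n
          using seq le by (auto intro!: bounded_borelI[of _ "C"])
        have bu: "bounded_borel (\<lambda>r. complex_of_real (u r))"
          using u b by (auto intro!: bounded_borelI[of _ "C"])
        show "P (\<lambda>r. complex_of_real (u r))"
        proof (rule lim[where C = C])
          show "\<And>n. P (\<lambda>r. complex_of_real (U n r))" using seq.IH le by blast
          show "(\<lambda>n. complex_of_real (U n r)) \<longlonglongrightarrow> complex_of_real (u r)" for r
            using seq.hyps(4)[of r] by (intro tendsto_of_real) simp
        qed (use bU bu seq.hyps(2) le in auto)
      qed
    qed
    then show ?thesis using bdd by blast
  qed
  obtain C where C: "0 \<le> C" "\<And>r. cmod (f r) \<le> C" using bounded_borel_bound[OF f] by blast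
  have [measurable]: "f \<in> borel_measurable borel" using f by (rule bounded_borel_measurable)
  define p where "p j r = (if j = (0::nat) then max 0 (Re (f r)) else if j = 1 then max 0 (- Re (f r))
     else if j = 2 then max 0 (Im (f r)) else max 0 (- Im (f r)))" for j r
  have pm: "p j \<in> borel_measurable borel" for j
    unfolding p_def by (cases "j = 0"; cases "j = 1"; cases "j = 2") simp_all
  have pb: "0 \<le> p j r" "p j r \<le> C" for j r
    using abs_Re_le_cmod[of "f r"] abs_Im_le_cmod[of "f r"] C(2)[of r] C(1) by (auto simp: p_def max_def)
  have Pp: "P (\<lambda>r. complex_of_real (p j r))" and Bp: "bounded_borel (\<lambda>r. complex_of_real (p j r))" for j
    using pm pb by (auto intro!: nonneg[of _ C] bounded_borelI[of _ C])
  have Ps: "P (\<lambda>r. c * complex_of_real (p j r))" and Bs: "bounded_borel (\<lambda>r. c * complex_of_real (p j r))" for j c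
    using scale Pp Bp by auto
  have "P (\<lambda>r. (1 * complex_of_real (p 0 r) + (-1) * complex_of_real (p 1 r)) +
     (\<i> * complex_of_real (p 2 r) + (-\<i>) * complex_of_real (p 3 r)))"
    by (intro add bounded_borel_add Ps Bs)
  also have "(\<lambda>r. (1 * complex_of_real (p 0 r) + (-1) * complex_of_real (p 1 r)) +
     (\<i> * complex_of_real (p 2 r) + (-\<i>) * complex_of_real (p 3 r))) = f"
    by (auto simp: p_def complex_eq_iff max_def)
  finally show ?thesis .
qed

locale spectral_measure =
  fixes E :: "real set \<Rightarrow> 'x ell2 \<Rightarrow> 'x ell2"
  assumes pvm: "projection_valued_measure E"
begin

lemma E_clinear: "B \<in> sets borel \<Longrightarrow> clinear (E B)"
  and E_idem: "B \<in> sets borel \<Longrightarrow> E B (E B h) = E B h"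
  and E_adj: "B \<in> sets borel \<Longrightarrow> cinner (E B h) k = cinner h (E B k)"
  and E_UNIV: "E UNIV h = h"
  and E_Int: "B \<in> sets borel \<Longrightarrow> C \<in> sets borel \<Longrightarrow> E (B \<inter> C) h = E B (E C h)"
  and E_sums: "range A \<subseteq> sets borel \<Longrightarrow> disjoint_family A \<Longrightarrow> (\<lambda>n. E (A n) h) sums E (\<Union>n. A n) h"
  for A :: "nat \<Rightarrow> real set"
  using pvm unfolding projection_valued_measure_def by (auto simp: fun_eq_iff)

lemma cinner_E_self: "B \<in> sets borel \<Longrightarrow> cinner (E B h) h = complex_of_real ((norm (E B h))\<^sup>2)"
  by (metis E_adj E_idem cinner_norm)

lemma E_empty: "E {} h = 0"
  using E_sums[of "\<lambda>_. {}" h] by (simp add: disjoint_family_on_def sums_def)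
    (metis LIMSEQ_unique One_nat_def lessI sums_0 sums_def sums_unique summable_LIMSEQ_zero summable_def tendsto_const)

lemma sets_spectral_dist [measurable_cong, simp]: "sets (spectral_dist E h) = sets borel"
  by (simp add: spectral_dist_def sets.sigma_sets_eq[of borel, simplified])

lemma space_spectral_dist [simp]: "space (spectral_dist E h) = UNIV"
  by (simp add: spectral_dist_def)

text \<open>The squared norm equals \<open>cinner (E B h) h\<close>, which is linear in
  \<open>E B h\<close>; this transports countable additivity from vectors to numbers.\<close>

lemma emeasure_spectral_dist:
  assumes "B \<in> sets borel" shows "emeasure (spectral_dist E h) B = ennreal ((norm (E B h))\<^sup>2)"
proof (rule emeasure_measure_of[OF spectral_dist_def])
  show "countably_additive (sets (spectral_dist E h)) (\<lambda>B. ennreal ((norm (E B h))\<^sup>2))"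
  proof (rule countably_additiveI)
    fix A :: "nat \<Rightarrow> real set"
    assume A: "range A \<subseteq> sets (spectral_dist E h)" "disjoint_family A"
    then have A': "range A \<subseteq> sets borel" by simp
    then have m: "A n \<in> sets borel" for n by auto
    then have U: "(\<Union>n. A n) \<in> sets borel" by auto
    have "(\<lambda>n. Re (cinner (E (A n) h) h)) sums Re (cinner (E (\<Union>n. A n) h) h)"
      by (intro bounded_linear.sums[OF bounded_linear_Re]
          bounded_linear.sums[OF bounded_bilinear.bounded_linear_left[OF bounded_bilinear_cinner]]
          E_sums A' A(2))
    then have "(\<lambda>n. (norm (E (A n) h))\<^sup>2) sums (norm (E (\<Union>n. A n) h))\<^sup>2"
      by (simp add: cinner_E_self m U)
    then show "(\<Sum>n. ennreal ((norm (E (A n) h))\<^sup>2)) = ennreal ((norm (E (\<Union> (range A)) h))\<^sup>2)"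
      by (subst suminf_ennreal2) (auto simp: sums_iff)
  qed
  show "positive (sets (spectral_dist E h)) (\<lambda>B. ennreal ((norm (E B h))\<^sup>2))"
    by (simp add: positive_def E_empty)
qed (use assms in auto)

lemma measurable_spectral_dist: "bounded_borel f \<Longrightarrow> f \<in> borel_measurable (spectral_dist E h)"
  by (simp add: bounded_borel_measurable cong: measurable_cong_sets)

lemma finite_measure_spectral_dist: "finite_measure (spectral_dist E h)"
  by (rule finite_measureI) (simp add: emeasure_spectral_dist)

lemma measure_spectral_dist:
  "B \<in> sets borel \<Longrightarrow> measure (spectral_dist E h) B = (norm (E B h))\<^sup>2"
  by (simp add: measure_def emeasure_spectral_dist)

lemma integrable_spectral_dist:
  assumes "bounded_borel f" shows "integrable (spectral_dist E h) f"
proof -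
  interpret finite_measure "spectral_dist E h" by (rule finite_measure_spectral_dist)
  obtain C where "\<And>r. cmod (f r) \<le> C" using bounded_borel_bound[OF assms] by blast
  then show ?thesis
    by (intro integrable_const_bound[of _ C]) (use assms in \<open>auto intro: measurable_spectral_dist\<close>)
qed

lemma integral_spectral_dist_lim:
  assumes "\<And>n. bounded_borel (F n)" "bounded_borel f" "\<And>n r. cmod (F n r) \<le> C" "\<And>r. (\<lambda>n. F n r) \<longlonglongrightarrow> f r"
  shows "(\<lambda>n. \<integral>r. F n r \<partial>spectral_dist E h) \<longlonglongrightarrow> (\<integral>r. f r \<partial>spectral_dist E h)"
proof (rule integral_dominated_convergence[where w = "\<lambda>_. C"])
  interpret finite_measure "spectral_dist E h" by (rule finite_measure_spectral_dist)
  show "integrable (spectral_dist E h) (\<lambda>_. C)" by simp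
  show "AE r in spectral_dist E h. (\<lambda>n. F n r) \<longlonglongrightarrow> f r" by (simp add: assms)
  show "AE r in spectral_dist E h. cmod (F n r) \<le> C" for n by (simp add: assms)
qed (use assms in \<open>auto intro: measurable_spectral_dist\<close>)

lemma fc_form_add:
  assumes "bounded_borel f" "bounded_borel g"
  shows "fc_form E (\<lambda>r. f r + g r) h k = fc_form E f h k + fc_form E g h k"
  using assms by (simp add: fc_form_def integrable_spectral_dist sum.distrib distrib_left add_divide_distrib)

lemma fc_form_scale:
  assumes "bounded_borel f"
  shows "fc_form E (\<lambda>r. c * f r) h k = c * fc_form E f h k"
  using assms by (simp add: fc_form_def sum_distrib_left mult.left_commute)

lemma fc_form_lim:
  assumes "\<And>n. bounded_borel (F n)" "bounded_borel f" "\<And>n r. cmod (F n r) \<le> C" "\<And>r. (\<lambda>n. F n r) \<longlonglongrightarrow> f r"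
  shows "(\<lambda>n. fc_form E (F n) h k) \<longlonglongrightarrow> fc_form E f h k"
  unfolding fc_form_def using assms
  by (intro tendsto_divide tendsto_sum tendsto_mult tendsto_const integral_spectral_dist_lim) auto

lemma sum_less_4: "(\<Sum>j<4. f j) = f 0 + f 1 + f 2 + f (3::nat)"
  by (simp add: eval_nat_numeral ac_simps)

lemma fc_form_indicator:
  assumes "B \<in> sets borel" shows "fc_form E (indicator B) h k = cinner (E B h) k"
proof -
  interpret E: finite_measure "spectral_dist E h" for h by (rule finite_measure_spectral_dist)
  have "(\<integral>r. indicator B r \<partial>spectral_dist E l) = cinner (E B l) l" for l
  proof -
    have "(\<integral>r. indicator B r \<partial>spectral_dist E l) = (\<integral>r. complex_of_real (indicator B r) \<partial>spectral_dist E l)"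
      by (rule Bochner_Integration.integral_cong) (auto simp: indicator_def)
    also have "\<dots> = complex_of_real (measure (spectral_dist E l) B)"
      by (simp only: integral_complex_of_real) (use assms in simp)
    also have "\<dots> = cinner (E B l) l"
      using assms by (simp add: measure_spectral_dist cinner_E_self)
    finally show ?thesis .
  qed
  then show ?thesis
    using clinear_add[OF E_clinear[OF assms]] clinear_scale[OF E_clinear[OF assms]]
    by (simp add: fc_form_def sum_less_4 cinner_add_left_ell2 cinner_add_right cinner_scaleC_left_ell2 cinner_scaleC_right
        algebra_simps power3_eq_cube)
qed

text \<open>The polarization sum is not visibly additive in \<open>h\<close>, because each spectral
  measure depends quadratically on its vector. For indicators the form is
  \<open>cinner (E B h) k\<close>, where all four properties are plain, and they survive linear
  combinations and bounded limits.\<close>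

lemma fc_form_sesquilinear:
  assumes "bounded_borel f"
  shows "(\<forall>h h' k. fc_form E f (h + h') k = fc_form E f h k + fc_form E f h' k) \<and>
    (\<forall>c h k. fc_form E f (c *\<^sub>C h) k = c * fc_form E f h k) \<and>
    (\<forall>h k. fc_form E (\<lambda>r. cnj (f r)) h k = cnj (fc_form E f k h)) \<and>
    (\<forall>h. fc_form E f h h = (\<integral>r. f r \<partial>spectral_dist E h))"
  using assms
proof (induction rule: bounded_borel_induct)
  case (indicator B)
  have *: "(\<lambda>r. cnj (indicator B r)) = indicator B" by (auto simp: indicator_def)
  have "(\<integral>r. indicator B r \<partial>spectral_dist E l) = cinner (E B l) l" for l
  proof -
    interpret finite_measure "spectral_dist E l" by (rule finite_measure_spectral_dist)
    have "(\<integral>r. indicator B r \<partial>spectral_dist E l) = (\<integral>r. complex_of_real (indicator B r) \<partial>spectral_dist E l)"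
      by (rule Bochner_Integration.integral_cong) (auto simp: indicator_def)
    also have "\<dots> = complex_of_real (measure (spectral_dist E l) B)"
      by (simp only: integral_complex_of_real) (use indicator in simp)
    also have "\<dots> = cinner (E B l) l"
      using indicator by (simp add: measure_spectral_dist cinner_E_self)
    finally show ?thesis .
  qed
  note int = this
  have herm: "cinner (E B h) k = cnj (cinner (E B k) h)" for h k
    by (metis E_adj indicator cinner_commute_ell2)
  show ?case
    unfolding * fc_form_indicator[OF indicator] clinear_add[OF E_clinear[OF indicator]]
      clinear_scale[OF E_clinear[OF indicator]] cinner_add_left_ell2 cinner_scaleC_left_ell2
    by (intro conjI allI refl herm int[symmetric])
next
  case (add f g)
  then show ?case
    by (simp add: fc_form_add bounded_borel_cnj integrable_spectral_dist distrib_left)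
next
  case (scale c f)
  then show ?case
    by (simp add: fc_form_scale bounded_borel_cnj mult.left_commute distrib_left)
next
  case (lim F f C)
  note L = fc_form_lim[OF lim.hyps(1) lim.hyps(4) lim.hyps(2) lim.hyps(3)]
  have Lc: "(\<lambda>n. fc_form E (\<lambda>r. cnj (F n r)) h k) \<longlonglongrightarrow> fc_form E (\<lambda>r. cnj (f r)) h k" for h k
    by (rule fc_form_lim[where C = C]) (use lim.hyps in \<open>auto intro: tendsto_cnj\<close>)
  show ?case
  proof (intro conjI allI)
    fix h h' k c
    show "fc_form E f (h + h') k = fc_form E f h k + fc_form E f h' k"
      by (rule LIMSEQ_unique[OF L]) (use lim.IH in \<open>auto intro: tendsto_add L\<close>)
    show "fc_form E f (c *\<^sub>C h) k = c * fc_form E f h k"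
      by (rule LIMSEQ_unique[OF L]) (use lim.IH in \<open>auto intro: tendsto_mult tendsto_const L\<close>)
    show "fc_form E (\<lambda>r. cnj (f r)) h k = cnj (fc_form E f k h)"
      by (rule LIMSEQ_unique[OF Lc]) (use lim.IH in \<open>auto intro: tendsto_cnj L\<close>)
    show "fc_form E f h h = (\<integral>r. f r \<partial>spectral_dist E h)"
      by (rule LIMSEQ_unique[OF L])
         (use lim.IH integral_spectral_dist_lim[OF lim.hyps(1) lim.hyps(4) lim.hyps(2) lim.hyps(3)] in auto)
  qed
qed

lemma
  assumes "bounded_borel f"
  shows fc_form_add_left: "fc_form E f (h + h') k = fc_form E f h k + fc_form E f h' k"
    and fc_form_scale_left: "fc_form E f (c *\<^sub>C h) k = c * fc_form E f h k"
    and fc_form_cnj: "fc_form E (\<lambda>r. cnj (f r)) h k = cnj (fc_form E f k h)"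
    and fc_form_diag: "fc_form E f h h = (\<integral>r. f r \<partial>spectral_dist E h)"
proof -
  note * = fc_form_sesquilinear[OF assms]
  show "fc_form E f (h + h') k = fc_form E f h k + fc_form E f h' k"
    by (rule *[THEN conjunct1, rule_format])
  show "fc_form E f (c *\<^sub>C h) k = c * fc_form E f h k"
    by (rule *[THEN conjunct2, THEN conjunct1, rule_format])
  show "fc_form E (\<lambda>r. cnj (f r)) h k = cnj (fc_form E f k h)"
    by (rule *[THEN conjunct2, THEN conjunct2, THEN conjunct1, rule_format])
  show "fc_form E f h h = (\<integral>r. f r \<partial>spectral_dist E h)"
    by (rule *[THEN conjunct2, THEN conjunct2, THEN conjunct2, rule_format])
qed

lemma fc_form_add_right: "bounded_borel f \<Longrightarrow> fc_form E f k (h + h') = fc_form E f k h + fc_form E f k h'"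
  using fc_form_cnj[of "\<lambda>r. cnj (f r)"] fc_form_add_left[of "\<lambda>r. cnj (f r)"] by (simp add: bounded_borel_cnj)

lemma fc_form_scale_right: "bounded_borel f \<Longrightarrow> fc_form E f k (c *\<^sub>C h) = cnj c * fc_form E f k h"
  using fc_form_cnj[of "\<lambda>r. cnj (f r)"] fc_form_scale_left[of "\<lambda>r. cnj (f r)"] by (simp add: bounded_borel_cnj)

lemma norm_integral_spectral_dist_le:
  assumes "bounded_borel f" "\<And>r. cmod (f r) \<le> C"
  shows "cmod (\<integral>r. f r \<partial>spectral_dist E h) \<le> C * (norm h)\<^sup>2"
proof -
  interpret finite_measure "spectral_dist E h" by (rule finite_measure_spectral_dist)
  have "cmod (\<integral>r. f r \<partial>spectral_dist E h) \<le> (\<integral>r. C \<partial>spectral_dist E h)"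
    using integrable_spectral_dist[OF assms(1), of h] assms(2)
    by (intro Bochner_Integration.integral_norm_bound_integral) auto
  then show ?thesis by (simp add: measure_spectral_dist E_UNIV mult.commute)
qed

text \<open>For unit vectors each of the four polarization vectors has norm at most 2, which gives
  the crude factor 4; scaling does the rest. The sharp bound \<open>norm_fc_le\<close> has to wait
  for multiplicativity.\<close>

lemma fc_form_bound:
  assumes f: "bounded_borel f" and C: "\<And>r. cmod (f r) \<le> C"
  shows "cmod (fc_form E f h k) \<le> 4 * C * norm h * norm k"
proof -
  have unit: "cmod (fc_form E f h k) \<le> 4 * C" if "norm h = 1" "norm k = 1" for h k
  proof -
    have C0: "0 \<le> C" using C norm_ge_zero order_trans by blast
    have "cmod (fc_form E f h k) = cmod (\<Sum>j<4. \<i> ^ j * (\<integral>r. f r \<partial>spectral_dist E (h + \<i> ^ j *\<^sub>C k))) / 4"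
      by (simp add: fc_form_def norm_divide)
    also have "cmod (\<Sum>j<4. \<i> ^ j * (\<integral>r. f r \<partial>spectral_dist E (h + \<i> ^ j *\<^sub>C k))) \<le> (\<Sum>j<(4::nat). C * 4)"
    proof (rule order_trans[OF norm_sum sum_mono])
      fix j :: nat
      have "norm (h + \<i> ^ j *\<^sub>C k) \<le> 2"
        by (rule norm_triangle_le) (simp add: norm_scaleC_ell2 norm_power that)
      then have "(norm (h + \<i> ^ j *\<^sub>C k))\<^sup>2 \<le> 2\<^sup>2" by (intro power_mono) auto
      then have "C * (norm (h + \<i> ^ j *\<^sub>C k))\<^sup>2 \<le> C * 4" using C0 by (intro mult_left_mono) auto
      then show "cmod (\<i> ^ j * (\<integral>r. f r \<partial>spectral_dist E (h + \<i> ^ j *\<^sub>C k))) \<le> C * 4"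
        using norm_integral_spectral_dist_le[OF f C, of "h + \<i> ^ j *\<^sub>C k"]
        by (simp add: norm_mult norm_power)
    qed
    finally show ?thesis by simp
  qed
  show ?thesis
  proof (cases "h = 0 \<or> k = 0")
    case True
    then show ?thesis using fc_form_scale_left[OF f, of 0] fc_form_scale_right[OF f, of _ 0] by auto
  next
    case False
    define h' k' where "h' = complex_of_real (inverse (norm h)) *\<^sub>C h" and "k' = complex_of_real (inverse (norm k)) *\<^sub>C k"
    have hk: "h = complex_of_real (norm h) *\<^sub>C h'" "k = complex_of_real (norm k) *\<^sub>C k'"
      using False by (simp_all add: h'_def k'_def scaleC_scaleC flip: of_real_mult of_real_inverse)
    have "norm h' = 1" "norm k' = 1" using False by (simp_all add: h'_def k'_def norm_scaleC_ell2 flip: of_real_inverse)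
    then have *: "cmod (fc_form E f h' k') \<le> 4 * C" by (rule unit)
    have "cmod (fc_form E f h k) = norm h * norm k * cmod (fc_form E f h' k')"
      by (subst hk(1), subst hk(2)) (simp add: fc_form_scale_left fc_form_scale_right f norm_mult)
    also have "\<dots> \<le> norm h * norm k * (4 * C)" using * by (intro mult_left_mono) auto
    finally show ?thesis by (simp add: mult_ac)
  qed
qed

lemma fc_dom_bounded: "bounded_borel f \<Longrightarrow> fc_dom E f = UNIV"
proof -
  assume f: "bounded_borel f"
  have "integrable (spectral_dist E h) (\<lambda>r. (cmod (f r))\<^sup>2)" for h
  proof -
    have "integrable (spectral_dist E h) (\<lambda>r. f r * cnj (f r))"
      using f by (intro integrable_spectral_dist) auto
    from integrable_Re[OF this] show ?thesis by (simp add: mult_cnj_cmod flip: of_real_power)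
  qed
  then show ?thesis by (auto simp: fc_dom_def)
qed

text \<open>The definite description in \<open>fc\<close> is meaningful because the bounded form is
  represented by a vector (\<open>ell2_riesz\<close>).\<close>

lemma cinner_fc:
  assumes "bounded_borel f" shows "cinner (fc E f h) k = fc_form E f h k"
proof -
  obtain C where C: "\<And>r. cmod (f r) \<le> C" using bounded_borel_bound[OF assms] by blast
  have "\<exists>v. \<forall>k. cinner v k = fc_form E f h k"
    by (rule ell2_riesz[where C = "4 * C * norm h"])
       (auto simp: assms fc_form_add_right fc_form_scale_right fc_form_bound[OF assms C])
  then obtain v where v: "\<And>k. cinner v k = fc_form E f h k" by blast
  have "fc E f h = v"
    unfolding fc_def fc_dom_bounded[OF assms]
    by (rule the_equality) (auto simp: v intro: ell2_eqI)
  with v show ?thesis by simp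
qed

lemma clinear_fc: "bounded_borel f \<Longrightarrow> clinear (fc E f)"
  unfolding clinear_def
  by (auto intro!: ell2_eqI simp: cinner_fc fc_form_add_left fc_form_scale_left cinner_add_left_ell2 cinner_scaleC_left_ell2)

lemma fc_add:
  "bounded_borel f \<Longrightarrow> bounded_borel g \<Longrightarrow> fc E (\<lambda>r. f r + g r) h = fc E f h + fc E g h"
  by (rule ell2_eqI) (simp add: cinner_fc bounded_borel_add fc_form_add cinner_add_left_ell2)

lemma fc_scale: "bounded_borel f \<Longrightarrow> fc E (\<lambda>r. c * f r) h = c *\<^sub>C fc E f h"
  by (rule ell2_eqI) (simp add: cinner_fc bounded_borel_mult fc_form_scale cinner_scaleC_left_ell2)

lemma fc_diff:
  assumes "bounded_borel f" "bounded_borel g" shows "fc E (\<lambda>r. f r - g r) h = fc E f h - fc E g h"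
  using fc_add[OF assms(1) bounded_borel_mult[OF bounded_borel_const[of "-1"] assms(2)], of h]
    fc_scale[OF assms(2), of "-1" h]
  by (simp add: scaleC_minus_one)

lemma fc_indicator: "B \<in> sets borel \<Longrightarrow> fc E (indicator B) h = E B h"
  by (rule ell2_eqI) (simp add: cinner_fc bounded_borel_indicator fc_form_indicator)

lemma fc_one: "fc E (\<lambda>_. 1) h = h"
  using fc_indicator[of UNIV h] by (simp add: E_UNIV indicator_def)

lemma fc_adjoint: "bounded_borel f \<Longrightarrow> cinner (fc E f h) k = cinner h (fc E (\<lambda>r. cnj (f r)) k)"
  by (subst (2) cinner_commute_ell2) (simp add: cinner_fc bounded_borel_cnj fc_form_cnj)

text \<open>Two inductions: first over \<open>g\<close> with an indicator as the left factor, where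
  \<open>E_Int\<close> gives the base case, and then over \<open>f\<close>.\<close>

lemma fc_mult:
  assumes f: "bounded_borel f" and g: "bounded_borel g"
  shows "fc E (\<lambda>r. f r * g r) h = fc E f (fc E g h)"
proof -
  have ind: "fc_form E (\<lambda>r. indicator A r * g r) h k = fc_form E g h (E A k)" if A: "A \<in> sets borel" for A h k
    using g
  proof (induction rule: bounded_borel_induct)
    case (indicator B)
    have "(\<lambda>r. indicator A r * indicator B r) = (indicator (A \<inter> B) :: real \<Rightarrow> complex)" by (auto simp: indicator_def)
    then show ?case using indicator A by (simp add: fc_form_indicator E_Int E_adj)
  next
    case (add f g)
    then show ?case using A by (simp add: fc_form_add distrib_left bounded_borel_mult bounded_borel_indicator)
  next
    case (scale c f)
    then show ?case using A fc_form_scale[of "\<lambda>r. indicator A r * f r" c]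
      by (simp add: fc_form_scale mult.left_commute bounded_borel_mult bounded_borel_indicator)
  next
    case (lim F f C)
    show ?case
    proof (rule LIMSEQ_unique)
      show "(\<lambda>n. fc_form E (\<lambda>r. indicator A r * F n r) h k) \<longlonglongrightarrow> fc_form E (\<lambda>r. indicator A r * f r) h k"
      proof (rule fc_form_lim[where C = C])
        show "cmod (indicator A r * F n r) \<le> C" for n r
          using lim.hyps(2)[of n r] order_trans[OF norm_ge_zero lim.hyps(2)[of n r]] by (simp add: indicator_def)
      qed (use lim.hyps A in \<open>auto intro: tendsto_mult\<close>)
      show "(\<lambda>n. fc_form E (\<lambda>r. indicator A r * F n r) h k) \<longlonglongrightarrow> fc_form E f h (E A k)"
        using fc_form_lim[OF lim.hyps(1) lim.hyps(4) lim.hyps(2) lim.hyps(3), of h "E A k"] lim.IH by simp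
    qed
  qed
  have "fc_form E (\<lambda>r. f r * g r) h k = fc_form E f (fc E g h) k" for k
    using f
  proof (induction rule: bounded_borel_induct)
    case (indicator B)
    then show ?case by (simp add: ind fc_form_indicator E_adj cinner_fc[OF g])
  next
    case (add f1 f2)
    then show ?case by (simp add: fc_form_add distrib_right bounded_borel_mult g)
  next
    case (scale c f)
    then show ?case using fc_form_scale[of "\<lambda>r. f r * g r" c]
      by (simp add: fc_form_scale mult.assoc bounded_borel_mult g)
  next
    case (lim F f C)
    obtain D where D: "0 \<le> D" "\<And>r. cmod (g r) \<le> D" using bounded_borel_bound[OF g] by blast
    show ?case
    proof (rule LIMSEQ_unique)
      show "(\<lambda>n. fc_form E (\<lambda>r. F n r * g r) h k) \<longlonglongrightarrow> fc_form E (\<lambda>r. f r * g r) h k"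
      proof (rule fc_form_lim[where C = "C * D"])
        show "cmod (F n r * g r) \<le> C * D" for n r
          using lim.hyps(2)[of n r] order_trans[OF norm_ge_zero lim.hyps(2)[of n r]] D
          by (auto simp: norm_mult intro!: mult_mono)
      qed (use lim.hyps g in \<open>auto intro: tendsto_mult\<close>)
      show "(\<lambda>n. fc_form E (\<lambda>r. F n r * g r) h k) \<longlonglongrightarrow> fc_form E f (fc E g h) k"
        using fc_form_lim[OF lim.hyps(1) lim.hyps(4) lim.hyps(2) lim.hyps(3), of "fc E g h" k] lim.IH by simp
    qed
  qed
  then show ?thesis using f g by (intro ell2_eqI) (simp add: cinner_fc bounded_borel_mult)
qed

lemma norm_fc_sq:
  assumes "bounded_borel f"
  shows "complex_of_real ((norm (fc E f h))\<^sup>2) = (\<integral>r. cnj (f r) * f r \<partial>spectral_dist E h)"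
proof -
  have "complex_of_real ((norm (fc E f h))\<^sup>2) = cinner (fc E (\<lambda>r. cnj (cnj (f r))) h) (fc E f h)"
    by (simp add: cinner_norm)
  also have "\<dots> = cinner (fc E (\<lambda>r. cnj (f r)) (fc E f h)) h"
    using assms by (simp add: fc_adjoint bounded_borel_cnj)
  also have "\<dots> = fc_form E (\<lambda>r. cnj (f r) * f r) h h"
    using assms by (simp add: bounded_borel_cnj bounded_borel_mult cinner_fc flip: fc_mult)
  finally show ?thesis using assms by (simp add: fc_form_diag bounded_borel_cnj bounded_borel_mult)
qed

lemma norm_fc_le:
  assumes "bounded_borel f" "\<And>r. cmod (f r) \<le> C"
  shows "norm (fc E f h) \<le> C * norm h"
proof -
  have C: "0 \<le> C" using assms(2) norm_ge_zero order_trans by blast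
  have "(norm (fc E f h))\<^sup>2 = cmod (\<integral>r. cnj (f r) * f r \<partial>spectral_dist E h)"
    unfolding norm_fc_sq[OF assms(1), symmetric] by (simp only: norm_of_real abs_power2)
  also have "\<dots> \<le> (C * C) * (norm h)\<^sup>2"
    using assms C by (intro norm_integral_spectral_dist_le) (auto simp: norm_mult intro!: mult_mono)
  finally have "(norm (fc E f h))\<^sup>2 \<le> (C * norm h)\<^sup>2" by (simp add: power2_eq_square mult_ac)
  then show ?thesis using C by (simp add: power2_le_iff_abs_le)
qed

text \<open>The squared error is the integral of the squared modulus of \<open>F n - f\<close>
  against the spectral measure of \<open>h\<close>, and dominated convergence applies.\<close>

lemma fc_lim:
  assumes "\<And>n. bounded_borel (F n)" "bounded_borel f" "\<And>n r. cmod (F n r) \<le> C" "\<And>r. (\<lambda>n. F n r) \<longlonglongrightarrow> f r"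
  shows "(\<lambda>n. fc E (F n) h) \<longlonglongrightarrow> fc E f h"
proof -
  obtain D where D: "0 \<le> D" "\<And>r. cmod (f r) \<le> D" using bounded_borel_bound[OF assms(2)] by blast
  have C: "0 \<le> C" using assms(3) norm_ge_zero order_trans by blast
  define G where "G n r = cnj (F n r - f r) * (F n r - f r)" for n r
  have "(\<lambda>n. \<integral>r. G n r \<partial>spectral_dist E h) \<longlonglongrightarrow> (\<integral>r. 0 \<partial>spectral_dist E h)"
  proof (rule integral_spectral_dist_lim[where C = "(C + D) * (C + D)"])
    show "cmod (G n r) \<le> (C + D) * (C + D)" for n r
    proof -
      have "cmod (F n r - f r) \<le> C + D" by (rule norm_triangle_le_diff) (intro add_mono assms(3) D(2))
      then show ?thesis unfolding G_def norm_mult complex_mod_cnj by (intro mult_mono) (use C D in auto)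
    qed
    show "bounded_borel (G n)" for n unfolding G_def using assms(1,2) by (intro bounded_borel_mult bounded_borel_cnj bounded_borel_diff)
    show "(\<lambda>n. G n r) \<longlonglongrightarrow> 0" for r
    proof -
      have "(\<lambda>n. F n r - f r) \<longlonglongrightarrow> 0" using assms(4)[of r] by (simp add: LIM_zero_iff)
      from tendsto_mult[OF tendsto_cnj[OF this] this] show ?thesis by (simp add: G_def)
    qed
  qed auto
  moreover have "(\<integral>r. G n r \<partial>spectral_dist E h) = complex_of_real ((norm (fc E (F n) h - fc E f h))\<^sup>2)" for n
    unfolding G_def by (subst norm_fc_sq[symmetric]) (use assms in \<open>auto simp: fc_diff\<close>)
  ultimately have "(\<lambda>n. complex_of_real ((norm (fc E (F n) h - fc E f h))\<^sup>2)) \<longlonglongrightarrow> 0" by simp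
  then have "(\<lambda>n. (norm (fc E (F n) h - fc E f h))\<^sup>2) \<longlonglongrightarrow> 0"
    using tendsto_Re[of _ 0] by fastforce
  then have "(\<lambda>n. norm (fc E (F n) h - fc E f h)) \<longlonglongrightarrow> 0"
    using tendsto_real_sqrt[of "\<lambda>n. (norm (fc E (F n) h - fc E f h))\<^sup>2" 0] by simp
  then show ?thesis by (simp add: Lim_null[of _ "fc E f h"] tendsto_norm_zero_iff)
qed

end

section \<open>Functional calculus for unbounded functions\<close>

context spectral_measure
begin

lemma AE_spectral_dist_E:
  assumes "A \<in> sets borel" shows "AE r in spectral_dist E (E A h). r \<in> A"
proof (rule AE_I)
  show "emeasure (spectral_dist E (E A h)) (- A) = 0"
    using assms by (simp add: emeasure_spectral_dist E_empty flip: E_Int)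
qed (use assms in auto)

lemma fc_dom_E:
  assumes f: "f \<in> borel_measurable borel" and A: "A \<in> sets borel" and C: "\<And>r. r \<in> A \<Longrightarrow> cmod (f r) \<le> C"
  shows "E A h \<in> fc_dom E f"
proof -
  interpret finite_measure "spectral_dist E (E A h)" by (rule finite_measure_spectral_dist)
  have "integrable (spectral_dist E (E A h)) (\<lambda>r. (cmod (f r))\<^sup>2)"
  proof (rule integrable_const_bound[where B = "C\<^sup>2"])
    show "AE r in spectral_dist E (E A h). norm ((cmod (f r))\<^sup>2) \<le> C\<^sup>2"
      using AE_spectral_dist_E[OF A]
    proof (rule AE_mp, intro AE_I2 impI)
      fix r assume "r \<in> A"
      then show "norm ((cmod (f r))\<^sup>2) \<le> C\<^sup>2" using C[of r] by (simp add: power_mono)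
    qed
  qed (use f in simp)
  then show ?thesis by (simp add: fc_dom_def)
qed

definition fc_cut :: "(real \<Rightarrow> complex) \<Rightarrow> nat \<Rightarrow> real \<Rightarrow> complex" where
  "fc_cut f n r = indicator {r. cmod (f r) \<le> real n} r * f r"

lemma
  assumes [measurable]: "f \<in> borel_measurable borel"
  shows bounded_borel_fc_cut: "bounded_borel (fc_cut f n)"
    and sets_fc_cut: "{r. cmod (f r) \<le> real n} \<in> sets borel"
proof -
  show *: "{r. cmod (f r) \<le> real n} \<in> sets borel" by measurable
  show "bounded_borel (fc_cut f n)"
    unfolding fc_cut_def by (rule bounded_borelI[where C = "real n"]) (use * in \<open>auto simp: indicator_def\<close>)
qed

lemma fc_cut_tendsto: "(\<lambda>n. fc_cut f n r) \<longlonglongrightarrow> f r"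
proof (rule tendsto_eventually)
  obtain N :: nat where "cmod (f r) \<le> real N" using real_arch_simple by blast
  then have "\<forall>n\<ge>N. fc_cut f n r = f r"
    by (auto simp: fc_cut_def indicator_def)
  then show "\<forall>\<^sub>F n in sequentially. fc_cut f n r = f r"
    by (auto simp: eventually_sequentially)
qed

lemma cmod_fc_cut_le: "cmod (fc_cut f n r) \<le> cmod (f r)"
  by (auto simp: fc_cut_def indicator_def)

lemma nn_integral_fc_cut:
  assumes "f \<in> borel_measurable borel"
  shows "(\<integral>\<^sup>+r. ennreal ((cmod (fc_cut f n r))\<^sup>2) \<partial>spectral_dist E h) = ennreal ((norm (fc E (fc_cut f n) h))\<^sup>2)"
proof -
  note b = bounded_borel_fc_cut[OF assms, of n]
  have "complex_of_real ((norm (fc E (fc_cut f n) h))\<^sup>2) = (\<integral>r. complex_of_real ((cmod (fc_cut f n r))\<^sup>2) \<partial>spectral_dist E h)"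
    unfolding norm_fc_sq[OF b] by (simp add: mult.commute[of "cnj _"] mult_cnj_cmod)
  then have "(norm (fc E (fc_cut f n) h))\<^sup>2 = (\<integral>r. (cmod (fc_cut f n r))\<^sup>2 \<partial>spectral_dist E h)"
    by (simp only: integral_complex_of_real of_real_eq_iff)
  moreover have "integrable (spectral_dist E h) (\<lambda>r. (cmod (fc_cut f n r))\<^sup>2)"
    using fc_dom_bounded[OF b] by (auto simp: fc_dom_def)
  ultimately show ?thesis by (simp add: nn_integral_eq_integral)
qed

text \<open>The domain is a condition on spectral measures, which are not additive in the vector.
  For the bounded cut-offs the integral is a squared norm, so the triangle inequality gives a bound
  uniform in \<open>n\<close>, and Fatou's lemma passes to \<open>f\<close>.\<close>

lemma fc_dom_add_scaleC:
  assumes f: "f \<in> borel_measurable borel" and h: "h \<in> fc_dom E f" and k: "k \<in> fc_dom E f"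
  shows "h + c *\<^sub>C k \<in> fc_dom E f"
proof -
  have int: "(\<integral>\<^sup>+r. ennreal ((cmod (f r))\<^sup>2) \<partial>spectral_dist E l) < \<infinity>" if "l \<in> fc_dom E f" for l
    using that by (simp add: fc_dom_def integrable_iff_bounded)
  define I where "I l = (\<integral>\<^sup>+r. ennreal ((cmod (f r))\<^sup>2) \<partial>spectral_dist E l)" for l
  have fm: "(\<lambda>r. ennreal ((cmod (fc_cut f n r))\<^sup>2)) \<in> borel_measurable (spectral_dist E l)" for n l
    using measurable_spectral_dist[OF bounded_borel_fc_cut[OF f, of n]] by measurable
  have le: "ennreal ((norm (fc E (fc_cut f n) l))\<^sup>2) \<le> I l" for n l
    unfolding nn_integral_fc_cut[OF f, symmetric] I_def
    by (intro nn_integral_mono ennreal_leI power_mono cmod_fc_cut_le) auto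
  have bound: "ennreal ((norm (fc E (fc_cut f n) (h + c *\<^sub>C k)))\<^sup>2) \<le> 2 * I h + ennreal (2 * (cmod c)\<^sup>2) * I k" for n
  proof -
    let ?T = "fc E (fc_cut f n)"
    have "norm (?T (h + c *\<^sub>C k)) \<le> norm (?T h) + cmod c * norm (?T k)"
      using norm_triangle_ineq[of "?T h" "c *\<^sub>C ?T k"] clinear_fc[OF bounded_borel_fc_cut[OF f, of n]]
      by (simp add: clinear_add clinear_scale norm_scaleC_ell2)
    then have "(norm (?T (h + c *\<^sub>C k)))\<^sup>2 \<le> (norm (?T h) + cmod c * norm (?T k))\<^sup>2"
      by (intro power_mono) auto
    also have "\<dots> \<le> 2 * (norm (?T h))\<^sup>2 + 2 * (cmod c)\<^sup>2 * (norm (?T k))\<^sup>2"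
      using sum_squares_bound[of "norm (?T h)" "cmod c * norm (?T k)"] by (simp add: power2_sum power_mult_distrib)
    finally have "ennreal ((norm (?T (h + c *\<^sub>C k)))\<^sup>2)
      \<le> ennreal (2 * (norm (?T h))\<^sup>2 + 2 * (cmod c)\<^sup>2 * (norm (?T k))\<^sup>2)" by (rule ennreal_leI)
    also have "\<dots> = 2 * ennreal ((norm (?T h))\<^sup>2) + ennreal (2 * (cmod c)\<^sup>2) * ennreal ((norm (?T k))\<^sup>2)"
      by (simp add: ennreal_plus ennreal_mult)
    also have "\<dots> \<le> 2 * I h + ennreal (2 * (cmod c)\<^sup>2) * I k"
      by (intro add_mono mult_left_mono le) auto
    finally show ?thesis .
  qed
  have "I (h + c *\<^sub>C k) = (\<integral>\<^sup>+r. liminf (\<lambda>n. ennreal ((cmod (fc_cut f n r))\<^sup>2)) \<partial>spectral_dist E (h + c *\<^sub>C k))"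
    unfolding I_def
  proof (rule nn_integral_cong)
    fix r
    have "(\<lambda>n. ennreal ((cmod (fc_cut f n r))\<^sup>2)) \<longlonglongrightarrow> ennreal ((cmod (f r))\<^sup>2)"
      by (intro tendsto_ennrealI tendsto_power tendsto_norm fc_cut_tendsto)
    then show "ennreal ((cmod (f r))\<^sup>2) = liminf (\<lambda>n. ennreal ((cmod (fc_cut f n r))\<^sup>2))"
      by (simp only: lim_imp_Liminf[OF sequentially_bot])
  qed
  also have "\<dots> \<le> liminf (\<lambda>n. \<integral>\<^sup>+r. ennreal ((cmod (fc_cut f n r))\<^sup>2) \<partial>spectral_dist E (h + c *\<^sub>C k))"
    by (rule nn_integral_liminf) (rule fm)
  also have "\<dots> \<le> 2 * I h + ennreal (2 * (cmod c)\<^sup>2) * I k"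
    unfolding nn_integral_fc_cut[OF f] by (rule Liminf_le) (simp_all add: bound)
  also have "\<dots> < \<infinity>"
    using int[OF h] int[OF k] by (simp add: I_def ennreal_mult_less_top)
  finally show ?thesis
    using f by (simp add: fc_dom_def integrable_iff_bounded I_def)
qed

text \<open>Prepares for \<open>R_kernel\<close>, where an exponential that is unbounded on the line
  acts on a spectrally projected vector: the result is a bounded function of the Hamiltonian applied
  to the unprojected vector.\<close>

lemma fc_E_unbounded:
  assumes f: "f \<in> borel_measurable borel" and B: "B \<in> sets borel" and C: "\<And>r. r \<in> B \<Longrightarrow> cmod (f r) \<le> C"
  shows "fc E f (E B h) = fc E (\<lambda>r. indicator B r * f r) h"
proof -
  let ?g = "\<lambda>r. indicator B r * f r"
  have g: "bounded_borel ?g"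
    by (rule bounded_borelI[where C = "max C 0"]) (use f B C in \<open>auto simp: indicator_def intro: max.coboundedI1\<close>)
  \<comment> \<open>The domain contains the ranges of the projections for the sets where
    \<open>cmod (f r) <= n\<close>. These sets exhaust the line, so testing against the domain
    determines a vector.\<close>
  have dense: "v = w" if vw: "\<forall>k\<in>fc_dom E f. cinner v k = cinner w k" for v w
  proof (rule ell2_eqI)
    fix k
    define K where "K n = E {r. cmod (f r) \<le> real n} k" for n
    have "(\<lambda>n. fc E (indicator {r. cmod (f r) \<le> real n}) k) \<longlonglongrightarrow> fc E (\<lambda>_. 1) k"
    proof (rule fc_lim[where C = 1])
      show "(\<lambda>n. indicator {r. cmod (f r) \<le> real n} r) \<longlonglongrightarrow> (1::complex)" for r
      proof (rule tendsto_eventually)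
        obtain N :: nat where "cmod (f r) \<le> real N" using real_arch_simple by blast
        then have "\<forall>n\<ge>N. cmod (f r) \<le> real n" by (meson of_nat_mono order_trans)
        then show "\<forall>\<^sub>F n in sequentially. indicator {r. cmod (f r) \<le> real n} r = (1::complex)"
          by (auto simp: eventually_sequentially indicator_def)
      qed
    qed (auto simp: indicator_def sets_fc_cut[OF f] intro: bounded_borel_indicator[OF sets_fc_cut[OF f], unfolded indicator_def])
    then have K: "K \<longlonglongrightarrow> k"
      unfolding K_def by (simp add: fc_one fc_indicator sets_fc_cut[OF f])
    have "K n \<in> fc_dom E f" for n
      unfolding K_def by (rule fc_dom_E[OF f sets_fc_cut[OF f]]) auto
    then have "(\<lambda>n. cinner v (K n)) = (\<lambda>n. cinner w (K n))" using vw by auto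
    with tendsto_cinner[OF tendsto_const K, of v] tendsto_cinner[OF tendsto_const K, of w]
    show "cinner v k = cinner w k" by (simp add: LIMSEQ_unique)
  qed
  have main: "cinner (fc E ?g h) k = fc_form E f (E B h) k" if k: "k \<in> fc_dom E f" for k
  proof (rule LIMSEQ_unique)
    show "(\<lambda>n. fc_form E (fc_cut f n) (E B h) k) \<longlonglongrightarrow> fc_form E f (E B h) k"
      unfolding fc_form_def
    proof (intro tendsto_divide tendsto_sum tendsto_mult tendsto_const)
      fix j :: nat
      let ?l = "E B h + \<i> ^ j *\<^sub>C k"
      interpret finite_measure "spectral_dist E ?l" by (rule finite_measure_spectral_dist)
      have fin: "integrable (spectral_dist E ?l) (\<lambda>r. (cmod (f r))\<^sup>2)"
        using fc_dom_add_scaleC[OF f fc_dom_E[OF f B C] k] by (simp add: fc_dom_def)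
      show "(\<lambda>n. \<integral>r. fc_cut f n r \<partial>spectral_dist E ?l) \<longlonglongrightarrow> (\<integral>r. f r \<partial>spectral_dist E ?l)"
      \<comment> \<open>The dominating function comes from s <= 1 + s^2. It is integrable because
        the measure is finite and the polarized vector lies in the domain.\<close>
      proof (rule integral_dominated_convergence[where w = "\<lambda>r. 1 + (cmod (f r))\<^sup>2"])
        show "AE r in spectral_dist E ?l. cmod (fc_cut f n r) \<le> 1 + (cmod (f r))\<^sup>2" for n
        proof (rule AE_I2)
          fix r
          have "0 \<le> (cmod (f r) - 1)\<^sup>2" by simp
          then show "cmod (fc_cut f n r) \<le> 1 + (cmod (f r))\<^sup>2"
            using cmod_fc_cut_le[of f n r] norm_ge_zero[of "f r"] unfolding power2_diff power_one by linarith
        qed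
        show "fc_cut f n \<in> borel_measurable (spectral_dist E ?l)" for n
          by (rule measurable_spectral_dist[OF bounded_borel_fc_cut[OF f]])
      qed (use f fin fc_cut_tendsto in auto)
    qed auto
    have "fc_form E (fc_cut f n) (E B h) k = cinner (fc E (\<lambda>r. fc_cut f n r * indicator B r) h) k" for n
      by (simp add: fc_mult bounded_borel_fc_cut f B bounded_borel_indicator fc_indicator cinner_fc)
    moreover have "(\<lambda>n. fc E (\<lambda>r. fc_cut f n r * indicator B r) h) \<longlonglongrightarrow> fc E ?g h"
    proof (rule fc_lim[where C = "max C 0"])
      show "cmod (fc_cut f n r * indicator B r) \<le> max C 0" for n r
        using cmod_fc_cut_le[of f n r] C[of r] by (auto simp: indicator_def le_max_iff_disj)
      show "(\<lambda>n. fc_cut f n r * indicator B r) \<longlonglongrightarrow> indicator B r * f r" for r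
        using tendsto_mult[OF fc_cut_tendsto tendsto_const, of f r "indicator B r"] by (simp add: mult.commute)
    qed (use g bounded_borel_fc_cut[OF f] B in auto)
    ultimately show "(\<lambda>n. fc_form E (fc_cut f n) (E B h) k) \<longlonglongrightarrow> cinner (fc E ?g h) k"
      by (auto intro: tendsto_cinner)
  qed
  show ?thesis
    unfolding fc_def[of E f]
  proof (rule the_equality)
    show "\<forall>k\<in>fc_dom E f. cinner (fc E ?g h) k = fc_form E f (E B h) k" using main by blast
    fix v assume "\<forall>k\<in>fc_dom E f. cinner v k = fc_form E f (E B h) k"
    then show "v = fc E ?g h" using main by (intro dense) auto
  qed
qed

end

instance cstar_algebra \<subseteq> banach ..

section \<open>States on \<open>C\<^sup>*\<close>-algebras\<close>

lemma star_zero [simp]: "star (0 :: 'a::cstar_algebra) = 0"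
  using star_scaleC[of 0 "0::'a"] by simp

lemma star_one [simp]: "star (1 :: 'a::cstar_algebra) = 1"
  by (metis star_mult star_star mult_1_left mult_1_right)

lemma star_minus: "star (- x :: 'a::cstar_algebra) = - star x"
  using star_scaleC[of "-1" x] by (simp add: scaleC_minus_one)

lemma star_diff: "star (x - y :: 'a::cstar_algebra) = star x - star y"
  using star_add[of x "- y"] by (simp add: star_minus)

lemma norm_star [simp]: "norm (star (x :: 'a::cstar_algebra)) = norm x"
proof -
  have *: "norm x \<le> norm (star x)" for x :: 'a
  proof (cases "x = 0")
    case False
    have "norm x * norm x \<le> norm (star x) * norm x"
      using norm_mult_ineq[of "star x" x] by (simp add: norm_star_mult power2_eq_square)
    then show ?thesis using False by (intro mult_right_le_imp_le[of "norm x" "norm x"]) simp_all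
  qed simp
  from *[of x] *[of "star x"] show ?thesis by (simp add: star_star)
qed

lemma bounded_linear_star: "bounded_linear (star :: 'a::cstar_algebra \<Rightarrow> 'a)"
  by (rule bounded_linear_intro[where K = 1])
     (simp_all add: star_add star_scaleC flip: scaleC_of_real)

lemmas tendsto_star = bounded_linear.tendsto[OF bounded_linear_star]

lemma norm_scaleC: "norm (c *\<^sub>C (x :: 'a::cstar_algebra)) = cmod c * norm x"
proof -
  have "(norm (c *\<^sub>C x))\<^sup>2 = norm (star (c *\<^sub>C x) * (c *\<^sub>C x))" by (simp add: norm_star_mult)
  also have "star (c *\<^sub>C x) * (c *\<^sub>C x) = complex_of_real ((cmod c)\<^sup>2) *\<^sub>C (star x * x)"
    by (simp only: complex_norm_square)
       (simp add: star_scaleC scaleC_mult_left scaleC_mult_right scaleC_scaleC mult.commute)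
  also have "norm \<dots> = (cmod c)\<^sup>2 * (norm x)\<^sup>2"
    by (simp only: scaleC_of_real norm_scaleR norm_star_mult) simp
  finally have "(norm (c *\<^sub>C x))\<^sup>2 = (cmod c * norm x)\<^sup>2" by (simp add: power_mult_distrib)
  then show ?thesis by (simp add: power2_eq_iff_nonneg)
qed

lemma bounded_bilinear_scaleC: "bounded_bilinear ((*\<^sub>C) :: complex \<Rightarrow> 'a::cstar_algebra \<Rightarrow> 'a)"
proof
  fix r :: real and c :: complex and x :: 'a
  show "(r *\<^sub>R c) *\<^sub>C x = r *\<^sub>R c *\<^sub>C x"
    by (simp only: scaleR_conv_of_real[where 'a = complex] flip: scaleC_scaleC scaleC_of_real[of r])
  show "c *\<^sub>C r *\<^sub>R x = r *\<^sub>R c *\<^sub>C x"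
    by (simp only: scaleC_scaleC mult.commute flip: scaleC_of_real[of r])
  show "\<exists>K. \<forall>c (x::'a). norm (c *\<^sub>C x) \<le> norm c * norm x * K"
    by (rule exI[of _ 1]) (simp add: norm_scaleC)
qed (simp_all add: scaleC_add_left scaleC_add_right)

lemmas tendsto_scaleC = bounded_bilinear.tendsto[OF bounded_bilinear_scaleC]

text \<open>\<open>y\<close> is the binomial series for the square root of 1 - x. It converges
  absolutely, and by Vandermonde's identity its Cauchy square has the binomial coefficients of
  exponent 1, which vanish from degree 2 on.\<close>

lemma norm_less_1_sqrt:
  fixes x :: "'a::cstar_algebra"
  assumes x: "star x = x" "norm x < 1"
  shows "\<exists>y. star y = y \<and> y * y = 1 - x"
proof -
  define c :: "nat \<Rightarrow> real" where "c n = (-1) ^ n * ((1/2) gchoose n)" for n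
  define f where "f n = c n *\<^sub>R x ^ n" for n
  have "summable (\<lambda>n. norm (((1/2::real) gchoose n) * norm x ^ n))"
    by (rule abs_summable_in_conv_radius) (use x in \<open>auto simp: conv_radius_gchoose one_ereal_def\<close>)
  then have sum: "summable (\<lambda>n. norm (f n))"
    by (rule summable_comparison_test'[where N = 0])
       (auto simp: f_def c_def abs_mult power_abs intro!: mult_left_mono norm_power_ineq)
  define y where "y = (\<Sum>n. f n)"
  have pow: "star (x ^ n) = x ^ n" for n
    by (induction n) (simp_all add: star_mult x power_commutes)
  have "star (f n) = f n" for n
    by (simp add: f_def linear_scale[OF bounded_linear.linear[OF bounded_linear_star]] pow)
  then have "star y = y"
    unfolding y_def using bounded_linear.suminf[OF bounded_linear_star summable_norm_cancel[OF sum]] by simp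
  moreover have "y * y = 1 - x"
  proof -
    have "(\<Sum>i\<le>k. f i * f (k - i)) = (if k = 0 then 1 else if k = 1 then - x else 0)" for k
    proof -
      have "(\<Sum>i\<le>k. f i * f (k - i)) = (\<Sum>i\<le>k. ((-1) ^ k * (((1/2) gchoose i) * ((1/2) gchoose (k - i)))) *\<^sub>R x ^ k)"
      proof (rule sum.cong)
        fix i assume "i \<in> {..k}"
        then have "(-1::real) ^ k = (-1) ^ i * (-1) ^ (k - i)" "x ^ k = x ^ i * x ^ (k - i)"
          by (simp_all flip: power_add)
        then show "f i * f (k - i) = ((-1) ^ k * (((1/2) gchoose i) * ((1/2) gchoose (k - i)))) *\<^sub>R x ^ k"
          by (simp add: f_def c_def mult_ac)
      qed simp
      also have "\<dots> = ((-1) ^ k * (1 gchoose k)) *\<^sub>R x ^ k"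
        using gbinomial_Vandermonde[of "1/2::real" "1/2" k]
        by (simp add: atMost_atLeast0 flip: scaleR_sum_left sum_distrib_left)
      also have "(1::real) gchoose k = of_nat (1 choose k)"
        using binomial_gbinomial[of 1 k, where 'a = real] by simp
      also have "((-1) ^ k * real (1 choose k)) *\<^sub>R x ^ k = (if k = 0 then 1 else if k = 1 then - x else 0)"
        by (auto simp: binomial_eq_0)
      finally show ?thesis .
    qed
    then have "y * y = (\<Sum>k. if k = 0 then 1 else if k = 1 then - x else 0)"
      unfolding y_def Cauchy_product[OF sum sum] by simp
    also have "\<dots> = (\<Sum>k\<in>{0, 1::nat}. if k = 0 then 1 else if k = 1 then - x else 0)"
      by (rule suminf_finite) auto
    finally show ?thesis by simp
  qed
  ultimately show ?thesis by blast
qed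

text \<open>A square root of \<open>r\<^sup>2 - x\<^sup>* x\<close> replaces the continuous functional calculus.\<close>

lemma norm_less_sqrt:
  fixes x :: "'a::cstar_algebra"
  assumes "norm x < r"
  shows "\<exists>y. star y * y = complex_of_real (r\<^sup>2) *\<^sub>C 1 - star x * x"
proof -
  have r: "0 < r" using assms norm_ge_zero order_le_less_trans by blast
  define z where "z = complex_of_real (1 / r\<^sup>2) *\<^sub>C (star x * x)"
  have "norm z = (norm x)\<^sup>2 / r\<^sup>2" by (simp only: z_def norm_scaleC norm_star_mult) (simp add: r norm_divide norm_power)
  also have "\<dots> < 1" using r assms by (simp add: power_strict_mono)
  finally have "norm z < 1" .
  moreover have "star z = z" by (simp add: z_def star_scaleC star_mult star_star)
  ultimately obtain y where y: "star y = y" "y * y = 1 - z" using norm_less_1_sqrt by blast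
  have "star (complex_of_real r *\<^sub>C y) * (complex_of_real r *\<^sub>C y) = complex_of_real (r\<^sup>2) *\<^sub>C (1 - z)"
    by (simp add: star_scaleC scaleC_mult_left scaleC_mult_right scaleC_scaleC y power2_eq_square)
  also have "\<dots> = complex_of_real (r\<^sup>2) *\<^sub>C 1 - star x * x"
    using r by (simp add: scaleC_diff_right z_def scaleC_scaleC flip: of_real_mult of_real_power of_real_divide)
  finally show ?thesis by blast
qed

section \<open>States and their GNS seminorm\<close>

locale cstar_state =
  fixes \<phi> :: "'a::cstar_algebra \<Rightarrow> complex"
  assumes state: "state \<phi>"
begin

lemma clinear: "clinear \<phi>" and one: "\<phi> 1 = 1" and pos: "\<phi> (star x * x) \<in> \<real>\<^sub>\<ge>\<^sub>0"
  using state by (auto simp: state_def)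

lemma add: "\<phi> (x + y) = \<phi> x + \<phi> y"
  and scale: "\<phi> (c *\<^sub>C x) = c * \<phi> x"
  and diff: "\<phi> (x - y) = \<phi> x - \<phi> y"
  and minus: "\<phi> (- x) = - \<phi> x"
  and zero: "\<phi> 0 = 0"
  using clinear_add[OF clinear] clinear_scale[OF clinear] clinear_diff[OF clinear]
    clinear_minus[OF clinear] clinear_zero[OF clinear]
  by (simp_all add: scaleC_complex_def)

lemma pos_Re: "0 \<le> Re (\<phi> (star x * x))" and pos_Im: "Im (\<phi> (star x * x)) = 0"
  using pos[of x] by (auto simp: complex_nonneg_Reals_iff)

lemma pos_of_real: "\<phi> (star x * x) = complex_of_real (Re (\<phi> (star x * x)))"
  by (simp add: complex_eq_iff pos_Im)

text \<open>Polarization: positivity on 1 + x settles the imaginary parts of the two values, and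
  positivity on 1 + i x their real parts.\<close>

lemma hermitian: "\<phi> (star x) = cnj (\<phi> x)"
proof -
  have "star (1 + x) * (1 + x) = 1 + x + star x + star x * x"
    by (simp add: star_add algebra_simps)
  then have 1: "Im (\<phi> x) + Im (\<phi> (star x)) = 0"
    using pos_Im[of "1 + x"] by (simp add: add one pos_Im)
  have "star (1 + \<i> *\<^sub>C x) * (1 + \<i> *\<^sub>C x) = 1 + \<i> *\<^sub>C x + (- \<i>) *\<^sub>C star x + star x * x"
    by (simp add: star_add star_scaleC algebra_simps scaleC_mult_left scaleC_mult_right scaleC_scaleC scaleC_add_right)
  then have 2: "Re (\<phi> x) - Re (\<phi> (star x)) = 0"
    using pos_Im[of "1 + \<i> *\<^sub>C x"] by (simp add: add scale one pos_Im)
  from 1 2 show ?thesis by (simp add: complex_eq_iff)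
qed

lemma cauchy_schwarz:
  "(cmod (\<phi> (star x * y)))\<^sup>2 \<le> Re (\<phi> (star x * x)) * Re (\<phi> (star y * y))"
proof -
  define X Y S where "X = Re (\<phi> (star x * x))" and "Y = Re (\<phi> (star y * y))" and "S = \<phi> (star x * y)"
  have S': "\<phi> (star y * x) = cnj S"
    using hermitian[of "star x * y"] by (simp add: star_mult star_star S_def)
  have key: "0 \<le> X - 2 * Re (c * S) + (cmod c)\<^sup>2 * Y" for c
  proof -
    have "star (x - c *\<^sub>C y) * (x - c *\<^sub>C y) = star x * x - c *\<^sub>C (star x * y) - cnj c *\<^sub>C (star y * x) + (c * cnj c) *\<^sub>C (star y * y)"
      by (simp add: star_diff star_scaleC algebra_simps scaleC_mult_left scaleC_mult_right scaleC_scaleC scaleC_diff_right)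
    then have "Re (\<phi> (star (x - c *\<^sub>C y) * (x - c *\<^sub>C y))) = X - Re (c * S) - Re (cnj c * cnj S) + Re (c * cnj c * \<phi> (star y * y))"
      by (simp add: add scale diff X_def S_def[symmetric] S')
    moreover have "Re (c * cnj c * \<phi> (star y * y)) = (cmod c)\<^sup>2 * Y"
      by (subst pos_of_real) (simp add: mult_cnj_cmod Y_def flip: of_real_power)
    moreover have "Re (cnj c * cnj S) = Re (c * S)" by simp
    ultimately show ?thesis using pos_Re[of "x - c *\<^sub>C y"] by linarith
  qed
  have key': "0 \<le> X - 2 * (t * (cmod S)\<^sup>2) + t\<^sup>2 * (cmod S)\<^sup>2 * Y" for t
  proof -
    have "complex_of_real t * cnj S * S = complex_of_real (t * (cmod S)\<^sup>2)"
      by (simp add: mult.assoc mult.commute[of "cnj S"] mult_cnj_cmod)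
    then have "Re (complex_of_real t * cnj S * S) = t * (cmod S)\<^sup>2" by (simp only: Re_complex_of_real)
    moreover have "(cmod (complex_of_real t * cnj S))\<^sup>2 = t\<^sup>2 * (cmod S)\<^sup>2"
      by (simp add: norm_mult power_mult_distrib)
    ultimately show ?thesis using key[of "complex_of_real t * cnj S"] by (simp only:)
  qed
  have Y0: "0 \<le> Y" by (simp add: Y_def pos_Re)
  have "(cmod S)\<^sup>2 \<le> X * Y"
  proof (cases "Y = 0")
    case True
    have "cmod S = 0"
    proof (rule ccontr)
      assume "cmod S \<noteq> 0"
      then have s: "0 < (cmod S)\<^sup>2" by simp
      then have "(X + 1) / (2 * (cmod S)\<^sup>2) * (cmod S)\<^sup>2 = (X + 1) / 2" by (simp add: field_simps)
      \<comment> \<open>With \<open>Y = 0\<close> this choice of \<open>t\<close> turns the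
        inequality into \<open>0 <= - 1\<close>.\<close>
      with key'[of "(X + 1) / (2 * (cmod S)\<^sup>2)"] True
      have "0 \<le> X - 2 * ((X + 1) / 2)" by simp
      then show False by (simp add: field_simps)
    qed
    with True show ?thesis by simp
  next
    case False
    with Y0 have Y: "0 < Y" by simp
    from key'[of "1 / Y"] have "0 \<le> X - (cmod S)\<^sup>2 / Y"
      using Y by (simp add: power2_eq_square field_simps)
    then show ?thesis using Y by (simp add: field_simps)
  qed
  then show ?thesis by (simp add: X_def Y_def S_def)
qed

text \<open>The length of the vector of \<open>x\<close> in the GNS space, defined without
  constructing that space.\<close>

definition semi :: "'a \<Rightarrow> real" where "semi x = sqrt (Re (\<phi> (star x * x)))"

lemma semi_nonneg [simp]: "0 \<le> semi x"
  by (simp add: semi_def pos_Re)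

lemma semi_sq: "(semi x)\<^sup>2 = Re (\<phi> (star x * x))"
  by (simp add: semi_def pos_Re)

lemma cmod_le_semi: "cmod (\<phi> (star x * y)) \<le> semi x * semi y"
proof -
  have "(cmod (\<phi> (star x * y)))\<^sup>2 \<le> (semi x * semi y)\<^sup>2"
    using cauchy_schwarz[of x y] by (simp add: power_mult_distrib semi_sq)
  then show ?thesis by (simp add: power2_le_iff_abs_le)
qed

text \<open>For \<open>norm x < r\<close> the element r^2 - star x * x has the form
  \<open>star z * z\<close>, and positivity of the state on \<open>z * y\<close> is the claim with
  \<open>r\<close> in place of \<open>norm x\<close>. Letting \<open>r\<close> decrease to
  \<open>norm x\<close> finishes the argument.\<close>

lemma semi_mult_le: "semi (x * y) \<le> norm x * semi y"
proof -
  have less: "(semi (x * y))\<^sup>2 \<le> r\<^sup>2 * (semi y)\<^sup>2" if "norm x < r" for r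
  proof -
    from norm_less_sqrt[OF that]
    obtain z where z: "star z * z = complex_of_real (r\<^sup>2) *\<^sub>C 1 - star x * x" by blast
    have "star (z * y) * (z * y) = star y * (star z * z) * y" by (simp add: star_mult mult.assoc)
    also have "\<dots> = complex_of_real (r\<^sup>2) *\<^sub>C (star y * y) - star (x * y) * (x * y)"
      by (simp add: z right_diff_distrib left_diff_distrib scaleC_mult_left scaleC_mult_right star_mult mult.assoc del: of_real_power)
    finally have "Re (\<phi> (star (z * y) * (z * y))) = r\<^sup>2 * Re (\<phi> (star y * y)) - Re (\<phi> (star (x * y) * (x * y)))"
      by (simp add: diff scale del: of_real_power)
    with pos_Re[of "z * y"] show ?thesis by (simp add: semi_sq)
  qed
  have "semi (x * y) \<le> r * semi y" if "norm x < r" for r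
  proof -
    have "0 < r" using that norm_ge_zero order_le_less_trans by blast
    with less[OF that] show ?thesis by (simp add: power_mult_distrib[symmetric] power2_le_iff_abs_le)
  qed
  then have "semi (x * y) \<le> (norm x + e) * semi y" if "0 < e" for e using that by simp
  then have *: "semi (x * y) \<le> norm x * semi y + e * semi y" if "0 < e" for e
    using that by (simp add: distrib_right)
  show ?thesis
  proof (cases "semi y = 0")
    case True
    with *[of 1] show ?thesis by simp
  next
    case False
    then have "0 < semi y" using semi_nonneg[of y] by linarith
    show ?thesis
    proof (rule field_le_epsilon)
      fix e :: real assume "0 < e"
      with *[of "e / semi y"] \<open>0 < semi y\<close> show "semi (x * y) \<le> norm x * semi y + e" by simp
    qed
  qed
qed

lemma semi_one [simp]: "semi 1 = 1"
  by (simp add: semi_def one)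

lemma semi_le_norm: "semi x \<le> norm x"
  using semi_mult_le[of x 1] by simp

lemma cmod_le_norm: "cmod (\<phi> x) \<le> norm x"
  using cmod_le_semi[of 1 x] semi_le_norm[of x] by simp

lemma bounded_linear: "bounded_linear \<phi>"
proof (rule bounded_linear_intro[where K = 1])
  fix r and x :: 'a
  show "\<phi> (r *\<^sub>R x) = r *\<^sub>R \<phi> x"
    using scale[of "complex_of_real r" x] by (simp add: scaleC_of_real scaleR_conv_of_real[where 'a = complex])
qed (simp_all add: add cmod_le_norm)

lemmas tendsto = bounded_linear.tendsto[OF bounded_linear]

lemma semi_triangle: "semi (x + y) \<le> semi x + semi y"
proof -
  have "star (x + y) * (x + y) = star x * x + star y * y + (star x * y + star y * x)"
    by (simp add: star_add algebra_simps)
  moreover have "Re (\<phi> (star y * x)) = Re (\<phi> (star x * y))"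
    using hermitian[of "star x * y"] by (simp add: star_mult star_star)
  ultimately have "(semi (x + y))\<^sup>2 = (semi x)\<^sup>2 + (semi y)\<^sup>2 + 2 * Re (\<phi> (star x * y))"
    by (simp add: semi_sq add)
  also have "\<dots> \<le> (semi x)\<^sup>2 + (semi y)\<^sup>2 + 2 * (semi x * semi y)"
    using cmod_le_semi[of x y] complex_Re_le_cmod[of "\<phi> (star x * y)"] by linarith
  also have "\<dots> = (semi x + semi y)\<^sup>2" by (simp add: power2_sum)
  finally show ?thesis by (simp add: power2_le_iff_abs_le)
qed

lemma semi_scale: "semi (c *\<^sub>C x) = cmod c * semi x"
proof -
  have "star (c *\<^sub>C x) * (c *\<^sub>C x) = complex_of_real ((cmod c)\<^sup>2) *\<^sub>C (star x * x)"
    by (simp only: complex_norm_square)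
       (simp add: star_scaleC scaleC_mult_left scaleC_mult_right scaleC_scaleC mult.commute)
  then show ?thesis by (simp add: semi_def scale real_sqrt_mult del: of_real_power)
qed

end

section \<open>The canonical anticommutation relations and Wick's theorem\<close>

text \<open>A determinant is affine in a single entry, the slope being the cofactor.\<close>

lemma det_change_entry:
  fixes M N :: "'b::comm_ring_1 Matrix.mat"
  assumes M: "M \<in> carrier_mat n n" and N: "N \<in> carrier_mat n n" and ij: "i < n" "j < n"
    and eq: "\<And>i' j'. i' < n \<Longrightarrow> j' < n \<Longrightarrow> (i', j') \<noteq> (i, j) \<Longrightarrow> M $$ (i', j') = N $$ (i', j')"
  shows "Determinant.det M = Determinant.det N + (M $$ (i, j) - N $$ (i, j)) * cofactor N i j"
proof -
  have cof: "cofactor M i l = cofactor N i l" if "l < n" for l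
  proof -
    have "mat_delete M i l = mat_delete N i l"
      unfolding mat_delete_def using M N eq by (intro Matrix.cong_mat) auto
    then show ?thesis by (simp add: cofactor_def)
  qed
  have "Determinant.det M = (\<Sum>l<n. M $$ (i, l) * cofactor N i l)"
    using laplace_expansion_row[OF M ij(1)] cof by simp
  also have "\<dots> = (\<Sum>l<n. N $$ (i, l) * cofactor N i l + (if l = j then (M $$ (i, j) - N $$ (i, j)) * cofactor N i j else 0))"
    by (rule sum.cong) (auto simp: eq ij algebra_simps)
  also have "\<dots> = Determinant.det N + (M $$ (i, j) - N $$ (i, j)) * cofactor N i j"
    using laplace_expansion_row[OF N ij(1)] ij by (simp add: sum.distrib)
  finally show ?thesis .
qed

section \<open>Words in creation and annihilation operators and their Wick matrices\<close>

fun creators :: "('c + 'd) list \<Rightarrow> 'c list" where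
  "creators [] = []" | "creators (Inl h # w) = h # creators w" | "creators (Inr k # w) = creators w"

fun annihilators :: "('c + 'd) list \<Rightarrow> 'd list" where
  "annihilators [] = []" | "annihilators (Inl h # w) = annihilators w" | "annihilators (Inr k # w) = k # annihilators w"

fun creators_before :: "('c + 'd) list \<Rightarrow> nat \<Rightarrow> nat" where
  "creators_before [] j = 0"
| "creators_before (Inl h # w) j = Suc (creators_before w j)"
| "creators_before (Inr k # w) 0 = 0"
| "creators_before (Inr k # w) (Suc j) = creators_before w j"

text \<open>Counts the pairs of an annihilator and a later creator, that is, the adjacent exchanges
  that normal ordering takes. It is both an exponent of the sign and the induction measure in Wick's
  theorem.\<close>

fun inversions :: "('c + 'd) list \<Rightarrow> nat" where
  "inversions [] = 0" | "inversions (Inl h # w) = inversions w"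
| "inversions (Inr k # w) = length (creators w) + inversions w"

lemma creators_append [simp]: "creators (u @ v) = creators u @ creators v"
  by (induction u rule: creators.induct) auto

lemma annihilators_append [simp]: "annihilators (u @ v) = annihilators u @ annihilators v"
  by (induction u rule: annihilators.induct) auto

lemma inversions_append [simp]:
  "inversions (u @ v) = inversions u + inversions v + length (annihilators u) * length (creators v)"
  by (induction u rule: inversions.induct) auto

lemma creators_before_append:
  "creators_before (u @ v) j = (if j < length (annihilators u) then creators_before u j
     else length (creators u) + creators_before v (j - length (annihilators u)))"
  by (induction u j rule: creators_before.induct) auto

lemma creators_before_le: "creators_before w j \<le> length (creators w)"
  by (induction w j rule: creators_before.induct) auto

lemma creators_map_Inl [simp]: "creators (map Inl hs) = hs" "annihilators (map Inl hs) = []"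
  by (induction hs) auto

lemma annihilators_map_Inr [simp]: "creators (map Inr ks) = []" "annihilators (map Inr ks) = ks"
  by (induction ks) auto

lemma normal_ordered_or_adjacent:
  "(\<exists>u k h v. w = u @ [Inr k, Inl h] @ v) \<or> w = map Inl (creators w) @ map Inr (annihilators w)"
proof (induction w)
  case (Cons c w)
  show ?case
  proof (cases "\<exists>u k h v. w = u @ [Inr k, Inl h] @ v")
    case True
    then show ?thesis by (metis append_Cons)
  next
    case False
    with Cons have w: "w = map Inl (creators w) @ map Inr (annihilators w)" by blast
    show ?thesis
    proof (cases c)
      case (Inl h)
      with w show ?thesis by simp
    next
      case (Inr k)
      show ?thesis
      proof (cases "creators w")
        case Nil
        with w Inr show ?thesis by simp
      next
        case (Cons h hs)
        with w have "c # w = [] @ [Inr k, Inl h] @ (map Inl hs @ map Inr (annihilators w))"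
          using Inr by simp
        then show ?thesis by blast
      qed
    qed
  qed
qed simp

text \<open>\<open>A\<close> contracts a creator with a later annihilator and \<open>B\<close> with
  an earlier one, the fermionic sign included. In use, \<open>A h k\<close> is
  \<open>cinner (K h) k\<close>, and \<open>B h k\<close> is
  \<open>cinner (K h) k - cinner h k\<close>, the negative of the value of the state on
  \<open>a k * star (a h)\<close>.\<close>

definition wick_matrix :: "('c \<Rightarrow> 'd \<Rightarrow> 'b) \<Rightarrow> ('c \<Rightarrow> 'd \<Rightarrow> 'b) \<Rightarrow> ('c + 'd) list \<Rightarrow> 'b Matrix.mat" where
  "wick_matrix A B w = Matrix.mat (length (creators w)) (length (creators w))
     (\<lambda>(i, j). (if i < creators_before w j then A else B) (creators w ! i) (annihilators w ! j))"

text \<open>Striking out an adjacent pair leaves the relative order of all other letters unchanged.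
  This is the minor needed for \<open>det_wick_matrix_swap\<close>.\<close>

lemma wick_matrix_delete:
  assumes "length (creators (u @ v)) = length (annihilators (u @ v))"
  defines "i \<equiv> length (creators u)" and "j \<equiv> length (annihilators u)"
  shows "mat_delete (wick_matrix A B (u @ [Inl h, Inr k] @ v)) i j = wick_matrix A B (u @ v)"
proof (rule Matrix.eq_matI)
  fix p q
  let ?n = "length (creators (u @ v))"
  assume "p < dim_row (wick_matrix A B (u @ v))" "q < dim_col (wick_matrix A B (u @ v))"
  then have pq: "p < ?n" "q < ?n" by (auto simp: wick_matrix_def)
  define p' q' where "p' = (if p < i then p else Suc p)" and "q' = (if q < j then q else Suc q)"
  have pq': "p' < Suc ?n" "q' < Suc ?n" using pq by (auto simp: p'_def q'_def)
  have 1: "creators (u @ [Inl h, Inr k] @ v) ! p' = creators (u @ v) ! p"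
    by (auto simp: p'_def i_def nth_append nth_Cons')
  have 2: "annihilators (u @ [Inl h, Inr k] @ v) ! q' = annihilators (u @ v) ! q"
    by (auto simp: q'_def j_def nth_append nth_Cons')
  have 3: "p' < creators_before (u @ [Inl h, Inr k] @ v) q' \<longleftrightarrow> p < creators_before (u @ v) q"
  proof (cases "q < j")
    case True
    then show ?thesis using creators_before_le[of u q]
      by (auto simp: q'_def p'_def j_def i_def creators_before_append)
  next
    case False
    then have "creators_before (u @ [Inl h, Inr k] @ v) q' = i + Suc (creators_before v (q - j))"
      by (auto simp: q'_def j_def i_def creators_before_append Suc_diff_le)
    moreover have "creators_before (u @ v) q = i + creators_before v (q - j)"
      using False by (auto simp: j_def i_def creators_before_append)
    ultimately show ?thesis by (auto simp: p'_def)
  qed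
  have "mat_delete (wick_matrix A B (u @ [Inl h, Inr k] @ v)) i j $$ (p, q)
      = wick_matrix A B (u @ [Inl h, Inr k] @ v) $$ (p', q')"
    using pq by (simp add: mat_delete_def wick_matrix_def p'_def q'_def)
  also have "\<dots> = (if p' < creators_before (u @ [Inl h, Inr k] @ v) q' then A else B)
      (creators (u @ [Inl h, Inr k] @ v) ! p') (annihilators (u @ [Inl h, Inr k] @ v) ! q')"
    using pq' by (simp add: wick_matrix_def)
  also have "\<dots> = wick_matrix A B (u @ v) $$ (p, q)"
    unfolding 1 2 3 using pq by (simp add: wick_matrix_def)
  finally show "mat_delete (wick_matrix A B (u @ [Inl h, Inr k] @ v)) i j $$ (p, q) = wick_matrix A B (u @ v) $$ (p, q)" .
qed (auto simp: mat_delete_def wick_matrix_def)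

text \<open>The exchange alters the relative order of this one creator and this one annihilator
  only, hence a single entry; its minor is the matrix of the word without the pair. This mirrors the
  anticommutation relation.\<close>

lemma det_wick_matrix_swap:
  fixes A B :: "'c \<Rightarrow> 'd \<Rightarrow> 'b::comm_ring_1"
  assumes len: "length (creators (u @ v)) = length (annihilators (u @ v))"
  shows "Determinant.det (wick_matrix A B (u @ [Inr k, Inl h] @ v)) =
    Determinant.det (wick_matrix A B (u @ [Inl h, Inr k] @ v)) +
    (B h k - A h k) * ((-1) ^ (length (creators u) + length (annihilators u)) * Determinant.det (wick_matrix A B (u @ v)))"
proof -
  define i j where "i = length (creators u)" and "j = length (annihilators u)"
  define n where "n = Suc (length (creators (u @ v)))"
  let ?w = "u @ [Inr k, Inl h] @ v" and ?w' = "u @ [Inl h, Inr k] @ v"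
  have lenj: "length (annihilators u) + length (annihilators v) = length (creators u) + length (creators v)"
    using len by simp
  have ij: "i < n" "j < n" using lenj by (auto simp: i_def j_def n_def)
  have nth: "creators ?w ! i = h" "annihilators ?w ! j = k" "creators ?w' ! i = h" "annihilators ?w' ! j = k"
    by (auto simp: i_def j_def nth_append)
  have cb: "creators_before ?w j = i" "creators_before ?w' j = Suc i"
    by (auto simp: i_def j_def creators_before_append)
  have "Determinant.det (wick_matrix A B ?w) = Determinant.det (wick_matrix A B ?w') +
     (wick_matrix A B ?w $$ (i, j) - wick_matrix A B ?w' $$ (i, j)) * cofactor (wick_matrix A B ?w') i j"
  proof (rule det_change_entry[OF _ _ ij])
    fix p q assume pq: "p < n" "q < n" "(p, q) \<noteq> (i, j)"
    have "creators ?w = creators ?w'" "annihilators ?w = annihilators ?w'" by auto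
    moreover have "p < creators_before ?w q \<longleftrightarrow> p < creators_before ?w' q"
    proof (cases "q = j")
      case True
      with pq cb show ?thesis by auto
    next
      case False
      then have "creators_before ?w q = creators_before ?w' q"
        by (cases "q - j") (auto simp: j_def creators_before_append)
      then show ?thesis by simp
    qed
    ultimately show "wick_matrix A B ?w $$ (p, q) = wick_matrix A B ?w' $$ (p, q)"
      using pq by (simp add: wick_matrix_def n_def)
  qed (auto simp: wick_matrix_def n_def)
  moreover have "wick_matrix A B ?w $$ (i, j) = B h k" "wick_matrix A B ?w' $$ (i, j) = A h k"
    using ij nth cb by (simp_all add: wick_matrix_def n_def)
  moreover have "cofactor (wick_matrix A B ?w') i j = (-1) ^ (i + j) * Determinant.det (wick_matrix A B (u @ v))"
    unfolding cofactor_def using wick_matrix_delete[OF len, of A B h k] by (simp add: i_def j_def)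
  ultimately show ?thesis by (simp add: i_def j_def)
qed

fun pair_word :: "('c \<times> 'd) list \<Rightarrow> ('c + 'd) list" where
  "pair_word [] = []" | "pair_word ((h, k) # ps) = Inl h # Inr k # pair_word ps"

lemma creators_pair_word [simp]: "creators (pair_word ps) = map fst ps"
  and annihilators_pair_word [simp]: "annihilators (pair_word ps) = map snd ps"
  and inversions_pair_word: "inversions (pair_word ps) = \<Sum>{..<length ps}"
  by (induction ps rule: pair_word.induct) (auto simp: )

text \<open>\<open>Suc j\<close>, not \<open>j\<close>: the creator of pair \<open>j\<close>
  precedes its own annihilator, so the diagonal of the Wick matrix belongs to the part with
  \<open>A\<close>.\<close>

lemma creators_before_pair_word: "j < length ps \<Longrightarrow> creators_before (pair_word ps) j = Suc j"
  by (induction ps arbitrary: j rule: pair_word.induct) (auto simp: less_Suc_eq_0_disj)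

section \<open>Anticommutation relations and quasi-free states\<close>

locale car =
  fixes a :: "'x ell2 \<Rightarrow> 'a::cstar_algebra"
  assumes car: "car_relations a"
begin

lemma star_a_clinear: "clinear (\<lambda>h. star (a h))"
  and a_a: "a h * a k + a k * a h = 0"
  and star_a_a: "star (a h) * a k + a k * star (a h) = cinner h k *\<^sub>C 1"
  using car by (auto simp: car_relations_def)

lemma star_a_add: "star (a (h + k)) = star (a h) + star (a k)"
  and star_a_scale: "star (a (c *\<^sub>C h)) = c *\<^sub>C star (a h)"
  using star_a_clinear by (auto simp: clinear_def)

lemma a_add: "a (h + k) = a h + a k"
  by (metis star_a_add star_add star_star)

lemma a_scale: "a (c *\<^sub>C h) = cnj c *\<^sub>C a h"
  by (metis star_a_scale star_scaleC star_star)

lemma a_anticommute: "a h * a k = - (a k * a h)"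
  using a_a by (simp add: eq_neg_iff_add_eq_0)

lemma star_a_star_a: "star (a h) * star (a k) = - (star (a k) * star (a h))"
  by (metis a_anticommute star_minus star_mult)

lemma a_star_a: "a k * star (a h) = cinner h k *\<^sub>C 1 - star (a h) * a k"
  using star_a_a[of h k] by (simp add: eq_diff_eq add.commute)

lemma a_sq: "a h * a h = 0"
proof -
  have "2 *\<^sub>R (a h * a h) = 0" using a_a[of h h] by (simp add: scaleR_2)
  then show ?thesis by simp
qed

text \<open>\<open>N\<close> is self-adjoint and \<open>N * N\<close> is the squared norm of
  \<open>h\<close> times \<open>N\<close>, so the C*-identity bounds the norm of
  \<open>N\<close>.\<close>

lemma norm_a_le: "norm (a h) \<le> norm h"
proof -
  define N where "N = star (a h) * a h"
  have "N * N = star (a h) * (a h * star (a h)) * a h" by (simp add: N_def mult.assoc)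
  also have "\<dots> = complex_of_real ((norm h)\<^sup>2) *\<^sub>C N"
    by (simp add: a_star_a cinner_norm right_diff_distrib left_diff_distrib scaleC_mult_left scaleC_mult_right
        mult.assoc N_def a_sq del: of_real_power)
  finally have NN: "N * N = complex_of_real ((norm h)\<^sup>2) *\<^sub>C N" .
  have "star N = N" by (simp add: N_def star_mult star_star)
  then have "(norm N)\<^sup>2 = norm (N * N)" using norm_star_mult[of N] by simp
  also have "\<dots> = (norm h)\<^sup>2 * norm N" unfolding NN norm_scaleC by (simp add: norm_power)
  finally have "norm N * norm N = (norm h)\<^sup>2 * norm N" by (simp add: power2_eq_square)
  then have "norm N \<le> (norm h)\<^sup>2" by (cases "norm N = 0") auto
  then have "(norm (a h))\<^sup>2 \<le> (norm h)\<^sup>2" by (simp add: N_def norm_star_mult)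
  then show ?thesis by (simp add: power2_le_iff_abs_le)
qed

fun letter :: "'x ell2 + 'x ell2 \<Rightarrow> 'a" where
  "letter (Inl h) = star (a h)" | "letter (Inr k) = a k"

text \<open>The quasi-free formula lists the creators in reverse order; reversing anticommuting
  factors costs one sign for each pair of them.\<close>

lemma prod_list_star_a_rev:
  "prod_list (map (\<lambda>h. star (a h)) hs) = ((-1) ^ \<Sum>{..<length hs}) *\<^sub>C prod_list (map (\<lambda>h. star (a h)) (rev hs))"
proof (induction hs)
  case (Cons h hs)
  have "star (a h) * prod_list (map (\<lambda>h. star (a h)) ks) = ((-1) ^ length ks) *\<^sub>C (prod_list (map (\<lambda>h. star (a h)) ks) * star (a h))" for ks
  proof (induction ks)
    case (Cons k ks)
    have "star (a h) * prod_list (map (\<lambda>h. star (a h)) (k # ks)) = - (star (a k) * (star (a h) * prod_list (map (\<lambda>h. star (a h)) ks)))"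
      using star_a_star_a[of h k] by (simp flip: mult.assoc)
    then show ?case by (simp add: Cons scaleC_mult_left scaleC_mult_right mult.assoc scaleC_minus_left)
  qed simp
  from this[of "rev hs"] Cons show ?case
    by (simp add: scaleC_mult_left scaleC_mult_right scaleC_scaleC flip: power_add)
qed simp

end

locale quasi_free = car a + cstar_state \<phi>
  for a :: "'x ell2 \<Rightarrow> 'a::cstar_algebra" and \<phi> :: "'a \<Rightarrow> complex" +
  fixes K :: "'x ell2 \<Rightarrow> 'x ell2"
  assumes quasi_free: "quasi_free_state a K \<phi>"
begin

lemma normal_ordered:
  "\<phi> (prod_list (map (\<lambda>h. star (a h)) (rev hs)) * prod_list (map a ks)) =
     (if length hs = length ks
      then Determinant.det (Matrix.mat (length hs) (length hs) (\<lambda>(i, j). cinner (K (hs ! i)) (ks ! j)))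
      else 0)"
  using quasi_free by (simp add: quasi_free_state_def)

text \<open>Induction on the inversions. Exchanging an adjacent annihilator and creator yields a
  word with one inversion less and a contraction term for the word without the pair; the determinant
  produces the same two terms by \<open>det_wick_matrix_swap\<close>. The base case is the
  quasi-free formula, and the sum in the exponent comes from the reversal of the creators.\<close>

lemma wick_word:
  assumes "length (creators w) = length (annihilators w)"
  shows "\<phi> (prod_list (map letter w)) = (-1) ^ (inversions w + \<Sum>{..<length (creators w)}) *
    Determinant.det (wick_matrix (\<lambda>h k. cinner (K h) k) (\<lambda>h k. cinner (K h) k - cinner h k) w)"
  using assms
proof (induction "inversions w" arbitrary: w rule: less_induct)
  case less
  have alg: "x * (t * d) - (- s) * (D + x * (r * d)) = s * D" if "s * r = - t" for x t d s r D :: complex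
  proof -
    have "s * (x * (r * d)) = (s * r) * x * d" by (simp add: mult_ac)
    then show ?thesis unfolding that by (simp add: algebra_simps)
  qed
  let ?D = "\<lambda>w. Determinant.det (wick_matrix (\<lambda>h k. cinner (K h) k) (\<lambda>h k. cinner (K h) k - cinner h k) w)"
  consider (sorted) "w = map Inl (creators w) @ map Inr (annihilators w)"
    | (swap) u k h v where "w = u @ [Inr k, Inl h] @ v"
    using normal_ordered_or_adjacent[of w] by blast
  then show ?case
  proof cases
    case sorted
    define hs ks where "hs = creators w" and "ks = annihilators w"
    have w: "w = map Inl hs @ map Inr ks" using sorted by (simp add: hs_def ks_def)
    have len: "length hs = length ks" using less.prems by (simp add: hs_def ks_def)
    have inv: "inversions (map Inl hs :: ('x ell2 + 'x ell2) list) = 0"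
      by (induction hs) auto
    have inv': "inversions (map Inr ks :: ('x ell2 + 'x ell2) list) = 0"
      by (induction ks) auto
    have "letter \<circ> Inl = (\<lambda>h. star (a h))" "letter \<circ> Inr = a" by auto
    then have "\<phi> (prod_list (map letter w)) = \<phi> (prod_list (map (\<lambda>h. star (a h)) hs) * prod_list (map a ks))"
      by (simp add: w)
    also have "\<dots> = (-1) ^ \<Sum>{..<length hs} * Determinant.det (Matrix.mat (length hs) (length hs) (\<lambda>(i, j). cinner (K (hs ! i)) (ks ! j)))"
      by (subst prod_list_star_a_rev) (simp add: scaleC_mult_left scale normal_ordered len)
    also have "Matrix.mat (length hs) (length hs) (\<lambda>(i, j). cinner (K (hs ! i)) (ks ! j)) =
       wick_matrix (\<lambda>h k. cinner (K h) k) (\<lambda>h k. cinner (K h) k - cinner h k) w"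
      unfolding wick_matrix_def w by (intro Matrix.cong_mat) (auto simp: creators_before_append)
    finally show ?thesis by (simp add: w inv inv')
  next
    case swap
    have len: "length (creators (u @ v)) = length (annihilators (u @ v))"
      using less.prems by (simp add: swap)
    define i j m where "i = length (creators u)" and "j = length (annihilators u)" and "m = length (creators v)"
    let ?w' = "u @ [Inl h, Inr k] @ v"
    have inv': "inversions w = Suc (inversions ?w')" and inv: "inversions w = inversions (u @ v) + j + Suc m"
      by (auto simp: swap j_def m_def algebra_simps)
    have "prod_list (map letter w) = prod_list (map letter u) * (a k * star (a h)) * prod_list (map letter v)"
      by (simp add: swap mult.assoc)
    also have "\<dots> = cinner h k *\<^sub>C prod_list (map letter (u @ v)) - prod_list (map letter ?w')"
      by (simp add: a_star_a right_diff_distrib left_diff_distrib scaleC_mult_left scaleC_mult_right mult.assoc)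
    finally have "\<phi> (prod_list (map letter w)) = cinner h k * \<phi> (prod_list (map letter (u @ v))) - \<phi> (prod_list (map letter ?w'))"
      by (simp add: diff scale)
    also have "\<phi> (prod_list (map letter (u @ v))) = (-1) ^ (inversions (u @ v) + \<Sum>{..<i + m}) * ?D (u @ v)"
      using less.hyps[OF _ len] inv by (simp add: i_def m_def)
    also have "\<phi> (prod_list (map letter ?w')) = (-1) ^ (inversions ?w' + \<Sum>{..<Suc (i + m)}) * ?D ?w'"
      using less.hyps[of ?w'] inv' len by (simp add: i_def m_def)
    also have "?D ?w' = ?D w + cinner h k * ((-1) ^ (i + j) * ?D (u @ v))"
      using det_wick_matrix_swap[OF len, of "\<lambda>h k. cinner (K h) k" "\<lambda>h k. cinner (K h) k - cinner h k" k h]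
      by (simp add: swap i_def j_def algebra_simps)
    also have "(-1) ^ (inversions ?w' + \<Sum>{..<Suc (i + m)}) = (- ((-1) ^ (inversions w + \<Sum>{..<length (creators w)})) :: complex)"
      unfolding inv' by (simp add: swap i_def m_def)
    also have "(-1) ^ (inversions w + \<Sum>{..<length (creators w)}) * (-1) ^ (i + j) = - ((-1) ^ (inversions (u @ v) + \<Sum>{..<i + m}) :: complex)"
    proof -
      \<comment> \<open>Deleting the pair lowers the inversions by \<open>j + m + 1\<close> and the
        sum by \<open>i + m\<close>. Together with the cofactor exponent \<open>i + j\<close> this
        makes an odd number, whence the opposite sign.\<close>
      have "inversions w + \<Sum>{..<length (creators w)} + (i + j) = Suc (inversions (u @ v) + \<Sum>{..<i + m}) + 2 * (i + j + m)"
        unfolding inv by (simp add: swap i_def m_def)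
      then show ?thesis by (simp flip: power_add) (simp add: power_add)
    qed
    then have "cinner h k * ((-1) ^ (inversions (u @ v) + \<Sum>{..<i + m}) * ?D (u @ v)) -
      - ((-1) ^ (inversions w + \<Sum>{..<length (creators w)})) * (?D w + cinner h k * ((-1) ^ (i + j) * ?D (u @ v))) =
      (-1) ^ (inversions w + \<Sum>{..<length (creators w)}) * ?D w"
      by (rule alg)
    finally show ?thesis .
  qed
qed

definition pair_matrix :: "(complex \<times> 'x ell2 \<times> 'x ell2) list \<Rightarrow> complex Matrix.mat" where
  "pair_matrix xs = Matrix.mat (length xs) (length xs) (\<lambda>(i, j). case (xs ! i, xs ! j) of ((c, h, _), (_, _, k)) \<Rightarrow>
     (if i = j then c else 0) + cinner (K h) k - (if i \<le> j then 0 else cinner h k))"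

text \<open>Induction on the number of non-zero scalars \<open>c\<close>: multiplying out one factor
  contributes \<open>c\<close> times the correlation of the list without it, and adding
  \<open>c\<close> to its diagonal entry contributes \<open>c\<close> times the corresponding minor.
  Without scalars this is Wick's theorem for alternating words, whose two sign exponents coincide
  and cancel.\<close>

lemma wick_pairs:
  "\<phi> (prod_list (map (\<lambda>(c, h, k). c *\<^sub>C 1 + star (a h) * a k) xs)) = Determinant.det (pair_matrix xs)"
proof (induction "length (filter (\<lambda>(c, h, k). c \<noteq> 0) xs)" arbitrary: xs)
  case 0
  define ps where "ps = map snd xs"
  have fst0: "fst x = 0" if "x \<in> set xs" for x
    using 0 that by (cases x) (auto simp: filter_empty_conv)
  have "map (\<lambda>(c, h, k). c *\<^sub>C 1 + star (a h) * a k) xs = map (\<lambda>(h, k). star (a h) * a k) ps"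
    unfolding ps_def using fst0 by (force simp: split: prod.splits)
  moreover have "prod_list (map (\<lambda>(h, k). star (a h) * a k) ps) = prod_list (map letter (pair_word ps))"
    by (induction ps rule: pair_word.induct) (auto simp: mult.assoc)
  moreover have "wick_matrix (\<lambda>h k. cinner (K h) k) (\<lambda>h k. cinner (K h) k - cinner h k) (pair_word ps) = pair_matrix xs"
    unfolding wick_matrix_def pair_matrix_def
  proof (intro Matrix.cong_mat)
    fix i j assume "i < length (creators (pair_word ps))" "j < length (creators (pair_word ps))"
    then have ij: "i < length xs" "j < length xs" by (auto simp: ps_def)
    then have "fst (xs ! i) = 0" using fst0 by simp
    then show "(case (i, j) of (i, j) \<Rightarrow> (if i < creators_before (pair_word ps) j then \<lambda>h. cinner (K h) else (\<lambda>h k. cinner (K h) k - cinner h k))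
          (creators (pair_word ps) ! i) (annihilators (pair_word ps) ! j)) =
        (case (i, j) of (i, j) \<Rightarrow> case (xs ! i, xs ! j) of ((c, h, _), (_, _, k)) \<Rightarrow>
          (if i = j then c else 0) + cinner (K h) k - (if i \<le> j then 0 else cinner h k))"
      using ij creators_before_pair_word[of j ps]
      by (cases "xs ! i"; cases "xs ! j") (auto simp: ps_def)
  qed (auto simp: ps_def)
  moreover have "(-1::complex) ^ (inversions (pair_word ps) + \<Sum>{..<length ps}) = 1"
    by (simp add: inversions_pair_word flip: mult_2)
  ultimately show ?case using wick_word[of "pair_word ps"] by simp
next
  case (Suc N)
  then have "filter (\<lambda>(c, h, k). c \<noteq> 0) xs \<noteq> []" by auto
  then obtain x where x: "x \<in> set xs" "fst x \<noteq> 0" by (auto simp: filter_empty_conv split: prod.splits)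
  then obtain c h k us vs where xs: "xs = us @ (c, h, k) # vs" and c: "c \<noteq> 0"
    by (metis split_list prod.collapse)
  let ?P = "\<lambda>xs. prod_list (map (\<lambda>(c, h, k). c *\<^sub>C 1 + star (a h) * a k) xs)"
  define ys where "ys = us @ (0, h, k) # vs"
  have "?P xs = c *\<^sub>C ?P (us @ vs) + ?P ys"
    by (simp add: xs ys_def distrib_left distrib_right scaleC_mult_left scaleC_mult_right mult.assoc)
  then have "\<phi> (?P xs) = c * \<phi> (?P (us @ vs)) + \<phi> (?P ys)" by (simp add: add scale)
  also have "\<phi> (?P (us @ vs)) = Determinant.det (pair_matrix (us @ vs))"
    using Suc c by (intro Suc.hyps) (simp add: xs)
  also have "\<phi> (?P ys) = Determinant.det (pair_matrix ys)"
    using Suc c by (intro Suc.hyps) (simp add: xs ys_def)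
  also have "c * Determinant.det (pair_matrix (us @ vs)) + Determinant.det (pair_matrix ys) = Determinant.det (pair_matrix xs)"
  proof -
    define i n where "i = length us" and "n = length xs"
    have i: "i < n" by (simp add: i_def n_def xs)
    have nth: "xs ! i = (c, h, k)" "ys ! i = (0, h, k)" "\<And>l. l \<noteq> i \<Longrightarrow> ys ! l = xs ! l"
      by (auto simp: xs ys_def i_def nth_append nth_Cons')
    have "Determinant.det (pair_matrix xs) = Determinant.det (pair_matrix ys) +
      (pair_matrix xs $$ (i, i) - pair_matrix ys $$ (i, i)) * cofactor (pair_matrix ys) i i"
    proof (rule det_change_entry[OF _ _ i i])
      show "pair_matrix xs \<in> carrier_mat n n" "pair_matrix ys \<in> carrier_mat n n"
        by (auto simp: pair_matrix_def n_def xs ys_def)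
      fix p q assume "p < n" "q < n" "(p, q) \<noteq> (i, i)"
      then show "pair_matrix xs $$ (p, q) = pair_matrix ys $$ (p, q)"
        using nth by (cases "p = i"; cases "q = i")
          (auto simp: pair_matrix_def n_def xs ys_def split: prod.splits)
    qed
    moreover have "pair_matrix xs $$ (i, i) - pair_matrix ys $$ (i, i) = c"
      using i nth by (simp add: pair_matrix_def n_def xs ys_def)
    moreover have "mat_delete (pair_matrix ys) i i = pair_matrix (us @ vs)"
    proof (rule Matrix.eq_matI)
      fix p q assume "p < dim_row (pair_matrix (us @ vs))" "q < dim_col (pair_matrix (us @ vs))"
      then have pq: "p < length (us @ vs)" "q < length (us @ vs)" by (auto simp: pair_matrix_def)
      have *: "(us @ vs) ! p = ys ! (if p < i then p else Suc p)" for p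
        by (auto simp: ys_def i_def nth_append Suc_diff_le)
      show "mat_delete (pair_matrix ys) i i $$ (p, q) = pair_matrix (us @ vs) $$ (p, q)"
        using pq by (simp add: mat_delete_def pair_matrix_def * ) (auto simp: ys_def split: prod.splits)
    qed (auto simp: mat_delete_def pair_matrix_def ys_def)
    ultimately show ?thesis by (simp add: cofactor_def)
  qed
  finally show ?case .
qed

end

section \<open>Bounded multilinear forms\<close>

text \<open>Relative to \<open>V\<close>, because the Euclidean form is first constructed on entire
  analytic elements only.\<close>

definition multi_bounded :: "'a::cstar_algebra set \<Rightarrow> nat \<Rightarrow> ('a list \<Rightarrow> complex) \<Rightarrow> bool" where
  "multi_bounded V n S \<longleftrightarrow>
     (\<forall>As i. length As = n \<and> set As \<subseteq> V \<and> i < n \<longrightarrow>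
        (\<forall>A\<in>V. \<forall>B\<in>V. S (As[i := A + B]) = S (As[i := A]) + S (As[i := B])) \<and>
        (\<forall>c. \<forall>A\<in>V. S (As[i := c *\<^sub>C A]) = c * S (As[i := A]))) \<and>
     (\<forall>As. length As = n \<and> set As \<subseteq> V \<longrightarrow> cmod (S As) \<le> prod_list (map norm As))"

definition csubspace :: "'a::complex_vector set \<Rightarrow> bool" where
  "csubspace V \<longleftrightarrow> (\<forall>A\<in>V. \<forall>B\<in>V. A + B \<in> V) \<and> (\<forall>c. \<forall>A\<in>V. c *\<^sub>C A \<in> V)"

lemma csubspace_UNIV [simp]: "csubspace UNIV"
  by (simp add: csubspace_def)

lemma csubspace_diff: "csubspace V \<Longrightarrow> A \<in> V \<Longrightarrow> B \<in> V \<Longrightarrow> A - B \<in> V"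
  unfolding csubspace_def by (metis diff_conv_add_uminus scaleC_minus_one)

text \<open>The exponent counts the replaced position too; \<open>1 <= C\<close> pays for this and
  avoids the exponent \<open>length xs - 1\<close>.\<close>

lemma prod_list_update_le:
  fixes xs :: "real list"
  assumes "i < length xs" "\<forall>x\<in>set xs. 0 \<le> x \<and> x \<le> C" "1 \<le> C" "0 \<le> d"
  shows "prod_list (xs[i := d]) \<le> d * C ^ length xs"
proof -
  have le: "0 \<le> prod_list ys \<and> prod_list ys \<le> C ^ length ys" if "\<forall>x\<in>set ys. 0 \<le> x \<and> x \<le> C" for ys
    using that
  proof (induction ys)
    case (Cons y ys)
    then show ?case using \<open>1 \<le> C\<close> by (auto intro!: mult_mono)
  qed simp
  show ?thesis
    using assms(1,2)
  proof (induction xs arbitrary: i)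
    case (Cons x xs)
    show ?case
    proof (cases i)
      case 0
      have "prod_list xs \<le> C ^ length xs" using le[of xs] Cons.prems by auto
      also have "\<dots> \<le> C ^ Suc (length xs)" using \<open>1 \<le> C\<close> by (intro power_increasing) auto
      finally show ?thesis using 0 \<open>0 \<le> d\<close> by (auto intro: mult_left_mono)
    next
      case (Suc j)
      with Cons have IH: "prod_list (xs[j := d]) \<le> d * C ^ length xs" by simp
      have "x * prod_list (xs[j := d]) \<le> x * (d * C ^ length xs)"
        using Cons.prems IH by (intro mult_left_mono) auto
      also have "\<dots> \<le> C * (d * C ^ length xs)"
        using Cons.prems \<open>0 \<le> d\<close> \<open>1 \<le> C\<close> by (intro mult_right_mono) auto
      finally show ?thesis using Suc by (simp add: mult_ac)
    qed
  qed simp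
qed

text \<open>Telescoping over the hybrid lists \<open>H i\<close>, which agree with \<open>Bs\<close>
  before position \<open>i\<close> and with \<open>As\<close> from there on.\<close>

lemma multi_bounded_diff:
  assumes V: "csubspace V" and S: "multi_bounded V n S"
    and As: "length As = n" "set As \<subseteq> V" and Bs: "length Bs = n" "set Bs \<subseteq> V"
    and C: "\<forall>A\<in>set As. norm A \<le> C" "\<forall>B\<in>set Bs. norm B \<le> C" "1 \<le> C"
  shows "cmod (S As - S Bs) \<le> (\<Sum>i<n. norm (As ! i - Bs ! i)) * C ^ n"
proof -
  define H where "H i = take i Bs @ drop i As" for i
  have H: "length (H i) = n" "set (H i) \<subseteq> V" "\<forall>A\<in>set (H i). norm A \<le> C" if "i \<le> n" for i
    using that As Bs C by (auto simp: H_def dest: in_set_takeD in_set_dropD)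
  have step: "cmod (S (H i) - S (H (Suc i))) \<le> norm (As ! i - Bs ! i) * C ^ n" if i: "i < n" for i
  proof -
    have ABV: "As ! i \<in> V" "Bs ! i \<in> V" using As Bs i by auto
    then have DV: "As ! i - Bs ! i \<in> V" by (rule csubspace_diff[OF V])
    have 1: "(H i)[i := As ! i] = H i" "(H i)[i := Bs ! i] = H (Suc i)"
      using i As Bs by (auto simp: H_def list_eq_iff_nth_eq nth_list_update nth_append less_Suc_eq)
    have "S ((H i)[i := (As ! i - Bs ! i) + Bs ! i]) = S ((H i)[i := As ! i - Bs ! i]) + S ((H i)[i := Bs ! i])"
      using S H[of i] i DV ABV unfolding multi_bounded_def by (metis less_imp_le)
    then have "S (H i) - S (H (Suc i)) = S ((H i)[i := As ! i - Bs ! i])" by (simp add: 1)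
    also have "cmod \<dots> \<le> prod_list (map norm ((H i)[i := As ! i - Bs ! i]))"
    proof -
      have "set ((H i)[i := As ! i - Bs ! i]) \<subseteq> V"
        using set_update_subset_insert[of "H i" i "As ! i - Bs ! i"] H(2)[of i] i DV by auto
      then show ?thesis using S H(1)[of i] i unfolding multi_bounded_def by simp
    qed
    also have "\<dots> = prod_list ((map norm (H i))[i := norm (As ! i - Bs ! i)])" by (simp add: map_update)
    also have "\<dots> \<le> norm (As ! i - Bs ! i) * C ^ length (map norm (H i))"
      by (rule prod_list_update_le) (use H[of i] i C(3) in auto)
    finally show ?thesis using H(1)[of i] i by simp
  qed
  have "S As - S Bs = (\<Sum>i<n. S (H i) - S (H (Suc i)))"
    using As Bs sum_lessThan_telescope'[of "\<lambda>i. S (H i)" n] by (simp add: H_def)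
  also have "cmod \<dots> \<le> (\<Sum>i<n. norm (As ! i - Bs ! i) * C ^ n)"
    by (rule order_trans[OF norm_sum sum_mono]) (use step in auto)
  finally show ?thesis by (simp add: sum_distrib_right)
qed

lemma multi_bounded_diff_tendsto:
  assumes V: "csubspace V" and S: "multi_bounded V n S"
    and X: "\<And>m::nat. length (X m) = n" "\<And>m. set (X m) \<subseteq> V" and Y: "\<And>m. length (Y m) = n" "\<And>m. set (Y m) \<subseteq> V"
    and L: "\<And>i. i < n \<Longrightarrow> (\<lambda>m. X m ! i) \<longlonglongrightarrow> L i" "\<And>i. i < n \<Longrightarrow> (\<lambda>m. Y m ! i) \<longlonglongrightarrow> L i"
  shows "(\<lambda>m. S (X m) - S (Y m)) \<longlonglongrightarrow> 0"
proof -
  have "\<exists>K. \<forall>m. norm (X m ! i) \<le> K \<and> norm (Y m ! i) \<le> K" if "i < n" for i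
  proof -
    have "Bseq (\<lambda>m. X m ! i)" "Bseq (\<lambda>m. Y m ! i)"
      using L[OF that] by (blast intro: convergent_imp_Bseq convergentI)+
    then obtain K1 K2 where "\<forall>m. norm (X m ! i) \<le> K1" "\<forall>m. norm (Y m ! i) \<le> K2" by (auto simp: Bseq_def)
    then show ?thesis by (intro exI[of _ "max K1 K2"]) (auto simp: le_max_iff_disj)
  qed
  then obtain K where K: "\<And>i m. i < n \<Longrightarrow> norm (X m ! i) \<le> K i \<and> norm (Y m ! i) \<le> K i" by metis
  define C where "C = 1 + (\<Sum>i<n. \<bar>K i\<bar>)"
  have KC: "K i \<le> C" if "i < n" for i
    using member_le_sum[of i "{..<n}" "\<lambda>i. \<bar>K i\<bar>"] that by (simp add: C_def)
  have C1: "1 \<le> C" by (simp add: C_def sum_nonneg)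
  have XC: "\<forall>A\<in>set (X m). norm A \<le> C" and YC: "\<forall>A\<in>set (Y m). norm A \<le> C" for m
    using K KC X(1)[of m] Y(1)[of m] by (metis in_set_conv_nth order_trans)+
  show ?thesis
  proof (rule Lim_null_comparison)
    show "\<forall>\<^sub>F m in sequentially. norm (S (X m) - S (Y m)) \<le> (\<Sum>i<n. norm (X m ! i - Y m ! i)) * C ^ n"
      by (intro always_eventually allI multi_bounded_diff[OF V S] X Y XC YC C1)
    have "(\<lambda>m. norm (X m ! i - Y m ! i)) \<longlonglongrightarrow> 0" if "i < n" for i
      using tendsto_norm[OF tendsto_diff[OF L[OF that]]] by simp
    then have "(\<lambda>m. \<Sum>i<n. norm (X m ! i - Y m ! i)) \<longlonglongrightarrow> (\<Sum>i<n. 0)" by (intro tendsto_sum) simp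
    then show "(\<lambda>m. (\<Sum>i<n. norm (X m ! i - Y m ! i)) * C ^ n) \<longlonglongrightarrow> 0"
      using tendsto_mult_left_zero by force
  qed
qed

lemma multi_bounded_tendsto:
  assumes S: "multi_bounded UNIV n S" and X: "\<And>m::nat. length (X m) = n" and As: "length As = n"
    and L: "\<And>i. i < n \<Longrightarrow> (\<lambda>m. X m ! i) \<longlonglongrightarrow> As ! i"
  shows "(\<lambda>m. S (X m)) \<longlonglongrightarrow> S As"
  using multi_bounded_diff_tendsto[OF csubspace_UNIV S X _ _ _ L, of "\<lambda>_. As"] As by (simp add: LIM_zero_iff)

text \<open>Density gives approximants \<open>q A m\<close>, and \<open>multi_bounded_diff\<close>
  makes the values of the form along them a Cauchy sequence.\<close>

lemma multi_bounded_extend: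
  fixes V :: "'a::cstar_algebra set"
  assumes V: "csubspace V" and dense: "closure V = UNIV" and S: "multi_bounded V n S"
  shows "\<exists>S'. multi_bounded UNIV n S' \<and> (\<forall>As. length As = n \<and> set As \<subseteq> V \<longrightarrow> S' As = S As)"
proof -
  have "\<exists>B\<in>V. dist B A < 1 / real (Suc m)" for A m
    using dense by (metis UNIV_I closure_approachable of_nat_0_less_iff zero_less_Suc zero_less_divide_1_iff)
  then obtain q where q: "\<And>A m. q A m \<in> V" "\<And>A m. dist (q A m) A < 1 / real (Suc m)" by metis
  have q_lim: "q A \<longlonglongrightarrow> A" for A
  proof (rule metric_tendsto_imp_tendsto[of "\<lambda>m. 1 / real (Suc m)" 0])
    show "(\<lambda>m. 1 / real (Suc m)) \<longlonglongrightarrow> 0" using LIMSEQ_inverse_real_of_nat by (simp add: inverse_eq_divide)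
  qed (use q(2) less_imp_le in \<open>auto simp: dist_real_def intro!: always_eventually\<close>)
  define S' where "S' As = lim (\<lambda>m. S (map (\<lambda>A. q A m) As))" for As
  have mV: "set (map (\<lambda>A. q A m) As) \<subseteq> V" for m As using q by auto
  have conv: "(\<lambda>m. S (map (\<lambda>A. q A m) As)) \<longlonglongrightarrow> S' As" if As: "length As = n" for As
  proof -
    define C where "C = 1 + sum_list (map norm As)"
    have "0 \<le> sum_list (map norm As)" by (rule sum_list_nonneg) auto
    then have C1: "1 \<le> C" by (simp add: C_def)
    have qC: "\<forall>B\<in>set (map (\<lambda>A. q A m) As). norm B \<le> C" for m
    proof -
      have "norm (q A m) \<le> C" if "A \<in> set As" for A
      proof -
        have "norm (q A m) \<le> norm A + dist (q A m) A"
          by (metis dist_norm norm_triangle_sub)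
        moreover have "dist (q A m) A \<le> 1" using q(2)[of A m] by (rule less_imp_le[OF less_le_trans]) simp
        moreover have "norm A \<le> sum_list (map norm As)"
          by (rule member_le_sum_list) (use that in auto)
        ultimately show ?thesis unfolding C_def by linarith
      qed
      then show ?thesis by auto
    qed
    have "Cauchy (\<lambda>m. S (map (\<lambda>A. q A m) As))"
    proof (rule metric_CauchyI)
      fix e :: real assume e: "0 < e"
      \<comment> \<open>The factor \<open>n * C ^ n\<close> of \<open>multi_bounded_diff\<close>
        times 2, one for each of the two approximations; the summand 1 keeps it positive for
        \<open>n = 0\<close>.\<close>
      define K where "K = real n * 2 * C ^ n + 1"
      have K: "0 < K" using C1 by (simp add: K_def add_nonneg_pos)
      obtain N where N: "1 / real (Suc N) < e / K" using e K nat_approx_posE[of "e / K"] by (metis divide_pos_pos)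
      have "dist (S (map (\<lambda>A. q A m) As)) (S (map (\<lambda>A. q A l) As)) < e" if ml: "m \<ge> N" "l \<ge> N" for m l
      proof -
        have "dist (S (map (\<lambda>A. q A m) As)) (S (map (\<lambda>A. q A l) As))
            \<le> (\<Sum>i<n. norm (map (\<lambda>A. q A m) As ! i - map (\<lambda>A. q A l) As ! i)) * C ^ n"
          unfolding dist_norm by (rule multi_bounded_diff[OF V S _ mV _ mV qC qC C1]) (use As in auto)
        also have "\<dots> \<le> (\<Sum>i<n. 2 / real (Suc N)) * C ^ n"
        proof (intro mult_right_mono sum_mono)
          fix i assume "i \<in> {..<n}"
          have le: "dist (q A m) A \<le> 1 / real (Suc N)" if "m \<ge> N" for A m
          proof -
            have "1 / real (Suc m) \<le> 1 / real (Suc N)" using that by (simp add: frac_le)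
            then show ?thesis using q(2)[of A m] by linarith
          qed
          have "norm (q A m - q A l) \<le> dist (q A m) A + dist (q A l) A" for A
            by (metis dist_norm dist_triangle2)
          then have "norm (q A m - q A l) \<le> 2 / real (Suc N)" for A
            using le[OF ml(1), of A] le[OF ml(2), of A] by (smt (verit) add_divide_distrib)
          then show "norm (map (\<lambda>A. q A m) As ! i - map (\<lambda>A. q A l) As ! i) \<le> 2 / real (Suc N)"
            using As \<open>i \<in> {..<n}\<close> by simp
        qed (use C1 in simp)
        also have "\<dots> = (1 / real (Suc N)) * (real n * 2 * C ^ n)" by simp
        also have "\<dots> \<le> (1 / real (Suc N)) * K" by (intro mult_left_mono) (auto simp: K_def)
        also have "\<dots> < (e / K) * K" using N K by (intro mult_strict_right_mono)
        also have "\<dots> = e" using K by simp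
        finally show ?thesis .
      qed
      then show "\<exists>M. \<forall>m\<ge>M. \<forall>l\<ge>M. dist (S (map (\<lambda>A. q A m) As)) (S (map (\<lambda>A. q A l) As)) < e" by blast
    qed
    then show ?thesis unfolding S'_def by (simp add: Cauchy_convergent_iff convergent_LIMSEQ_iff)
  qed
  \<comment> \<open>Any approximating lists give the same limit. This makes the extension linear in
    each position, although \<open>q\<close> itself need not be.\<close>
  have approx: "(\<lambda>m. S (X m)) \<longlonglongrightarrow> S' As"
    if As: "length As = n" and X: "\<And>m. length (X m) = n" "\<And>m. set (X m) \<subseteq> V"
      "\<And>i. i < n \<Longrightarrow> (\<lambda>m. X m ! i) \<longlonglongrightarrow> As ! i" for X As
  proof -
    have "(\<lambda>m. S (X m) - S (map (\<lambda>A. q A m) As)) \<longlonglongrightarrow> 0"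
      by (rule multi_bounded_diff_tendsto[OF V S X(1,2) _ _ X(3)]) (use As q q_lim in auto)
    from tendsto_add[OF this conv[OF As]] show ?thesis by simp
  qed
  have upd: "(\<lambda>m. S ((map (\<lambda>A. q A m) As)[i := B m])) \<longlonglongrightarrow> S' (As[i := A])"
    if "length As = n" "\<And>m. B m \<in> V" "B \<longlonglongrightarrow> A" for As i A B
  proof (rule approx)
    show "set ((map (\<lambda>A. q A m) As)[i := B m]) \<subseteq> V" for m
      using set_update_subset_insert[of "map (\<lambda>A. q A m) As" i "B m"] mV that(2)[of m] by blast
    show "(\<lambda>m. (map (\<lambda>A. q A m) As)[i := B m] ! j) \<longlonglongrightarrow> As[i := A] ! j" if "j < n" for j
      using that \<open>length As = n\<close> \<open>B \<longlonglongrightarrow> A\<close> q_lim by (cases "i = j") auto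
  qed (use that in auto)
  have "multi_bounded UNIV n S'"
    unfolding multi_bounded_def
  proof (intro conjI allI impI ballI)
    fix As :: "'a list" and i A B
    assume *: "length As = n \<and> set As \<subseteq> UNIV \<and> i < n"
    have "(\<lambda>m. S ((map (\<lambda>A. q A m) As)[i := q A m + q B m])) \<longlonglongrightarrow> S' (As[i := A + B])"
      using V q * by (intro upd tendsto_add q_lim) (auto simp: csubspace_def)
    moreover have "S ((map (\<lambda>A. q A m) As)[i := q A m + q B m])
        = S ((map (\<lambda>A. q A m) As)[i := q A m]) + S ((map (\<lambda>A. q A m) As)[i := q B m])" for m
      using S q mV * unfolding multi_bounded_def by simp
    ultimately have "(\<lambda>m. S ((map (\<lambda>A. q A m) As)[i := q A m]) + S ((map (\<lambda>A. q A m) As)[i := q B m])) \<longlonglongrightarrow> S' (As[i := A + B])"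
      by simp
    moreover have "(\<lambda>m. S ((map (\<lambda>A. q A m) As)[i := q A m]) + S ((map (\<lambda>A. q A m) As)[i := q B m])) \<longlonglongrightarrow> S' (As[i := A]) + S' (As[i := B])"
      using * q q_lim by (intro tendsto_add upd) auto
    ultimately show "S' (As[i := A + B]) = S' (As[i := A]) + S' (As[i := B])" by (rule LIMSEQ_unique)
  next
    fix As :: "'a list" and i A c
    assume *: "length As = n \<and> set As \<subseteq> UNIV \<and> i < n"
    have "(\<lambda>m. S ((map (\<lambda>A. q A m) As)[i := c *\<^sub>C q A m])) \<longlonglongrightarrow> S' (As[i := c *\<^sub>C A])"
      using V q * by (intro upd tendsto_scaleC tendsto_const q_lim) (auto simp: csubspace_def)
    moreover have "S ((map (\<lambda>A. q A m) As)[i := c *\<^sub>C q A m]) = c * S ((map (\<lambda>A. q A m) As)[i := q A m])" for m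
      using S q mV * unfolding multi_bounded_def by simp
    ultimately have "(\<lambda>m. c * S ((map (\<lambda>A. q A m) As)[i := q A m])) \<longlonglongrightarrow> S' (As[i := c *\<^sub>C A])" by simp
    moreover have "(\<lambda>m. c * S ((map (\<lambda>A. q A m) As)[i := q A m])) \<longlonglongrightarrow> c * S' (As[i := A])"
      using * q q_lim by (intro tendsto_mult tendsto_const upd) auto
    ultimately show "S' (As[i := c *\<^sub>C A]) = c * S' (As[i := A])" by (rule LIMSEQ_unique)
  next
    fix As :: "'a list" assume "length As = n \<and> set As \<subseteq> UNIV"
    then have As: "length As = n" by simp
    have "(\<lambda>m. prod_list (map (\<lambda>A. norm (q A m)) Bs)) \<longlonglongrightarrow> prod_list (map norm Bs)" for Bs
      by (induction Bs) (auto intro!: tendsto_mult tendsto_norm q_lim)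
    then have "(\<lambda>m. prod_list (map norm (map (\<lambda>A. q A m) As))) \<longlonglongrightarrow> prod_list (map norm As)"
      by (simp add: o_def)
    moreover have "cmod (S (map (\<lambda>A. q A m) As)) \<le> prod_list (map norm (map (\<lambda>A. q A m) As))" for m
      using S As mV[of m As] unfolding multi_bounded_def by (metis length_map)
    ultimately show "cmod (S' As) \<le> prod_list (map norm As)"
      by (intro LIMSEQ_le[OF tendsto_norm[OF conv[OF As]]]) auto
  qed
  moreover have "S' As = S As" if "length As = n" "set As \<subseteq> V" for As
    using approx[of As "\<lambda>_. As"] that LIMSEQ_unique tendsto_const by blast
  ultimately show ?thesis by blast
qed

lemma euclidean_form_iff_multi_bounded:
  "euclidean_form \<phi> \<alpha> ts S \<longleftrightarrow> multi_bounded UNIV (length ts) S \<and>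
     (\<forall>As Fs. length As = length ts \<and> length Fs = length ts \<and>
          (\<forall>i<length ts. entire_extension \<alpha> (As ! i) (Fs ! i)) \<longrightarrow>
        S As = \<phi> (prod_list (map (\<lambda>i. (Fs ! i) (\<i> * complex_of_real (ts ! i))) [0..<length ts])))"
  unfolding euclidean_form_def multi_bounded_def clinear_def by (simp add: scaleC_complex_def) blast

section \<open>Entire analytic elements\<close>

lemma entire_const [intro]: "entire (\<lambda>_. A)"
  unfolding entire_def by (intro allI exI[of _ 0]) simp

lemma entire_add [intro]: "entire F \<Longrightarrow> entire G \<Longrightarrow> entire (\<lambda>z. F z + G z)"
  unfolding entire_def
proof (intro allI)
  fix z
  assume "\<forall>z. \<exists>A. (F has_derivative (\<lambda>w. w *\<^sub>C A)) (at z)" "\<forall>z. \<exists>A. (G has_derivative (\<lambda>w. w *\<^sub>C A)) (at z)"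
  then obtain A B where "(F has_derivative (\<lambda>w. w *\<^sub>C A)) (at z)" "(G has_derivative (\<lambda>w. w *\<^sub>C B)) (at z)" by blast
  from has_derivative_add[OF this] show "\<exists>A. ((\<lambda>z. F z + G z) has_derivative (\<lambda>w. w *\<^sub>C A)) (at z)"
    by (intro exI[of _ "A + B"]) (simp add: scaleC_add_right)
qed

lemma entire_mult [intro]: "entire F \<Longrightarrow> entire G \<Longrightarrow> entire (\<lambda>z. F z * G z)"
  unfolding entire_def
proof (intro allI)
  fix z
  assume "\<forall>z. \<exists>A. (F has_derivative (\<lambda>w. w *\<^sub>C A)) (at z)" "\<forall>z. \<exists>A. (G has_derivative (\<lambda>w. w *\<^sub>C A)) (at z)"
  then obtain A B where "(F has_derivative (\<lambda>w. w *\<^sub>C A)) (at z)" "(G has_derivative (\<lambda>w. w *\<^sub>C B)) (at z)" by blast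
  from has_derivative_mult[OF this] show "\<exists>A. ((\<lambda>z. F z * G z) has_derivative (\<lambda>w. w *\<^sub>C A)) (at z)"
    by (intro exI[of _ "F z * B + A * G z"]) (simp add: scaleC_add_right scaleC_mult_left scaleC_mult_right)
qed

lemma entire_scaleC [intro]: "entire F \<Longrightarrow> entire (\<lambda>z. c *\<^sub>C F z)"
  using entire_mult[OF entire_const[of "c *\<^sub>C 1"], of F] by (simp add: scaleC_mult_left)

lemma entire_shift: "entire F \<Longrightarrow> entire (\<lambda>z. F (z + c))"
  unfolding entire_def
proof (intro allI)
  fix z
  assume "\<forall>z. \<exists>A. (F has_derivative (\<lambda>w. w *\<^sub>C A)) (at z)"
  then obtain A where A: "(F has_derivative (\<lambda>w. w *\<^sub>C A)) (at (z + c))" by blast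
  have "((\<lambda>z. z + c) has_derivative (\<lambda>w. w)) (at z)" by (auto intro!: derivative_eq_intros)
  from diff_chain_at[OF this] A show "\<exists>A. ((\<lambda>z. F (z + c)) has_derivative (\<lambda>w. w *\<^sub>C A)) (at z)"
    by (intro exI[of _ A]) (simp add: o_def)
qed

lemma entire_star: "entire F \<Longrightarrow> entire (\<lambda>z. star (F (cnj z)))"
  unfolding entire_def
proof (intro allI)
  fix z
  assume "\<forall>z. \<exists>A. (F has_derivative (\<lambda>w. w *\<^sub>C A)) (at z)"
  then obtain A where A: "(F has_derivative (\<lambda>w. w *\<^sub>C A)) (at (cnj z))" by blast
  have "(cnj has_derivative cnj) (at z)" by (rule bounded_linear_imp_has_derivative[OF bounded_linear_cnj])
  from diff_chain_at[OF this A] have "((\<lambda>z. F (cnj z)) has_derivative (\<lambda>w. cnj w *\<^sub>C A)) (at z)"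
    by (simp add: o_def)
  from bounded_linear.has_derivative[OF bounded_linear_star this]
  show "\<exists>A. ((\<lambda>z. star (F (cnj z))) has_derivative (\<lambda>w. w *\<^sub>C A)) (at z)"
    by (intro exI[of _ "star A"]) (simp add: star_scaleC)
qed

lemma (in cstar_state) holomorphic_entire:
  assumes "entire F" shows "(\<lambda>z. \<phi> (X * F z * Y)) holomorphic_on UNIV"
proof (rule holomorphic_onI)
  fix z :: complex
  have "entire (\<lambda>z. X * F z * Y)" by (intro entire_mult entire_const assms)
  then obtain A where "((\<lambda>z. X * F z * Y) has_derivative (\<lambda>w. w *\<^sub>C A)) (at z)" unfolding entire_def by blast
  from bounded_linear.has_derivative[OF bounded_linear this]
  have "((\<lambda>z. \<phi> (X * F z * Y)) has_derivative (*) (\<phi> A)) (at z)" by (simp add: scale mult.commute[of _ "\<phi> A"])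
  then show "(\<lambda>z. \<phi> (X * F z * Y)) field_differentiable at z within UNIV"
    by (auto simp: field_differentiable_def has_field_derivative_def)
qed

text \<open>The identity theorem applies because the reals accumulate at 0.\<close>

lemma holomorphic_eq_on_reals:
  assumes f: "f holomorphic_on UNIV" and g: "g holomorphic_on UNIV"
    and eq: "\<And>t. f (complex_of_real t) = g (complex_of_real t)"
  shows "f z = g z"
proof -
  have hol: "(\<lambda>z. f z - g z) holomorphic_on UNIV" by (intro holomorphic_intros f g)
  have lim: "0 islimpt range complex_of_real"
    unfolding islimpt_sequential
  proof (intro exI conjI allI)
    show "(\<lambda>n. complex_of_real (1 / real (Suc n))) \<longlonglongrightarrow> 0"
      using tendsto_of_real[OF LIMSEQ_inverse_real_of_nat, where 'a = complex] by (simp add: inverse_eq_divide)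
    show "complex_of_real (1 / real (Suc n)) \<in> range complex_of_real - {0}" for n
      by (auto simp del: of_real_divide)
  qed
  have "f z - g z = 0"
    by (rule analytic_continuation[OF hol open_UNIV connected_UNIV subset_UNIV UNIV_I lim _ UNIV_I]) (use eq in auto)
  then show ?thesis by simp
qed

lemma exp_remainder: "cmod (exp \<xi> - 1 - \<xi>) \<le> (cmod \<xi>)\<^sup>2 * exp (cmod \<xi>)"
proof -
  have "cmod (exp \<xi> - (\<Sum>k\<le>1. \<xi> ^ k / fact k)) \<le> exp \<bar>Re \<xi>\<bar> * cmod \<xi> ^ Suc 1 / fact 1"
    by (rule Taylor_exp)
  also have "\<dots> \<le> exp (cmod \<xi>) * (cmod \<xi>)\<^sup>2"
    by (simp add: power2_eq_square abs_Re_le_cmod mult_right_mono)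
  finally show ?thesis by (simp add: diff_diff_eq mult.commute)
qed

section \<open>Spectral cut-offs and entire analytic letters\<close>

context spectral_measure
begin

text \<open>Restricting to a bounded spectral window makes the exponential bounded for every complex
  \<open>z\<close>, so that no domain questions arise.\<close>

definition cut_exp :: "nat \<Rightarrow> complex \<Rightarrow> real \<Rightarrow> complex" where
  "cut_exp n z r = indicator {- real n..real n} r * exp (z * complex_of_real r)"

lemma cmod_cut_exp_le: "cmod (cut_exp n z r) \<le> exp (cmod z * real n)"
proof (cases "r \<in> {- real n..real n}")
  case True
  have "cmod (exp (z * complex_of_real r)) \<le> exp (cmod (z * complex_of_real r))" by (rule norm_exp)
  also have "\<dots> \<le> exp (cmod z * real n)" using True by (auto simp: norm_mult intro: mult_left_mono)
  finally show ?thesis using True by (simp add: cut_exp_def)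
qed (simp add: cut_exp_def)

lemma bounded_borel_cut_exp [intro, simp]: "bounded_borel (cut_exp n z)"
proof (rule bounded_borelI)
  have "(\<lambda>r. exp (z * complex_of_real r)) \<in> borel_measurable borel"
    by (intro borel_measurable_continuous_onI continuous_intros)
  then show "cut_exp n z \<in> borel_measurable borel" unfolding cut_exp_def by measurable
qed (rule cmod_cut_exp_le)

lemma cut_exp_mult: "cut_exp n z r * cut_exp n w r = cut_exp n (z + w) r"
  by (simp add: cut_exp_def indicator_def exp_add algebra_simps)

lemma cnj_cut_exp: "cnj (cut_exp n z r) = cut_exp n (cnj z) r"
  by (simp add: cut_exp_def indicator_def exp_cnj)

definition ex :: "nat \<Rightarrow> complex \<Rightarrow> 'x ell2 \<Rightarrow> 'x ell2" where
  "ex n z = fc E (cut_exp n z)"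

lemma ex_add: "ex n z (h + k) = ex n z h + ex n z k"
  unfolding ex_def by (simp add: clinear_add clinear_fc)

lemma cut_tendsto_1: "(\<lambda>n. indicator {- real n..real n} r :: complex) \<longlonglongrightarrow> 1"
proof (rule tendsto_eventually)
  obtain N :: nat where "\<bar>r\<bar> \<le> real N" using real_arch_simple by blast
  then have "\<forall>n\<ge>N. r \<in> {- real n..real n}" by (auto dest: of_nat_mono[where 'a = real])
  then show "\<forall>\<^sub>F n in sequentially. indicator {- real n..real n} r = (1::complex)"
    by (auto simp: eventually_sequentially indicator_def)
qed

lemma ex_0_tendsto: "(\<lambda>n. ex n 0 h) \<longlonglongrightarrow> h"
proof -
  have "(\<lambda>n. fc E (cut_exp n 0) h) \<longlonglongrightarrow> fc E (\<lambda>_. 1) h"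
    using cut_tendsto_1 by (intro fc_lim[where C = 1]) (auto simp: cut_exp_def indicator_def)
  then show ?thesis by (simp add: ex_def fc_one)
qed

text \<open>Exponentials with a real exponent are self-adjoint and move across the inner product, so
  only the sum of the two exponents matters. This is why correlations depend on time
  differences.\<close>

lemma cinner_fc_ex:
  assumes "bounded_borel g"
  shows "cinner (fc E g (ex n z h)) (ex n (complex_of_real t) k) = cinner (fc E (\<lambda>r. cut_exp n (z + complex_of_real t) r * g r) h) k"
proof -
  have "cinner (fc E g (ex n z h)) (ex n (complex_of_real t) k)
      = cinner (fc E (\<lambda>r. g r * cut_exp n z r) h) (fc E (\<lambda>r. cnj (cut_exp n (complex_of_real t) r)) k)"
    using assms by (simp add: ex_def fc_mult cnj_cut_exp)
  also have "\<dots> = cinner (fc E (\<lambda>r. cut_exp n (complex_of_real t) r * (g r * cut_exp n z r)) h) k"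
    using assms by (simp add: fc_mult bounded_borel_mult flip: fc_adjoint)
  also have "(\<lambda>r. cut_exp n (complex_of_real t) r * (g r * cut_exp n z r)) = (\<lambda>r. cut_exp n (z + complex_of_real t) r * g r)"
    by (rule ext) (simp add: mult_ac flip: cut_exp_mult)
  finally show ?thesis .
qed

lemma cinner_ex_ex:
  "cinner (ex n z h) (ex n (complex_of_real t) k) = cinner (fc E (cut_exp n (z + complex_of_real t)) h) k"
  using cinner_fc_ex[of "\<lambda>_. 1"] by (simp add: fc_one)

end

locale car_flow = spectral_measure E + car a
  for E :: "real set \<Rightarrow> 'x ell2 \<Rightarrow> 'x ell2" and a :: "'x ell2 \<Rightarrow> 'a::cstar_algebra" +
  fixes \<alpha> :: "real \<Rightarrow> 'a \<Rightarrow> 'a"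
  assumes flow: "quasi_free_flow a E \<alpha>"
begin

lemma \<alpha>_bij: "bij (\<alpha> t)" and \<alpha>_clinear: "clinear (\<alpha> t)" and \<alpha>_mult: "\<alpha> t (x * y) = \<alpha> t x * \<alpha> t y"
  and \<alpha>_star: "\<alpha> t (star x) = star (\<alpha> t x)"
  and \<alpha>_plus: "\<alpha> (s + t) x = \<alpha> s (\<alpha> t x)"
  and \<alpha>_a: "\<alpha> t (a h) = a (fc E (\<lambda>r. exp (\<i> * complex_of_real (t * r))) h)"
  using flow unfolding quasi_free_flow_def star_automorphism_def by auto

lemma \<alpha>_add: "\<alpha> t (x + y) = \<alpha> t x + \<alpha> t y" and \<alpha>_scale: "\<alpha> t (c *\<^sub>C x) = c *\<^sub>C \<alpha> t x"
  using \<alpha>_clinear by (auto simp: clinear_def)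

lemma \<alpha>_one: "\<alpha> t 1 = 1"
proof -
  obtain y where "\<alpha> t y = 1" using \<alpha>_bij[of t] by (metis bij_pointE)
  then show ?thesis using \<alpha>_mult[of t y 1] by simp
qed

lemma \<alpha>_0: "\<alpha> 0 x = x"
proof -
  have "\<alpha> 0 (\<alpha> 0 x) = \<alpha> 0 x" using \<alpha>_plus[of 0 0 x] by simp
  then show ?thesis using \<alpha>_bij[of 0] by (metis bij_def injD)
qed

lemma ext_one: "entire_extension \<alpha> (c *\<^sub>C 1) (\<lambda>_. c *\<^sub>C 1)"
  by (auto simp: entire_extension_def \<alpha>_one \<alpha>_scale)

lemma ext_add: "entire_extension \<alpha> A F \<Longrightarrow> entire_extension \<alpha> B G \<Longrightarrow> entire_extension \<alpha> (A + B) (\<lambda>z. F z + G z)"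
  by (auto simp: entire_extension_def \<alpha>_add)

lemma ext_mult: "entire_extension \<alpha> A F \<Longrightarrow> entire_extension \<alpha> B G \<Longrightarrow> entire_extension \<alpha> (A * B) (\<lambda>z. F z * G z)"
  by (auto simp: entire_extension_def \<alpha>_mult)

lemma ext_scaleC: "entire_extension \<alpha> A F \<Longrightarrow> entire_extension \<alpha> (c *\<^sub>C A) (\<lambda>z. c *\<^sub>C F z)"
  by (auto simp: entire_extension_def \<alpha>_scale)

lemma ext_star: "entire_extension \<alpha> A F \<Longrightarrow> entire_extension \<alpha> (star A) (\<lambda>z. star (F (cnj z)))"
  by (auto simp: entire_extension_def \<alpha>_star entire_star)

lemma ext_prod_list:
  assumes "\<And>y. y \<in> set ys \<Longrightarrow> entire_extension \<alpha> (A y) (F y)"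
  shows "entire_extension \<alpha> (prod_list (map A ys)) (\<lambda>z. prod_list (map (\<lambda>y. F y z) ys))"
  using assms
proof (induction ys)
  case Nil
  show ?case using ext_one[of 1] by simp
next
  case (Cons y ys)
  then show ?case using ext_mult[of "A y" "F y"] by simp
qed

text \<open>For real \<open>z\<close> these are the flow applied to a letter with cut argument.
  Since \<open>a\<close> is antilinear, \<open>ann\<close> takes \<open>cnj z\<close>, which makes
  it holomorphic as well.\<close>

definition cre :: "nat \<Rightarrow> 'x ell2 \<Rightarrow> complex \<Rightarrow> 'a" where "cre n h z = star (a (ex n (\<i> * z) h))"
definition ann :: "nat \<Rightarrow> 'x ell2 \<Rightarrow> complex \<Rightarrow> 'a" where "ann n h z = a (ex n (\<i> * cnj z) h)"

lemma a_diff: "a (h - k) = a h - a k"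
  using a_add[of h "- k"] a_scale[of "-1" k] by (simp add: scaleC_minus_one)

text \<open>On the window the exponential has a first-order Taylor expansion in \<open>z\<close>
  whose remainder is quadratic in \<open>w\<close>, uniformly in \<open>r\<close>. The map from
  \<open>h\<close> to \<open>star (a h)\<close> is linear and contractive, so the estimate carries
  over to the norm of the algebra.\<close>

lemma entire_cre: "entire (cre n h)"
  unfolding entire_def
proof (intro allI)
  fix z
  define g where "g r = \<i> * complex_of_real r * cut_exp n (\<i> * z) r" for r
  have gb: "bounded_borel g"
  proof (rule bounded_borelI)
    show "g \<in> borel_measurable borel" unfolding g_def
      by (intro borel_measurable_times bounded_borel_measurable[OF bounded_borel_cut_exp] borel_measurable_continuous_onI continuous_intros)
    show "cmod (g r) \<le> real n * exp (cmod (\<i> * z) * real n)" for r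
    proof (cases "r \<in> {- real n..real n}")
      case True
      then have "\<bar>r\<bar> \<le> real n" by auto
      then show ?thesis using cmod_cut_exp_le[of n "\<i> * z" r]
        unfolding g_def norm_mult by (intro mult_mono) auto
    qed (simp add: g_def cut_exp_def)
  qed
  define A where "A = star (a (fc E g h))"
  define K where "K = exp (cmod z * real n) * (real n)\<^sup>2 * exp (real n) * norm h"
  have bound: "norm (cre n h (z + w) - cre n h z - w *\<^sub>C A) \<le> K * (cmod w)\<^sup>2" if w: "cmod w \<le> 1" for w
  proof -
    define q where "q r = (cut_exp n (\<i> * (z + w)) r - cut_exp n (\<i> * z) r) - w * g r" for r
    have q: "bounded_borel q" unfolding q_def using gb by (intro bounded_borel_diff bounded_borel_mult) auto
    have "cre n h (z + w) - cre n h z - w *\<^sub>C A = star (a (fc E q h))"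
    proof -
      have "fc E q h = ex n (\<i> * (z + w)) h - ex n (\<i> * z) h - w *\<^sub>C fc E g h"
        unfolding q_def ex_def using gb by (subst fc_diff) (auto simp: fc_diff fc_scale)
      then show ?thesis by (simp add: cre_def A_def a_diff star_diff star_a_scale)
    qed
    then have "norm (cre n h (z + w) - cre n h z - w *\<^sub>C A) \<le> norm (fc E q h)"
      using norm_a_le by simp
    also have "\<dots> \<le> (exp (cmod z * real n) * ((cmod w)\<^sup>2 * (real n)\<^sup>2 * exp (real n))) * norm h"
    proof (rule norm_fc_le[OF q])
      fix r
      show "cmod (q r) \<le> exp (cmod z * real n) * ((cmod w)\<^sup>2 * (real n)\<^sup>2 * exp (real n))"
      proof (cases "r \<in> {- real n..real n}")
        case True
        then have r: "\<bar>r\<bar> \<le> real n" by auto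
        let ?\<xi> = "\<i> * w * complex_of_real r"
        have "q r = cut_exp n (\<i> * z) r * (exp ?\<xi> - 1 - ?\<xi>)"
          using True by (simp add: q_def g_def cut_exp_def exp_add algebra_simps)
        then have "cmod (q r) = cmod (cut_exp n (\<i> * z) r) * cmod (exp ?\<xi> - 1 - ?\<xi>)" by (simp add: norm_mult)
        also have "\<dots> \<le> exp (cmod (\<i> * z) * real n) * ((cmod ?\<xi>)\<^sup>2 * exp (cmod ?\<xi>))"
          by (intro mult_mono cmod_cut_exp_le exp_remainder) auto
        also have "cmod ?\<xi> = cmod w * \<bar>r\<bar>" by (simp add: norm_mult)
        also have "(cmod w * \<bar>r\<bar>)\<^sup>2 * exp (cmod w * \<bar>r\<bar>) \<le> ((cmod w)\<^sup>2 * (real n)\<^sup>2) * exp (real n)"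
        proof (intro mult_mono)
          show "(cmod w * \<bar>r\<bar>)\<^sup>2 \<le> (cmod w)\<^sup>2 * (real n)\<^sup>2"
            using r by (simp add: power_mult_distrib mult_left_mono power2_le_iff_abs_le)
          have "cmod w * \<bar>r\<bar> \<le> 1 * real n" using r w by (intro mult_mono) auto
          then show "exp (cmod w * \<bar>r\<bar>) \<le> exp (real n)" by simp
        qed auto
        finally show ?thesis by (simp add: norm_mult)
      qed (simp add: q_def g_def cut_exp_def)
    qed
    also have "\<dots> = K * (cmod w)\<^sup>2" by (simp add: K_def mult_ac)
    finally show ?thesis .
  qed
  have "(cre n h has_derivative (\<lambda>w. w *\<^sub>C A)) (at z)"
    unfolding has_derivative_at
  proof (intro conjI)
    show "bounded_linear (\<lambda>w. w *\<^sub>C A)"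
      by (rule bounded_bilinear.bounded_linear_left[OF bounded_bilinear_scaleC])
    show "(\<lambda>w. norm (cre n h (z + w) - cre n h z - w *\<^sub>C A) / norm w) \<midarrow>0\<rightarrow> 0"
    proof (rule Lim_null_comparison)
      show "\<forall>\<^sub>F w in at 0. norm (norm (cre n h (z + w) - cre n h z - w *\<^sub>C A) / norm w) \<le> K * cmod w"
        unfolding eventually_at
      proof (intro exI[of _ 1] conjI ballI impI)
        fix w :: complex assume "w \<noteq> 0 \<and> dist w 0 < 1"
        then show "norm (norm (cre n h (z + w) - cre n h z - w *\<^sub>C A) / norm w) \<le> K * cmod w"
          using bound[of w] by (simp add: divide_le_eq power2_eq_square mult.assoc)
      qed simp
      have "((\<lambda>w. K * cmod w) \<longlongrightarrow> K * cmod 0) (at 0)" by (intro tendsto_intros)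
      then show "((\<lambda>w. K * cmod w) \<longlongrightarrow> 0) (at 0)" by simp
    qed
  qed
  then show "\<exists>A. (cre n h has_derivative (\<lambda>w. w *\<^sub>C A)) (at z)" by blast
qed

lemma ann_eq_star_cre: "ann n h = (\<lambda>z. star (cre n h (cnj z)))"
  by (simp add: ann_def cre_def star_star fun_eq_iff)

lemma bounded_borel_exp_i: "bounded_borel (\<lambda>r. exp (\<i> * complex_of_real (t * r)))"
  by (rule bounded_borelI[where C = 1]) (intro borel_measurable_continuous_onI continuous_intros, simp)

lemma ext_cre: "entire_extension \<alpha> (cre n h 0) (cre n h)"
proof -
  have "fc E (\<lambda>r. exp (\<i> * complex_of_real (t * r))) (ex n 0 h) = ex n (\<i> * complex_of_real t) h" for t
  proof -
    have "(\<lambda>r. exp (\<i> * complex_of_real (t * r)) * cut_exp n 0 r) = cut_exp n (\<i> * complex_of_real t)"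
      by (auto simp: cut_exp_def mult_ac)
    then show ?thesis
      unfolding ex_def fc_mult[OF bounded_borel_exp_i bounded_borel_cut_exp, symmetric] by (simp only:)
  qed
  then show ?thesis
    by (simp add: entire_extension_def entire_cre cre_def \<alpha>_star \<alpha>_a)
qed

lemma ext_ann: "entire_extension \<alpha> (ann n h 0) (ann n h)"
  using ext_star[OF ext_cre[of n h]] by (simp add: ann_eq_star_cre)

lemma bounded_linear_a: "bounded_linear a"
proof (rule bounded_linear_intro[where K = 1])
  show "a (r *\<^sub>R h) = r *\<^sub>R a h" for r h
    unfolding scaleR_ell2_def a_scale complex_cnj_complex_of_real scaleC_of_real[of r "a h"] ..
qed (simp_all add: a_add norm_a_le)

end

section \<open>Determinantal formula for Euclidean correlations\<close>

lemma tendsto_det: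
  fixes M :: "'i \<Rightarrow> complex Matrix.mat"
  assumes M: "\<And>m. M m \<in> carrier_mat n n" and N: "N \<in> carrier_mat n n"
    and lim: "\<And>i j. i < n \<Longrightarrow> j < n \<Longrightarrow> ((\<lambda>m. M m $$ (i, j)) \<longlongrightarrow> N $$ (i, j)) F"
  shows "((\<lambda>m. Determinant.det (M m)) \<longlongrightarrow> Determinant.det N) F"
  unfolding det_def'[OF M] det_def'[OF N]
  by (intro tendsto_sum tendsto_mult tendsto_const tendsto_prod lim) (auto simp: permutes_in_image)

lemma map_upt_nth_map2:
  "length ts = length ys \<Longrightarrow> map (\<lambda>i. g (ts ! i) (ys ! i)) [0..<length ts] = map2 g ts ys"
  by (rule nth_equalityI) auto

lemma prod_list_concat_map2:
  "prod_list (map2 (\<lambda>t ys. prod_list (map (f t) ys)) ts yss) = prod_list (map (\<lambda>(t, y). f t y) (concat (map2 (\<lambda>t ys. map (Pair t) ys) ts yss)) :: 'b::monoid_mult list)"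
proof (induction ts arbitrary: yss)
  case (Cons t ts)
  then show ?case by (cases yss) (simp_all add: o_def)
qed simp

lemma fst_concat_map2: "fst ` set (concat (map2 (\<lambda>t ys. map (Pair t) ys) ts yss)) \<subseteq> set ts"
  by (auto dest: set_zip_leftD)

lemma sorted_concat_map2:
  "sorted ts \<Longrightarrow> sorted (map fst (concat (map2 (\<lambda>t ys. map (Pair t) ys) ts yss)))"
proof (induction ts arbitrary: yss)
  case (Cons t ts)
  show ?case
  proof (cases yss)
    case (Cons ys zss)
    have 1: "map fst (map (Pair t) ys) = replicate (length ys) t" by (induction ys) auto
    have 2: "\<forall>s\<in>set (map fst (concat (map2 (\<lambda>t ys. map (Pair t) ys) ts zss))). t \<le> s"
      using fst_concat_map2[of ts zss] Cons.prems unfolding set_map by (meson sorted_wrt.simps(2) subsetD)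
    have 3: "sorted (map fst (concat (map2 (\<lambda>t ys. map (Pair t) ys) ts zss)))"
      using Cons.IH Cons.prems by simp
    have "map fst (concat (map2 (\<lambda>t ys. map (Pair t) ys) (t # ts) yss)) =
      replicate (length ys) t @ map fst (concat (map2 (\<lambda>t ys. map (Pair t) ys) ts zss))"
      unfolding Cons using 1 by simp
    then show ?thesis using 2 3 by (simp only: sorted_append) (auto simp: sorted_replicate)
  qed simp
qed simp

definition corr_kernel :: "(real set \<Rightarrow> 'x ell2 \<Rightarrow> 'x ell2) \<Rightarrow> (real \<Rightarrow> real) \<Rightarrow> 'x \<Rightarrow> real \<Rightarrow> 'x \<Rightarrow> real \<Rightarrow> complex" where
  "corr_kernel E f x t y s = cinner (fc E (\<lambda>r. complex_of_real (exp ((s - t) * r) * f r)) (ket x)) (ket y)"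

text \<open>A list entry \<open>(t, x, c, b)\<close> stands for the factor \<open>c + b \<rho>\<^sub>x\<close> at time \<open>t\<close>; the determinant is
  the Euclidean correlation of these factors in the quasi-free state with symbol \<open>k\<close>.\<close>

definition corr_matrix :: "(real set \<Rightarrow> 'x ell2 \<Rightarrow> 'x ell2) \<Rightarrow> (real \<Rightarrow> real) \<Rightarrow> (real \<times> 'x \<times> complex \<times> complex) list \<Rightarrow> complex Matrix.mat" where
  "corr_matrix E k xs = Matrix.mat (length xs) (length xs) (\<lambda>(i, j). case (xs ! i, xs ! j) of ((t, x, c, b), (s, y, _)) \<Rightarrow>
     (if i = j then c else 0) + b * (if i \<le> j then corr_kernel E k x t y s else - corr_kernel E (\<lambda>r. 1 - k r) x t y s))"

text \<open>For ordered times this bounds the functions of the Hamiltonian in both kinds of entries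
  of \<open>corr_matrix\<close>: \<open>k\<close> has to beat the first exponential where
  \<open>r\<close> is large, and \<open>1 - k\<close> the second where \<open>r\<close> is very
  negative.\<close>

definition symbol_bounded :: "(real \<Rightarrow> real) \<Rightarrow> real set \<Rightarrow> bool" where
  "symbol_bounded k T \<longleftrightarrow> k \<in> borel_measurable borel \<and> (\<forall>r. 0 \<le> k r \<and> k r \<le> 1) \<and>
     (\<forall>t\<in>T. \<forall>s\<in>T. t \<le> s \<longrightarrow> (\<exists>C. \<forall>r. exp ((s - t) * r) * k r \<le> C \<and> exp ((t - s) * r) * (1 - k r) \<le> C))"

lemma symbol_bounded_borel:
  assumes "symbol_bounded k T" "t \<in> T" "s \<in> T" "t \<le> s"
  shows "bounded_borel (\<lambda>r. complex_of_real (exp ((s - t) * r) * k r))"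
    and "bounded_borel (\<lambda>r. complex_of_real (exp ((t - s) * r) * (1 - k r)))"
    and "bounded_borel (\<lambda>r. complex_of_real (k r))"
proof -
  have [measurable]: "k \<in> borel_measurable borel" and k: "\<And>r. 0 \<le> k r" "\<And>r. k r \<le> 1"
    using assms by (auto simp: symbol_bounded_def)
  obtain C where C: "\<And>r. exp ((s - t) * r) * k r \<le> C" "\<And>r. exp ((t - s) * r) * (1 - k r) \<le> C"
    using assms unfolding symbol_bounded_def by blast
  show "bounded_borel (\<lambda>r. complex_of_real (exp ((s - t) * r) * k r))"
  proof (rule bounded_borelI)
    show "cmod (complex_of_real (exp ((s - t) * r) * k r)) \<le> C" for r
      using C(1)[of r] k(1)[of r] by (simp only: norm_of_real) simp
  qed measurable
  show "bounded_borel (\<lambda>r. complex_of_real (exp ((t - s) * r) * (1 - k r)))"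
  proof (rule bounded_borelI)
    show "cmod (complex_of_real (exp ((t - s) * r) * (1 - k r))) \<le> C" for r
      using C(2)[of r] k(2)[of r] by (simp only: norm_of_real) simp
  qed measurable
  show "bounded_borel (\<lambda>r. complex_of_real (k r))"
  proof (rule bounded_borelI)
    show "cmod (complex_of_real (k r)) \<le> 1" for r using k[of r] by simp
  qed measurable
qed

context car
begin

abbreviation \<rho> :: "'x \<Rightarrow> 'a" where "\<rho> \<equiv> number_at a"

definition factor :: "'x \<times> complex \<times> complex \<Rightarrow> 'a" where
  "factor = (\<lambda>(x, c, b). c *\<^sub>C 1 + b *\<^sub>C \<rho> x)"

end

context car_flow
begin

lemma cre_0_tendsto: "(\<lambda>n. cre n h 0) \<longlonglongrightarrow> star (a h)"
  and ann_0_tendsto: "(\<lambda>n. ann n h 0) \<longlonglongrightarrow> a h"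
  unfolding cre_def ann_def using ex_0_tendsto[of h]
  by (auto intro!: tendsto_star bounded_linear.tendsto[OF bounded_linear_a])

text \<open>Removes the spectral cut. The exponents \<open>- t\<close> and \<open>s\<close> are
  those of a creator at time \<open>t\<close> and an annihilator at time \<open>s\<close> after
  evaluation at imaginary times; they combine to \<open>s - t\<close>. The order of the times
  decides which of the two contractions has a bounded kernel.\<close>

lemma ex_symbol_tendsto:
  assumes k: "symbol_bounded k T" "t \<in> T" "s \<in> T" and K: "K = fc E (\<lambda>r. complex_of_real (k r))"
  shows "t \<le> s \<Longrightarrow> (\<lambda>m. cinner (K (ex m (complex_of_real (- t)) (ket x))) (ex m (complex_of_real s) (ket y)))
      \<longlonglongrightarrow> corr_kernel E k x t y s"
    and "s \<le> t \<Longrightarrow> (\<lambda>m. cinner (K (ex m (complex_of_real (- t)) (ket x))) (ex m (complex_of_real s) (ket y))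
      - cinner (ex m (complex_of_real (- t)) (ket x)) (ex m (complex_of_real s) (ket y)))
      \<longlonglongrightarrow> - corr_kernel E (\<lambda>r. 1 - k r) x t y s"
proof -
  have lim: "(\<lambda>m. cinner (fc E (\<lambda>r. indicator {- real m..real m} r * g r) h) l) \<longlonglongrightarrow> cinner (fc E g h) l"
    if g: "bounded_borel g" for g h l
  proof -
    obtain C where C: "0 \<le> C" "\<And>r. cmod (g r) \<le> C" using bounded_borel_bound[OF g] by blast
    have "(\<lambda>m. fc E (\<lambda>r. indicator {- real m..real m} r * g r) h) \<longlonglongrightarrow> fc E g h"
    proof (rule fc_lim[where C = C])
      show "(\<lambda>m. indicator {- real m..real m} r * g r) \<longlonglongrightarrow> g r" for r
        using tendsto_mult[OF cut_tendsto_1 tendsto_const, of r "g r"] by simp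
      show "bounded_borel (\<lambda>r. indicator {- real m..real m} r * g r)" for m
        by (intro bounded_borel_mult bounded_borel_indicator g) simp
      show "cmod (indicator {- real m..real m} r * g r) \<le> C" for m r
        using C by (simp add: indicator_def)
    qed (rule g)
    then show ?thesis by (intro tendsto_cinner tendsto_const)
  qed
  have kb: "bounded_borel (\<lambda>r. complex_of_real (k r))" using symbol_bounded_borel(3)[OF k(1,2,2)] by simp
  have cut: "cut_exp m (complex_of_real (- t) + complex_of_real s) r = indicator {- real m..real m} r * complex_of_real (exp ((s - t) * r))" for m r
    by (simp add: cut_exp_def exp_of_real[symmetric] algebra_simps)
  have Kform: "cinner (K (ex m (complex_of_real (- t)) (ket x))) (ex m (complex_of_real s) (ket y)) =
      cinner (fc E (\<lambda>r. indicator {- real m..real m} r * complex_of_real (exp ((s - t) * r) * k r)) (ket x)) (ket y)" for m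
    unfolding K cinner_fc_ex[OF kb] cut by (simp add: mult.assoc)
  {
    assume ts: "t \<le> s"
    show "(\<lambda>m. cinner (K (ex m (complex_of_real (- t)) (ket x))) (ex m (complex_of_real s) (ket y)))
      \<longlonglongrightarrow> corr_kernel E k x t y s"
      unfolding Kform corr_kernel_def by (rule lim[OF symbol_bounded_borel(1)[OF k ts]])
  next
    assume st: "s \<le> t"
    have "cinner (K (ex m (complex_of_real (- t)) (ket x))) (ex m (complex_of_real s) (ket y))
      - cinner (ex m (complex_of_real (- t)) (ket x)) (ex m (complex_of_real s) (ket y)) =
      - cinner (fc E (\<lambda>r. indicator {- real m..real m} r * complex_of_real (exp ((s - t) * r) * (1 - k r))) (ket x)) (ket y)" for m
    proof -
      let ?z = "complex_of_real (- t) + complex_of_real s"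
      have "cinner (K (ex m (complex_of_real (- t)) (ket x))) (ex m (complex_of_real s) (ket y))
        - cinner (ex m (complex_of_real (- t)) (ket x)) (ex m (complex_of_real s) (ket y)) =
        cinner (fc E (\<lambda>r. cut_exp m ?z r * complex_of_real (k r) - cut_exp m ?z r) (ket x)) (ket y)"
        unfolding K cinner_fc_ex[OF kb] cinner_ex_ex
        by (simp only: fc_diff[OF bounded_borel_mult[OF bounded_borel_cut_exp kb] bounded_borel_cut_exp] cinner_diff_left)
      also have "(\<lambda>r. cut_exp m ?z r * complex_of_real (k r) - cut_exp m ?z r) =
        (\<lambda>r. (-1) * (indicator {- real m..real m} r * complex_of_real (exp ((s - t) * r) * (1 - k r))))"
        unfolding cut by (auto simp: algebra_simps)
      also have "fc E \<dots> (ket x) = (-1) *\<^sub>C fc E (\<lambda>r. indicator {- real m..real m} r * complex_of_real (exp ((s - t) * r) * (1 - k r))) (ket x)"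
        by (rule fc_scale[OF bounded_borel_mult[OF bounded_borel_indicator symbol_bounded_borel(2)[OF k(1,3,2) st]]]) simp
      finally show ?thesis by (simp only: cinner_scaleC_left_ell2) simp
    qed
    then show "(\<lambda>m. cinner (K (ex m (complex_of_real (- t)) (ket x))) (ex m (complex_of_real s) (ket y))
      - cinner (ex m (complex_of_real (- t)) (ket x)) (ex m (complex_of_real s) (ket y)))
      \<longlonglongrightarrow> - corr_kernel E (\<lambda>r. 1 - k r) x t y s"
      unfolding corr_kernel_def by (simp only:) (rule tendsto_minus[OF lim[OF symbol_bounded_borel(2)[OF k(1,3,2) st]]])
  }
qed

text \<open>The factors are approximated by entire analytic elements built from cut letters, on
  which the definition of the form prescribes the value and \<open>wick_pairs\<close> computes it.
  Since the times are sorted, \<open>i <= j\<close> implies \<open>t <= s\<close>, so every entry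
  falls into the case of \<open>ex_symbol_tendsto\<close> in which its limit is known.\<close>

theorem euclidean_form_det:
  assumes qf: "quasi_free_state a (fc E (\<lambda>r. complex_of_real (k r))) \<phi>"
    and S: "euclidean_form \<phi> \<alpha> ts S" and len: "length yss = length ts"
    and sorted: "sorted ts" and k: "symbol_bounded k (set ts)"
  shows "S (map (\<lambda>ys. prod_list (map factor ys)) yss) =
    Determinant.det (corr_matrix E k (concat (map2 (\<lambda>t ys. map (Pair t) ys) ts yss)))"
proof (rule LIMSEQ_unique)
  let ?K = "fc E (\<lambda>r. complex_of_real (k r))"
  interpret quasi_free a \<phi> ?K
    by unfold_locales (use qf in \<open>auto simp: quasi_free_state_def\<close>)
  define el where "el m y z = (case y of (x, c, b) \<Rightarrow> c *\<^sub>C 1 + b *\<^sub>C (cre m (ket x) z * ann m (ket x) z))" for m y z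
  define X where "X m = map (\<lambda>ys. prod_list (map (\<lambda>y. el m y 0) ys)) yss" for m
  define flat where "flat = concat (map2 (\<lambda>t ys. map (Pair t) ys) ts yss)"
  define P where "P m = map (\<lambda>(t, x, c, b). (c, b *\<^sub>C ex m (complex_of_real (- t)) (ket x), ex m (complex_of_real t) (ket x))) flat" for m
  note S' = S[unfolded euclidean_form_iff_multi_bounded]
  have el_ext: "entire_extension \<alpha> (el m y 0) (el m y)" for m y
    unfolding el_def
    by (cases y) (auto intro!: ext_add ext_one ext_scaleC ext_mult ext_cre ext_ann)
  show "(\<lambda>m. S (X m)) \<longlonglongrightarrow> S (map (\<lambda>ys. prod_list (map factor ys)) yss)"
  proof (rule multi_bounded_tendsto[OF conjunct1[OF S']])
    have el_lim: "(\<lambda>m. el m y 0) \<longlonglongrightarrow> factor y" for y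
      unfolding el_def factor_def number_at_def
      by (cases y) (auto intro!: tendsto_add tendsto_const tendsto_scaleC tendsto_mult cre_0_tendsto ann_0_tendsto)
    have "(\<lambda>m. prod_list (map (\<lambda>y. el m y 0) ys)) \<longlonglongrightarrow> prod_list (map factor ys)" for ys
      by (induction ys) (auto intro!: tendsto_mult el_lim)
    then show "(\<lambda>m. X m ! i) \<longlonglongrightarrow> map (\<lambda>ys. prod_list (map factor ys)) yss ! i" if "i < length ts" for i
      using that len by (simp add: X_def)
  qed (use len in \<open>auto simp: X_def\<close>)
  have "S (X m) = Determinant.det (pair_matrix (P m))" for m
  proof -
    define Fs where "Fs = map (\<lambda>ys z. prod_list (map (\<lambda>y. el m y z) ys)) yss"
    have "S (X m) = \<phi> (prod_list (map (\<lambda>i. (Fs ! i) (\<i> * complex_of_real (ts ! i))) [0..<length ts]))"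
    proof (rule conjunct2[OF S', rule_format], intro conjI allI impI)
      fix i assume "i < length ts"
      then show "entire_extension \<alpha> (X m ! i) (Fs ! i)"
        using len ext_prod_list[of "yss ! i" "\<lambda>y. el m y 0" "el m"] el_ext by (simp add: X_def Fs_def)
    qed (use len in \<open>auto simp: X_def Fs_def\<close>)
    also have "map (\<lambda>i. (Fs ! i) (\<i> * complex_of_real (ts ! i))) [0..<length ts]
       = map (\<lambda>i. (\<lambda>t ys. prod_list (map (\<lambda>y. el m y (\<i> * complex_of_real t)) ys)) (ts ! i) (yss ! i)) [0..<length ts]"
      using len by (intro map_cong) (auto simp: Fs_def)
    also have "\<dots> = map2 (\<lambda>t ys. prod_list (map (\<lambda>y. el m y (\<i> * complex_of_real t)) ys)) ts yss"
      by (rule map_upt_nth_map2) (simp add: len)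
    also have "prod_list \<dots> = prod_list (map (\<lambda>(t, y). el m y (\<i> * complex_of_real t)) flat)"
      unfolding prod_list_concat_map2 flat_def ..
    also have "map (\<lambda>(t, y). el m y (\<i> * complex_of_real t)) flat = map (\<lambda>(c, h, k). c *\<^sub>C 1 + star (a h) * a k) (P m)"
    proof -
      have "\<i> * (\<i> * complex_of_real t) = complex_of_real (- t)" "\<i> * cnj (\<i> * complex_of_real t) = complex_of_real t" for t
        by (simp_all add: algebra_simps flip: mult.assoc)
      then show ?thesis
        by (auto simp: P_def el_def cre_def ann_def star_a_scale scaleC_mult_left)
    qed
    finally show ?thesis by (simp add: wick_pairs)
  qed
  moreover have "(\<lambda>m. Determinant.det (pair_matrix (P m))) \<longlonglongrightarrow> Determinant.det (corr_matrix E k flat)"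
  proof (rule tendsto_det[where n = "length flat"])
    fix i j assume ij: "i < length flat" "j < length flat"
    obtain t x c b where i: "flat ! i = (t, x, c, b)" by (metis prod_cases4)
    obtain s y c' b' where j: "flat ! j = (s, y, c', b')" by (metis prod_cases4)
    have sub: "fst ` set flat \<subseteq> set ts" and srt: "sorted (map fst flat)"
      unfolding flat_def by (rule fst_concat_map2, rule sorted_concat_map2[OF sorted])
    have T: "t \<in> set ts" "s \<in> set ts" using ij i j sub by (metis fst_conv image_subset_iff nth_mem)+
    have le: "i \<le> j \<Longrightarrow> t \<le> s" "j \<le> i \<Longrightarrow> s \<le> t"
      using sorted_nth_mono[OF srt, of i j] sorted_nth_mono[OF srt, of j i] ij i j by auto
    have clin: "?K (b *\<^sub>C v) = b *\<^sub>C ?K v" for v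
      using clinear_scale[OF clinear_fc[OF symbol_bounded_borel(3)[OF k T(1) T(1)]]] by simp
    have entry: "pair_matrix (P m) $$ (i, j) = (if i = j then c else 0) + b * (cinner (?K (ex m (complex_of_real (- t)) (ket x))) (ex m (complex_of_real s) (ket y))
       - (if i \<le> j then 0 else cinner (ex m (complex_of_real (- t)) (ket x)) (ex m (complex_of_real s) (ket y))))" for m
      using ij i j by (simp add: pair_matrix_def P_def clin cinner_scaleC_left_ell2 algebra_simps)
    have entry': "corr_matrix E k flat $$ (i, j) = (if i = j then c else 0) + b * (if i \<le> j then corr_kernel E k x t y s else - corr_kernel E (\<lambda>r. 1 - k r) x t y s)"
      using ij i j by (simp add: corr_matrix_def)
    show "(\<lambda>m. pair_matrix (P m) $$ (i, j)) \<longlonglongrightarrow> corr_matrix E k flat $$ (i, j)"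
      unfolding entry entry'
      using ex_symbol_tendsto[OF k T refl] le
      by (intro tendsto_add tendsto_mult tendsto_const) auto
  qed (auto simp: pair_matrix_def P_def corr_matrix_def)
  ultimately show "(\<lambda>m. S (X m)) \<longlonglongrightarrow> Determinant.det (corr_matrix E k (concat (map2 (\<lambda>t ys. map (Pair t) ys) ts yss)))"
    by (simp add: flat_def)
qed

end

section \<open>Euclidean forms of the ground state\<close>

context car
begin

text \<open>The elements that preserve the closure of \<open>W\<close> by left multiplication,
  together with their adjoints, form a closed star-subalgebra containing the generators, hence
  everything; applying them to 1 gives the claim. Thus \<open>W\<close> may be any subspace, not
  only an algebra.\<close>

lemma closure_generated_UNIV:
  assumes gen: "cstar_generated (range a) = UNIV"
    and W: "csubspace W" "1 \<in> W"
    and a: "\<And>h A. A \<in> W \<Longrightarrow> a h * A \<in> closure W" and star_a: "\<And>h A. A \<in> W \<Longrightarrow> star (a h) * A \<in> closure W"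
  shows "closure W = UNIV"
proof -
  have lim: "L A \<in> closure W" if "A \<in> closure W" "\<And>B. B \<in> W \<Longrightarrow> L B \<in> closure W" "bounded_linear L" for L A
  proof -
    obtain X where X: "\<And>n. X n \<in> W" "X \<longlonglongrightarrow> A" using \<open>A \<in> closure W\<close> by (auto simp: closure_sequential)
    from closed_sequentially[OF closed_closure _ bounded_linear.tendsto[OF that(3) X(2)]]
    show ?thesis using that(2) X(1) by blast
  qed
  have cl_add: "A + B \<in> closure W" if AB: "A \<in> closure W" "B \<in> closure W" for A B
  proof -
    obtain X Y where "\<And>n. X n \<in> W" "X \<longlonglongrightarrow> A" "\<And>n. Y n \<in> W" "Y \<longlonglongrightarrow> B"
      using AB unfolding closure_sequential by blast
    then show ?thesis unfolding closure_sequential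
      using W by (intro exI[of _ "\<lambda>n. X n + Y n"]) (auto simp: csubspace_def intro: tendsto_add)
  qed
  have cl_scale: "c *\<^sub>C A \<in> closure W" if "A \<in> closure W" for c A
  proof (rule lim[OF that])
    show "c *\<^sub>C B \<in> closure W" if "B \<in> W" for B
      using W(1) that closure_subset unfolding csubspace_def by blast
  qed (rule bounded_bilinear.bounded_linear_right[OF bounded_bilinear_scaleC])
  define G where "G = {B. (\<forall>A\<in>closure W. B * A \<in> closure W) \<and> (\<forall>A\<in>closure W. star B * A \<in> closure W)}"
  have "star_subalgebra G"
    unfolding star_subalgebra_def G_def
    by (auto simp: distrib_right mult.assoc star_add star_mult star_star star_scaleC scaleC_mult_left intro: cl_add cl_scale)
  moreover have "closed G"
    unfolding closed_sequential_limits
  proof (intro allI impI)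
    fix X l assume "(\<forall>n. X n \<in> G) \<and> X \<longlonglongrightarrow> l"
    then have X: "\<And>n. X n \<in> G" "X \<longlonglongrightarrow> l" by auto
    have "l * A \<in> closure W" if "A \<in> closure W" for A
      using closed_sequentially[OF closed_closure _ tendsto_mult[OF X(2) tendsto_const]] X(1) that unfolding G_def by blast
    moreover have "star l * A \<in> closure W" if "A \<in> closure W" for A
      using closed_sequentially[OF closed_closure _ tendsto_mult[OF tendsto_star[OF X(2)] tendsto_const]] X(1) that unfolding G_def by blast
    ultimately show "l \<in> G" by (simp add: G_def)
  qed
  moreover have "range a \<subseteq> G"
  proof (intro image_subsetI)
    fix h
    have "a h * A \<in> closure W" if "A \<in> closure W" for A
      by (rule lim[OF that a bounded_linear_mult_right])
    moreover have "star (a h) * A \<in> closure W" if "A \<in> closure W" for A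
      by (rule lim[OF that star_a bounded_linear_mult_right])
    ultimately show "a h \<in> G" by (simp add: G_def)
  qed
  ultimately have "cstar_generated (range a) \<subseteq> G" unfolding cstar_generated_def by blast
  then have "B * 1 \<in> closure W" for B using gen W(2) closure_subset unfolding G_def by blast
  then show ?thesis by auto
qed

definition normal_word :: "'x ell2 list \<Rightarrow> 'x ell2 list \<Rightarrow> 'a" where
  "normal_word hs ks = prod_list (map (\<lambda>h. star (a h)) hs) * prod_list (map a ks)"

text \<open>The elements on which the quasi-free formula prescribes the values of the state; density
  will transfer identities from here to the whole algebra.\<close>

inductive_set normal_span :: "'a set" where
  word: "normal_word hs ks \<in> normal_span"
| sum: "A \<in> normal_span \<Longrightarrow> B \<in> normal_span \<Longrightarrow> A + B \<in> normal_span"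
| scalar: "A \<in> normal_span \<Longrightarrow> c *\<^sub>C A \<in> normal_span"

lemma normal_span_creator: "A \<in> normal_span \<Longrightarrow> star (a h) * A \<in> normal_span"
proof (induction rule: normal_span.induct)
  case (word hs ks)
  have "star (a h) * normal_word hs ks = normal_word (h # hs) ks" by (simp add: normal_word_def mult.assoc)
  then show ?case by (simp add: normal_span.word)
qed (auto simp: distrib_left scaleC_mult_right intro: normal_span.intros)

lemma normal_span_annihilator: "A \<in> normal_span \<Longrightarrow> a k * A \<in> normal_span"
proof (induction rule: normal_span.induct)
  case (word hs ks)
  show ?case
  proof (induction hs)
    case Nil
    have "a k * normal_word [] ks = normal_word [] (k # ks)" by (simp add: normal_word_def)
    then show ?case by (simp add: normal_span.word)
  next
    case (Cons h hs)
    have "a k * normal_word (h # hs) ks = (a k * star (a h)) * normal_word hs ks" by (simp add: normal_word_def mult.assoc)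
    also have "\<dots> = cinner h k *\<^sub>C normal_word hs ks + (-1) *\<^sub>C (star (a h) * (a k * normal_word hs ks))"
      by (simp add: a_star_a left_diff_distrib scaleC_mult_left mult.assoc scaleC_minus_one)
    finally show ?case
      using Cons by (auto intro!: normal_span.intros normal_span_creator)
  qed
qed (auto simp: distrib_left scaleC_mult_right intro: normal_span.intros)

lemma closure_normal_span:
  assumes "cstar_generated (range a) = UNIV" shows "closure normal_span = UNIV"
proof (rule closure_generated_UNIV[OF assms])
  show "csubspace normal_span" by (auto simp: csubspace_def intro: normal_span.intros)
  show "1 \<in> normal_span" using normal_span.word[of "[]" "[]"] by (simp add: normal_word_def)
qed (use closure_subset normal_span_creator normal_span_annihilator in blast)+

end

lemma (in cstar_state) continuous_semi: "X \<longlonglongrightarrow> x \<Longrightarrow> (\<lambda>n. semi (X n)) \<longlonglongrightarrow> semi x" for X :: "nat \<Rightarrow> 'a"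
  unfolding semi_def by (intro tendsto_real_sqrt tendsto_Re tendsto tendsto_mult tendsto_star)

locale ground_flow = car_flow E a \<alpha> + quasi_free a \<psi> "neg_proj E"
  for E :: "real set \<Rightarrow> 'x ell2 \<Rightarrow> 'x ell2" and a :: "'x ell2 \<Rightarrow> 'a::cstar_algebra"
    and \<alpha> :: "real \<Rightarrow> 'a \<Rightarrow> 'a" and \<psi> :: "'a \<Rightarrow> complex" +
  assumes gen: "cstar_generated (range a) = UNIV"
begin

lemma neg_proj_fc: "neg_proj E h = fc E (indicator {..<0}) h"
  by (simp add: neg_proj_def fc_indicator)

text \<open>The unitary \<open>U\<close> is a function of the Hamiltonian and commutes with the
  spectral projection, so the determinants on normal-ordered words do not change. The state composed
  with the flow is again a state, hence continuous, and density finishes the argument.\<close>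

lemma \<psi>_invariant: "\<psi> (\<alpha> t A) = \<psi> A"
proof -
  have st: "cstar_state (\<lambda>x. \<psi> (\<alpha> t x))"
    by unfold_locales
       (simp add: state_def clinear_def \<alpha>_add \<alpha>_scale add scale \<alpha>_one one scaleC_complex_def \<alpha>_mult \<alpha>_star pos)
  define U where "U = fc E (\<lambda>r. exp (\<i> * complex_of_real (t * r)))"
  have Ucinner: "cinner (neg_proj E (U h)) (U k) = cinner (neg_proj E h) k" for h k
  proof -
    let ?u = "\<lambda>r. exp (\<i> * complex_of_real (t * r))"
    have b: "bounded_borel ?u" "bounded_borel (indicator {..<0})"
      by (rule bounded_borel_exp_i, rule bounded_borel_indicator) simp
    have "cinner (neg_proj E (U h)) (U k) = cinner (fc E (\<lambda>r. indicator {..<0} r * ?u r) h) (fc E (\<lambda>r. cnj (cnj (?u r))) k)"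
      unfolding neg_proj_fc U_def fc_mult[OF b(2,1)] by simp
    also have "\<dots> = cinner (fc E (\<lambda>r. cnj (?u r) * (indicator {..<0} r * ?u r)) h) k"
      unfolding fc_mult[OF bounded_borel_cnj[OF b(1)] bounded_borel_mult[OF b(2,1)]] fc_adjoint[OF bounded_borel_cnj[OF b(1)], symmetric] ..
    also have "(\<lambda>r. cnj (?u r) * (indicator {..<0} r * ?u r)) = indicator {..<0}"
      by (auto simp: indicator_def mult.commute[of "cnj _"] mult_cnj_cmod exp_cnj simp flip: exp_add)
    finally show ?thesis by (simp add: neg_proj_fc)
  qed
  have "\<psi> (\<alpha> t A) = \<psi> A" if "A \<in> normal_span" for A
    using that
  proof (induction rule: normal_span.induct)
    case (word hs ks)
    have "\<alpha> t (prod_list xs) = prod_list (map (\<alpha> t) xs)" for xs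
      by (induction xs) (auto simp: \<alpha>_one \<alpha>_mult)
    then have "\<alpha> t (normal_word hs ks) = normal_word (map U hs) (map U ks)"
      by (simp add: normal_word_def \<alpha>_mult \<alpha>_star \<alpha>_a o_def U_def)
    then have "\<psi> (\<alpha> t (normal_word hs ks)) = \<psi> (normal_word (map U hs) (map U ks))" by simp
    also have "\<dots> = \<psi> (normal_word hs ks)"
    proof -
      have nw: "\<psi> (normal_word hs ks) = (if length hs = length ks
        then Determinant.det (Matrix.mat (length hs) (length hs) (\<lambda>(i, j). cinner (neg_proj E (rev hs ! i)) (ks ! j))) else 0)" for hs ks
        unfolding normal_word_def using normal_ordered[of "rev hs" ks] by simp
      have "Matrix.mat (length hs) (length hs) (\<lambda>(i, j). cinner (neg_proj E (rev (map U hs) ! i)) (map U ks ! j))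
          = Matrix.mat (length hs) (length hs) (\<lambda>(i, j). cinner (neg_proj E (rev hs ! i)) (ks ! j))"
        if "length hs = length ks"
        using that by (intro Matrix.cong_mat) (auto simp: Ucinner rev_map)
      then show ?thesis unfolding nw by simp
    qed
    finally show ?case .
  qed (simp_all add: \<alpha>_add \<alpha>_scale add scale)
  then have eq: "\<psi> (\<alpha> t B) = \<psi> B" if "B \<in> normal_span" for B using that .
  obtain X where X: "\<And>n. X n \<in> normal_span" "X \<longlonglongrightarrow> A"
    using closure_normal_span[OF gen] by (metis UNIV_I closure_sequential)
  have "(\<lambda>n. \<psi> (X n)) \<longlonglongrightarrow> \<psi> (\<alpha> t A)"
    using cstar_state.tendsto[OF st X(2)] eq[OF X(1)] by simp
  moreover have "(\<lambda>n. \<psi> (X n)) \<longlonglongrightarrow> \<psi> A" by (rule tendsto[OF X(2)])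
  ultimately show ?thesis by (rule LIMSEQ_unique)
qed

text \<open>The entire extension of \<open>t \<mapsto> \<alpha>\<^sub>t A\<close> satisfies \<open>F (z + t) = \<alpha>\<^sub>t (F z)\<close>. Only its weak form in the
  state is within reach of the scalar identity theorem, and it suffices.\<close>

definition wext :: "(complex \<Rightarrow> 'a) \<Rightarrow> bool" where
  "wext F \<longleftrightarrow> entire F \<and> (\<forall>X Y z t. \<psi> (X * F (z + complex_of_real t) * Y) = \<psi> (X * \<alpha> t (F z) * Y))"

lemma wext_entire: "wext F \<Longrightarrow> entire F"
  and wextD: "wext F \<Longrightarrow> \<psi> (X * F (z + complex_of_real t) * Y) = \<psi> (X * \<alpha> t (F z) * Y)"
  by (auto simp: wext_def)

text \<open>Both sides are holomorphic in \<open>z\<close> and agree for real \<open>z\<close>. On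
  the right-hand side, invariance of the state moves the automorphism from \<open>F z\<close> to the
  fixed elements \<open>X\<close> and \<open>Y\<close>.\<close>

lemma wext_ext:
  assumes "entire_extension \<alpha> A F" shows "wext F"
proof -
  have F: "entire F" "\<And>t. F (complex_of_real t) = \<alpha> t A" using assms by (auto simp: entire_extension_def)
  have "\<psi> (X * F (z + complex_of_real t) * Y) = \<psi> (X * \<alpha> t (F z) * Y)" for X Y z t
  proof (rule holomorphic_eq_on_reals[where f = "\<lambda>z. \<psi> (X * F (z + complex_of_real t) * Y)" and g = "\<lambda>z. \<psi> (X * \<alpha> t (F z) * Y)"])
    show "(\<lambda>z. \<psi> (X * F (z + complex_of_real t) * Y)) holomorphic_on UNIV"
      by (rule holomorphic_entire[OF entire_shift[OF F(1)]])
    have inv: "\<alpha> t (\<alpha> (- t) Z) = Z" for Z using \<alpha>_plus[of t "- t" Z] by (simp add: \<alpha>_0)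
    have "\<psi> (X * \<alpha> t (F z) * Y) = \<psi> (\<alpha> (- t) X * F z * \<alpha> (- t) Y)" for z
      using \<psi>_invariant[of t "\<alpha> (- t) X * F z * \<alpha> (- t) Y"] by (simp add: \<alpha>_mult inv)
    then show "(\<lambda>z. \<psi> (X * \<alpha> t (F z) * Y)) holomorphic_on UNIV"
      using holomorphic_entire[OF F(1)] by simp
    show "\<psi> (X * F (complex_of_real s + complex_of_real t) * Y) = \<psi> (X * \<alpha> t (F (complex_of_real s)) * Y)" for s
      using F(2)[of "s + t"] \<alpha>_plus[of t s A] by (simp add: F(2) add.commute)
  qed
  then show ?thesis using F(1) by (simp add: wext_def)
qed

lemma wext_mult:
  assumes "wext F" "wext G" shows "wext (\<lambda>z. F z * G z)"
proof -
  have "\<psi> (X * (F (z + complex_of_real t) * G (z + complex_of_real t)) * Y) = \<psi> (X * \<alpha> t (F z * G z) * Y)" for X Y z t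
    using wextD[OF assms(2), of "X * F (z + complex_of_real t)" z t Y] wextD[OF assms(1), of X z t "\<alpha> t (G z) * Y"]
    by (simp add: mult.assoc \<alpha>_mult)
  then show ?thesis using assms by (simp add: wext_def entire_mult)
qed

lemma wext_add: "wext F \<Longrightarrow> wext G \<Longrightarrow> wext (\<lambda>z. F z + G z)"
  by (auto simp: wext_def entire_add distrib_left distrib_right add \<alpha>_add)

lemma wext_scaleC: "wext F \<Longrightarrow> wext (\<lambda>z. c *\<^sub>C F z)"
  by (auto simp: wext_def entire_scaleC scale scaleC_mult_left scaleC_mult_right \<alpha>_scale)

lemma wext_one: "wext (\<lambda>_. 1)"
  using wext_ext[OF ext_one[of 1]] by simp

lemma wext_shift:
  assumes "wext F" shows "wext (\<lambda>z. F (z + c))"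
proof -
  have "\<psi> (X * F (z + complex_of_real t + c) * Y) = \<psi> (X * \<alpha> t (F (z + c)) * Y)" for X Y z t
    using wextD[OF assms, of X "z + c" t Y] by (simp add: add_ac)
  then show ?thesis using assms by (simp add: wext_def entire_shift)
qed

lemma wext_star:
  assumes "wext F" shows "wext (\<lambda>z. star (F (cnj z)))"
proof -
  have "\<psi> (X * star (F (cnj (z + complex_of_real t))) * Y) = \<psi> (X * \<alpha> t (star (F (cnj z))) * Y)" for X Y z t
  proof -
    have "\<psi> (X * star Z * Y) = cnj (\<psi> (star Y * Z * star X))" for Z
      using hermitian[of "star Y * Z * star X"] by (simp add: star_mult star_star mult.assoc)
    then show ?thesis using wextD[OF assms, of "star Y" "cnj z" t "star X"] by (simp add: \<alpha>_star)
  qed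
  then show ?thesis using assms by (simp add: wext_def entire_star)
qed

text \<open>By invariance the scalar function is constant on the reals, hence everywhere. In
  particular all imaginary times may be shifted together.\<close>

lemma wext_translation:
  assumes "wext F" shows "\<psi> (F z) = \<psi> (F w)"
proof -
  have hol: "(\<lambda>z. \<psi> (F z)) holomorphic_on UNIV"
    using holomorphic_entire[OF wext_entire[OF assms], of 1 1] by simp
  have "\<psi> (F (complex_of_real t)) = \<psi> (F 0)" for t
    using wextD[OF assms, of 1 0 t 1] by (simp add: \<psi>_invariant)
  then have "\<psi> (F z) = \<psi> (F 0)" for z
    by (rule holomorphic_eq_on_reals[OF hol holomorphic_on_const])
  then show ?thesis by metis
qed

section \<open>Normal ordering for the ground state and contractivity in imaginary time\<close>

abbreviation pos_part :: "'x ell2 \<Rightarrow> 'x ell2" where "pos_part \<equiv> E {0..}"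
abbreviation neg_part :: "'x ell2 \<Rightarrow> 'x ell2" where "neg_part \<equiv> E {..<0}"

lemma pos_part_add_neg_part: "pos_part h + neg_part h = h"
proof -
  have "(\<lambda>r. indicator {0..} r + indicator {..<0} r) = (\<lambda>_::real. 1::complex)" by (auto simp: indicator_def)
  then have "fc E (indicator {0..}) h + fc E (indicator {..<0}) h = h"
    using fc_add[of "indicator {0..}" "indicator {..<0}" h] by (simp add: bounded_borel_indicator fc_one)
  then show ?thesis by (simp add: fc_indicator)
qed

lemma ex_part:
  assumes "B \<in> sets borel"
  shows "ex n z (E B h) = fc E (\<lambda>r. cut_exp n z r * indicator B r) h" and "E B (ex n z (E B h)) = ex n z (E B h)"
proof -
  show 1: "ex n z (E B h) = fc E (\<lambda>r. cut_exp n z r * indicator B r) h"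
    using assms by (simp add: ex_def fc_mult bounded_borel_indicator fc_indicator)
  have "E B (ex n z (E B h)) = fc E (\<lambda>r. indicator B r * (cut_exp n z r * indicator B r)) h"
    unfolding 1 using assms by (subst fc_mult) (auto simp: fc_indicator)
  also have "(\<lambda>r. indicator B r * (cut_exp n z r * indicator B r)) = (\<lambda>r. cut_exp n z r * indicator B r)"
    by (auto simp: indicator_def)
  finally show "E B (ex n z (E B h)) = ex n z (E B h)" using 1 by simp
qed

lemma wext_cre: "wext (cre n h)" and wext_ann: "wext (ann n h)"
  using wext_ext ext_cre ext_ann by blast+

lemma \<psi>_number: "\<psi> (star (a g) * a g) = cinner (neg_part g) g"
  using normal_ordered[of "[g]" "[g]"] by (simp add: neg_proj_def det_single)

text \<open>The ground state fills the negative energies and leaves the others, the kernel of the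
  Hamiltonian included, empty: creating in a filled mode or annihilating in an empty one kills the
  GNS vector.\<close>

lemma semi_annihilator:
  shows "semi (cre n (neg_part h) z) = 0" and "semi (ann n (pos_part h) z) = 0"
proof -
  let ?g = "ex n (\<i> * z) (neg_part h)"
  have "\<psi> (a ?g * star (a ?g)) = cinner ?g ?g - \<psi> (star (a ?g) * a ?g)"
    by (simp add: a_star_a diff scale one)
  also have "\<dots> = 0" using ex_part(2)[of "{..<0}"] by (simp add: \<psi>_number)
  finally show "semi (cre n (neg_part h) z) = 0" by (simp add: semi_def cre_def star_star)
  let ?g = "ex n (\<i> * cnj z) (pos_part h)"
  have "neg_part ?g = neg_part (pos_part ?g)" using ex_part(2)[of "{0..}"] by simp
  also have "\<dots> = E ({..<0} \<inter> {0..}) ?g" by (simp add: E_Int)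
  also have "{..<0} \<inter> {0..} = ({} :: real set)" by auto
  finally have "neg_part ?g = 0" by (simp add: E_empty)
  then show "semi (ann n (pos_part h) z) = 0" by (simp add: semi_def ann_def \<psi>_number)
qed

text \<open>At the imaginary time the creator carries the factor exp (- t r) with r >= 0 and the
  annihilator exp (t r) with r < 0; both are at most 1.\<close>

lemma norm_creator_le:
  assumes "0 \<le> t"
  shows "norm (cre n (pos_part h) (\<i> * complex_of_real t)) \<le> norm h"
    and "norm (ann n (neg_part h) (\<i> * complex_of_real t)) \<le> norm h"
proof -
  have bound: "cmod (cut_exp n (complex_of_real s) r * indicator B r) \<le> 1" if "\<And>r. r \<in> B \<Longrightarrow> s * r \<le> 0" for s r B
    using that[of r] by (auto simp: cut_exp_def indicator_def norm_mult)
  have le: "norm (ex n (complex_of_real s) (E B h)) \<le> norm h" if "\<And>r. r \<in> B \<Longrightarrow> s * r \<le> 0" "B \<in> sets borel" for s B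
    unfolding ex_part(1)[OF that(2)]
    using norm_fc_le[of "\<lambda>r. cut_exp n (complex_of_real s) r * indicator B r" 1 h] bound[OF that(1)] that(2)
    by (simp add: bounded_borel_mult bounded_borel_indicator)
  have *: "\<i> * (\<i> * complex_of_real t) = complex_of_real (- t)" "\<i> * cnj (\<i> * complex_of_real t) = complex_of_real t"
    by (simp_all add: algebra_simps flip: mult.assoc)
  show "norm (cre n (pos_part h) (\<i> * complex_of_real t)) \<le> norm h"
    unfolding cre_def norm_star * by (rule order_trans[OF norm_a_le le]) (use assms in auto)
  show "norm (ann n (neg_part h) (\<i> * complex_of_real t)) \<le> norm h"
    unfolding ann_def * by (rule order_trans[OF norm_a_le le]) (use assms in \<open>auto simp: mult_nonneg_nonpos\<close>)
qed

lemma semi_bounded_mult: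
  assumes "\<exists>C. \<forall>t\<ge>0. semi (F (\<i> * complex_of_real t)) \<le> C" "\<And>t. 0 \<le> t \<Longrightarrow> norm (c (\<i> * complex_of_real t)) \<le> K"
  shows "\<exists>C. \<forall>t\<ge>0. semi (c (\<i> * complex_of_real t) * F (\<i> * complex_of_real t)) \<le> C"
proof -
  obtain C where C: "\<And>t. 0 \<le> t \<Longrightarrow> semi (F (\<i> * complex_of_real t)) \<le> C" using assms(1) by blast
  have "semi (c (\<i> * complex_of_real t) * F (\<i> * complex_of_real t)) \<le> K * C" if "0 \<le> t" for t
  proof (rule order_trans[OF semi_mult_le mult_mono])
    show "0 \<le> K" using assms(2)[OF that] norm_ge_zero order_trans by blast
  qed (use that C assms(2) in auto)
  then show ?thesis by blast
qed

text \<open>Normal ordering with respect to the ground state: functions \<open>F\<close> whose imaginary time evolution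
  \<open>F (it)\<close> stays bounded in the GNS seminorm, since the annihilators at the right end vanish.\<close>

inductive_set normal_funs :: "(complex \<Rightarrow> 'a) set" where
  unit: "(\<lambda>_. 1) \<in> normal_funs"
| cre: "F \<in> normal_funs \<Longrightarrow> (\<lambda>z. cre n (pos_part h) z * F z) \<in> normal_funs"
| ann: "F \<in> normal_funs \<Longrightarrow> (\<lambda>z. ann n (neg_part h) z * F z) \<in> normal_funs"
| null_cre: "wext X \<Longrightarrow> (\<lambda>z. X z * cre n (neg_part h) z) \<in> normal_funs"
| null_ann: "wext X \<Longrightarrow> (\<lambda>z. X z * ann n (pos_part h) z) \<in> normal_funs"
| sum: "F \<in> normal_funs \<Longrightarrow> G \<in> normal_funs \<Longrightarrow> (\<lambda>z. F z + G z) \<in> normal_funs"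
| scalar: "F \<in> normal_funs \<Longrightarrow> (\<lambda>z. c *\<^sub>C F z) \<in> normal_funs"

lemma normal_funs_wext: "F \<in> normal_funs \<Longrightarrow> wext F"
  by (induction rule: normal_funs.induct)
     (auto intro: wext_one wext_mult wext_add wext_scaleC wext_cre wext_ann)

lemma normal_funs_bounded: "F \<in> normal_funs \<Longrightarrow> \<exists>C. \<forall>t\<ge>0. semi (F (\<i> * complex_of_real t)) \<le> C"
proof (induction rule: normal_funs.induct)
  case (cre F n h)
  then show ?case by (intro semi_bounded_mult[where K = "norm h"] norm_creator_le)
next
  case (ann F n h)
  then show ?case by (intro semi_bounded_mult[where K = "norm h"] norm_creator_le)
next
  case (null_cre X n h)
  have "semi (X z * cre n (neg_part h) z) \<le> 0" for z
    using semi_mult_le[of "X z" "cre n (neg_part h) z"] by (simp add: semi_annihilator)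
  then show ?case by blast
next
  case (null_ann X n h)
  have "semi (X z * ann n (pos_part h) z) \<le> 0" for z
    using semi_mult_le[of "X z" "ann n (pos_part h) z"] by (simp add: semi_annihilator)
  then show ?case by blast
next
  case (sum F G)
  then obtain C D where "\<forall>t\<ge>0. semi (F (\<i> * complex_of_real t)) \<le> C" "\<forall>t\<ge>0. semi (G (\<i> * complex_of_real t)) \<le> D" by blast
  then show ?case by (intro exI[of _ "C + D"]) (blast intro: order_trans[OF semi_triangle] add_mono)
next
  case (scalar F c)
  then obtain C where "\<forall>t\<ge>0. semi (F (\<i> * complex_of_real t)) \<le> C" by blast
  then show ?case by (intro exI[of _ "cmod c * C"]) (auto simp: semi_scale intro: mult_left_mono)
qed (auto intro: exI[of _ 1])

text \<open>The two exponents are opposite and cancel in the anticommutator, which therefore does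
  not depend on \<open>z\<close>; this keeps the scalars that arise in normal ordering
  constant.\<close>

lemma ann_cre: "ann n k z * cre m h z = cinner (ex m 0 h) (ex n 0 k) *\<^sub>C 1 - cre m h z * ann n k z"
proof -
  have "cinner (ex m (\<i> * z) h) (ex n (\<i> * cnj z) k) = cinner (ex m (\<i> * z) h) (fc E (\<lambda>r. cnj (cut_exp n (cnj (\<i> * cnj z)) r)) k)"
    by (simp add: ex_def cnj_cut_exp)
  also have "\<dots> = cinner (fc E (\<lambda>r. cut_exp n (- (\<i> * z)) r * cut_exp m (\<i> * z) r) h) k"
    by (simp add: ex_def fc_mult flip: fc_adjoint)
  also have "(\<lambda>r. cut_exp n (- (\<i> * z)) r * cut_exp m (\<i> * z) r) = (\<lambda>r. cut_exp n 0 r * cut_exp m 0 r)"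
    by (auto simp: cut_exp_def indicator_def simp flip: exp_add)
  also have "cinner (fc E (\<lambda>r. cut_exp n 0 r * cut_exp m 0 r) h) k = cinner (ex m 0 h) (fc E (\<lambda>r. cnj (cut_exp n 0 r)) k)"
    by (simp add: ex_def fc_mult fc_adjoint)
  also have "\<dots> = cinner (ex m 0 h) (ex n 0 k)" by (simp add: ex_def cnj_cut_exp)
  finally show ?thesis by (simp add: ann_def cre_def a_star_a)
qed

lemma cre_cre: "cre n k z * cre m h z = (-1) *\<^sub>C (cre m h z * cre n k z)"
  unfolding cre_def scaleC_minus_one by (rule star_a_star_a)

lemma ann_ann: "ann n k z * ann m h z = (-1) *\<^sub>C (ann m h z * ann n k z)"
  unfolding ann_def scaleC_minus_one by (rule a_anticommute)

text \<open>Letters that annihilate the ground state are moved to the right. Passing another letter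
  leaves at most a scalar multiple of the remaining function, and in front of a vanishing right end
  they are absorbed into the prefix \<open>X\<close>.\<close>

lemma normal_funs_left_annihilator:
  assumes "F \<in> normal_funs"
  shows "(\<lambda>z. cre m (neg_part k) z * F z) \<in> normal_funs \<and> (\<lambda>z. ann m (pos_part k) z * F z) \<in> normal_funs"
  using assms
proof (induction rule: normal_funs.induct)
  case unit
  show ?case using normal_funs.null_cre[OF wext_one, of m k] normal_funs.null_ann[OF wext_one, of m k] by simp
next
  case (cre F n h)
  have "(\<lambda>z. cre m (neg_part k) z * (cre n (pos_part h) z * F z)) = (\<lambda>z. (-1) *\<^sub>C (cre n (pos_part h) z * (cre m (neg_part k) z * F z)))"
    by (simp add: cre_cre[of m _ _ n] scaleC_mult_left flip: mult.assoc)
  moreover have "(\<lambda>z. ann m (pos_part k) z * (cre n (pos_part h) z * F z)) =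
     (\<lambda>z. cinner (ex n 0 (pos_part h)) (ex m 0 (pos_part k)) *\<^sub>C F z + (-1) *\<^sub>C (cre n (pos_part h) z * (ann m (pos_part k) z * F z)))"
    by (simp add: ann_cre scaleC_mult_left left_diff_distrib scaleC_minus_one flip: mult.assoc)
  ultimately show ?case using cre by (auto intro!: normal_funs.intros)
next
  case (ann F n h)
  have "(\<lambda>z. ann m (pos_part k) z * (ann n (neg_part h) z * F z)) = (\<lambda>z. (-1) *\<^sub>C (ann n (neg_part h) z * (ann m (pos_part k) z * F z)))"
    by (simp add: ann_ann[of m _ _ n] scaleC_mult_left flip: mult.assoc)
  moreover have "(\<lambda>z. cre m (neg_part k) z * (ann n (neg_part h) z * F z)) =
     (\<lambda>z. cinner (ex m 0 (neg_part k)) (ex n 0 (neg_part h)) *\<^sub>C F z + (-1) *\<^sub>C (ann n (neg_part h) z * (cre m (neg_part k) z * F z)))"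
    by (simp add: ann_cre scaleC_mult_left left_diff_distrib scaleC_minus_one flip: mult.assoc)
  ultimately show ?case using ann by (auto intro!: normal_funs.intros)
next
  case (null_cre X n h)
  then show ?case
    using normal_funs.null_cre[OF wext_mult[OF wext_cre[of m "neg_part k"] null_cre], of n h]
      normal_funs.null_cre[OF wext_mult[OF wext_ann[of m "pos_part k"] null_cre], of n h] by (simp add: mult.assoc)
next
  case (null_ann X n h)
  then show ?case
    using normal_funs.null_ann[OF wext_mult[OF wext_cre[of m "neg_part k"] null_ann], of n h]
      normal_funs.null_ann[OF wext_mult[OF wext_ann[of m "pos_part k"] null_ann], of n h] by (simp add: mult.assoc)
qed (auto simp: distrib_left scaleC_mult_right intro: normal_funs.intros)

lemma cre_add: "cre m (h + k) z = cre m h z + cre m k z" and ann_add: "ann m (h + k) z = ann m h z + ann m k z"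
  by (simp_all add: cre_def ann_def ex_add a_add star_add)

lemma normal_funs_left:
  assumes "F \<in> normal_funs"
  shows "(\<lambda>z. cre m h z * F z) \<in> normal_funs" and "(\<lambda>z. ann m h z * F z) \<in> normal_funs"
proof -
  have "(\<lambda>z. cre m h z * F z) = (\<lambda>z. cre m (pos_part h) z * F z + cre m (neg_part h) z * F z)"
    by (simp flip: distrib_right cre_add add: pos_part_add_neg_part)
  then show "(\<lambda>z. cre m h z * F z) \<in> normal_funs"
    using assms normal_funs_left_annihilator[OF assms] by (auto intro!: normal_funs.intros)
  have "(\<lambda>z. ann m h z * F z) = (\<lambda>z. ann m (pos_part h) z * F z + ann m (neg_part h) z * F z)"
    by (simp flip: distrib_right ann_add add: pos_part_add_neg_part)
  then show "(\<lambda>z. ann m h z * F z) \<in> normal_funs"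
    using assms normal_funs_left_annihilator[OF assms] by (auto intro!: normal_funs.intros)
qed

text \<open>Serves two dense sets: the values at 0 of the normally ordered functions, and the entire
  analytic elements.\<close>

lemma letters_dense:
  assumes "csubspace W" "1 \<in> W"
    and "\<And>m h A. A \<in> W \<Longrightarrow> cre m h 0 * A \<in> W" "\<And>m h A. A \<in> W \<Longrightarrow> ann m h 0 * A \<in> W"
  shows "closure W = UNIV"
proof (rule closure_generated_UNIV[OF gen assms(1,2)])
  fix h A assume "A \<in> W"
  then show "a h * A \<in> closure W"
    unfolding closure_sequential
    using assms(4) tendsto_mult[OF ann_0_tendsto tendsto_const, of h A]
    by (intro exI[of _ "\<lambda>m. ann m h 0 * A"]) simp
  from \<open>A \<in> W\<close> show "star (a h) * A \<in> closure W"
    unfolding closure_sequential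
    using assms(3) tendsto_mult[OF cre_0_tendsto tendsto_const, of h A]
    by (intro exI[of _ "\<lambda>m. cre m h 0 * A"]) simp
qed

lemma closure_normal_funs: "closure ((\<lambda>F. F 0) ` normal_funs) = UNIV"
proof (rule letters_dense)
  show "csubspace ((\<lambda>F. F 0) ` normal_funs)"
    unfolding csubspace_def using normal_funs.sum normal_funs.scalar by (auto simp: image_iff)
  show "1 \<in> (\<lambda>F. F 0) ` normal_funs" using normal_funs.unit by (auto simp: image_iff)
  fix m h A assume "A \<in> (\<lambda>F. F 0) ` normal_funs"
  then obtain F where F: "F \<in> normal_funs" "A = F 0" by blast
  show "cre m h 0 * A \<in> (\<lambda>F. F 0) ` normal_funs"
    using normal_funs_left(1)[OF F(1), of m h] F(2) by (force simp: image_iff)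
  show "ann m h 0 * A \<in> (\<lambda>F. F 0) ` normal_funs"
    using normal_funs_left(2)[OF F(1), of m h] F(2) by (force simp: image_iff)
qed

text \<open>Log-convexity: \<open>g t\<^sup>2 \<le> g 0 * g (2 t)\<close> for \<open>g t = semi (F (it))\<close>, and iterating this against the
  boundedness of \<open>g\<close> forces \<open>g t \<le> g 0\<close>.\<close>

lemma normal_funs_contraction:
  assumes F: "F \<in> normal_funs" and t: "0 \<le> t"
  shows "semi (F (\<i> * complex_of_real t)) \<le> semi (F 0)"
proof -
  define g where "g t = semi (F (\<i> * complex_of_real t))" for t
  note w = normal_funs_wext[OF F]
  have step: "(g t)\<^sup>2 \<le> g 0 * g (2 * t)" for t
  proof -
    \<comment> \<open>Translation by \<open>- i t\<close> shifts half of the imaginary time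
      \<open>2 t\<close> to the left factor: at 0 the function pairs \<open>F 0\<close> with
      \<open>F (2 i t)\<close>, and at \<open>- i t\<close> it is the square of
      \<open>F (i t)\<close>.\<close>
    define H where "H z = star (F (cnj z)) * F (z + \<i> * complex_of_real (2 * t))" for z
    have "wext H" unfolding H_def by (intro wext_mult wext_star wext_shift w)
    then have "\<psi> (H (- (\<i> * complex_of_real t))) = \<psi> (H 0)" by (rule wext_translation)
    moreover have "H (- (\<i> * complex_of_real t)) = star (F (\<i> * complex_of_real t)) * F (\<i> * complex_of_real t)"
      by (simp add: H_def algebra_simps)
    ultimately have "\<psi> (star (F (\<i> * complex_of_real t)) * F (\<i> * complex_of_real t)) = \<psi> (star (F 0) * F (\<i> * complex_of_real (2 * t)))"
      by (simp add: H_def)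
    then have "(g t)\<^sup>2 \<le> cmod (\<psi> (star (F 0) * F (\<i> * complex_of_real (2 * t))))"
      unfolding g_def semi_sq by (metis complex_Re_le_cmod)
    also have "\<dots> \<le> semi (F 0) * g (2 * t)" unfolding g_def by (rule cmod_le_semi)
    finally show ?thesis by (simp add: g_def)
  qed
  have nn: "0 \<le> g t" for t by (simp add: g_def)
  obtain C where C: "\<And>t. 0 \<le> t \<Longrightarrow> g t \<le> C" using normal_funs_bounded[OF F] unfolding g_def by blast
  have "g t \<le> g 0"
  proof (cases "g 0 = 0")
    case True
    then show ?thesis using step[of t] by simp
  next
    case False
    with nn[of 0] have g0: "0 < g 0" by linarith
    show ?thesis
    proof (rule ccontr)
      assume "\<not> g t \<le> g 0"
      define q where "q = g t / g 0"
      have q: "1 < q" using g0 \<open>\<not> g t \<le> g 0\<close> by (simp add: q_def)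
      have pow: "q ^ (2 ^ n) * g 0 \<le> g (2 ^ n * t)" for n
      proof (induction n)
        case 0
        then show ?case using g0 by (simp add: q_def)
      next
        case (Suc n)
        have "(q ^ (2 ^ n) * g 0)\<^sup>2 \<le> (g (2 ^ n * t))\<^sup>2" using Suc g0 q by (intro power_mono) auto
        also have "\<dots> \<le> g 0 * g (2 * (2 ^ n * t))" by (rule step)
        finally have "g 0 * (q ^ (2 ^ Suc n) * g 0) \<le> g 0 * g (2 ^ Suc n * t)"
          unfolding power_mult_distrib power_mult[symmetric] by (simp add: power2_eq_square mult_ac)
        then show ?case using g0 by simp
      qed
      obtain n where n: "C / g 0 < q ^ n" using q real_arch_pow by blast
      also have "q ^ n \<le> q ^ (2 ^ n)" using q by (intro power_increasing) (auto simp: less_imp_le less_exp)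
      finally have "C < q ^ (2 ^ n) * g 0" using g0 by (simp add: field_simps)
      with pow[of n] C[of "2 ^ n * t"] t show False by simp
    qed
  qed
  then show ?thesis by (simp add: g_def)
qed

text \<open>For a general \<open>G\<close> no bound on its imaginary time evolution is known
  beforehand, so log-convexity alone does not help. Instead \<open>G\<close> is tested against the
  dense normally ordered functions: translation moves the time to them, and they contract. Finally
  the test elements approximate \<open>G (i t)\<close> itself.\<close>

lemma wext_contraction:
  assumes G: "wext G" and t: "0 \<le> t"
  shows "semi (G (\<i> * complex_of_real t)) \<le> semi (G 0)"
proof -
  let ?G = "G (\<i> * complex_of_real t)"
  have pre: "cmod (\<psi> (star (F 0) * ?G)) \<le> semi (F 0) * semi (G 0)" if F: "F \<in> normal_funs" for F
  proof -
    define H where "H z = star (F (cnj z)) * G (z + \<i> * complex_of_real t)" for z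
    have "wext H" unfolding H_def by (intro wext_mult wext_star wext_shift normal_funs_wext F G)
    then have "\<psi> (H 0) = \<psi> (H (- (\<i> * complex_of_real t)))" by (rule wext_translation)
    then have "\<psi> (star (F 0) * ?G) = \<psi> (star (F (\<i> * complex_of_real t)) * G 0)"
      by (simp add: H_def)
    then have "cmod (\<psi> (star (F 0) * ?G)) \<le> semi (F (\<i> * complex_of_real t)) * semi (G 0)"
      using cmod_le_semi by metis
    also have "\<dots> \<le> semi (F 0) * semi (G 0)"
      by (intro mult_right_mono normal_funs_contraction F t semi_nonneg)
    finally show ?thesis .
  qed
  obtain B where B: "\<And>n. B n \<in> (\<lambda>F. F 0) ` normal_funs" "B \<longlonglongrightarrow> ?G"
    using closure_normal_funs by (metis UNIV_I closure_sequential)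
  have "cmod (\<psi> (star ?G * ?G)) \<le> semi ?G * semi (G 0)"
  proof (rule LIMSEQ_le)
    show "(\<lambda>n. cmod (\<psi> (star (B n) * ?G))) \<longlonglongrightarrow> cmod (\<psi> (star ?G * ?G))"
      by (intro tendsto_norm tendsto tendsto_mult tendsto_star B tendsto_const)
    show "(\<lambda>n. semi (B n) * semi (G 0)) \<longlonglongrightarrow> semi ?G * semi (G 0)"
      by (intro tendsto_mult continuous_semi B tendsto_const)
    show "\<exists>N. \<forall>n\<ge>N. cmod (\<psi> (star (B n) * ?G)) \<le> semi (B n) * semi (G 0)"
      using pre B(1) by (auto simp: image_iff) metis
  qed
  then have "(semi ?G)\<^sup>2 \<le> semi ?G * semi (G 0)"
    unfolding semi_sq by (meson complex_Re_le_cmod order_trans)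
  then show ?thesis
    using semi_nonneg[of ?G] semi_nonneg[of "G 0"] by (cases "semi ?G = 0") (auto simp: power2_eq_square)
qed

text \<open>The imaginary times are measured from \<open>t0\<close>, and \<open>z\<close> moves all
  factors together; this makes the product a function to which translation and contraction
  apply.\<close>

definition time_prod :: "real \<Rightarrow> real list \<Rightarrow> (complex \<Rightarrow> 'a) list \<Rightarrow> complex \<Rightarrow> 'a" where
  "time_prod t0 ts Fs z = prod_list (map2 (\<lambda>t F. F (z + \<i> * complex_of_real (t - t0))) ts Fs)"

lemma wext_time_prod: "\<forall>F\<in>set Fs. wext F \<Longrightarrow> wext (time_prod t0 ts Fs)"
proof (induction ts arbitrary: Fs)
  case Nil
  then show ?case using wext_one by (simp add: time_prod_def[abs_def])
next
  case (Cons t ts)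
  show ?case
  proof (cases Fs)
    case Nil
    then show ?thesis using wext_one by (simp add: time_prod_def[abs_def])
  next
    case (Cons F Gs)
    then have "time_prod t0 (t # ts) Fs = (\<lambda>z. F (z + \<i> * complex_of_real (t - t0)) * time_prod t0 ts Gs z)"
      by (simp add: time_prod_def[abs_def])
    then show ?thesis using Cons Cons.IH[of Gs] Cons.prems by (simp add: wext_mult wext_shift)
  qed
qed

text \<open>Moving the reference time from \<open>t0\<close> to the first time \<open>t\<close> is
  an evolution by \<open>t - t0 >= 0\<close>, which contracts. The first factor then stands at time
  0 and is pulled out by \<open>semi_mult_le\<close>.\<close>

lemma semi_time_prod_le:
  assumes "sorted (t0 # ts)" "\<forall>F\<in>set Fs. wext F" "length Fs = length ts"
  shows "semi (time_prod t0 ts Fs 0) \<le> prod_list (map (\<lambda>F. norm (F 0)) Fs)"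
  using assms
proof (induction ts arbitrary: Fs t0)
  case Nil
  then show ?case by (simp add: time_prod_def)
next
  case (Cons t ts)
  then obtain F Gs where Fs: "Fs = F # Gs" by (cases Fs) auto
  have shift: "time_prod t0 (t # ts) Fs 0 = time_prod t (t # ts) Fs (\<i> * complex_of_real (t - t0))"
    unfolding time_prod_def by (intro arg_cong[where f = prod_list] map_cong refl) (auto simp: algebra_simps)
  have "semi (time_prod t0 (t # ts) Fs 0) \<le> semi (time_prod t (t # ts) Fs 0)"
    unfolding shift using Cons.prems by (intro wext_contraction wext_time_prod) auto
  also have "time_prod t (t # ts) Fs 0 = F 0 * time_prod t ts Gs 0" by (simp add: time_prod_def Fs)
  also have "semi (F 0 * time_prod t ts Gs 0) \<le> norm (F 0) * semi (time_prod t ts Gs 0)" by (rule semi_mult_le)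
  also have "\<dots> \<le> norm (F 0) * prod_list (map (\<lambda>F. norm (F 0)) Gs)"
    using Cons.prems Fs by (intro mult_left_mono Cons.IH) auto
  finally show ?case by (simp add: Fs)
qed

text \<open>Translation invariance first puts the earliest time at 0, whatever its sign.\<close>

lemma cmod_time_prod_le:
  assumes "sorted ts" "\<forall>F\<in>set Fs. wext F" "length Fs = length ts"
  shows "cmod (\<psi> (time_prod 0 ts Fs 0)) \<le> prod_list (map (\<lambda>F. norm (F 0)) Fs)"
proof (cases ts)
  case Nil
  then show ?thesis using assms by (simp add: time_prod_def one)
next
  case (Cons t ts')
  have "time_prod 0 ts Fs 0 = time_prod t ts Fs (\<i> * complex_of_real t)"
    unfolding time_prod_def by (intro arg_cong[where f = prod_list] map_cong refl) (auto simp: algebra_simps)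
  then have "\<psi> (time_prod 0 ts Fs 0) = \<psi> (time_prod t ts Fs 0)"
    using wext_translation[OF wext_time_prod[OF assms(2)]] by metis
  then have "cmod (\<psi> (time_prod 0 ts Fs 0)) \<le> semi (time_prod t ts Fs 0)"
    using cmod_le_semi[of 1 "time_prod t ts Fs 0"] by simp
  also have "\<dots> \<le> prod_list (map (\<lambda>F. norm (F 0)) Fs)"
    by (rule semi_time_prod_le) (use assms Cons in auto)
  finally show ?thesis .
qed

lemma ext_0: "entire_extension \<alpha> A F \<Longrightarrow> F 0 = A"
  unfolding entire_extension_def by (metis \<alpha>_0 of_real_0)

lemma prod_list_update_linear:
  fixes xs :: "'a list"
  assumes "i < length xs"
  shows "prod_list (xs[i := x + y]) = prod_list (xs[i := x]) + prod_list (xs[i := y])"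
    and "prod_list (xs[i := c *\<^sub>C x]) = c *\<^sub>C prod_list (xs[i := x])"
  using assms
  by (induction xs arbitrary: i)
     (auto simp: nth_Cons' distrib_left distrib_right scaleC_mult_left scaleC_mult_right split: nat.splits)

lemma time_prod_update:
  assumes "i < length ts" "length Fs = length ts"
  shows "time_prod 0 ts (Fs[i := F]) 0 =
    prod_list ((map2 (\<lambda>t F. F (\<i> * complex_of_real t)) ts Fs)[i := F (\<i> * complex_of_real (ts ! i))])"
  unfolding time_prod_def
  by (intro arg_cong[where f = prod_list] nth_equalityI) (use assms in \<open>auto simp: nth_list_update\<close>)

text \<open>On entire analytic elements the values are prescribed and
  \<open>cmod_time_prod_le\<close> bounds them; \<open>multi_bounded_extend\<close> does the
  rest.\<close>

theorem ex_euclidean_form: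
  assumes "sorted ts" shows "\<exists>S. euclidean_form \<psi> \<alpha> ts S"
proof -
  let ?n = "length ts"
  define V where "V = {A. \<exists>F. entire_extension \<alpha> A F}"
  define e where "e A = (SOME F. entire_extension \<alpha> A F)" for A
  have e: "entire_extension \<alpha> A (e A)" if "A \<in> V" for A
    using that unfolding V_def e_def by (metis (mono_tags, lifting) mem_Collect_eq someI_ex)
  define \<Psi> where "\<Psi> Fs = \<psi> (time_prod 0 ts Fs 0)" for Fs
  have \<Psi>_add: "\<Psi> (Fs[i := \<lambda>z. F z + G z]) = \<Psi> (Fs[i := F]) + \<Psi> (Fs[i := G])"
    and \<Psi>_scale: "\<Psi> (Fs[i := \<lambda>z. c *\<^sub>C F z]) = c * \<Psi> (Fs[i := F])"
    if "i < ?n" "length Fs = ?n" for Fs i F G c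
    unfolding \<Psi>_def time_prod_update[OF that] using that by (simp_all add: prod_list_update_linear add scale)
  have \<Psi>_le: "cmod (\<Psi> Fs) \<le> prod_list (map (\<lambda>F. norm (F 0)) Fs)" if "length Fs = ?n" "\<forall>F\<in>set Fs. wext F" for Fs
    unfolding \<Psi>_def using cmod_time_prod_le assms that by blast
  \<comment> \<open>The value must not depend on the chosen extension. The difference of two
    extensions vanishes at 0, and since the bound involves values at 0 only, it contributes
    nothing.\<close>
  have indep: "\<Psi> (Fs[i := F]) = \<Psi> (Fs[i := G])"
    if *: "i < ?n" "length Fs = ?n" "\<forall>F\<in>set Fs. wext F" "entire_extension \<alpha> A F" "entire_extension \<alpha> A G" for Fs i F G A
  proof -
    let ?D = "\<lambda>z. F z + (-1) *\<^sub>C G z"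
    have "wext ?D" using * by (intro wext_add wext_scaleC wext_ext)
    then have "\<forall>F\<in>set (Fs[i := ?D]). wext F" using *(3) set_update_subset_insert[of Fs i ?D] by blast
    then have "cmod (\<Psi> (Fs[i := ?D])) \<le> prod_list (map (\<lambda>F. norm (F 0)) (Fs[i := ?D]))"
      using * by (intro \<Psi>_le) auto
    also have "prod_list (map (\<lambda>F. norm (F 0)) (Fs[i := ?D])) = 0"
    proof -
      have "?D \<in> set (Fs[i := ?D])" using * by (simp add: set_update_memI)
      moreover have "norm (?D 0) = 0" using * by (simp add: ext_0[of A] scaleC_minus_one)
      ultimately show ?thesis unfolding prod_list_zero_iff by (metis (no_types, lifting) imageI list.set_map)
    qed
    finally have "\<Psi> (Fs[i := ?D]) = 0" by simp
    moreover have "\<Psi> (Fs[i := ?D]) = \<Psi> (Fs[i := F]) + (-1) * \<Psi> (Fs[i := G])"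
      unfolding \<Psi>_add[OF *(1,2)] \<Psi>_scale[OF *(1,2)] ..
    ultimately show ?thesis by simp
  qed
  define s where "s As = \<Psi> (map e As)" for As
  have mem: "\<forall>F\<in>set (map e As). wext F" if "set As \<subseteq> V" for As
    using that e wext_ext by auto
  have V: "csubspace V"
    unfolding csubspace_def V_def using ext_add ext_scaleC by blast
  have "closure V = UNIV"
  proof (rule letters_dense[OF V])
    show "1 \<in> V" using ext_one[of 1] by (auto simp: V_def)
    show "cre m h 0 * A \<in> V" "ann m h 0 * A \<in> V" if "A \<in> V" for m h A
      using that ext_mult ext_cre ext_ann unfolding V_def by blast+
  qed
  moreover have "multi_bounded V ?n s"
    unfolding multi_bounded_def
  proof (intro conjI allI impI ballI)
    fix As i A B assume *: "length As = ?n \<and> set As \<subseteq> V \<and> i < ?n" and AB: "A \<in> V" "B \<in> V"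
    have "s (As[i := A + B]) = \<Psi> ((map e As)[i := \<lambda>z. e A z + e B z])"
      unfolding s_def map_update using * AB V e mem
      by (intro indep[where A = "A + B"] ext_add) (auto simp: csubspace_def)
    also have "\<dots> = s (As[i := A]) + s (As[i := B])" using * by (simp add: \<Psi>_add s_def map_update)
    finally show "s (As[i := A + B]) = s (As[i := A]) + s (As[i := B])" .
  next
    fix As i A c assume *: "length As = ?n \<and> set As \<subseteq> V \<and> i < ?n" and A: "A \<in> V"
    have "s (As[i := c *\<^sub>C A]) = \<Psi> ((map e As)[i := \<lambda>z. c *\<^sub>C e A z])"
      unfolding s_def map_update using * A V e mem
      by (intro indep[where A = "c *\<^sub>C A"] ext_scaleC) (auto simp: csubspace_def)
    also have "\<dots> = c * s (As[i := A])" using * by (simp add: \<Psi>_scale s_def map_update)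
    finally show "s (As[i := c *\<^sub>C A]) = c * s (As[i := A])" .
  next
    fix As assume *: "length As = ?n \<and> set As \<subseteq> V"
    have "cmod (s As) \<le> prod_list (map (\<lambda>F. norm (F 0)) (map e As))"
      unfolding s_def using * mem by (intro \<Psi>_le) auto
    also have "map (\<lambda>F. norm (F 0)) (map e As) = map norm As"
      using * ext_0[OF e] by auto
    finally show "cmod (s As) \<le> prod_list (map norm As)" .
  qed
  ultimately obtain S where S: "multi_bounded UNIV ?n S" "\<And>As. length As = ?n \<Longrightarrow> set As \<subseteq> V \<Longrightarrow> S As = s As"
    using multi_bounded_extend[OF V] by blast
  have "S As = \<psi> (prod_list (map (\<lambda>i. (Fs ! i) (\<i> * complex_of_real (ts ! i))) [0..<?n]))"
    if len: "length As = ?n" "length Fs = ?n" and ext: "\<forall>i<?n. entire_extension \<alpha> (As ! i) (Fs ! i)" for As Fs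
  proof -
    have AjV: "As ! j \<in> V" if "j < ?n" for j using ext that unfolding V_def by blast
    then have AV: "set As \<subseteq> V" using len by (metis in_set_conv_nth subsetI)
    \<comment> \<open>Exchanges the chosen extensions for the given ones, one position at a
      time.\<close>
    define H where "H j = take j Fs @ drop j (map e As)" for j
    have Hw: "\<forall>F\<in>set (H j). wext F" for j
    proof -
      have "\<forall>F\<in>set Fs. wext F" using len ext wext_ext by (metis in_set_conv_nth)
      moreover have "F \<in> set Fs \<or> F \<in> set (map e As)" if "F \<in> set (H j)" for F
        using that unfolding H_def set_append by (blast dest: in_set_takeD in_set_dropD)
      ultimately show ?thesis using mem[OF AV] by blast
    qed
    have "\<Psi> (H j) = \<Psi> (H 0)" if "j \<le> ?n" for j
      using that
    proof (induction j)
      case (Suc j)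
      have Hj: "H j = take j Fs @ e (As ! j) # drop (Suc j) (map e As)"
        using len Suc.prems unfolding H_def by (subst Cons_nth_drop_Suc[symmetric]) auto
      have l: "length (take j Fs) = j" using len Suc.prems by simp
      have "H (Suc j) = (H j)[j := Fs ! j]" "(H j)[j := e (As ! j)] = H j"
        using len Suc.prems list_update_length[of "take j Fs"] unfolding Hj l
        by (auto simp: H_def take_Suc_conv_app_nth)
      moreover have "\<Psi> ((H j)[j := Fs ! j]) = \<Psi> ((H j)[j := e (As ! j)])"
        by (rule indep[where A = "As ! j"]) (use Suc.prems len Hw ext e[OF AjV] in \<open>auto simp: H_def\<close>)
      ultimately show ?case using Suc by simp
    qed simp
    from this[of ?n] have "\<Psi> Fs = \<Psi> (map e As)" using len by (simp add: H_def)
    then have "S As = \<Psi> Fs" using S(2)[OF len(1) AV] by (simp add: s_def)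
    also have "\<dots> = \<psi> (prod_list (map2 (\<lambda>t F. F (\<i> * complex_of_real t)) ts Fs))" by (simp add: \<Psi>_def time_prod_def)
    also have "map2 (\<lambda>t F. F (\<i> * complex_of_real t)) ts Fs = map (\<lambda>i. (Fs ! i) (\<i> * complex_of_real (ts ! i))) [0..<?n]"
      by (rule nth_equalityI) (use len in auto)
    finally show ?thesis .
  qed
  then show ?thesis using S(1) unfolding euclidean_form_iff_multi_bounded by blast
qed

end

section \<open>Tilting by a chemical potential\<close>

lemma ell2_trunc_scaleC: "ell2_trunc F (c *\<^sub>C h) = c *\<^sub>C ell2_trunc F h"
  by (rule ell2_eqI) (simp add: cinner_ell2_trunc_commute cinner_scaleC_left_ell2)

lemma ell2_trunc_diff: "ell2_trunc F (h - k) = ell2_trunc F h - ell2_trunc F k"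
  by (rule ell2_eqI) (simp add: cinner_ell2_trunc_commute cinner_diff_left)

lemma ell2_trunc_idem: "finite F \<Longrightarrow> ell2_trunc F (ell2_trunc F h) = ell2_trunc F h"
  by (rule ell2_eqI) (simp add: cinner_ell2_trunc ell2_coord_trunc)

lemma ell2_trunc_minus: "ell2_trunc F (- h) = - ell2_trunc F h"
  by (rule ell2_eqI) (simp add: cinner_ell2_trunc_commute cinner_minus_left)

section \<open>Finite sections of a resolvent\<close>

context spectral_measure
begin

text \<open>\<open>\<zeta> F\<close> solves (1 - c K) u = v compressed to the coordinates in
  \<open>F\<close>. Since c K has norm at most c < 1, the compressions are uniformly coercive, and
  the error is controlled by the truncation error of the true solution, as in Cea's lemma.\<close>

lemma tilt_vector_tendsto:
  fixes \<zeta> :: "'x set \<Rightarrow> 'x ell2"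
  assumes k: "k \<in> borel_measurable borel" "\<And>r. 0 \<le> k r" "\<And>r. k r \<le> 1" and c: "0 \<le> c" "c < 1"
    and K: "K = fc E (\<lambda>r. complex_of_real (k r))"
    and \<zeta>: "\<And>F. finite F \<Longrightarrow> ell2_trunc F (\<zeta> F) = \<zeta> F"
      "\<And>F. finite F \<Longrightarrow> ell2_trunc F (\<zeta> F - complex_of_real c *\<^sub>C K (\<zeta> F)) = ell2_trunc F v"
  shows "(\<zeta> \<longlongrightarrow> fc E (\<lambda>r. complex_of_real (1 / (1 - c * k r))) v) (finite_subsets_at_top UNIV)"
proof -
  define u where "u = fc E (\<lambda>r. complex_of_real (1 / (1 - c * k r))) v"
  have kb: "bounded_borel (\<lambda>r. complex_of_real (k r))"
    by (rule bounded_borelI[where C = 1]) (use k in auto)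
  have ck: "1 - c \<le> 1 - c * k r" for r using mult_left_mono[OF k(3)[of r] c(1)] by simp
  have pos: "0 < 1 - c * k r" for r using ck[of r] c(2) by linarith
  have ub: "bounded_borel (\<lambda>r. complex_of_real (1 / (1 - c * k r)))"
  proof (rule bounded_borelI[where C = "1 / (1 - c)"])
    show "(\<lambda>r. complex_of_real (1 / (1 - c * k r))) \<in> borel_measurable borel" using k(1) by measurable
    show "cmod (complex_of_real (1 / (1 - c * k r))) \<le> 1 / (1 - c)" for r
      using pos[of r] ck[of r] c(2) unfolding norm_of_real by (simp add: frac_le)
  qed
  have K_lin: "K (h + h') = K h + K h'" "K (b *\<^sub>C h) = b *\<^sub>C K h" "K (h - h') = K h - K h'" for h h' b
    unfolding K using clinear_fc[OF kb] by (simp_all add: clinear_add clinear_scale clinear_diff)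
  have K_le: "norm (K h) \<le> norm h" for h
    unfolding K using norm_fc_le[OF kb, of 1 h] k by simp
  have u: "u - complex_of_real c *\<^sub>C K u = v"
  proof -
    let ?g = "\<lambda>r. complex_of_real (1 / (1 - c * k r))"
    have "complex_of_real c *\<^sub>C K u = fc E (\<lambda>r. complex_of_real c * (complex_of_real (k r) * ?g r)) v"
      unfolding K u_def fc_scale[OF bounded_borel_mult[OF kb ub]] fc_mult[OF kb ub] ..
    then have "u - complex_of_real c *\<^sub>C K u = fc E (\<lambda>r. ?g r - complex_of_real c * (complex_of_real (k r) * ?g r)) v"
      unfolding u_def by (subst fc_diff[OF ub bounded_borel_mult[OF bounded_borel_const bounded_borel_mult[OF kb ub]]]) simp
    also have "(\<lambda>r. ?g r - complex_of_real c * (complex_of_real (k r) * ?g r)) = (\<lambda>_. 1)"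
    proof
      fix r
      have "1 / (1 - c * k r) - c * (k r * (1 / (1 - c * k r))) = 1" using pos[of r] by (simp add: field_simps)
      then show "?g r - complex_of_real c * (complex_of_real (k r) * ?g r) = 1"
        by (simp only: flip: of_real_mult of_real_diff) simp
    qed
    finally show ?thesis by (simp add: fc_one)
  qed
  define q where "q = 1 + c / (1 - c)"
  have bound: "norm (\<zeta> F - u) \<le> q * norm (ell2_trunc F u - u)" if F: "finite F" for F
  proof -
    let ?P = "ell2_trunc F" and ?c = "complex_of_real c"
    \<comment> \<open>\<open>d\<close> is the error inside the truncated subspace and
      \<open>w\<close> the truncation error. The equations leave P (d - c K d) = - P (c K w), and
      pairing with \<open>d\<close> gives \<open>(1 - c) * norm d <= c * norm w\<close>; hence the
      constant \<open>q\<close>.\<close>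
    define d where "d = \<zeta> F - ?P u"
    define w where "w = u - ?P u"
    have Pd: "?P d = d" using F by (simp add: d_def ell2_trunc_diff \<zeta>(1) ell2_trunc_idem)
    have "?P (d - ?c *\<^sub>C K d) = ?P (\<zeta> F - ?c *\<^sub>C K (\<zeta> F)) - ?P (?P u - ?c *\<^sub>C K (?P u))"
      by (simp add: d_def K_lin ell2_trunc_diff ell2_trunc_scaleC scaleC_diff_right)
    also have "\<dots> = ?P v - ?P (?P u - ?c *\<^sub>C K (?P u))" by (simp add: \<zeta>(2) F)
    also have "\<dots> = ?P (- (?c *\<^sub>C K w))"
    proof -
      have "v - (?P u - ?c *\<^sub>C K (?P u)) = w - ?c *\<^sub>C K w"
        by (simp add: u[symmetric] w_def K_lin(3) scaleC_diff_right)
      moreover have "?P w = 0" using F by (simp add: w_def ell2_trunc_diff ell2_trunc_idem)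
      ultimately show ?thesis by (metis ell2_trunc_diff ell2_trunc_minus diff_0)
    qed
    finally have "cinner (?P (d - ?c *\<^sub>C K d)) d = cinner (?P (- (?c *\<^sub>C K w))) d" by simp
    then have "cinner (d - ?c *\<^sub>C K d) d = cinner (- (?c *\<^sub>C K w)) d"
      by (simp add: cinner_ell2_trunc_commute Pd)
    then have eq: "cinner d d = ?c * cinner (K d) d - ?c * cinner (K w) d"
      by (simp add: cinner_diff_left cinner_minus_left cinner_scaleC_left_ell2 algebra_simps)
    have "(norm d)\<^sup>2 = cmod (cinner d d)" by (simp add: cinner_norm norm_power)
    also have "\<dots> \<le> c * cmod (cinner (K d) d) + c * cmod (cinner (K w) d)"
      unfolding eq using c(1) by (intro norm_triangle_le_diff) (simp add: norm_mult)
    also have "\<dots> \<le> c * (norm d * norm d) + c * (norm w * norm d)"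
      by (intro add_mono mult_left_mono c order_trans[OF cinner_cauchy_schwarz mult_right_mono] K_le) auto
    finally have "norm d * ((1 - c) * norm d) \<le> norm d * (c * norm w)" by (simp add: power2_eq_square algebra_simps)
    then have "(1 - c) * norm d \<le> c * norm w" using c
      by (cases "norm d = 0") auto
    then have "norm d \<le> c / (1 - c) * norm w" using c by (simp add: field_simps)
    moreover have "norm (\<zeta> F - u) \<le> norm d + norm w"
      using norm_triangle_ineq4[of d w] by (simp add: d_def w_def)
    moreover have "norm w = norm (?P u - u)" by (simp add: w_def norm_minus_commute)
    ultimately show ?thesis by (simp add: q_def distrib_right)
  qed
  have "((\<lambda>F. \<zeta> F - u) \<longlongrightarrow> 0) (finite_subsets_at_top UNIV)"
  proof (rule Lim_null_comparison)
    show "\<forall>\<^sub>F F in finite_subsets_at_top UNIV. norm (\<zeta> F - u) \<le> q * norm (ell2_trunc F u - u)"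
      by (rule eventually_finite_subsets_at_top_weakI) (rule bound)
    have "((\<lambda>F. norm (ell2_trunc F u - u)) \<longlongrightarrow> 0) (finite_subsets_at_top UNIV)"
      using tendsto_norm[OF tendsto_diff[OF ell2_trunc_tendsto tendsto_const[of u]], of u] by simp
    from tendsto_mult[OF tendsto_const this, of q]
    show "((\<lambda>F. q * norm (ell2_trunc F u - u)) \<longlongrightarrow> 0) (finite_subsets_at_top UNIV)" by simp
  qed
  then have "(\<zeta> \<longlongrightarrow> u) (finite_subsets_at_top UNIV)" by (simp add: Lim_null[of _ u])
  then show ?thesis unfolding u_def .
qed

end

text \<open>\<open>Z\<close> stands for C A^-1, and \<open>D'\<close> for the Schur complement D - C
  A^-1 B. The block matrix is a unipotent lower triangular one times an upper triangular
  one.\<close>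

lemma det_schur:
  fixes A B C D D' Z :: "'b::idom Matrix.mat"
  assumes carr: "A \<in> carrier_mat m m" "B \<in> carrier_mat m n" "C \<in> carrier_mat n m" "D \<in> carrier_mat n n"
    "D' \<in> carrier_mat n n" "Z \<in> carrier_mat n m"
    and Z: "Z * A = C" and D: "Z * B + D' = D"
  shows "Determinant.det (four_block_mat A B C D) = Determinant.det A * Determinant.det D'"
proof -
  have "four_block_mat (1\<^sub>m m) (0\<^sub>m m n) Z (1\<^sub>m n) * four_block_mat A B (0\<^sub>m n m) D' = four_block_mat A B C D"
    by (subst mult_four_block_mat[of _ m m _ n _ n _ _ m _ n]) (use carr Z D in auto)
  moreover have "Determinant.det (four_block_mat (1\<^sub>m m) (0\<^sub>m m n) Z (1\<^sub>m n)) = 1"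
    using carr by (subst det_four_block_mat_upper_right_zero[of _ m _ n]) auto
  moreover have "Determinant.det (four_block_mat A B (0\<^sub>m n m) D') = Determinant.det A * Determinant.det D'"
    using carr by (subst det_four_block_mat_lower_left_zero[of _ m _ n]) auto
  moreover have "four_block_mat (1\<^sub>m m) (0\<^sub>m m n) Z (1\<^sub>m n) \<in> carrier_mat (m + n) (m + n)"
    "four_block_mat A B (0\<^sub>m n m) D' \<in> carrier_mat (m + n) (m + n)" using carr by auto
  ultimately show ?thesis using det_mult by (metis mult_1)
qed

section \<open>The tilted determinants\<close>

context spectral_measure
begin

text \<open>A kernel vector of \<open>A\<close> gives \<open>\<omega>\<close> with
  \<open>cinner \<omega> \<omega> = c * cinner (K \<omega>) \<omega>\<close>, which forces
  \<open>\<omega> = 0\<close>, because \<open>K\<close> is a contraction and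
  \<open>c < 1\<close>.\<close>

lemma tilt_matrix_nonsingular:
  assumes kb: "bounded_borel (\<lambda>r. complex_of_real (k r))" and k: "\<And>r. 0 \<le> k r" "\<And>r. k r \<le> 1" and c: "0 \<le> c" "c < 1"
    and K: "K = fc E (\<lambda>r. complex_of_real (k r))" and ys: "distinct ys"
    and A: "A = Matrix.mat (length ys) (length ys) (\<lambda>(i, j). (if i = j then 1 else 0) - complex_of_real c * cinner (K (ket (ys ! i))) (ket (ys ! j)))"
  shows "Determinant.det A \<noteq> 0"
proof
  let ?m = "length ys"
  have Ac: "A \<in> carrier_mat ?m ?m" by (simp add: A)
  assume "Determinant.det A = 0"
  then obtain w where w: "w \<in> carrier_vec ?m" "w \<noteq> 0\<^sub>v ?m" "A *\<^sub>v w = 0\<^sub>v ?m"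
    using det_0_iff_vec_prod_zero[OF Ac] by blast
  \<comment> \<open>The conjugates compensate for the antilinearity of \<open>cinner\<close> on the
    right.\<close>
  define \<omega> where "\<omega> = (\<Sum>j<?m. cnj (vec_index w j) *\<^sub>C ket (ys ! j))"
  have K_lin: "clinear K" unfolding K by (rule clinear_fc[OF kb])
  have row: "vec_index w i = complex_of_real c * cinner (K (ket (ys ! i))) \<omega>" if i: "i < ?m" for i
  proof -
    have "0 = vec_index (A *\<^sub>v w) i" using w i by simp
    also have "\<dots> = (\<Sum>j<?m. A $$ (i, j) * vec_index w j)"
      using i w(1) Ac by (simp add: Matrix.scalar_prod_def atLeast0LessThan)
    also have "\<dots> = (\<Sum>j<?m. (if i = j then vec_index w j else 0) - complex_of_real c * (cinner (K (ket (ys ! i))) (ket (ys ! j)) * vec_index w j))"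
      using i by (intro sum.cong) (auto simp: A algebra_simps)
    also have "\<dots> = vec_index w i - complex_of_real c * cinner (K (ket (ys ! i))) \<omega>"
      using i by (simp add: sum_subtractf \<omega>_def cinner_sum_right cinner_scaleC_right sum_distrib_left mult_ac)
    finally show ?thesis by simp
  qed
  have kk: "cinner (ket (ys ! i)) (ket (ys ! j)) = (if i = j then 1 else 0)" if "i < ?m" "j < ?m" for i j
    using that ys by (auto simp: cinner_ket ell2_coord_ket nth_eq_iff_index_eq)
  have \<omega>w: "cinner (ket (ys ! i)) \<omega> = vec_index w i" if i: "i < ?m" for i
  proof -
    have "cinner (ket (ys ! i)) \<omega> = (\<Sum>j<?m. if i = j then vec_index w j else 0)"
      unfolding \<omega>_def cinner_sum_right by (rule sum.cong) (auto simp: cinner_scaleC_right kk i)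
    then show ?thesis using i by simp
  qed
  have "cinner \<omega> \<omega> = (\<Sum>i<?m. cnj (vec_index w i) * vec_index w i)"
    by (subst (1) \<omega>_def) (simp add: cinner_sum_left cinner_scaleC_left_ell2 \<omega>w)
  also have "\<dots> = (\<Sum>i<?m. cnj (vec_index w i) * (complex_of_real c * cinner (K (ket (ys ! i))) \<omega>))"
    using row by (intro sum.cong) auto
  also have "\<dots> = complex_of_real c * cinner (K \<omega>) \<omega>"
  proof -
    have K\<omega>: "K \<omega> = (\<Sum>i<?m. cnj (vec_index w i) *\<^sub>C K (ket (ys ! i)))"
      by (simp add: \<omega>_def clinear_sum[OF K_lin] clinear_scale[OF K_lin])
    have "cinner (K \<omega>) \<omega> = (\<Sum>i<?m. cnj (vec_index w i) * cinner (K (ket (ys ! i))) \<omega>)"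
      unfolding K\<omega> cinner_sum_left cinner_scaleC_left_ell2 ..
    then show ?thesis by (simp add: sum_distrib_left mult.left_commute)
  qed
  finally have "(norm \<omega>)\<^sup>2 = cmod (complex_of_real c * cinner (K \<omega>) \<omega>)"
    by (metis cinner_norm norm_of_real abs_power2)
  also have "\<dots> \<le> c * (norm \<omega> * norm \<omega>)"
    unfolding norm_mult K using c norm_fc_le[OF kb, of 1 \<omega>] k
    by (auto intro!: mult_mono order_trans[OF cinner_cauchy_schwarz mult_right_mono])
  finally have "(1 - c) * (norm \<omega>)\<^sup>2 \<le> 0" by (simp add: power2_eq_square algebra_simps)
  then have "\<omega> = 0" using c by (simp add: mult_le_0_iff)
  then have "vec_index w i = 0" if "i < ?m" for i using \<omega>w[OF that] by simp
  then have "w = 0\<^sub>v ?m" using w(1) by (intro Matrix.eq_vecI) auto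
  with w(2) show False by blast
qed

text \<open>The additional factors \<open>1 - c \<rho>\<^sub>y\<close> at the earliest time \<open>t0\<close>, for \<open>y\<close> in a finite set \<open>F\<close>, amount
  to a Schur complement divided by their own non-zero correlation. As \<open>F\<close> exhausts the space, \<open>\<Prod>(1 - c \<rho>\<^sub>y)\<close> formally
  becomes \<open>(1 - c)\<close> to the power of the total number operator, which turns the symbol \<open>k\<close> into
  \<open>(1 - c) k / (1 - c k)\<close>.\<close>

theorem tilt_nonneg:
  fixes xs :: "(real \<times> 'x \<times> complex \<times> complex) list"
  assumes sym: "symbol_bounded k (insert t0 (fst ` set xs))" and sorted: "sorted (map fst xs)" and t0: "\<forall>t\<in>fst ` set xs. t0 \<le> t"
    and c: "0 \<le> c" "c < 1"
    and nonneg: "\<And>ys zs. distinct ys \<Longrightarrow> zs = [] \<or> zs = xs \<Longrightarrow>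
      Determinant.det (corr_matrix E k (map (\<lambda>y. (t0, y, 1, - complex_of_real c)) ys @ zs)) \<in> \<real>\<^sub>\<ge>\<^sub>0"
  shows "Determinant.det (corr_matrix E (\<lambda>r. (1 - c) * k r / (1 - c * k r)) xs) \<in> \<real>\<^sub>\<ge>\<^sub>0"
proof -
  let ?n = "length xs" and ?c = "complex_of_real c"
  define K where "K = fc E (\<lambda>r. complex_of_real (k r))"
  have k: "k \<in> borel_measurable borel" "\<And>r. 0 \<le> k r" "\<And>r. k r \<le> 1" using sym by (auto simp: symbol_bounded_def)
  note [measurable] = k(1)
  have kb: "bounded_borel (\<lambda>r. complex_of_real (k r))" using symbol_bounded_borel(3)[OF sym, of t0 t0] by simp
  define t x al be where "t i = fst (xs ! i)" and "x i = fst (snd (xs ! i))" and "al i = fst (snd (snd (xs ! i)))"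
    and "be i = snd (snd (snd (xs ! i)))" for i
  have xs_nth: "xs ! i = (t i, x i, al i, be i)" for i by (simp add: t_def x_def al_def be_def)
  have tT: "t i \<in> insert t0 (fst ` set xs)" "t0 \<le> t i" if "i < ?n" for i
    using that t0 by (auto simp: t_def)
  have t_mono: "t i \<le> t j" if "i \<le> j" "j < ?n" for i j
    using sorted_nth_mono[OF sorted that(1)] that by (simp add: t_def)
  \<comment> \<open>The exponential of (t j - t i) r is split at the time \<open>t0\<close> of the
    added factors: \<open>g j\<close> belongs to the upper right block and \<open>f i\<close> to the
    lower left one, whose rows are represented by the vectors \<open>v i\<close>.\<close>
  define g where "g j r = complex_of_real (exp ((t j - t0) * r) * k r)" for j r
  define f where "f i r = complex_of_real (exp ((t0 - t i) * r) * (1 - k r))" for i r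
  have gb: "bounded_borel (g j)" if "j < ?n" for j
    unfolding g_def[abs_def] using symbol_bounded_borel(1)[OF sym _ tT(1) tT(2)] that by simp
  have fb: "bounded_borel (f j)" if "j < ?n" for j
    unfolding f_def[abs_def] using symbol_bounded_borel(2)[OF sym _ tT(1) tT(2)] that by simp
  define v where "v i = be i *\<^sub>C (- fc E (f i) (ket (x i)))" for i
  define h where "h r = complex_of_real (1 / (1 - c * k r))" for r
  define yl where "yl F = (SOME ys. set ys = F \<and> distinct ys)" for F :: "'x set"
  have yl: "set (yl F) = F" "distinct (yl F)" if "finite F" for F
    using someI_ex[OF finite_distinct_list[OF that]] by (auto simp: yl_def)
  define D where "D = corr_matrix E k xs"
  have Dc: "D \<in> carrier_mat ?n ?n" by (simp add: D_def corr_matrix_def)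
  define Q where "Q F \<zeta> \<longleftrightarrow> (\<forall>i<?n. ell2_trunc F (\<zeta> i) = \<zeta> i \<and> ell2_trunc F (\<zeta> i - ?c *\<^sub>C K (\<zeta> i)) = ell2_trunc F (v i)) \<and>
     Determinant.det (Matrix.mat ?n ?n (\<lambda>(i, j). D $$ (i, j) + ?c * cinner (fc E (g j) (\<zeta> i)) (ket (x j)))) \<in> \<real>\<^sub>\<ge>\<^sub>0" for F \<zeta>
  have "\<exists>\<zeta>. Q F \<zeta>"
    if F: "finite F" for F
  proof -
    define ys where "ys = yl F"
    have ys: "set ys = F" "distinct ys" using yl[OF F] by (auto simp: ys_def)
    let ?m = "length ys"
    define pre where "pre = map (\<lambda>y. (t0, y, 1 :: complex, - ?c)) ys"
    define A where "A = Matrix.mat ?m ?m (\<lambda>(i, j). (if i = j then 1 else 0) - ?c * cinner (K (ket (ys ! i))) (ket (ys ! j)))"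
    define B where "B = Matrix.mat ?m ?n (\<lambda>(i, j). - ?c * cinner (fc E (g j) (ket (ys ! i))) (ket (x j)))"
    define C where "C = Matrix.mat ?n ?m (\<lambda>(i, j). cinner (v i) (ket (ys ! j)))"
    have carr: "A \<in> carrier_mat ?m ?m" "B \<in> carrier_mat ?m ?n" "C \<in> carrier_mat ?n ?m"
      by (auto simp: A_def B_def C_def)
    have detA: "Determinant.det A \<noteq> 0"
      by (rule tilt_matrix_nonsingular[OF kb k(2,3) c K_def ys(2) A_def])
    have block: "corr_matrix E k (pre @ xs) = four_block_mat A B C D"
    proof (rule Matrix.eq_matI)
      fix i j assume "i < dim_row (four_block_mat A B C D)" "j < dim_col (four_block_mat A B C D)"
      then have ij: "i < ?m + ?n" "j < ?m + ?n" using carr Dc by auto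
      have pre_nth: "(pre @ xs) ! l = (if l < ?m then (t0, ys ! l, 1, - ?c) else xs ! (l - ?m))" for l
        by (auto simp: pre_def nth_append)
      \<comment> \<open>Below the diagonal the kernel carries - (1 - K) instead of K. At equal times
        and distinct sites the difference is an inner product of orthogonal basis vectors, so the
        block of the added factors is the compression of 1 - c K.\<close>
      have low: "- corr_kernel E (\<lambda>r. 1 - k r) (ys ! i) t0 (ys ! j) t0 = cinner (K (ket (ys ! i))) (ket (ys ! j))"
        if "i < ?m" "j < ?m" "i \<noteq> j"
      proof -
        have "fc E (\<lambda>r. complex_of_real (1 - k r)) (ket (ys ! i)) = ket (ys ! i) - K (ket (ys ! i))"
          using fc_diff[OF bounded_borel_const[of 1] kb] by (simp add: K_def fc_one)
        moreover have "cinner (ket (ys ! i)) (ket (ys ! j)) = 0"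
          using that ys(2) by (auto simp: cinner_ket ell2_coord_ket nth_eq_iff_index_eq)
        ultimately show ?thesis by (simp add: corr_kernel_def cinner_diff_left)
      qed
      have up: "corr_kernel E k (ys ! i) t0 (ys ! j) t0 = cinner (K (ket (ys ! i))) (ket (ys ! j))"
        by (simp add: corr_kernel_def K_def)
      have dims: "length (pre @ xs) = ?m + ?n" by (simp add: pre_def)
      have lhs: "corr_matrix E k (pre @ xs) $$ (i, j) = (case ((pre @ xs) ! i, (pre @ xs) ! j) of ((t, x, c, b), (s, y, _)) \<Rightarrow>
         (if i = j then c else 0) + b * (if i \<le> j then corr_kernel E k x t y s else - corr_kernel E (\<lambda>r. 1 - k r) x t y s))"
        using ij unfolding corr_matrix_def dims by simp
      have rhs: "four_block_mat A B C D $$ (i, j) = (if i < ?m then if j < ?m then A $$ (i, j) else B $$ (i, j - ?m)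
         else if j < ?m then C $$ (i - ?m, j) else D $$ (i - ?m, j - ?m))"
        using ij carr Dc by (subst index_mat_four_block) auto
      consider "i < ?m" "j < ?m" | "i < ?m" "\<not> j < ?m" | "\<not> i < ?m" "j < ?m" | "\<not> i < ?m" "\<not> j < ?m" by blast
      then show "corr_matrix E k (pre @ xs) $$ (i, j) = four_block_mat A B C D $$ (i, j)"
      proof cases
        case 1
        then show ?thesis unfolding lhs rhs pre_nth using low up by (simp add: A_def)
      next
        case 2
        then show ?thesis unfolding lhs rhs pre_nth using ij by (simp add: B_def xs_nth corr_kernel_def g_def[abs_def])
      next
        case 3
        then show ?thesis unfolding lhs rhs pre_nth using ij
          by (simp add: C_def xs_nth corr_kernel_def f_def[abs_def] v_def cinner_scaleC_left_ell2 cinner_minus_left)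
      next
        case 4
        then have "i - ?m \<le> j - ?m \<longleftrightarrow> i \<le> j" "i - ?m = j - ?m \<longleftrightarrow> i = j" by auto
        with 4 show ?thesis unfolding lhs rhs pre_nth using ij by (simp add: D_def corr_matrix_def xs_nth)
      qed
    qed (use carr Dc in \<open>auto simp: corr_matrix_def pre_def\<close>)
    obtain Ai where Ai: "Ai \<in> carrier_mat ?m ?m" "Ai * A = 1\<^sub>m ?m"
      using det_non_zero_imp_unit[OF carr(1) detA] by (auto simp: Units_def ring_mat_def)
    define Z where "Z = C * Ai"
    have Zc: "Z \<in> carrier_mat ?n ?m" using carr Ai by (simp add: Z_def)
    have ZA: "Z * A = C" unfolding Z_def using carr Ai by (simp add: assoc_mult_mat[of _ ?n ?m _ ?m _ ?m])
    \<comment> \<open>Row \<open>i\<close> of \<open>Z\<close> as a vector supported in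
      \<open>F\<close>; \<open>Z * A = C\<close> becomes the compressed equation of
      \<open>tilt_vector_tendsto\<close>.\<close>
    define \<zeta> where "\<zeta> i = (\<Sum>l<?m. Z $$ (i, l) *\<^sub>C ket (ys ! l))" for i
    define D' where "D' = Matrix.mat ?n ?n (\<lambda>(i, j). D $$ (i, j) + ?c * cinner (fc E (g j) (\<zeta> i)) (ket (x j)))"
    have "Z * B + D' = D"
    proof (rule Matrix.eq_matI)
      fix i j assume "i < dim_row D" "j < dim_col D"
      then have ij: "i < ?n" "j < ?n" using Dc by auto
      have "(Z * B) $$ (i, j) = (\<Sum>l<?m. Z $$ (i, l) * B $$ (l, j))"
        using ij Zc carr by (simp add: Matrix.scalar_prod_def atLeast0LessThan)
      also have "\<dots> = - ?c * cinner (fc E (g j) (\<zeta> i)) (ket (x j))"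
        using ij clinear_fc[OF gb[OF ij(2)]]
        by (simp add: B_def \<zeta>_def clinear_sum clinear_scale cinner_sum_left cinner_scaleC_left_ell2 sum_distrib_left mult_ac sum_negf)
      finally show "(Z * B + D') $$ (i, j) = D $$ (i, j)" using ij Zc carr by (simp add: D'_def)
    qed (use Dc Zc carr in \<open>auto simp: D'_def\<close>)
    then have "Determinant.det (corr_matrix E k (pre @ xs)) = Determinant.det A * Determinant.det D'"
      unfolding block using det_schur[OF carr Dc _ Zc ZA] by (simp add: D'_def)
    moreover have "Determinant.det (corr_matrix E k (pre @ xs)) \<in> \<real>\<^sub>\<ge>\<^sub>0"
      unfolding pre_def by (rule nonneg) (use ys in auto)
    \<comment> \<open>This is the correlation of the added factors alone, hence non-negative as
      well, so that division by it keeps the sign.\<close>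
    moreover have "Determinant.det A \<in> \<real>\<^sub>\<ge>\<^sub>0"
    proof -
      have "corr_matrix E k (pre @ []) = A"
      proof (rule Matrix.eq_matI)
        fix i j assume "i < dim_row A" "j < dim_col A"
        then have ij: "i < ?m" "j < ?m" using carr by auto
        have "corr_matrix E k (pre @ []) $$ (i, j) = corr_matrix E k (pre @ xs) $$ (i, j)"
          using ij by (simp add: corr_matrix_def pre_def nth_append)
        also have "\<dots> = A $$ (i, j)" unfolding block using ij carr Dc by simp
        finally show "corr_matrix E k (pre @ []) $$ (i, j) = A $$ (i, j)" .
      qed (use carr in \<open>auto simp: corr_matrix_def pre_def\<close>)
      then show ?thesis using nonneg[OF ys(2), of "[]"] by (simp add: pre_def)
    qed
    ultimately have "Determinant.det D' \<in> \<real>\<^sub>\<ge>\<^sub>0"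
      using detA nonneg_Reals_divide_I[of "Determinant.det A * Determinant.det D'" "Determinant.det A"] by simp
    moreover have "ell2_trunc F (\<zeta> i) = \<zeta> i" for i
    proof -
      have "ell2_trunc F (ket (ys ! l)) = ket (ys ! l)" if "l < ?m" for l
      proof (rule ell2_eqI)
        fix k
        have "ys ! l \<in> F" using that ys by auto
        then have "cinner (ell2_trunc F (ket (ys ! l))) k = (\<Sum>y\<in>F. if y = ys ! l then cnj (ell2_coord k y) else 0)"
          unfolding cinner_ell2_trunc by (intro sum.cong) (auto simp: ell2_coord_ket)
        also have "\<dots> = cinner (ket (ys ! l)) k" using F \<open>ys ! l \<in> F\<close> by (simp add: cinner_ket_left)
        finally show "cinner (ell2_trunc F (ket (ys ! l))) k = cinner (ket (ys ! l)) k" .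
      qed
      moreover have "ell2_trunc F (\<Sum>l\<in>I. q l) = (\<Sum>l\<in>I. ell2_trunc F (q l))" for I and q :: "nat \<Rightarrow> 'x ell2"
        by (rule ell2_eqI) (simp add: cinner_ell2_trunc_commute cinner_sum_left)
      ultimately show ?thesis by (simp add: \<zeta>_def ell2_trunc_scaleC)
    qed
    moreover have "ell2_trunc F (\<zeta> i - ?c *\<^sub>C K (\<zeta> i)) = ell2_trunc F (v i)" if i: "i < ?n" for i
    proof -
      have Kl: "clinear K" unfolding K_def by (rule clinear_fc[OF kb])
      have coord: "cinner (\<zeta> i - ?c *\<^sub>C K (\<zeta> i)) (ket y) = cinner (v i) (ket y)" if "y \<in> F" for y
      proof -
        obtain j where j: "j < ?m" "y = ys ! j" using \<open>y \<in> F\<close> ys by (metis in_set_conv_nth)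
        have "cinner (v i) (ket y) = (Z * A) $$ (i, j)" unfolding ZA using i j by (simp add: C_def)
        also have "\<dots> = (\<Sum>l<?m. Z $$ (i, l) * A $$ (l, j))"
          using i j Zc carr by (simp add: Matrix.scalar_prod_def atLeast0LessThan)
        also have "\<dots> = (\<Sum>l<?m. Z $$ (i, l) * cinner (ket (ys ! l)) (ket y) - ?c * (Z $$ (i, l) * cinner (K (ket (ys ! l))) (ket y)))"
          using j ys by (intro sum.cong) (auto simp: A_def cinner_ket ell2_coord_ket nth_eq_iff_index_eq algebra_simps)
        also have "\<dots> = cinner (\<zeta> i - ?c *\<^sub>C K (\<zeta> i)) (ket y)"
          by (simp add: \<zeta>_def clinear_sum[OF Kl] clinear_scale[OF Kl] cinner_diff_left cinner_sum_left cinner_scaleC_left_ell2 sum_subtractf sum_distrib_left)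
        finally show ?thesis by simp
      qed
      show ?thesis unfolding ell2_trunc_def
        by (intro sum.cong refl) (use coord in \<open>simp add: cinner_ket\<close>)
    qed
    ultimately show ?thesis unfolding D'_def Q_def by blast
  qed
  then obtain \<zeta> where "\<And>F. finite F \<Longrightarrow> Q F (\<zeta> F)" by metis
  then have \<zeta>: "\<And>F i. finite F \<Longrightarrow> i < ?n \<Longrightarrow> ell2_trunc F (\<zeta> F i) = \<zeta> F i"
      "\<And>F i. finite F \<Longrightarrow> i < ?n \<Longrightarrow> ell2_trunc F (\<zeta> F i - ?c *\<^sub>C K (\<zeta> F i)) = ell2_trunc F (v i)"
      "\<And>F. finite F \<Longrightarrow> Determinant.det (Matrix.mat ?n ?n (\<lambda>(i, j). D $$ (i, j) + ?c * cinner (fc E (g j) (\<zeta> F i)) (ket (x j)))) \<in> \<real>\<^sub>\<ge>\<^sub>0" for F i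
    unfolding Q_def by blast+
  let ?k' = "\<lambda>r. (1 - c) * k r / (1 - c * k r)"
  have ck: "1 - c \<le> 1 - c * k r" for r using mult_left_mono[OF k(3)[of r] c(1)] by simp
  have pos: "0 < 1 - c * k r" for r using ck[of r] c(2) by linarith
  have hb: "bounded_borel h"
  proof (rule bounded_borelI[where C = "1 / (1 - c)"])
    show "h \<in> borel_measurable borel" unfolding h_def[abs_def] by measurable
    show "cmod (h r) \<le> 1 / (1 - c)" for r
      using pos[of r] ck[of r] c(2) unfolding h_def norm_of_real by (simp add: frac_le)
  qed
  have lim: "((\<lambda>F. D $$ (i, j) + ?c * cinner (fc E (g j) (\<zeta> F i)) (ket (x j))) \<longlongrightarrow> corr_matrix E ?k' xs $$ (i, j)) (finite_subsets_at_top UNIV)"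
    if ij: "i < ?n" "j < ?n" for i j
  proof -
    have "((\<lambda>F. \<zeta> F i) \<longlongrightarrow> fc E h (v i)) (finite_subsets_at_top UNIV)"
      unfolding h_def[abs_def]
      by (rule tilt_vector_tendsto[OF k c K_def]) (use \<zeta> ij in auto)
    moreover have "bounded_linear (fc E (g j))"
    proof -
      obtain Cg where Cg: "\<And>r. cmod (g j r) \<le> Cg" using bounded_borel_bound[OF gb[OF ij(2)]] by blast
      have "fc E (g j) (r *\<^sub>R h) = r *\<^sub>R fc E (g j) h" for r h
        unfolding scaleR_ell2_def by (rule clinear_scale[OF clinear_fc[OF gb[OF ij(2)]]])
      then show ?thesis
        using norm_fc_le[OF gb[OF ij(2)] Cg] clinear_add[OF clinear_fc[OF gb[OF ij(2)]]]
        by (intro bounded_linear_intro[where K = Cg]) (auto simp: mult.commute)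
    qed
    ultimately have "((\<lambda>F. fc E (g j) (\<zeta> F i)) \<longlongrightarrow> fc E (g j) (fc E h (v i))) (finite_subsets_at_top UNIV)"
      by (rule bounded_linear.tendsto[rotated])
    then have lim1: "((\<lambda>F. D $$ (i, j) + ?c * cinner (fc E (g j) (\<zeta> F i)) (ket (x j))) \<longlongrightarrow>
      D $$ (i, j) + ?c * cinner (fc E (g j) (fc E h (v i))) (ket (x j))) (finite_subsets_at_top UNIV)"
      by (intro tendsto_add tendsto_mult tendsto_const tendsto_cinner)
    define p where "p r = g j r * (h r * f i r)" for r
    have pb: "bounded_borel p" unfolding p_def[abs_def] using gb fb hb ij by (intro bounded_borel_mult) auto
    have "fc E (g j) (fc E h (v i)) = (- be i) *\<^sub>C fc E p (ket (x i))"
      using gb[OF ij(2)] fb[OF ij(1)] hb clinear_fc[OF gb[OF ij(2)]] clinear_fc[OF hb]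
      by (simp add: p_def[abs_def] v_def fc_mult bounded_borel_mult clinear_scale scaleC_minus_right scaleC_minus_left clinear_minus)
    then have val: "D $$ (i, j) + ?c * cinner (fc E (g j) (fc E h (v i))) (ket (x j))
       = D $$ (i, j) - be i * cinner (fc E (\<lambda>r. ?c * p r) (ket (x i))) (ket (x j))"
      using pb by (simp add: cinner_scaleC_left_ell2 fc_scale mult_ac)
    have p: "?c * p r = complex_of_real (exp ((t j - t i) * r) * (c * k r * (1 - k r) / (1 - c * k r)))" for r
    proof -
      have "exp ((t j - t0) * r) * exp ((t0 - t i) * r) = exp ((t j - t i) * r)"
        by (simp add: algebra_simps flip: exp_add)
      moreover have "c * ((e1 * k r) * (q * (e2 * (1 - k r)))) = (e1 * e2) * (c * k r * (1 - k r) * q)" for e1 e2 q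
        by (simp only: mult_ac)
      ultimately have "c * ((exp ((t j - t0) * r) * k r) * ((1 / (1 - c * k r)) * (exp ((t0 - t i) * r) * (1 - k r))))
        = exp ((t j - t i) * r) * (c * k r * (1 - k r) / (1 - c * k r))"
        by simp
      then show ?thesis unfolding p_def g_def h_def f_def by (simp only: flip: of_real_mult)
    qed
    have entry: "corr_matrix E q xs $$ (i, j) = (if i = j then al i else 0) + be i *
      (if i \<le> j then cinner (fc E (\<lambda>r. complex_of_real (exp ((t j - t i) * r) * q r)) (ket (x i))) (ket (x j))
       else - cinner (fc E (\<lambda>r. complex_of_real (exp ((t j - t i) * r) * (1 - q r))) (ket (x i))) (ket (x j)))" for q
      using ij unfolding corr_matrix_def corr_kernel_def by (simp add: xs_nth)
    have cpb: "bounded_borel (\<lambda>r. ?c * p r)" using pb by (intro bounded_borel_mult) auto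
    \<comment> \<open>The correction turns k into k' = (1 - c) k / (1 - c k) in both triangles: k -
      c k (1 - k) / (1 - c k) = k', and (1 - k) + c k (1 - k) / (1 - c k) = 1 - k'.\<close>
    have "D $$ (i, j) - be i * cinner (fc E (\<lambda>r. ?c * p r) (ket (x i))) (ket (x j)) = corr_matrix E ?k' xs $$ (i, j)"
    proof (cases "i \<le> j")
      case True
      have kk: "bounded_borel (\<lambda>r. complex_of_real (exp ((t j - t i) * r) * k r))"
        by (rule symbol_bounded_borel(1)[OF sym tT(1)[OF ij(1)] tT(1)[OF ij(2)] t_mono[OF True ij(2)]])
      have "(\<lambda>r. complex_of_real (exp ((t j - t i) * r) * k r) - ?c * p r) = (\<lambda>r. complex_of_real (exp ((t j - t i) * r) * ?k' r))"
      proof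
        fix r
        have "exp ((t j - t i) * r) * k r - exp ((t j - t i) * r) * (c * k r * (1 - k r) / (1 - c * k r)) = exp ((t j - t i) * r) * ?k' r"
          using pos[of r] by (simp add: field_simps)
        then show "complex_of_real (exp ((t j - t i) * r) * k r) - ?c * p r = complex_of_real (exp ((t j - t i) * r) * ?k' r)"
          unfolding p by (simp only: flip: of_real_diff)
      qed
      then have "fc E (\<lambda>r. complex_of_real (exp ((t j - t i) * r) * ?k' r)) (ket (x i)) =
        fc E (\<lambda>r. complex_of_real (exp ((t j - t i) * r) * k r)) (ket (x i)) - fc E (\<lambda>r. ?c * p r) (ket (x i))"
        using fc_diff[OF kk cpb] by metis
      then show ?thesis unfolding D_def entry
        by (simp only: True if_True cinner_diff_left right_diff_distrib add_diff_eq)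
    next
      case False
      then have ji: "j \<le> i" by simp
      have kk: "bounded_borel (\<lambda>r. complex_of_real (exp ((t j - t i) * r) * (1 - k r)))"
        by (rule symbol_bounded_borel(2)[OF sym tT(1)[OF ij(2)] tT(1)[OF ij(1)] t_mono[OF ji ij(1)]])
      have "(\<lambda>r. complex_of_real (exp ((t j - t i) * r) * (1 - k r)) + ?c * p r) = (\<lambda>r. complex_of_real (exp ((t j - t i) * r) * (1 - ?k' r)))"
      proof
        fix r
        have "exp ((t j - t i) * r) * (1 - k r) + exp ((t j - t i) * r) * (c * k r * (1 - k r) / (1 - c * k r)) = exp ((t j - t i) * r) * (1 - ?k' r)"
          using pos[of r] by (simp add: field_simps)
        then show "complex_of_real (exp ((t j - t i) * r) * (1 - k r)) + ?c * p r = complex_of_real (exp ((t j - t i) * r) * (1 - ?k' r))"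
          unfolding p by (simp only: flip: of_real_add)
      qed
      then have "fc E (\<lambda>r. complex_of_real (exp ((t j - t i) * r) * (1 - ?k' r))) (ket (x i)) =
        fc E (\<lambda>r. complex_of_real (exp ((t j - t i) * r) * (1 - k r))) (ket (x i)) + fc E (\<lambda>r. ?c * p r) (ket (x i))"
        using fc_add[OF kk cpb] by metis
      then show ?thesis unfolding D_def entry
        by (simp only: False if_False cinner_add_left_ell2 minus_add_distrib distrib_left) simp
    qed
    then show ?thesis using lim1 val by simp
  qed
  have "((\<lambda>F. Determinant.det (Matrix.mat ?n ?n (\<lambda>(i, j). D $$ (i, j) + ?c * cinner (fc E (g j) (\<zeta> F i)) (ket (x j)))))
     \<longlongrightarrow> Determinant.det (corr_matrix E ?k' xs)) (finite_subsets_at_top UNIV)"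
    by (rule tendsto_det[where n = ?n]) (use lim in \<open>auto simp: corr_matrix_def\<close>)
  then show ?thesis
    by (rule Lim_in_closed_set[OF closed_nonneg_Reals_complex, rotated 2])
       (auto intro!: eventually_finite_subsets_at_top_weakI \<zeta>(3))
qed

end

section \<open>Positivity on the diagonal algebra\<close>

lemma cstar_generated_subalgebra: "star_subalgebra (cstar_generated G)"
  unfolding cstar_generated_def star_subalgebra_def by blast

lemma cstar_generated_superset: "G \<subseteq> cstar_generated G"
  unfolding cstar_generated_def by blast

lemma cstar_generated_minimal: "star_subalgebra S \<Longrightarrow> closed S \<Longrightarrow> G \<subseteq> S \<Longrightarrow> cstar_generated G \<subseteq> S"
  unfolding cstar_generated_def by blast

lemma star_subalgebra_closure:
  assumes S: "star_subalgebra S" shows "star_subalgebra (closure S)"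
proof -
  have 2: "A + B \<in> closure S" "A * B \<in> closure S" if AB: "A \<in> closure S" "B \<in> closure S" for A B
  proof -
    obtain X Y where XY: "\<And>n. X n \<in> S" "X \<longlonglongrightarrow> A" "\<And>n. Y n \<in> S" "Y \<longlonglongrightarrow> B"
      using AB unfolding closure_sequential by blast
    show "A + B \<in> closure S"
      unfolding closure_sequential using S XY tendsto_add[OF XY(2,4)]
      by (intro exI[of _ "\<lambda>n. X n + Y n"]) (simp add: star_subalgebra_def)
    show "A * B \<in> closure S"
      unfolding closure_sequential using S XY tendsto_mult[OF XY(2,4)]
      by (intro exI[of _ "\<lambda>n. X n * Y n"]) (simp add: star_subalgebra_def)
  qed
  have 1: "star A \<in> closure S" "c *\<^sub>C A \<in> closure S" if A: "A \<in> closure S" for A c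
  proof -
    obtain X where X: "\<And>n. X n \<in> S" "X \<longlonglongrightarrow> A" using A unfolding closure_sequential by blast
    show "star A \<in> closure S"
      unfolding closure_sequential using S X tendsto_star[OF X(2)]
      by (intro exI[of _ "\<lambda>n. star (X n)"]) (simp add: star_subalgebra_def)
    show "c *\<^sub>C A \<in> closure S"
      unfolding closure_sequential using S X tendsto_scaleC[OF tendsto_const X(2), of c]
      by (intro exI[of _ "\<lambda>n. c *\<^sub>C X n"]) (simp add: star_subalgebra_def)
  qed
  have "1 \<in> closure S" using S closure_subset by (auto simp: star_subalgebra_def)
  with 1 2 show ?thesis by (simp add: star_subalgebra_def)
qed

section \<open>Cylinder elements of the diagonal algebra\<close>

context car
begin

lemma star_\<rho>: "star (\<rho> x) = \<rho> x"
  by (simp add: number_at_def star_mult star_star)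

lemma \<rho>_idem: "\<rho> x * \<rho> x = \<rho> x"
proof -
  have "\<rho> x * \<rho> x = star (a (ket x)) * (a (ket x) * star (a (ket x))) * a (ket x)"
    by (simp add: number_at_def mult.assoc)
  also have "\<dots> = \<rho> x"
    by (simp add: a_star_a cinner_norm right_diff_distrib left_diff_distrib mult.assoc a_sq number_at_def)
  finally show ?thesis .
qed

lemma \<rho>_commute: "\<rho> x * \<rho> y = \<rho> y * \<rho> x"
proof (cases "x = y")
  case False
  have ac: "a (ket x) * star (a (ket y)) = - (star (a (ket y)) * a (ket x))"
    using False by (simp add: a_star_a cinner_ket ell2_coord_ket)
  have ca: "star (a (ket x)) * a (ket y) = - (a (ket y) * star (a (ket x)))"
    using False a_star_a[of "ket y" "ket x"] by (simp add: cinner_ket ell2_coord_ket)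
  let ?cx = "star (a (ket x))" and ?x = "a (ket x)" and ?cy = "star (a (ket y))" and ?y = "a (ket y)"
  have "?cx * (?x * ?cy) * ?y = (?cx * ?cy) * (- (?x * ?y))" unfolding ac by (simp add: mult.assoc)
  also have "- (?x * ?y) = ?y * ?x" using a_anticommute[of "ket x" "ket y"] by simp
  also have "?cx * ?cy = - (?cy * ?cx)" by (rule star_a_star_a)
  also have "- (?cy * ?cx) * (?y * ?x) = ?cy * (- (?cx * ?y)) * ?x" by (simp add: mult.assoc)
  also have "- (?cx * ?y) = ?y * ?cx" unfolding ca by simp
  finally show ?thesis by (simp add: number_at_def mult.assoc)
qed simp

text \<open>Functions of finitely many occupation numbers as decision trees over the sites in
  \<open>L\<close>: the left branch for an occupied site, the right one for an empty site. Algebraic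
  operations then act branch by branch.\<close>

fun cylinders :: "'x list \<Rightarrow> 'a set" where
  "cylinders [] = {c *\<^sub>C 1 |c. True}"
| "cylinders (x # L) = {\<rho> x * A + (1 - \<rho> x) * B |A B. A \<in> cylinders L \<and> B \<in> cylinders L}"

fun pos_cylinders :: "'x list \<Rightarrow> 'a set" where
  "pos_cylinders [] = {complex_of_real r *\<^sub>C 1 |r. 0 \<le> r}"
| "pos_cylinders (x # L) = {\<rho> x * A + (1 - \<rho> x) * B |A B. A \<in> pos_cylinders L \<and> B \<in> pos_cylinders L}"

lemma cylinders_commute: "A \<in> cylinders L \<Longrightarrow> \<rho> x * A = A * \<rho> x"
proof (induction L arbitrary: A)
  case Nil
  then show ?case by (auto simp: scaleC_mult_left scaleC_mult_right)
next
  case (Cons y L)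
  then obtain B C where A: "A = \<rho> y * B + (1 - \<rho> y) * C" "B \<in> cylinders L" "C \<in> cylinders L" by auto
  have "\<rho> x * (\<rho> y * B) = (\<rho> y * B) * \<rho> x" and "\<rho> x * (\<rho> y * C) = (\<rho> y * C) * \<rho> x"
    using Cons.IH[OF A(2)] Cons.IH[OF A(3)] by (metis \<rho>_commute mult.assoc)+
  then show ?case using Cons.IH[OF A(3)] by (simp add: A(1) algebra_simps)
qed

text \<open>\<open>\<rho> x\<close> and \<open>1 - \<rho> x\<close> are complementary projections
  commuting with the branches of the left factor, so the mixed terms vanish.\<close>

lemma cylinder_mult:
  assumes "A \<in> cylinders L" "B \<in> cylinders L"
  shows "(\<rho> x * A + (1 - \<rho> x) * B) * (\<rho> x * A' + (1 - \<rho> x) * B') = \<rho> x * (A * A') + (1 - \<rho> x) * (B * B')"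
proof -
  have AB: "A * \<rho> x = \<rho> x * A" "B * \<rho> x = \<rho> x * B" using assms cylinders_commute by simp_all
  have 1: "\<rho> x * (\<rho> x * Z) = \<rho> x * Z" for Z using \<rho>_idem by (simp flip: mult.assoc)
  have 2: "A * (\<rho> x * Z) = \<rho> x * (A * Z)" "B * (\<rho> x * Z) = \<rho> x * (B * Z)" for Z
    using AB by (simp_all flip: mult.assoc)
  show ?thesis by (simp add: algebra_simps 1 2)
qed

lemma cylinder_star:
  assumes "A \<in> cylinders L" "B \<in> cylinders L"
  shows "star (\<rho> x * A + (1 - \<rho> x) * B) = \<rho> x * star A + (1 - \<rho> x) * star B"
proof -
  have "star (A * \<rho> x) = \<rho> x * star A" "star (B * \<rho> x) = \<rho> x * star B" by (simp_all add: star_mult star_\<rho>)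
  then show ?thesis
    using assms by (simp add: star_add algebra_simps star_diff cylinders_commute)
qed

lemma cylinders_add: "A \<in> cylinders L \<Longrightarrow> B \<in> cylinders L \<Longrightarrow> A + B \<in> cylinders L"
proof (induction L arbitrary: A B)
  case Nil
  then show ?case by (auto simp flip: scaleC_add_left)
next
  case (Cons x L)
  then obtain A1 A2 B1 B2 where *: "A = \<rho> x * A1 + (1 - \<rho> x) * A2" "B = \<rho> x * B1 + (1 - \<rho> x) * B2"
    "A1 \<in> cylinders L" "A2 \<in> cylinders L" "B1 \<in> cylinders L" "B2 \<in> cylinders L" by auto
  have "A + B = \<rho> x * (A1 + B1) + (1 - \<rho> x) * (A2 + B2)" by (simp add: * algebra_simps)
  with * Cons.IH show ?case by auto
qed

lemma cylinders_mult: "A \<in> cylinders L \<Longrightarrow> B \<in> cylinders L \<Longrightarrow> A * B \<in> cylinders L"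
proof (induction L arbitrary: A B)
  case Nil
  then show ?case by (auto simp: scaleC_mult_left scaleC_scaleC)
next
  case (Cons x L)
  then obtain A1 A2 B1 B2 where *: "A = \<rho> x * A1 + (1 - \<rho> x) * A2" "B = \<rho> x * B1 + (1 - \<rho> x) * B2"
    "A1 \<in> cylinders L" "A2 \<in> cylinders L" "B1 \<in> cylinders L" "B2 \<in> cylinders L" by auto
  then show ?case using Cons.IH cylinder_mult[OF *(3,4), of x B1 B2] by auto
qed

lemma cylinders_star: "A \<in> cylinders L \<Longrightarrow> star A \<in> cylinders L"
proof (induction L arbitrary: A)
  case Nil
  then show ?case by (auto simp: star_scaleC)
next
  case (Cons x L)
  then obtain A1 A2 where *: "A = \<rho> x * A1 + (1 - \<rho> x) * A2" "A1 \<in> cylinders L" "A2 \<in> cylinders L" by auto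
  then show ?case using Cons.IH cylinder_star[OF *(2,3), of x] by auto
qed

lemma cylinders_scaleC: "A \<in> cylinders L \<Longrightarrow> c *\<^sub>C A \<in> cylinders L"
proof (induction L arbitrary: A)
  case Nil
  then show ?case by (auto simp: scaleC_scaleC)
next
  case (Cons x L)
  then obtain A1 A2 where *: "A = \<rho> x * A1 + (1 - \<rho> x) * A2" "A1 \<in> cylinders L" "A2 \<in> cylinders L" by auto
  have "c *\<^sub>C A = \<rho> x * (c *\<^sub>C A1) + (1 - \<rho> x) * (c *\<^sub>C A2)"
    by (simp add: * scaleC_add_right scaleC_mult_right)
  with * Cons.IH show ?case by auto
qed

lemma star_mult_self_pos_cylinders: "A \<in> cylinders L \<Longrightarrow> star A * A \<in> pos_cylinders L"
proof (induction L arbitrary: A)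
  case Nil
  then obtain c where A: "A = c *\<^sub>C 1" by auto
  have "star A * A = complex_of_real ((cmod c)\<^sup>2) *\<^sub>C 1"
    unfolding A by (simp add: star_scaleC scaleC_mult_left scaleC_scaleC mult.commute[of "cnj c"] mult_cnj_cmod)
  moreover have "0 \<le> (cmod c)\<^sup>2" by simp
  ultimately show ?case unfolding pos_cylinders.simps by blast
next
  case (Cons x L)
  then obtain A1 A2 where *: "A = \<rho> x * A1 + (1 - \<rho> x) * A2" "A1 \<in> cylinders L" "A2 \<in> cylinders L" by auto
  then show ?case
    using Cons.IH cylinder_star[OF *(2,3), of x] cylinder_mult[OF cylinders_star[OF *(2)] cylinders_star[OF *(3)], of x A1 A2] by auto
qed

lemma cylinders_const: "c *\<^sub>C 1 \<in> cylinders L"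
proof (induction L)
  case (Cons x L)
  have "c *\<^sub>C 1 = \<rho> x * (c *\<^sub>C 1) + (1 - \<rho> x) * (c *\<^sub>C 1)" by (simp add: left_diff_distrib)
  with Cons show ?case unfolding cylinders.simps by blast
qed auto

text \<open>Any two site lists have a common extension, so that the cylinder elements over all lists
  together form an algebra.\<close>

lemma cylinders_append: "cylinders L \<subseteq> cylinders (L @ L')" "cylinders L' \<subseteq> cylinders (L @ L')"
proof (induction L)
  case Nil
  {
    case 1
    show ?case using cylinders_const by auto
  next
    case 2
    show ?case by simp
  }
next
  case (Cons x L)
  {
    case 1
    show ?case unfolding append_Cons cylinders.simps using Cons(1) by blast
  next
    case 2
    show ?case
    proof
      fix A assume "A \<in> cylinders L'"
      then have "A \<in> cylinders (L @ L')" using Cons(2) by blast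
      moreover have "A = \<rho> x * A + (1 - \<rho> x) * A" by (simp add: left_diff_distrib)
      ultimately show "A \<in> cylinders ((x # L) @ L')" unfolding append_Cons cylinders.simps by blast
    qed
  }
qed

lemma diagonal_algebra_cylinders: "diagonal_algebra a \<subseteq> closure (\<Union>L. cylinders L)"
  unfolding diagonal_algebra_def
proof (rule cstar_generated_minimal[OF star_subalgebra_closure closed_closure])
  show "star_subalgebra (\<Union>L. cylinders L)"
    unfolding star_subalgebra_def
  proof (intro conjI ballI allI)
    show "1 \<in> (\<Union>L. cylinders L)" using cylinders_const[of 1] by auto
    fix A assume "A \<in> (\<Union>L. cylinders L)"
    then obtain L where A: "A \<in> cylinders L" by blast
    show "star A \<in> (\<Union>L. cylinders L)" "c *\<^sub>C A \<in> (\<Union>L. cylinders L)" for c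
      using cylinders_star[OF A] cylinders_scaleC[OF A, of c] by (blast intro: UN_I)+
    fix B assume "B \<in> (\<Union>L. cylinders L)"
    then obtain L' where B: "B \<in> cylinders L'" by blast
    note AB = subsetD[OF cylinders_append(1) A, of L'] subsetD[OF cylinders_append(2) B, of L]
    show "A + B \<in> (\<Union>L. cylinders L)" "A * B \<in> (\<Union>L. cylinders L)"
      using cylinders_add[OF AB] cylinders_mult[OF AB] by (blast intro: UN_I)+
  qed
  have "\<rho> x = \<rho> x * (1 *\<^sub>C 1) + (1 - \<rho> x) * (0 *\<^sub>C 1)" for x by simp
  then have "\<rho> x \<in> cylinders [x]" for x unfolding cylinders.simps by blast
  then have "\<rho> x \<in> (\<Union>L. cylinders L)" for x by (rule UN_I[OF UNIV_I])
  then show "range \<rho> \<subseteq> closure (\<Union>L. cylinders L)" using closure_subset[of "\<Union>L. cylinders L"] by auto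
qed

text \<open>The codes for which \<open>factor\<close> is an occupation projection
  \<open>\<rho> x\<close> or its complement.\<close>

definition projections :: "('x \<times> complex \<times> complex) set" where
  "projections = {(x, c, b). (c = 0 \<and> b = 1) \<or> (c = 1 \<and> b = -1)}"

text \<open>A positive cylinder is a combination of products of projections with non-negative
  coefficients. The induction absorbs the leading projection into the functional, which is why
  \<open>f\<close> is generalized.\<close>

lemma nonneg_on_pos_cylinders:
  assumes "\<And>A B. f (A + B) = f A + f B" "\<And>c A. f (c *\<^sub>C A) = c * f A"
    and "\<And>ys. set ys \<subseteq> projections \<Longrightarrow> f (prod_list (map factor ys)) \<in> \<real>\<^sub>\<ge>\<^sub>0"
    and "A \<in> pos_cylinders L"
  shows "f A \<in> \<real>\<^sub>\<ge>\<^sub>0"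
  using assms
proof (induction L arbitrary: f A)
  case Nil
  then obtain r where r: "A = complex_of_real r *\<^sub>C 1" "0 \<le> r" by auto
  have "f 1 \<in> \<real>\<^sub>\<ge>\<^sub>0" using Nil(3)[of "[]"] by simp
  then show ?case unfolding r(1) Nil(2) using r(2) by (intro nonneg_Reals_mult_I) auto
next
  case (Cons x L)
  then obtain B C where A: "A = \<rho> x * B + (1 - \<rho> x) * C" "B \<in> pos_cylinders L" "C \<in> pos_cylinders L" by auto
  have "(\<lambda>A. f (\<rho> x * A)) B \<in> \<real>\<^sub>\<ge>\<^sub>0"
  proof (rule Cons.IH[OF _ _ _ A(2)])
    show "f (\<rho> x * prod_list (map factor ys)) \<in> \<real>\<^sub>\<ge>\<^sub>0" if "set ys \<subseteq> projections" for ys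
      using Cons.prems(3)[of "(x, 0, 1) # ys"] that by (simp add: factor_def projections_def)
  qed (simp_all add: distrib_left scaleC_mult_right Cons.prems)
  moreover have "(\<lambda>A. f ((1 - \<rho> x) * A)) C \<in> \<real>\<^sub>\<ge>\<^sub>0"
  proof (rule Cons.IH[OF _ _ _ A(3)])
    show "f ((1 - \<rho> x) * prod_list (map factor ys)) \<in> \<real>\<^sub>\<ge>\<^sub>0" if "set ys \<subseteq> projections" for ys
      using Cons.prems(3)[of "(x, 1, -1) # ys"] that by (simp add: factor_def projections_def scaleC_minus_one)
  qed (simp_all add: distrib_left scaleC_mult_right Cons.prems)
  ultimately show ?case unfolding A(1) Cons.prems(1) by (rule nonneg_Reals_add_I)
qed

text \<open>A positive diagonal element is \<open>star d * d\<close>; approximating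
  \<open>d\<close>, and not the product, by cylinder elements makes the approximants positive
  cylinders.\<close>

lemma nonneg_on_diagonal_pos:
  assumes S: "multi_bounded UNIV n S"
    and proj: "\<And>yss. length yss = n \<Longrightarrow> (\<forall>ys\<in>set yss. set ys \<subseteq> projections) \<Longrightarrow> S (map (\<lambda>ys. prod_list (map factor ys)) yss) \<in> \<real>\<^sub>\<ge>\<^sub>0"
    and As: "length As = n" "set As \<subseteq> diagonal_pos a"
  shows "S As \<in> \<real>\<^sub>\<ge>\<^sub>0"
proof -
  define proj_prod where "proj_prod A \<longleftrightarrow> (\<exists>ys. set ys \<subseteq> projections \<and> A = prod_list (map factor ys))" for A
  \<comment> \<open>Positions before \<open>j\<close> hold arbitrary positive cylinders, the others
    products of projections; raising \<open>j\<close> uses linearity in one position.\<close>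
  have cyl: "S As \<in> \<real>\<^sub>\<ge>\<^sub>0"
    if "length As = n" "\<forall>i<n. (if i < j then \<exists>L. As ! i \<in> pos_cylinders L else proj_prod (As ! i))" "j \<le> n" for As j
    using that
  proof (induction j arbitrary: As)
    case 0
    then have "\<forall>i<n. \<exists>ys. set ys \<subseteq> projections \<and> As ! i = prod_list (map factor ys)" by (simp add: proj_prod_def)
    then obtain Y where Y: "\<And>i. i < n \<Longrightarrow> set (Y i) \<subseteq> projections \<and> As ! i = prod_list (map factor (Y i))" by metis
    have "As = map (\<lambda>ys. prod_list (map factor ys)) (map Y [0..<n])"
      by (rule nth_equalityI) (use 0 Y in auto)
    then show ?case using proj[of "map Y [0..<n]"] Y by auto
  next
    case (Suc j)
    then have j: "j < n" by simp
    have upd: "S (As[j := A + B]) = S (As[j := A]) + S (As[j := B])" "S (As[j := c *\<^sub>C A]) = c * S (As[j := A])" for A B c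
      using S Suc.prems(1) j unfolding multi_bounded_def by auto
    obtain L where L: "As ! j \<in> pos_cylinders L" using Suc.prems(2)[rule_format, OF j] by auto
    have "(\<lambda>A. S (As[j := A])) (As ! j) \<in> \<real>\<^sub>\<ge>\<^sub>0"
    proof (rule nonneg_on_pos_cylinders[OF upd _ L])
      fix ys assume "set ys \<subseteq> projections"
      then have "proj_prod (prod_list (map factor ys))" by (auto simp: proj_prod_def)
      then show "S (As[j := prod_list (map factor ys)]) \<in> \<real>\<^sub>\<ge>\<^sub>0"
        using Suc.prems j by (intro Suc.IH) (auto simp: nth_list_update)
    qed
    then show ?case by simp
  qed
  have "\<exists>X. (\<forall>m. \<exists>L. X m \<in> pos_cylinders L) \<and> X \<longlonglongrightarrow> A" if A: "A \<in> diagonal_pos a" for A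
  proof -
    obtain d where d: "A = star d * d" "d \<in> diagonal_algebra a" using A unfolding diagonal_pos_def by blast
    then obtain Y where Y: "\<And>m. Y m \<in> (\<Union>L. cylinders L)" "Y \<longlonglongrightarrow> d"
      using diagonal_algebra_cylinders by (metis closure_sequential subsetD)
    have "(\<lambda>m. star (Y m) * Y m) \<longlonglongrightarrow> A" unfolding d(1) by (intro tendsto_mult tendsto_star Y)
    moreover have "\<exists>L. star (Y m) * Y m \<in> pos_cylinders L" for m
      using Y(1)[of m] star_mult_self_pos_cylinders by blast
    ultimately show ?thesis by (intro exI[of _ "\<lambda>m. star (Y m) * Y m"]) simp
  qed
  then obtain X where X: "\<And>A m. A \<in> diagonal_pos a \<Longrightarrow> \<exists>L. X A m \<in> pos_cylinders L" "\<And>A. A \<in> diagonal_pos a \<Longrightarrow> X A \<longlonglongrightarrow> A"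
    by metis
  have AsD: "As ! i \<in> diagonal_pos a" if "i < n" for i using As that by auto
  have lim: "(\<lambda>m. S (map (\<lambda>A. X A m) As)) \<longlonglongrightarrow> S As"
    by (rule multi_bounded_tendsto[OF S]) (use As AsD X(2) in auto)
  have "S (map (\<lambda>A. X A m) As) \<in> \<real>\<^sub>\<ge>\<^sub>0" for m
    by (rule cyl[where j = n]) (use As AsD X(1) in auto)
  then show ?thesis by (rule closed_sequentially[OF closed_nonneg_Reals_complex _ lim])
qed

lemma factor_diagonal_pos:
  assumes "c = 0 \<and> b = 1 \<or> c = 1 \<and> b = -1 \<or> (\<exists>s. 0 \<le> s \<and> s \<le> 1 \<and> c = 1 \<and> b = - complex_of_real s)"
  shows "factor (x, c, b) \<in> diagonal_pos a"
proof -
  have alg: "star_subalgebra (diagonal_algebra a)" unfolding diagonal_algebra_def by (rule cstar_generated_subalgebra)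
  have \<rho>D: "\<rho> x \<in> diagonal_algebra a" unfolding diagonal_algebra_def by (rule subsetD[OF cstar_generated_superset rangeI])
  have pos: "1 + (- complex_of_real s) *\<^sub>C \<rho> x \<in> diagonal_pos a" if s: "0 \<le> s" "s \<le> 1" for s
  proof -
    \<comment> \<open>Chosen such that (1 - q \<rho>)^2 = 1 - s \<rho>, that is, 2 q - q^2 =
      s.\<close>
    define q where "q = 1 - sqrt (1 - s)"
    have q: "2 * q - q * q = s" using s by (simp add: q_def algebra_simps)
    define d where "d = 1 + complex_of_real (- q) *\<^sub>C \<rho> x"
    have "d \<in> diagonal_algebra a" using alg \<rho>D unfolding d_def star_subalgebra_def by blast
    moreover have "star d * d = 1 + (complex_of_real (- q) + complex_of_real (- q) + complex_of_real (- q) * complex_of_real (- q)) *\<^sub>C \<rho> x"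
    proof -
      have "(1 + c *\<^sub>C \<rho> x) * (1 + c *\<^sub>C \<rho> x) = 1 + (c *\<^sub>C \<rho> x + c *\<^sub>C \<rho> x + (c * c) *\<^sub>C \<rho> x)" for c
        by (simp add: distrib_left distrib_right scaleC_mult_left scaleC_mult_right scaleC_scaleC \<rho>_idem scaleC_add_right)
      moreover have "star d = d" by (simp add: d_def star_add star_scaleC star_\<rho>)
      ultimately show ?thesis by (simp only: d_def scaleC_add_left)
    qed
    moreover have "complex_of_real (- q) + complex_of_real (- q) + complex_of_real (- q) * complex_of_real (- q) = - complex_of_real s"
      unfolding q[symmetric] by simp
    ultimately show ?thesis unfolding diagonal_pos_def by (metis (mono_tags, lifting) mem_Collect_eq)
  qed
  have "\<rho> x \<in> diagonal_pos a" unfolding diagonal_pos_def using \<rho>D star_\<rho> \<rho>_idem by (metis (mono_tags, lifting) mem_Collect_eq)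
  then show ?thesis using assms pos[of 1] pos by (auto simp: factor_def)
qed

end

section \<open>The zero temperature limit\<close>

definition fermi_symbol :: "real \<Rightarrow> real \<Rightarrow> real" where
  "fermi_symbol \<beta> r = exp (- \<beta> * r) / (1 + exp (- \<beta> * r))"

definition neg_symbol :: "real \<Rightarrow> real" where
  "neg_symbol r = (if r < 0 then 1 else 0)"

lemma fermi_op_eq: "fermi_op E \<beta> = fc E (\<lambda>r. complex_of_real (fermi_symbol \<beta> r))"
  by (simp add: fermi_op_def fermi_symbol_def)

lemma fermi_symbol_measurable [measurable]: "fermi_symbol \<beta> \<in> borel_measurable borel"
  unfolding fermi_symbol_def[abs_def] by measurable

lemma fermi_symbol_range: "0 \<le> fermi_symbol \<beta> r" "fermi_symbol \<beta> r \<le> 1"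
  by (auto simp: fermi_symbol_def add_pos_pos less_imp_le divide_le_eq)

lemma one_minus_fermi_symbol: "1 - fermi_symbol \<beta> r = 1 / (1 + exp (- \<beta> * r))"
proof -
  have "0 < 1 + exp (- \<beta> * r)" by (simp add: add_pos_pos)
  then show ?thesis by (simp add: fermi_symbol_def field_simps)
qed

text \<open>For times in a window of length \<beta>, both numerators are exponentials whose
  exponents lie between 0 and - \<beta> r. They are bounded by 1 + exp (- \<beta> r), the
  denominator of the Fermi function, so the constant 1 works.\<close>

lemma symbol_bounded_fermi:
  assumes T: "T \<subseteq> {- \<beta> / 2..\<beta> / 2}" shows "symbol_bounded (fermi_symbol \<beta>) T"
  unfolding symbol_bounded_def
proof (intro conjI allI ballI impI)
  fix t s assume ts: "t \<in> T" "s \<in> T" "t \<le> s"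
  then have "- \<beta> / 2 \<le> t" "s \<le> \<beta> / 2" using T by auto
  with ts have u: "0 \<le> s - t" "s - t \<le> \<beta>" by linarith+
  show "\<exists>C. \<forall>r. exp ((s - t) * r) * fermi_symbol \<beta> r \<le> C \<and> exp ((t - s) * r) * (1 - fermi_symbol \<beta> r) \<le> C"
  proof (intro exI[of _ 1] allI conjI)
    fix r :: real
    define w where "w = exp (- \<beta> * r)"
    have w: "0 < 1 + w" by (simp add: w_def add_pos_pos)
    have fs: "fermi_symbol \<beta> r = w / (1 + w)" "1 - fermi_symbol \<beta> r = 1 / (1 + w)"
      unfolding one_minus_fermi_symbol by (simp_all add: fermi_symbol_def w_def)
    have max: "exp v \<le> 1 + w" if "v \<le> 0 \<or> v \<le> - \<beta> * r" for v
      using that exp_le_cancel_iff[of v 0] exp_le_cancel_iff[of v "- \<beta> * r"] exp_gt_zero[of "- \<beta> * r"]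
      unfolding w_def by (auto intro: order_trans)
    have "exp ((s - t) * r) * w = exp ((s - t - \<beta>) * r)" unfolding w_def by (simp add: algebra_simps flip: exp_add)
    also have "\<dots> \<le> 1 + w"
    proof (rule max, cases "0 \<le> r")
      case True
      then show "(s - t - \<beta>) * r \<le> 0 \<or> (s - t - \<beta>) * r \<le> - \<beta> * r" using u by (simp add: mult_nonpos_nonneg)
    next
      case False
      then have "(s - t) * r \<le> 0" using u by (simp add: mult_nonneg_nonpos)
      then show "(s - t - \<beta>) * r \<le> 0 \<or> (s - t - \<beta>) * r \<le> - \<beta> * r" by (simp add: algebra_simps)
    qed
    finally show "exp ((s - t) * r) * fermi_symbol \<beta> r \<le> 1"
      using w unfolding fs by (simp add: divide_le_eq)
    have "exp ((t - s) * r) \<le> 1 + w"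
    proof (rule max, cases "0 \<le> r")
      case True
      then show "(t - s) * r \<le> 0 \<or> (t - s) * r \<le> - \<beta> * r" using u by (simp add: mult_nonpos_nonneg)
    next
      case False
      then have "\<beta> * r \<le> (s - t) * r" using u by (intro mult_right_mono_neg) auto
      then show "(t - s) * r \<le> 0 \<or> (t - s) * r \<le> - \<beta> * r" by (simp add: algebra_simps)
    qed
    then show "exp ((t - s) * r) * (1 - fermi_symbol \<beta> r) \<le> 1"
      using w unfolding fs(2) by (simp add: divide_le_eq)
  qed
qed (auto simp: fermi_symbol_range)

lemma symbol_bounded_neg: "symbol_bounded neg_symbol T"
  unfolding symbol_bounded_def
proof (intro conjI allI ballI impI)
  show "neg_symbol \<in> borel_measurable borel" unfolding neg_symbol_def[abs_def] by measurable
  fix t s :: real assume ts: "t \<le> s"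
  show "\<exists>C. \<forall>r. exp ((s - t) * r) * neg_symbol r \<le> C \<and> exp ((t - s) * r) * (1 - neg_symbol r) \<le> C"
    using ts by (intro exI[of _ 1]) (auto simp: neg_symbol_def mult_nonneg_nonpos mult_nonpos_nonneg)
qed (auto simp: neg_symbol_def)

text \<open>The Fermi function at inverse temperature \<open>n\<^sup>2\<close> and chemical potential \<open>- 1 / n\<close>. The shift
  excludes the kernel of the Hamiltonian in the limit.\<close>

definition shifted_symbol :: "nat \<Rightarrow> real \<Rightarrow> real" where
  "shifted_symbol n r = 1 / (1 + exp (real n * real n * r + real n))"

text \<open>Tilting multiplies the odds k / (1 - k) = exp (- \<beta> r) by 1 - c, so it only shifts
  the exponent: with \<beta> = n^2 and 1 - c = e^-n it becomes - n^2 r - n.\<close>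

lemma tilted_fermi_symbol:
  assumes "c = 1 - exp (- real n)"
  shows "(1 - c) * fermi_symbol (real n * real n) r / (1 - c * fermi_symbol (real n * real n) r) = shifted_symbol n r"
proof -
  define w e where "w = exp (real n * real n * r)" and "e = exp (real n)"
  have we: "0 < w" "0 < e" by (simp_all add: w_def e_def)
  have "fermi_symbol (real n * real n) r = inverse w / (1 + inverse w)"
    by (simp add: fermi_symbol_def w_def exp_minus)
  also have "\<dots> = 1 / (1 + w)" using we by (simp add: field_simps)
  finally have k: "fermi_symbol (real n * real n) r = 1 / (1 + w)" .
  have c: "c = 1 - 1 / e" using assms by (simp add: e_def exp_minus inverse_eq_divide)
  have "shifted_symbol n r = 1 / (1 + w * e)" by (simp add: shifted_symbol_def w_def e_def exp_add)
  moreover have "(1 - c) * (1 / (1 + w)) / (1 - c * (1 / (1 + w))) = 1 / (1 + w * e)"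
  proof -
    have "1 - c * (1 / (1 + w)) = (1 + w - c) / (1 + w)" using we by (simp add: diff_divide_distrib)
    moreover have "(1 - c) * (1 / (1 + w)) / ((1 + w - c) / (1 + w)) = (1 - c) / (1 + w - c)" using we by simp
    moreover have "1 - c = 1 / e" "1 + w - c = (1 + w * e) / e"
      using we by (simp_all add: c add_divide_distrib)
    ultimately show ?thesis using we by simp
  qed
  ultimately show ?thesis unfolding k by simp
qed

lemma shifted_symbol_range: "0 \<le> shifted_symbol n r" "shifted_symbol n r \<le> 1"
  by (simp_all add: shifted_symbol_def add_pos_pos less_imp_le)

lemma shifted_symbol_measurable [measurable]: "shifted_symbol n \<in> borel_measurable borel"
  unfolding shifted_symbol_def[abs_def] by measurable

text \<open>The error is eventually at most e^-n: for r >= 0, including 0, the exponent is at least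
  n, and for r < 0 it is n (n r + 1) <= - n as soon as n >= 2 / (- r).\<close>

lemma shifted_symbol_tendsto: "(\<lambda>n. shifted_symbol n r) \<longlonglongrightarrow> neg_symbol r"
proof -
  have e0: "(\<lambda>n. exp (- real n)) \<longlonglongrightarrow> 0"
  proof -
    have "(\<lambda>n. exp (-1 :: real) ^ n) \<longlonglongrightarrow> 0" by (rule LIMSEQ_realpow_zero) auto
    then show ?thesis by (simp flip: exp_of_nat_mult)
  qed
  have "\<forall>\<^sub>F n in sequentially. norm (shifted_symbol n r - neg_symbol r) \<le> exp (- real n)"
  proof (cases "r < 0")
    case True
    obtain N :: nat where N: "2 / - r \<le> real N" using real_arch_simple by blast
    have "norm (shifted_symbol n r - neg_symbol r) \<le> exp (- real n)" if "n \<ge> N" for n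
    proof -
      define w where "w = exp (real n * real n * r + real n)"
      have w: "0 < w" by (simp add: w_def)
      have "2 / - r \<le> real n" using N that by (meson of_nat_mono order_trans)
      then have "real n * r \<le> - 2" using True by (simp add: field_simps)
      then have "real n * (real n * r + 1) \<le> real n * (- 1)" by (intro mult_left_mono) auto
      then have "real n * real n * r + real n \<le> - real n" by (simp add: algebra_simps)
      then have "w \<le> exp (- real n)" by (simp add: w_def)
      moreover have "shifted_symbol n r - neg_symbol r = - (w / (1 + w))"
        using True w unfolding shifted_symbol_def neg_symbol_def w_def[symmetric] by (simp add: field_simps)
      moreover have "w / (1 + w) \<le> w" using w by (simp add: divide_le_eq)
      ultimately show ?thesis using w by simp
    qed
    then show ?thesis by (auto simp: eventually_sequentially)
  next
    case False
    have "norm (shifted_symbol n r - neg_symbol r) \<le> exp (- real n)" for n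
    proof -
      have "exp (real n) \<le> 1 + exp (real n * real n * r + real n)"
      proof -
        have "real n \<le> real n * real n * r + real n" using False by simp
        then have "exp (real n) \<le> exp (real n * real n * r + real n)" by (simp only: exp_le_cancel_iff)
        then show ?thesis by linarith
      qed
      then have "1 / (1 + exp (real n * real n * r + real n)) \<le> 1 / exp (real n)"
        by (intro divide_left_mono) (auto simp: add_pos_pos)
      then show ?thesis using False shifted_symbol_range[of n r]
        by (simp add: neg_symbol_def shifted_symbol_def exp_minus inverse_eq_divide)
    qed
    then show ?thesis by (auto simp: eventually_sequentially)
  qed
  from Lim_null_comparison[OF this e0] show ?thesis by (simp add: LIM_zero_iff)
qed

lemma shifted_symbol_upper:
  assumes "0 \<le> u" "u \<le> real n" shows "exp (u * r) * shifted_symbol n r \<le> 1"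
proof -
  have "exp (u * r) \<le> 1 + exp (real n * real n * r + real n)"
  proof (cases "0 \<le> r")
    case True
    have "real n \<le> real n * real n" by (cases n) auto
    then have "u * r \<le> real n * real n * r + real n" using True assms by (intro add_increasing2 mult_right_mono) auto
    then show ?thesis using exp_le_cancel_iff[of "u * r" "real n * real n * r + real n"] by linarith
  next
    case False
    then have "u * r \<le> 0" using assms by (simp add: mult_nonneg_nonpos)
    then have "exp (u * r) \<le> 1" by simp
    moreover have "0 < exp (real n * real n * r + real n)" by simp
    ultimately show ?thesis by linarith
  qed
  then show ?thesis by (simp add: shifted_symbol_def add_pos_pos)
qed

text \<open>The bound has to be uniform in \<open>n\<close>. The symbol changes over at r = - 1 / n:
  to the right of this point \<open>- u * r\<close> is at most \<open>u\<close>, and to the left the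
  factor is at most \<open>exp v\<close>, whose decay wins because u <= n.\<close>

lemma shifted_symbol_lower:
  assumes "0 \<le> u" "u \<le> real n" "1 \<le> n" shows "exp (- u * r) * (1 - shifted_symbol n r) \<le> exp u"
proof -
  define v where "v = real n * real n * r + real n"
  have s: "1 - shifted_symbol n r = exp v / (1 + exp v)"
  proof -
    define w where "w = exp v"
    have "0 < w" by (simp add: w_def)
    then have "1 - 1 / (1 + w) = w / (1 + w)" by (simp add: field_simps)
    then show ?thesis by (simp add: shifted_symbol_def w_def v_def)
  qed
  have le1: "1 - shifted_symbol n r \<le> 1" using shifted_symbol_range by simp
  have lev: "1 - shifted_symbol n r \<le> exp v" unfolding s by (simp add: divide_le_eq add_pos_pos)
  have n: "1 \<le> real n" using assms by simp
  have vn: "v = real n * (real n * r + 1)" by (simp add: v_def algebra_simps)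
  show ?thesis
  proof (cases "0 \<le> v")
    case True
    then have "- 1 \<le> real n * r" using n by (simp add: vn zero_le_mult_iff)
    then have "- 1 \<le> r" using n by (cases "0 \<le> r") (auto intro: order_trans[of _ "real n * r"] simp: mult_le_cancel_right2)
    then have "- u * r \<le> u" using assms(1) mult_left_mono[of "-1" r u] by simp
    then have "exp (- u * r) * (1 - shifted_symbol n r) \<le> exp u * 1"
      using le1 shifted_symbol_range[of n r] by (intro mult_mono) auto
    then show ?thesis by simp
  next
    case False
    then have nr: "real n * r + 1 < 0" using n by (simp add: vn mult_less_0_iff not_le)
    \<comment> \<open>The product equals v - u r - u / n, so its sign gives v - u r <= u /
      n.\<close>
    have "(real n - u / real n) * (real n * r + 1) \<le> 0"
    proof (rule mult_nonneg_nonpos)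
      have "u / real n \<le> u" using n assms(1) by (simp add: divide_le_eq mult_le_cancel_left1)
      then show "0 \<le> real n - u / real n" using assms(2) by linarith
    qed (use nr in simp)
    moreover have "(real n - u / real n) * (real n * r + 1) = v - u * r - u / real n"
      using n by (simp add: v_def algebra_simps)
    ultimately have "v - u * r \<le> u / real n" by simp
    also have "u / real n \<le> u" using n assms(1) by (simp add: divide_le_eq mult_le_cancel_left1)
    finally have "- u * r + v \<le> u" by simp
    have "exp (- u * r) * (1 - shifted_symbol n r) \<le> exp (- u * r) * exp v"
      using lev by (intro mult_left_mono) auto
    also have "\<dots> = exp (- u * r + v)" by (rule exp_add[symmetric])
    also have "\<dots> \<le> exp u" using \<open>- u * r + v \<le> u\<close> by simp
    finally show ?thesis .
  qed
qed

text \<open>Dominated convergence in every entry. The uniform bounds require \<open>n\<close> to be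
  at least 1 and at least the time difference \<open>u\<close>, so an initial segment is
  dropped.\<close>

lemma (in spectral_measure) corr_matrix_shifted_tendsto:
  assumes sorted: "sorted (map fst xs)"
  shows "(\<lambda>n. Determinant.det (corr_matrix E (shifted_symbol n) xs)) \<longlonglongrightarrow> Determinant.det (corr_matrix E neg_symbol xs)"
proof (rule tendsto_det[where n = "length xs"])
  fix i j assume ij: "i < length xs" "j < length xs"
  obtain t x c b where i: "xs ! i = (t, x, c, b)" by (metis prod_cases4)
  obtain s y c' b' where j: "xs ! j = (s, y, c', b')" by (metis prod_cases4)
  define u where "u = \<bar>s - t\<bar>"
  obtain N0 :: nat where N0: "u \<le> real N0" using real_arch_simple by blast
  define N where "N = Suc N0"
  have N: "u \<le> real (n + N)" "1 \<le> n + N" for n using N0 by (auto simp: N_def)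
  have u0: "0 \<le> u" by (simp add: u_def)
  have kn: "\<And>n. shifted_symbol n \<in> borel_measurable borel" by measurable
  have k0: "neg_symbol \<in> borel_measurable borel" using symbol_bounded_neg by (simp add: symbol_bounded_def)
  have shift: "(\<lambda>n. shifted_symbol (n + N) r) \<longlonglongrightarrow> neg_symbol r" for r
    using shifted_symbol_tendsto[of r] by (rule LIMSEQ_ignore_initial_segment)
  have up: "(\<lambda>n. corr_kernel E (shifted_symbol (n + N)) x t y s) \<longlonglongrightarrow> corr_kernel E neg_symbol x t y s" if "t \<le> s"
    unfolding corr_kernel_def
  proof (intro tendsto_cinner tendsto_const fc_lim)
    have st: "s - t = u" using that by (simp add: u_def)
    have b: "cmod (complex_of_real (exp ((s - t) * r) * shifted_symbol (n + N) r)) \<le> 1" for n r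
      using shifted_symbol_upper[OF u0 N(1)[of n], of r] shifted_symbol_range(1)[of "n + N" r]
      by (simp only: norm_of_real st) simp
    then show "cmod (complex_of_real (exp ((s - t) * r) * shifted_symbol (n + N) r)) \<le> 1" for n r .
    show "bounded_borel (\<lambda>r. complex_of_real (exp ((s - t) * r) * shifted_symbol (n + N) r))" for n
      by (rule bounded_borelI[OF _ b]) measurable
    show "bounded_borel (\<lambda>r. complex_of_real (exp ((s - t) * r) * neg_symbol r))"
      by (rule symbol_bounded_borel(1)[OF symbol_bounded_neg[of UNIV] _ _ that]) auto
    show "(\<lambda>n. complex_of_real (exp ((s - t) * r) * shifted_symbol (n + N) r)) \<longlonglongrightarrow> complex_of_real (exp ((s - t) * r) * neg_symbol r)" for r
      by (intro tendsto_of_real tendsto_mult tendsto_const shift)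
  qed
  have low: "(\<lambda>n. corr_kernel E (\<lambda>r. 1 - shifted_symbol (n + N) r) x t y s) \<longlonglongrightarrow> corr_kernel E (\<lambda>r. 1 - neg_symbol r) x t y s" if "s \<le> t"
    unfolding corr_kernel_def
  proof (intro tendsto_cinner tendsto_const fc_lim)
    have st: "s - t = - u" using that by (simp add: u_def)
    have b: "cmod (complex_of_real (exp ((s - t) * r) * (1 - shifted_symbol (n + N) r))) \<le> exp u" for n r
      using shifted_symbol_lower[OF u0 N(1)[of n] N(2)[of n], of r] shifted_symbol_range(2)[of "n + N" r]
      by (simp only: norm_of_real st) simp
    then show "cmod (complex_of_real (exp ((s - t) * r) * (1 - shifted_symbol (n + N) r))) \<le> exp u" for n r .
    show "bounded_borel (\<lambda>r. complex_of_real (exp ((s - t) * r) * (1 - shifted_symbol (n + N) r)))" for n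
      by (rule bounded_borelI[OF _ b]) measurable
    show "bounded_borel (\<lambda>r. complex_of_real (exp ((s - t) * r) * (1 - neg_symbol r)))"
      by (rule symbol_bounded_borel(2)[OF symbol_bounded_neg[of UNIV] _ _ that]) auto
    show "(\<lambda>n. complex_of_real (exp ((s - t) * r) * (1 - shifted_symbol (n + N) r))) \<longlonglongrightarrow> complex_of_real (exp ((s - t) * r) * (1 - neg_symbol r))" for r
      by (intro tendsto_of_real tendsto_mult tendsto_const tendsto_diff shift)
  qed
  have le: "i \<le> j \<Longrightarrow> t \<le> s" "j \<le> i \<Longrightarrow> s \<le> t"
    using sorted_nth_mono[OF sorted, of i j] sorted_nth_mono[OF sorted, of j i] ij i j by auto
  have entry: "corr_matrix E k xs $$ (i, j) = (if i = j then c else 0) + b * (if i \<le> j then corr_kernel E k x t y s else - corr_kernel E (\<lambda>r. 1 - k r) x t y s)" for k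
    using ij i j by (simp add: corr_matrix_def)
  have "(\<lambda>n. corr_matrix E (shifted_symbol (n + N)) xs $$ (i, j)) \<longlonglongrightarrow> corr_matrix E neg_symbol xs $$ (i, j)"
    unfolding entry using up low le by (cases "i \<le> j") (auto intro!: tendsto_add tendsto_mult tendsto_const tendsto_minus)
  then show "(\<lambda>n. corr_matrix E (shifted_symbol n) xs $$ (i, j)) \<longlonglongrightarrow> corr_matrix E neg_symbol xs $$ (i, j)"
    by (rule LIMSEQ_offset)
qed (auto simp: corr_matrix_def)

section \<open>From the Gibbs states to the ground state\<close>

context car_flow
begin

text \<open>Every list entry becomes a time slot of its own holding a single factor, and equal times
  may repeat. Positivity of the form then is positivity of the determinant by
  \<open>euclidean_form_det\<close>.\<close>

lemma stochastically_positive_det_nonneg: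
  assumes qf: "quasi_free_state a (fermi_op E \<beta>) \<phi>" and sp: "stochastically_positive a \<alpha> \<phi> (ereal \<beta>)"
    and xs: "sorted (map fst xs)" "fst ` set xs \<subseteq> {- \<beta> / 2..\<beta> / 2}" "\<forall>y\<in>snd ` set xs. factor y \<in> diagonal_pos a"
  shows "Determinant.det (corr_matrix E (fermi_symbol \<beta>) xs) \<in> \<real>\<^sub>\<ge>\<^sub>0"
proof -
  let ?ts = "map fst xs" and ?yss = "map (\<lambda>e. [snd e]) xs"
  have "set ?ts \<subseteq> time_window (ereal \<beta>)"
    using xs(2) by (auto simp: time_window_def)
  then obtain S where S: "euclidean_form \<phi> \<alpha> ?ts S"
      "\<And>As. length As = length ?ts \<Longrightarrow> set As \<subseteq> diagonal_pos a \<Longrightarrow> S As \<in> \<real>\<^sub>\<ge>\<^sub>0"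
    using sp xs(1) unfolding stochastically_positive_def by blast
  have "concat (map2 (\<lambda>t ys. map (Pair t) ys) ?ts ?yss) = xs" by (induction xs) auto
  moreover have "S (map (\<lambda>ys. prod_list (map factor ys)) ?yss) =
      Determinant.det (corr_matrix E (fermi_symbol \<beta>) (concat (map2 (\<lambda>t ys. map (Pair t) ys) ?ts ?yss)))"
    by (rule euclidean_form_det[OF _ S(1) _ xs(1) symbol_bounded_fermi]) (use qf xs(2) in \<open>auto simp: fermi_op_eq\<close>)
  moreover have "S (map (\<lambda>ys. prod_list (map factor ys)) ?yss) \<in> \<real>\<^sub>\<ge>\<^sub>0"
    using xs(3) by (intro S(2)) auto
  ultimately show ?thesis by simp
qed

theorem neg_symbol_det_nonneg:
  assumes qf: "\<And>\<beta>. \<beta> > 0 \<Longrightarrow> quasi_free_state a (fermi_op E \<beta>) (\<phi> \<beta>)"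
    and sp: "\<And>\<beta>. \<beta> > 0 \<Longrightarrow> stochastically_positive a \<alpha> (\<phi> \<beta>) (ereal \<beta>)"
    and xs: "sorted (map fst xs)" "snd ` set xs \<subseteq> projections"
  shows "Determinant.det (corr_matrix E neg_symbol xs) \<in> \<real>\<^sub>\<ge>\<^sub>0"
proof -
  \<comment> \<open>For n > N0 all times lie in the window of \<beta> = n^2, as 2 |t| <= n <=
    n^2.\<close>
  obtain N0 :: nat where N0: "(\<Sum>t\<in>fst ` set xs. 2 * \<bar>t\<bar>) \<le> real N0" using real_arch_simple by blast
  have "Determinant.det (corr_matrix E (shifted_symbol n) xs) \<in> \<real>\<^sub>\<ge>\<^sub>0" if n: "n \<ge> Suc N0" for n
  proof -
    define \<beta> c where "\<beta> = real n * real n" and "c = 1 - exp (- real n)"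
    have n1: "1 \<le> real n" using n by simp
    have \<beta>: "0 < \<beta>" using n1 by (simp add: \<beta>_def)
    have c: "0 \<le> c" "c < 1" "c \<le> 1" by (simp_all add: c_def)
    have win: "fst ` set xs \<subseteq> {- \<beta> / 2..\<beta> / 2}"
    proof
      fix t assume t: "t \<in> fst ` set xs"
      have "2 * \<bar>t\<bar> \<le> (\<Sum>t\<in>fst ` set xs. 2 * \<bar>t\<bar>)" using t by (intro member_le_sum) auto
      also have "\<dots> \<le> real n" using N0 n by linarith
      also have "\<dots> \<le> \<beta>" using n1 by (simp add: \<beta>_def)
      finally show "t \<in> {- \<beta> / 2..\<beta> / 2}" by (auto simp: abs_le_iff)
    qed
    have "Determinant.det (corr_matrix E (\<lambda>r. (1 - c) * fermi_symbol \<beta> r / (1 - c * fermi_symbol \<beta> r)) xs) \<in> \<real>\<^sub>\<ge>\<^sub>0"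
    proof (rule tilt_nonneg[where ?t0.0 = "- \<beta> / 2"])
      show "symbol_bounded (fermi_symbol \<beta>) (insert (- \<beta> / 2) (fst ` set xs))"
        using win \<beta> by (intro symbol_bounded_fermi) auto
      show "\<forall>t\<in>fst ` set xs. - \<beta> / 2 \<le> t" using win by auto
      fix ys :: "'x list" and zs assume zs: "zs = [] \<or> zs = xs"
      let ?pre = "map (\<lambda>y. (- \<beta> / 2, y, 1 :: complex, - complex_of_real c)) ys"
      have "map fst ?pre = replicate (length ys) (- \<beta> / 2)" by (induction ys) auto
      then have "sorted (map fst ?pre)" by (metis sorted_replicate)
      then have "sorted (map fst (?pre @ zs))"
        using xs(1) zs win by (auto simp: sorted_append)
      moreover have "\<forall>y\<in>snd ` set (?pre @ zs). factor y \<in> diagonal_pos a"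
      proof -
        have "factor (y, 1, - complex_of_real c) \<in> diagonal_pos a" for y
          using c by (intro factor_diagonal_pos) blast
        moreover have "factor y \<in> diagonal_pos a" if "y \<in> projections" for y
          using that by (cases y) (auto simp: projections_def intro!: factor_diagonal_pos)
        ultimately show ?thesis using zs xs(2) by auto
      qed
      ultimately show "Determinant.det (corr_matrix E (fermi_symbol \<beta>) (?pre @ zs)) \<in> \<real>\<^sub>\<ge>\<^sub>0"
        using zs win \<beta> by (intro stochastically_positive_det_nonneg[OF qf[OF \<beta>] sp[OF \<beta>]]) auto
    qed (use xs c in auto)
    then show ?thesis unfolding \<beta>_def tilted_fermi_symbol[OF c_def] .
  qed
  then show ?thesis
    by (intro Lim_in_closed_set[OF closed_nonneg_Reals_complex _ sequentially_bot corr_matrix_shifted_tendsto[OF xs(1)]])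
       (auto simp: eventually_sequentially)
qed

end

text \<open>Below the diagonal the determinant has - (1 - k) even at equal times, where
  \<open>R_kernel\<close> uses k. The two differ by \<open>cinner (ket x) (ket y)\<close>, which
  vanishes because equal times force distinct sites.\<close>

lemma (in spectral_measure) corr_kernel_eq_R_kernel:
  shows "t \<le> s \<Longrightarrow> corr_kernel E neg_symbol x t y s = R_kernel E x t y s"
    and "s \<le> t \<Longrightarrow> (x, t) \<noteq> (y, s) \<Longrightarrow> - corr_kernel E (\<lambda>r. 1 - neg_symbol r) x t y s = R_kernel E x t y s"
proof -
  have up: "corr_kernel E neg_symbol x t y s = R_kernel E x t y s" if "t \<le> s" for t s
  proof -
    let ?f = "\<lambda>r. complex_of_real (exp ((s - t) * r))"
    have "fc E ?f (E {..<0} (ket x)) = fc E (\<lambda>r. indicator {..<0} r * ?f r) (ket x)"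
      by (rule fc_E_unbounded[where C = 1]) (use that in \<open>auto simp: mult_nonneg_nonpos\<close>)
    also have "(\<lambda>r. indicator {..<0} r * ?f r) = (\<lambda>r. complex_of_real (exp ((s - t) * r) * neg_symbol r))"
      by (auto simp: indicator_def neg_symbol_def)
    finally show ?thesis using that by (simp only: corr_kernel_def R_kernel_def neg_proj_def if_True)
  qed
  then show "t \<le> s \<Longrightarrow> corr_kernel E neg_symbol x t y s = R_kernel E x t y s" by simp
  assume st: "s \<le> t" and ne: "(x, t) \<noteq> (y, s)"
  have nb: "bounded_borel (\<lambda>r. complex_of_real (neg_symbol r))"
    using symbol_bounded_borel(3)[OF symbol_bounded_neg[of UNIV], of 0 0] by simp
  have neg: "fc E (\<lambda>r. complex_of_real (neg_symbol r)) h = E {..<0} h" for h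
  proof -
    have "(\<lambda>r. complex_of_real (neg_symbol r)) = indicator {..<0}" by (auto simp: indicator_def neg_symbol_def)
    then show ?thesis by (simp add: fc_indicator)
  qed
  have pos: "ket x - E {..<0} (ket x) = E {0..} (ket x)"
  proof -
    have "fc E (\<lambda>r. 1 - complex_of_real (neg_symbol r)) (ket x) = ket x - E {..<0} (ket x)"
      using fc_diff[OF bounded_borel_const[of 1] nb] by (simp add: fc_one neg)
    moreover have "(\<lambda>r. 1 - complex_of_real (neg_symbol r)) = indicator {0..}" by (auto simp: indicator_def neg_symbol_def)
    ultimately show ?thesis by (simp add: fc_indicator)
  qed
  show "- corr_kernel E (\<lambda>r. 1 - neg_symbol r) x t y s = R_kernel E x t y s"
  proof (cases "s = t")
    case True
    have "corr_kernel E (\<lambda>r. 1 - neg_symbol r) x t y s = cinner (ket x - E {..<0} (ket x)) (ket y)"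
      unfolding pos corr_kernel_def using True
      by (subst fc_indicator[symmetric]) (auto simp: indicator_def neg_symbol_def intro!: arg_cong[where f = "\<lambda>f. cinner (fc E f (ket x)) (ket y)"])
    also have "\<dots> = - cinner (E {..<0} (ket x)) (ket y)"
    proof -
      have "cinner (ket x) (ket y) = 0" using ne True by (simp add: cinner_ket ell2_coord_ket)
      then show ?thesis by (simp add: cinner_diff_left)
    qed
    also have "cinner (E {..<0} (ket x)) (ket y) = corr_kernel E neg_symbol x t y s"
      using True by (simp add: corr_kernel_def neg)
    finally show ?thesis using up[of t s] True by simp
  next
    case False
    let ?f = "\<lambda>r. complex_of_real (exp (- (t - s) * r))"
    have "fc E ?f (E {0..} (ket x)) = fc E (\<lambda>r. indicator {0..} r * ?f r) (ket x)"
      by (rule fc_E_unbounded[where C = 1]) (use st in \<open>auto simp: mult_nonpos_nonneg\<close>)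
    also have "(\<lambda>r. indicator {0..} r * ?f r) = (\<lambda>r. complex_of_real (exp ((s - t) * r) * (1 - neg_symbol r)))"
      by (auto simp: indicator_def neg_symbol_def)
    finally show ?thesis using st False by (simp add: corr_kernel_def R_kernel_def neg_proj_def pos)
  qed
qed

theorem proposition5p1:
  fixes D :: "'x::countable ell2 set" and H :: "'x ell2 \<Rightarrow> 'x ell2"
    and E :: "real set \<Rightarrow> 'x ell2 \<Rightarrow> 'x ell2"
    and a :: "'x ell2 \<Rightarrow> 'a::cstar_algebra" and \<alpha> :: "real \<Rightarrow> 'a \<Rightarrow> 'a"
    and \<iota> :: "(('x \<Rightarrow> bool) \<Rightarrow> complex) \<Rightarrow> 'a"
    and \<phi> :: "real \<Rightarrow> 'a \<Rightarrow> complex" and \<psi> :: "'a \<Rightarrow> complex"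
  assumes "self_adjoint D H" and "spectral_measure_of D H E"
    and "car_algebra a" and "diagonal_identification a \<iota>"
    and "quasi_free_flow a E \<alpha>"
    and "\<And>\<beta>. \<beta> > 0 \<Longrightarrow> quasi_free_state a (fermi_op E \<beta>) (\<phi> \<beta>)"
    and "quasi_free_state a (neg_proj E) \<psi>"
    and "\<And>\<beta>. \<beta> > 0 \<Longrightarrow> stochastically_positive a \<alpha> (\<phi> \<beta>) (ereal \<beta>)"
  shows "stochastically_positive a \<alpha> \<psi> \<infinity> \<and>
    (\<forall>(M :: 'w measure) X. associated_process \<iota> \<alpha> \<psi> \<infinity> M X \<longrightarrow>
      (\<forall>n xs ts. n \<ge> 1 \<and> length xs = n \<and> length ts = n \<and> sorted ts \<and> distinct (zip xs ts) \<longrightarrow>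
        complex_of_real (measure M {\<omega> \<in> space M. \<forall>i<n. X (ts ! i) \<omega> (xs ! i)}) =
        Determinant.det (Matrix.mat n n
          (\<lambda>(i, j). R_kernel E (xs ! i) (ts ! i) (xs ! j) (ts ! j)))))"
proof -
  interpret car_flow E a \<alpha>
    using assms(2,3,5) by unfold_locales (auto simp: spectral_measure_of_def car_algebra_def)
  interpret ground_flow E a \<alpha> \<psi>
    using assms(3,7) by unfold_locales (auto simp: car_algebra_def quasi_free_state_def)
  have neg: "neg_proj E = fc E (\<lambda>r. complex_of_real (neg_symbol r))"
  proof -
    have "(\<lambda>r. complex_of_real (neg_symbol r)) = indicator {..<0}" by (auto simp: indicator_def neg_symbol_def)
    then show ?thesis by (simp add: fun_eq_iff neg_proj_fc)
  qed
  have det: "S (map (\<lambda>ys. prod_list (map factor ys)) yss) =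
      Determinant.det (corr_matrix E neg_symbol (concat (map2 (\<lambda>t ys. map (Pair t) ys) ts yss)))"
    if "euclidean_form \<psi> \<alpha> ts S" "sorted ts" "length yss = length ts" for ts S yss
    by (rule euclidean_form_det[OF _ that(1,3,2) symbol_bounded_neg]) (use assms(7) neg in simp)
  show ?thesis
  proof (intro conjI allI impI)
    show "stochastically_positive a \<alpha> \<psi> \<infinity>"
      unfolding stochastically_positive_def
    proof (intro allI impI)
      fix ts :: "real list" assume ts: "sorted ts \<and> set ts \<subseteq> time_window \<infinity>"
      obtain S where S: "euclidean_form \<psi> \<alpha> ts S" using ex_euclidean_form ts by blast
      have mb: "multi_bounded UNIV (length ts) S" using S unfolding euclidean_form_iff_multi_bounded by blast
      have "S As \<in> \<real>\<^sub>\<ge>\<^sub>0" if "length As = length ts" "set As \<subseteq> diagonal_pos a" for As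
      proof (rule nonneg_on_diagonal_pos[OF mb _ that])
        fix yss assume yss: "length yss = length ts" "\<forall>ys\<in>set yss. set ys \<subseteq> projections"
        let ?flat = "concat (map2 (\<lambda>t ys. map (Pair t) ys) ts yss)"
        have "snd ` set ?flat \<subseteq> projections" using yss(2) by (fastforce dest: set_zip_rightD)
        then have "Determinant.det (corr_matrix E neg_symbol ?flat) \<in> \<real>\<^sub>\<ge>\<^sub>0"
          using assms(6,8) ts by (intro neg_symbol_det_nonneg sorted_concat_map2) auto
        then show "S (map (\<lambda>ys. prod_list (map factor ys)) yss) \<in> \<real>\<^sub>\<ge>\<^sub>0"
          using det[OF S _ yss(1)] ts by simp
      qed
      then show "\<exists>S. euclidean_form \<psi> \<alpha> ts S \<and> (\<forall>As. length As = length ts \<and> set As \<subseteq> diagonal_pos a \<longrightarrow> S As \<in> \<real>\<^sub>\<ge>\<^sub>0)"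
        using S by blast
    qed
  next
    fix M :: "'w measure" and X n and xs :: "'x list" and ts :: "real list"
    assume proc: "associated_process \<iota> \<alpha> \<psi> \<infinity> M X"
      and *: "n \<ge> 1 \<and> length xs = n \<and> length ts = n \<and> sorted ts \<and> distinct (zip xs ts)"
    then have n1: "0 < n" and len: "length xs = n" "length ts = n" and srt: "sorted ts" and dist: "distinct (zip xs ts)" by auto
    obtain S where S: "euclidean_form \<psi> \<alpha> ts S" using ex_euclidean_form srt by blast
    define fs where "fs = map (\<lambda>x (\<omega> :: 'x \<Rightarrow> bool). if \<omega> x then 1 else 0 :: complex) xs"
    have win: "set ts \<subseteq> time_window \<infinity>" by (auto simp: time_window_def)
    have coord: "continuous_on UNIV (\<lambda>\<omega> :: 'x \<Rightarrow> bool. \<omega> x)" for x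
      by (rule continuous_on_product_coordinates)
    have cont: "continuous_on UNIV (\<lambda>\<omega> :: 'x \<Rightarrow> bool. if \<omega> x then 1 else 0 :: complex)" for x
    proof -
      have "continuous_on UNIV (\<lambda>b. if b then 1 else 0 :: complex)"
        by (intro continuous_at_imp_continuous_on ballI) (simp add: isCont_def at_discrete)
      from continuous_on_compose2[OF this coord] show ?thesis by simp
    qed
    have "\<forall>ts S fs. sorted ts \<and> set ts \<subseteq> time_window \<infinity> \<and> euclidean_form \<psi> \<alpha> ts S \<and>
        length fs = length ts \<and> (\<forall>f\<in>set fs. continuous_on UNIV f) \<longrightarrow>
        (\<integral>\<omega>. (\<Prod>i<length ts. (fs ! i) (X (ts ! i) \<omega>)) \<partial>M) = S (map \<iota> fs)"
      using proc unfolding associated_process_def by blast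
    moreover have "length fs = length ts" "\<forall>f\<in>set fs. continuous_on UNIV f"
      using len cont by (auto simp: fs_def)
    ultimately have "(\<integral>\<omega>. (\<Prod>i<length ts. (fs ! i) (X (ts ! i) \<omega>)) \<partial>M) = S (map \<iota> fs)"
      using S srt win by blast
    \<comment> \<open>The coordinate function at \<open>x\<close> is identified with
      \<open>\<rho> x\<close>, which is the factor with \<open>c = 0\<close> and
      \<open>b = 1\<close>.\<close>
    also have "map \<iota> fs = map (\<lambda>ys. prod_list (map factor ys)) (map (\<lambda>x. [(x, 0, 1)]) xs)"
      using assms(4) by (simp add: fs_def factor_def diagonal_identification_def)
    also have "S \<dots> = Determinant.det (corr_matrix E neg_symbol (concat (map2 (\<lambda>t ys. map (Pair t) ys) ts (map (\<lambda>x. [(x, 0, 1)]) xs))))"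
      by (rule det[OF S srt]) (simp add: len)
    also have "concat (map2 (\<lambda>t ys. map (Pair t) ys) ts (map (\<lambda>x. [(x, 0, 1)]) xs)) = map2 (\<lambda>t x. (t, x, 0 :: complex, 1 :: complex)) ts xs"
    proof -
      have "concat (map2 (\<lambda>t ys. map (Pair t) ys) us (map (\<lambda>x. [(x, 0, 1)]) zs)) = map2 (\<lambda>t x. (t, x, 0 :: complex, 1 :: complex)) us zs"
        if "length us = length zs" for us :: "real list" and zs :: "'x list"
        using that by (induction us zs rule: list_induct2) auto
      then show ?thesis using len by simp
    qed
    also have "corr_matrix E neg_symbol (map2 (\<lambda>t x. (t, x, 0 :: complex, 1 :: complex)) ts xs) =
      Matrix.mat n n (\<lambda>(i, j). R_kernel E (xs ! i) (ts ! i) (xs ! j) (ts ! j))"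
    proof (rule Matrix.eq_matI)
      fix i j assume "i < dim_row (Matrix.mat n n (\<lambda>(i, j). R_kernel E (xs ! i) (ts ! i) (xs ! j) (ts ! j)))"
        "j < dim_col (Matrix.mat n n (\<lambda>(i, j). R_kernel E (xs ! i) (ts ! i) (xs ! j) (ts ! j)))"
      then have ij: "i < n" "j < n" by auto
      have le: "i \<le> j \<Longrightarrow> ts ! i \<le> ts ! j" "j \<le> i \<Longrightarrow> ts ! j \<le> ts ! i"
        using sorted_nth_mono[OF srt] ij len by auto
      \<comment> \<open>Distinctness of the space-time points makes the entries below the diagonal
        agree with the kernel at equal times too.\<close>
      have ne: "(xs ! i, ts ! i) \<noteq> (xs ! j, ts ! j)" if "i \<noteq> j"
        using nth_eq_iff_index_eq[OF dist, of i j] ij len that by simp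
      show "corr_matrix E neg_symbol (map2 (\<lambda>t x. (t, x, 0, 1)) ts xs) $$ (i, j) =
        Matrix.mat n n (\<lambda>(i, j). R_kernel E (xs ! i) (ts ! i) (xs ! j) (ts ! j)) $$ (i, j)"
      proof (cases "i \<le> j")
        case True
        then show ?thesis using ij len corr_kernel_eq_R_kernel(1)[OF le(1)[OF True]] by (simp add: corr_matrix_def)
      next
        case False
        then have ji: "j \<le> i" "i \<noteq> j" by auto
        show ?thesis using False ij len corr_kernel_eq_R_kernel(2)[OF le(2)[OF ji(1)] ne[OF ji(2)]] by (simp add: corr_matrix_def)
      qed
    qed (auto simp: corr_matrix_def len)
    finally have int: "(\<integral>\<omega>. (\<Prod>i<length ts. (fs ! i) (X (ts ! i) \<omega>)) \<partial>M) =
      Determinant.det (Matrix.mat n n (\<lambda>(i, j). R_kernel E (xs ! i) (ts ! i) (xs ! j) (ts ! j)))" .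
    define A where "A = {\<omega> \<in> space M. \<forall>i<n. X (ts ! i) \<omega> (xs ! i)}"
    interpret prob_space M using proc by (simp add: associated_process_def)
    have "{\<omega> \<in> space M. X (ts ! i) \<omega> (xs ! i)} \<in> sets M" if "i < n" for i
    proof -
      have "ts ! i \<in> time_window \<infinity>" using win len that by auto
      then have "X (ts ! i) \<in> borel_measurable M" using proc by (simp add: associated_process_def)
      moreover have "{\<omega> :: 'x \<Rightarrow> bool. \<omega> (xs ! i)} \<in> sets borel"
        using open_vimage[OF Topological_Spaces.open_discrete coord[of "xs ! i"], of "{True}"] by (simp add: vimage_def borel_open)
      ultimately have "X (ts ! i) -` {\<omega>. \<omega> (xs ! i)} \<inter> space M \<in> sets M" by (rule measurable_sets)
      moreover have "X (ts ! i) -` {\<omega>. \<omega> (xs ! i)} \<inter> space M = {\<omega> \<in> space M. X (ts ! i) \<omega> (xs ! i)}" by auto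
      ultimately show ?thesis by simp
    qed
    then have "(\<Inter>i<n. {\<omega> \<in> space M. X (ts ! i) \<omega> (xs ! i)}) \<in> sets M"
      using n1 by (intro sets.finite_INT) (auto simp: lessThan_empty_iff)
    moreover have "(\<Inter>i<n. {\<omega> \<in> space M. X (ts ! i) \<omega> (xs ! i)}) = A" using n1 by (auto simp: A_def)
    ultimately have A: "A \<in> sets M" by simp
    have "(\<integral>\<omega>. (\<Prod>i<length ts. (fs ! i) (X (ts ! i) \<omega>)) \<partial>M) = (\<integral>\<omega>. complex_of_real (indicator A \<omega>) \<partial>M)"
    proof (rule Bochner_Integration.integral_cong[OF refl])
      fix \<omega> assume "\<omega> \<in> space M"
      then show "(\<Prod>i<length ts. (fs ! i) (X (ts ! i) \<omega>)) = complex_of_real (indicator A \<omega>)"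
        using len by (auto simp: fs_def A_def indicator_def intro: prod.neutral)
    qed
    also have "\<dots> = complex_of_real (measure M A)"
      unfolding integral_complex_of_real using A by simp
    finally show "complex_of_real (measure M {\<omega> \<in> space M. \<forall>i<n. X (ts ! i) \<omega> (xs ! i)}) =
        Determinant.det (Matrix.mat n n (\<lambda>(i, j). R_kernel E (xs ! i) (ts ! i) (xs ! j) (ts ! j)))"
      using int by (simp add: A_def)
  qed
qed

end
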